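(* Let $f(t,x,v)=f_{0v}(v)\sum_{i,j=1}^rX_i(t,x)S_{ij}(t)V_j(t,v)$ be a (sufficiently regular, velocity-decaying) solution of the dynamical low-rank evolution equations, defined in the context, for the stochastic Vlasov--Poisson equation, with fixed velocity modes $U_1=1/\|1\|_v$, $U_{i+1}=v_i/\|v_i\|_v$ ($1\le i\le d$), $U_{d+2}=\chi_2/\|\chi_2\|_v$, $m\ge d+2$. Let $\rho=\int f\,dv$, $J=\int vf\,dv$, and let $E$ be the self-consistent field of $f$. Then: (1) (mass) $d\rho(t,x)+\nabla_x\cdot J(t,x)\,dt=0$, and hence $\mathcal M[f(t)]=\mathcal M[f(0)]$ almost surely, where $\mathcal M[f]=\int_{\mathbb T^d}\rho\,dx$. (2) (momentum) $dJ=-\nabla_x\cdot\big(\int_{\mathbb R^d}v\otimes v\,f\,dv\big)dt+E\rho\,dt+\sum_{l=1}^K\sigma_l(x)\rho\star d\beta_l(t)$, and hence $\mathbb E[\mathcal P[f(t)]]=\mathbb E[\mathcal P[f(0)]]$, where $\mathcal P[f]=\int_{\mathbb T^d}J\,dx$. (3) (energy) With $\mathcal H[f]=\frac12\int_{\mathbb T^d\times\mathbb R^d}|v|^2f\,dv\,dx+\frac12\int_{\mathbb T^d}|E|^2\,dx$, $$d\mathcal H[f(t)]=\sum_{l=1}^K\Big(\int_{\mathbb T^d}\sigma_l(x)\cdot J(t,x)\,dx\Big)d\beta_l(t)+\frac12\Big(\int_{\mathbb T^d}\operatorname{Tr}(\sigma\sigma^\top)(x)\,\rho(t,x)\,dx\Big)dt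 .$$
   Context: Model. $x\in\mathbb T^d$, $v\in\mathbb R^d$; $\beta_1,\dots,\beta_K$ are independent Brownian motions on a complete filtered probability space; $\sigma_l:\mathbb T^d\to\mathbb R^d$ are given and $\sigma=(\sigma_1,\dots,\sigma_K)$ is the $d\times K$ matrix with these columns. $\star$ denotes the Stratonovich integral. The stochastic Vlasov--Poisson equation is $df+(v\cdot\nabla_xf+E\cdot\nabla_vf)\,dt+\sum_{l}\sigma_l(x)\cdot\nabla_vf\star d\beta_l=0$, with $E=-\nabla u$, $-\Delta u=\int f\,dv-1$ on $\mathbb T^d$. Notation. $f_{0v}(v)>0$ is a fixed weight (e.g. Gaussian) such that $1$, $v_i$, $|v|^2\in L^2(\mathbb R^d;f_{0v})$. $\langle g,h\rangle_x=\int gh\,dx$; $\langle g,h\rangle_v=\int f_{0v}gh\,dv$ with norm $\|\cdot\|_v$; $(\cdot,\cdot)_v$, $(\cdot,\cdot)_{xv}$ are the unweighted $L^2$ products. $\alpha_2=\langle|v|^2,1\rangle_v/\langle1,1\rangle_v$, $\chi_2=|v|^2-\alpha_2$; the weight is such that the fixed modes are orthonormal. Low-rank dynamics. $(X_i)$ is orthonormal for $\langle\cdot,\cdot\rangle_x$, $(V_j)$ is orthonormal for $\langle\cdot,\cdot\rangle_v$, $S$ is an invertible $r\times r$ matrix; $V_a(t,\cdot)=U_a$ is time independent for $a\le m$ and $V_p=W_p$ is evolving for $m<p\le r$. The gauge conditions $\langle X_i,dX_j\rangle_x=0$, $\langle V_i,dV_j\rangle_v=0$ are imposed. With $\mathrm{RHS}=-(v\cdot\nabla_xf+E\cdot\nabla_vf)\,dt-\sum_l\sigma_l\cdot\nabla_vf\star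 d\beta_l$, where $E$ is the field generated by the low-rank $f$ through the Poisson equation, the evolution equations (in the Stratonovich sense) are the Petrov--Galerkin equations $d\big(\sum_iX_iS_{ik}\big)=(V_k,\mathrm{RHS})_v$ for $1\le k\le r$; $dS_{kl}=(X_kV_l,\mathrm{RHS})_{xv}$ for $1\le k,l\le r$; $\sum_{i}\sum_{p>m}S_{iq}S_{ip}\,dW_p+\sum_{i,l}S_{iq}\,dS_{il}\,V_l=\frac1{f_{0v}}\sum_iS_{iq}\langle X_i,\mathrm{RHS}\rangle_x$ for $m<q\le r$. Regularity, decay in $v$ (so that integration by parts in $v$ has no boundary terms) and integrability (so that It\^o integrals are martingales and expectations exist) are assumed as needed. *)

theory Defs
  imports "HOL-Probability.Probability"
begin

section \<open>Differential operators and the torus\<close>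

definition grad :: "(real^'d \<Rightarrow> real) \<Rightarrow> real^'d \<Rightarrow> real^'d" where
  "grad g x = (\<chi> i. frechet_derivative g (at x) (axis i 1))"

definition divergence :: "(real^'d \<Rightarrow> real^'d) \<Rightarrow> real^'d \<Rightarrow> real" where
  "divergence G x = (\<Sum>i\<in>UNIV. frechet_derivative G (at x) (axis i 1) $ i)"

definition mat_divergence :: "(real^'d \<Rightarrow> real^'d^'d) \<Rightarrow> real^'d \<Rightarrow> real^'d" where
  "mat_divergence G x = (\<chi> i. \<Sum>j\<in>UNIV. frechet_derivative G (at x) (axis j 1) $ i $ j)"

definition laplacian :: "(real^'d \<Rightarrow> real) \<Rightarrow> real^'d \<Rightarrow> real" where
  "laplacian g = divergence (grad g)"

definition outer :: "real^'d \<Rightarrow> real^'d \<Rightarrow> real^'d^'d" where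
  "outer v w = (\<chi> i j. v $ i * w $ j)"

text \<open>The torus is \<open>(\<real>/L\<int>)\<^sup>d\<close> with an arbitrary period \<open>L > 0\<close>: functions on it are \<open>L\<close>-periodic
  functions on \<open>\<real>\<^sup>d\<close>, integrated over the fundamental cell.\<close>

definition cell :: "real \<Rightarrow> (real^'d) set" where
  "cell L = cbox 0 (\<chi> i. L)"

definition periodic :: "real \<Rightarrow> (real^'d \<Rightarrow> 'b) \<Rightarrow> bool" where
  "periodic L g \<longleftrightarrow> (\<forall>x i. g (x + axis i L) = g x)"

definition inner_x :: "real \<Rightarrow> (real^'d \<Rightarrow> real) \<Rightarrow> (real^'d \<Rightarrow> real) \<Rightarrow> real" where
  "inner_x L g h = (LBINT x:cell L. g x * h x)"

text \<open>The inner product of \<open>L\<^sup>2(f\<^sub>0\<^sub>v)\<close>; the weight \<open>f\<^sub>0\<^sub>v\<close> is called \<open>w\<close> throughout.\<close>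

definition inner_v :: "(real^'d \<Rightarrow> real) \<Rightarrow> (real^'d \<Rightarrow> real) \<Rightarrow> (real^'d \<Rightarrow> real) \<Rightarrow> real" where
  "inner_v w g h = (LBINT v. w v * g v * h v)"

definition norm_v :: "(real^'d \<Rightarrow> real) \<Rightarrow> (real^'d \<Rightarrow> real) \<Rightarrow> real" where
  "norm_v w g = sqrt (inner_v w g g)"

definition in_L2_v :: "(real^'d \<Rightarrow> real) \<Rightarrow> (real^'d \<Rightarrow> real) \<Rightarrow> bool" where
  "in_L2_v w g \<longleftrightarrow> g \<in> borel_measurable lborel \<and> integrable lborel (\<lambda>v. w v * (g v)\<^sup>2)"

definition orthonormal_modes :: "('f \<Rightarrow> 'f \<Rightarrow> real) \<Rightarrow> nat \<Rightarrow> (nat \<Rightarrow> 'f) \<Rightarrow> bool" where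
  "orthonormal_modes ip r e \<longleftrightarrow>
     (\<forall>i\<in>{1..r}. \<forall>j\<in>{1..r}. ip (e i) (e j) = (if i = j then 1 else 0))"

definition chi2 :: "(real^'d \<Rightarrow> real) \<Rightarrow> real^'d \<Rightarrow> real" where
  "chi2 w v = (norm v)\<^sup>2 - inner_v w (\<lambda>v. (norm v)\<^sup>2) (\<lambda>_. 1) / inner_v w (\<lambda>_. 1) (\<lambda>_. 1)"

definition admissible_weight :: "(real^'d \<Rightarrow> real) \<Rightarrow> bool" where
  "admissible_weight w \<longleftrightarrow> (\<forall>v. 0 < w v) \<and> (\<forall>v. w differentiable (at v)) \<and>
     continuous_on UNIV (grad w) \<and>
     in_L2_v w (\<lambda>_. 1) \<and> (\<forall>i. in_L2_v w (\<lambda>v. v $ i)) \<and> in_L2_v w (\<lambda>v. (norm v)\<^sup>2)"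

definition invertible_upto :: "nat \<Rightarrow> (nat \<Rightarrow> nat \<Rightarrow> real) \<Rightarrow> bool" where
  "invertible_upto r A \<longleftrightarrow> (\<exists>B. \<forall>i\<in>{1..r}. \<forall>k\<in>{1..r}.
     (\<Sum>j\<in>{1..r}. A i j * B j k) = (if i = k then 1 else 0) \<and>
     (\<Sum>j\<in>{1..r}. B i j * A j k) = (if i = k then 1 else 0))"

section \<open>Moments of a phase space density\<close>

definition mass_density :: "(real^'d \<Rightarrow> real^'d \<Rightarrow> real) \<Rightarrow> real^'d \<Rightarrow> real" where
  "mass_density f x = (LBINT v. f x v)"

definition momentum_density :: "(real^'d \<Rightarrow> real^'d \<Rightarrow> real) \<Rightarrow> real^'d \<Rightarrow> real^'d" where
  "momentum_density f x = (LBINT v. f x v *\<^sub>R v)"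

definition stress :: "(real^'d \<Rightarrow> real^'d \<Rightarrow> real) \<Rightarrow> real^'d \<Rightarrow> real^'d^'d" where
  "stress f x = (LBINT v. f x v *\<^sub>R outer v v)"

definition total_mass :: "real \<Rightarrow> (real^'d \<Rightarrow> real^'d \<Rightarrow> real) \<Rightarrow> real" where
  "total_mass L f = (LBINT x:cell L. mass_density f x)"

definition total_momentum :: "real \<Rightarrow> (real^'d \<Rightarrow> real^'d \<Rightarrow> real) \<Rightarrow> real^'d" where
  "total_momentum L f = (LBINT x:cell L. momentum_density f x)"

definition total_energy ::
  "real \<Rightarrow> (real^'d \<Rightarrow> real^'d \<Rightarrow> real) \<Rightarrow> (real^'d \<Rightarrow> real^'d) \<Rightarrow> real" where
  "total_energy L f E =
     1/2 * (LBINT x:cell L. LBINT v. (norm v)\<^sup>2 * f x v) + 1/2 * (LBINT x:cell L. (norm (E x))\<^sup>2)"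

definition poisson_potential ::
  "real \<Rightarrow> (real^'d \<Rightarrow> real) \<Rightarrow> (real^'d \<Rightarrow> real) \<Rightarrow> bool" where
  "poisson_potential L \<rho> u \<longleftrightarrow> periodic L u \<and>
     (\<forall>x. u differentiable (at x)) \<and> (\<forall>x. grad u differentiable (at x)) \<and>
     (\<forall>i. continuous_on UNIV (\<lambda>x. frechet_derivative (grad u) (at x) (axis i 1))) \<and>
     (\<forall>x. - laplacian u x = \<rho> x - 1)"

section \<open>Filtered probability space and Brownian motions\<close>

definition complete_filtered_space :: "'w measure \<Rightarrow> (real \<Rightarrow> 'w measure) \<Rightarrow> bool" where
  "complete_filtered_space M F \<longleftrightarrow> prob_space M \<and> filtration (space M) F \<and>
     (\<forall>t. sets (F t) \<subseteq> sets M) \<and>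
     (\<forall>A\<in>null_sets M. \<forall>B. B \<subseteq> A \<longrightarrow> B \<in> sets (F 0))"

definition adapted_upto ::
  "(real \<Rightarrow> 'w measure) \<Rightarrow> real \<Rightarrow> (real \<Rightarrow> 'w \<Rightarrow> real) \<Rightarrow> bool" where
  "adapted_upto F T Z \<longleftrightarrow> (\<forall>t\<in>{0..T}. Z t \<in> borel_measurable (F t))"

definition brownian_motion ::
  "'w measure \<Rightarrow> (real \<Rightarrow> 'w measure) \<Rightarrow> (real \<Rightarrow> 'w \<Rightarrow> real) \<Rightarrow> bool" where
  "brownian_motion M F B \<longleftrightarrow>
     (\<forall>t\<ge>0. B t \<in> borel_measurable (F t)) \<and>
     (AE \<omega> in M. B 0 \<omega> = 0) \<and>
     (AE \<omega> in M. continuous_on {0..} (\<lambda>t. B t \<omega>)) \<and>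
     (\<forall>s t. 0 \<le> s \<and> s < t \<longrightarrow>
        distributed M lborel (\<lambda>\<omega>. B t \<omega> - B s \<omega>) (normal_density 0 (sqrt (t - s))) \<and>
        prob_space.indep_set M (sets (F s))
          {(\<lambda>\<omega>. B t \<omega> - B s \<omega>) -` A \<inter> space M | A. A \<in> sets borel})"

definition independent_brownian_motions ::
  "'w measure \<Rightarrow> (real \<Rightarrow> 'w measure) \<Rightarrow> ('k \<Rightarrow> real \<Rightarrow> 'w \<Rightarrow> real) \<Rightarrow> bool" where
  "independent_brownian_motions M F \<beta> \<longleftrightarrow> (\<forall>l. brownian_motion M F (\<beta> l)) \<and>
     prob_space.indep_vars M (\<lambda>_. PiM {0..} (\<lambda>_. borel))
       (\<lambda>l \<omega>. \<lambda>t\<in>{0..}. \<beta> l t \<omega>) UNIV"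

section \<open>Stochastic integrals\<close>

text \<open>Convergence to zero in probability along a filter. The covering event \<open>A\<close> makes the definition
  meaningful without a measurability proviso on \<open>D\<close>; for measurable \<open>D\<close> it is the usual notion.\<close>

definition null_in_prob :: "'w measure \<Rightarrow> 'q filter \<Rightarrow> ('q \<Rightarrow> 'w \<Rightarrow> ennreal) \<Rightarrow> bool" where
  "null_in_prob M G D \<longleftrightarrow> (\<forall>\<epsilon>>0. \<forall>\<eta>>0. \<forall>\<^sub>F q in G.
     \<exists>A\<in>sets M. measure M A < \<eta> \<and> (\<forall>\<omega>\<in>space M - A. D q \<omega> \<le> ennreal \<epsilon>))"

definition partition_of :: "real \<Rightarrow> nat \<Rightarrow> (nat \<Rightarrow> real) \<Rightarrow> bool" where
  "partition_of t n \<pi> \<longleftrightarrow> \<pi> 0 = 0 \<and> \<pi> n = t \<and> (\<forall>i<n. \<pi> i \<le> \<pi> (Suc i))"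

definition mesh_to_zero :: "real \<Rightarrow> (nat \<times> (nat \<Rightarrow> real)) filter" where
  "mesh_to_zero t = (INF \<delta>\<in>{0<..}. principal
     {(n, \<pi>). partition_of t n \<pi> \<and> (\<forall>i<n. \<pi> (Suc i) - \<pi> i < \<delta>)})"

text \<open>\<open>I(t,p) = \<integral>\<^sub>0\<^sup>t Y(s,p) \<star> dZ(s,p)\<close> for processes depending on a spatial parameter \<open>p\<close> (position or
  velocity): the continuous random field \<open>I\<close> is the limit in probability of the Stratonovich
  (trapezoidal) sums, locally uniformly in \<open>p\<close>. Processes without a parameter are treated as
  constant in \<open>p\<close>.\<close>

definition has_strat_integral ::
  "'w measure \<Rightarrow> real \<Rightarrow> (real \<Rightarrow> 'w \<Rightarrow> 'p::topological_space \<Rightarrow> 'b::real_normed_vector) \<Rightarrow>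
   (real \<Rightarrow> 'w \<Rightarrow> 'p \<Rightarrow> real) \<Rightarrow> (real \<Rightarrow> 'w \<Rightarrow> 'p \<Rightarrow> 'b) \<Rightarrow> bool" where
  "has_strat_integral M T Y Z I \<longleftrightarrow>
     (AE \<omega> in M. continuous_on ({0..T} \<times> UNIV) (\<lambda>(t, p). I t \<omega> p)) \<and>
     (\<forall>t\<in>{0..T}. \<forall>C. compact C \<longrightarrow> null_in_prob M (mesh_to_zero t) (\<lambda>(n, \<pi>) \<omega>.
        SUP p\<in>C. ennreal (norm
          ((\<Sum>i<n. (Z (\<pi> (Suc i)) \<omega> p - Z (\<pi> i) \<omega> p) *\<^sub>R
                   ((1/2) *\<^sub>R (Y (\<pi> i) \<omega> p + Y (\<pi> (Suc i)) \<omega> p))) - I t \<omega> p))))"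

text \<open>\<open>\<langle>Y, dZ\<rangle> = 0\<close> in the Stratonovich sense, for function-valued processes and an inner product \<open>ip\<close>.\<close>

definition strat_orthogonal ::
  "'w measure \<Rightarrow> real \<Rightarrow> (('p \<Rightarrow> real) \<Rightarrow> ('p \<Rightarrow> real) \<Rightarrow> real) \<Rightarrow>
   (real \<Rightarrow> 'w \<Rightarrow> 'p \<Rightarrow> real) \<Rightarrow> (real \<Rightarrow> 'w \<Rightarrow> 'p \<Rightarrow> real) \<Rightarrow> bool" where
  "strat_orthogonal M T ip Y Z \<longleftrightarrow>
     (\<forall>t\<in>{0..T}. null_in_prob M (mesh_to_zero t) (\<lambda>(n, \<pi>) \<omega>. ennreal
        \<bar>\<Sum>i<n. ip (\<lambda>p. (Y (\<pi> i) \<omega> p + Y (\<pi> (Suc i)) \<omega> p) / 2)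
                   (\<lambda>p. Z (\<pi> (Suc i)) \<omega> p - Z (\<pi> i) \<omega> p)\<bar>))"

text \<open>The It\^o integral \<open>I(t) = \<integral>\<^sub>0\<^sup>t H(s) dB(s)\<close> (continuous version) of an adapted \<open>H\<close>, by approximation
  with the simple processes \<open>\<Sum>\<^sub>i \<xi>\<^sub>i 1\<^bsub>(\<pi>\<^sub>i, \<pi>\<^sub>i\<^sub>+\<^sub>1]\<^esub>\<close>, \<open>\<xi>\<^sub>i\<close> bounded and \<open>F(\<pi>\<^sub>i)\<close>-measurable.\<close>

definition has_ito_integral ::
  "'w measure \<Rightarrow> (real \<Rightarrow> 'w measure) \<Rightarrow> real \<Rightarrow> (real \<Rightarrow> 'w \<Rightarrow> real) \<Rightarrow> (real \<Rightarrow> 'w \<Rightarrow> real) \<Rightarrow>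
   (real \<Rightarrow> 'w \<Rightarrow> real) \<Rightarrow> bool" where
  "has_ito_integral M F T H B I \<longleftrightarrow> adapted_upto F T H \<and>
     (AE \<omega> in M. continuous_on {0..T} (\<lambda>t. I t \<omega>)) \<and>
     (\<forall>t\<in>{0..T}. \<exists>n \<pi> \<xi>.
        (\<forall>q. partition_of t (n q) (\<pi> q)) \<and>
        (\<forall>q. \<forall>i<n q. \<xi> q i \<in> borel_measurable (F (\<pi> q i)) \<and>
           (\<exists>c. \<forall>\<omega>\<in>space M. \<bar>\<xi> q i \<omega>\<bar> \<le> c)) \<and>
        null_in_prob M sequentially (\<lambda>q \<omega>. \<integral>\<^sup>+s\<in>{0..t}. ennreal
          (((\<Sum>i<n q. \<xi> q i \<omega> * indicator {\<pi> q i<..\<pi> q (Suc i)} s) - H s \<omega>)\<^sup>2) \<partial>lborel) \<and>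
        null_in_prob M sequentially (\<lambda>q \<omega>. ennreal
          \<bar>(\<Sum>i<n q. \<xi> q i \<omega> * (B (\<pi> q (Suc i)) \<omega> - B (\<pi> q i) \<omega>)) - I t \<omega>\<bar>))"

section \<open>Low-rank dynamics\<close>

text \<open>Modes are numbered \<open>1..r\<close>; in \<open>X i t \<omega> x\<close>, \<open>S i j t \<omega>\<close>, \<open>V j t \<omega> v\<close> the time and the sample point
  precede the spatial variable.\<close>

definition lowrank_density ::
  "nat \<Rightarrow> (real^'d \<Rightarrow> real) \<Rightarrow> (nat \<Rightarrow> real \<Rightarrow> 'w \<Rightarrow> real^'d \<Rightarrow> real) \<Rightarrow>
   (nat \<Rightarrow> nat \<Rightarrow> real \<Rightarrow> 'w \<Rightarrow> real) \<Rightarrow> (nat \<Rightarrow> real \<Rightarrow> 'w \<Rightarrow> real^'d \<Rightarrow> real) \<Rightarrow>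
   real \<Rightarrow> 'w \<Rightarrow> real^'d \<Rightarrow> real^'d \<Rightarrow> real" where
  "lowrank_density r w X S V t \<omega> x v =
     w v * (\<Sum>i\<in>{1..r}. \<Sum>j\<in>{1..r}. X i t \<omega> x * S i j t \<omega> * V j t \<omega> v)"

text \<open>\<open>RHS = rhs_drift dt + \<Sum>\<^sub>l rhs_noise \<sigma>\<^sub>l \<star> d\<beta>\<^sub>l\<close>.\<close>

definition rhs_drift ::
  "(real^'d \<Rightarrow> real^'d \<Rightarrow> real) \<Rightarrow> (real^'d \<Rightarrow> real^'d) \<Rightarrow> real^'d \<Rightarrow> real^'d \<Rightarrow> real" where
  "rhs_drift f E x v = - (v \<bullet> grad (\<lambda>y. f y v) x + E x \<bullet> grad (f x) v)"

definition rhs_noise ::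
  "(real^'d \<Rightarrow> real^'d) \<Rightarrow> (real^'d \<Rightarrow> real^'d \<Rightarrow> real) \<Rightarrow> real^'d \<Rightarrow> real^'d \<Rightarrow> real" where
  "rhs_noise s f x v = - (s x \<bullet> grad (f x) v)"

text \<open>\<open>R(t,p) = \<integral>\<^sub>0\<^sup>t \<Phi>(s,p)(RHS)\<close>, where \<open>\<Phi>(t,p)\<close> is a linear functional on functions of \<open>(x,v)\<close>.\<close>

definition tested_rhs ::
  "'w measure \<Rightarrow> real \<Rightarrow> ('k::finite \<Rightarrow> real \<Rightarrow> 'w \<Rightarrow> real) \<Rightarrow> (real^'d \<Rightarrow> real^'k^'d) \<Rightarrow>
   (real \<Rightarrow> 'w \<Rightarrow> real^'d \<Rightarrow> real^'d \<Rightarrow> real) \<Rightarrow> (real \<Rightarrow> 'w \<Rightarrow> real^'d \<Rightarrow> real^'d) \<Rightarrow>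
   (real \<Rightarrow> 'w \<Rightarrow> 'p::topological_space \<Rightarrow> (real^'d \<Rightarrow> real^'d \<Rightarrow> real) \<Rightarrow> real) \<Rightarrow>
   (real \<Rightarrow> 'w \<Rightarrow> 'p \<Rightarrow> real) \<Rightarrow> bool" where
  "tested_rhs M T \<beta> \<sigma> f E \<Phi> R \<longleftrightarrow> (\<exists>N.
     (\<forall>l. has_strat_integral M T
        (\<lambda>t \<omega> p. \<Phi> t \<omega> p (rhs_noise (\<lambda>x. column l (\<sigma> x)) (f t \<omega>))) (\<lambda>t \<omega> _. \<beta> l t \<omega>) (N l)) \<and>
     (AE \<omega> in M. \<forall>t\<in>{0..T}. \<forall>p.
        R t \<omega> p = (LBINT s:{0..t}. \<Phi> s \<omega> p (rhs_drift (f s \<omega>) (E s \<omega>))) + (\<Sum>l\<in>UNIV. N l t \<omega> p)))"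

text \<open>\<open>d(\<Sum>\<^sub>i X\<^sub>i S\<^sub>i\<^sub>k) = (V\<^sub>k, RHS)\<^sub>v\<close>\<close>

definition K_equation where
  "K_equation M T \<beta> \<sigma> r f E X S V \<longleftrightarrow> (\<forall>k\<in>{1..r}.
     tested_rhs M T \<beta> \<sigma> f E (\<lambda>t \<omega> (x::real^'d) h. LBINT v. V k t \<omega> v * h x v)
       (\<lambda>t \<omega> x. (\<Sum>i\<in>{1..r}. X i t \<omega> x * S i k t \<omega>) - (\<Sum>i\<in>{1..r}. X i 0 \<omega> x * S i k 0 \<omega>)))"

text \<open>\<open>dS\<^sub>k\<^sub>l = (X\<^sub>k V\<^sub>l, RHS)\<^sub>x\<^sub>v\<close>; the parameter of type \<^typ>\<open>real\<close> is a dummy.\<close>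

definition S_equation where
  "S_equation M T L \<beta> \<sigma> r f E X S V \<longleftrightarrow> (\<forall>k\<in>{1..r}. \<forall>l\<in>{1..r}.
     tested_rhs M T \<beta> \<sigma> f E
       (\<lambda>t \<omega> (_::real) h. LBINT x:cell L. LBINT v. X k t \<omega> x * V l t \<omega> v * h x v)
       (\<lambda>t \<omega> _. S k l t \<omega> - S k l 0 \<omega>))"

text \<open>\<open>\<Sum>\<^sub>i \<Sum>\<^bsub>p>m\<^esub> S\<^sub>i\<^sub>q S\<^sub>i\<^sub>p \<star> dW\<^sub>p + \<Sum>\<^sub>i\<^sub>l (S\<^sub>i\<^sub>q V\<^sub>l) \<star> dS\<^sub>i\<^sub>l = w\<^sup>-\<^sup>1 \<Sum>\<^sub>i S\<^sub>i\<^sub>q \<langle>X\<^sub>i, RHS\<rangle>\<^sub>x\<close>\<close>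

definition W_equation where
  "W_equation M T L \<beta> \<sigma> w m r f E X S V \<longleftrightarrow> (\<forall>q\<in>{m<..r}. \<exists>P Q.
     (\<forall>i\<in>{1..r}. \<forall>p\<in>{m<..r}.
        has_strat_integral M T (\<lambda>t \<omega> _. S i q t \<omega> * S i p t \<omega>) (V p) (P i p)) \<and>
     (\<forall>i\<in>{1..r}. \<forall>l\<in>{1..r}.
        has_strat_integral M T (\<lambda>t \<omega> v. S i q t \<omega> * V l t \<omega> v) (\<lambda>t \<omega> _. S i l t \<omega>) (Q i l)) \<and>
     tested_rhs M T \<beta> \<sigma> f E
       (\<lambda>t \<omega> (v::real^'d) h.
          1 / w v * (\<Sum>i\<in>{1..r}. S i q t \<omega> * inner_x L (X i t \<omega>) (\<lambda>x. h x v)))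
       (\<lambda>t \<omega> v. (\<Sum>i\<in>{1..r}. \<Sum>p\<in>{m<..r}. P i p t \<omega> v) + (\<Sum>i\<in>{1..r}. \<Sum>l\<in>{1..r}. Q i l t \<omega> v)))"

definition gauge_conditions where
  "gauge_conditions M T L w r X V \<longleftrightarrow> (\<forall>i\<in>{1..r}. \<forall>j\<in>{1..r}.
     strat_orthogonal M T (inner_x L) (X i) (X j) \<and> strat_orthogonal M T (inner_v w) (V i) (V j))"

text \<open>Regularity and velocity decay of one sample path. The integrable majorants make all velocity
  integrals in the evolution equations absolutely convergent, uniformly in time, and remove the
  boundary terms in the integrations by parts in \<open>v\<close>.\<close>

definition regular_path ::
  "real \<Rightarrow> real \<Rightarrow> (real^'d \<Rightarrow> real) \<Rightarrow> nat \<Rightarrow> (nat \<Rightarrow> real \<Rightarrow> real^'d \<Rightarrow> real) \<Rightarrow>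
   (nat \<Rightarrow> nat \<Rightarrow> real \<Rightarrow> real) \<Rightarrow> (nat \<Rightarrow> real \<Rightarrow> real^'d \<Rightarrow> real) \<Rightarrow> (real \<Rightarrow> real^'d \<Rightarrow> real^'d) \<Rightarrow> bool"
where
  "regular_path T L w r X S V E \<longleftrightarrow>
     (\<forall>i\<in>{1..r}. (\<forall>t\<in>{0..T}. periodic L (X i t) \<and> (\<forall>x. X i t differentiable (at x))) \<and>
        continuous_on ({0..T} \<times> UNIV) (\<lambda>(t, x). X i t x) \<and>
        continuous_on ({0..T} \<times> UNIV) (\<lambda>(t, x). grad (X i t) x)) \<and>
     (\<forall>i\<in>{1..r}. \<forall>j\<in>{1..r}. continuous_on {0..T} (S i j)) \<and>
     (\<forall>j\<in>{1..r}. (\<forall>t\<in>{0..T}. \<forall>v. V j t differentiable (at v)) \<and>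
        continuous_on ({0..T} \<times> UNIV) (\<lambda>(t, v). V j t v) \<and>
        continuous_on ({0..T} \<times> UNIV) (\<lambda>(t, v). grad (V j t) v)) \<and>
     (\<forall>j\<in>{1..r}. \<forall>k\<in>{1..r}. \<exists>g. integrable lborel g \<and> (\<forall>t\<in>{0..T}. \<forall>v.
        (1 + norm v) * (w v * \<bar>V j t v * V k t v\<bar>) \<le> g v \<and>
        \<bar>V k t v\<bar> * norm (grad (\<lambda>v. w v * V j t v) v) \<le> g v)) \<and>
     continuous_on ({0..T} \<times> UNIV) (\<lambda>(t, x). E t x)"

end

theory Submission
  imports Defs
begin

text \<open>Only the equation for \<open>K\<^sub>k = \<Sum>\<^sub>i X\<^sub>i S\<^sub>i\<^sub>k\<close> with a fixed mode \<open>V\<^sub>k = U\<^sub>k\<close> enters. By orthonormality of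
  the \<open>V\<^sub>j\<close>, the densities of mass, momentum and kinetic energy are combinations of the \<open>K\<^sub>k\<close> belonging to
  \<open>1\<close>, \<open>v\<^sub>b\<close> and \<open>\<chi>\<^sub>2\<close>, so after integration by parts in \<open>v\<close> they satisfy the exact moment equations.

  The mass density has no noise, hence is \<open>C\<^sup>1\<close> in time, and the Stratonovich integral of a \<open>C\<^sup>1\<close> path \<open>h\<close> is
  the pathwise Stieltjes integral \<open>h \<beta> - \<integral> \<beta> dh\<close>. It has mean zero, being a limit of sums with adapted
  integrands; together with \<open>\<integral> E \<rho> dx = 0\<close> this gives the momentum law. In the energy law the integrand
  \<open>\<integral> \<sigma>\<^sub>l \<bullet> J dx\<close> has the martingale part \<open>\<Sum>\<^sub>k \<integral> (\<integral> \<sigma>\<^sub>l \<bullet> \<sigma>\<^sub>k \<rho> dx) d\<beta>\<^sub>k\<close>, whose covariation with \<open>\<beta>\<^sub>l\<close> produces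
  the trace term. The Poisson equation turns the increment of the field energy into \<open>- \<integral> \<integral> E \<bullet> J dx dt\<close>.\<close>

subsection \<open>Gradients and integration by parts on the torus and on the whole space\<close>

text \<open>Stochastic integrals are given only as limits in probability of sums, so they are
  evaluated along the dyadic partitions of [0, t]. These have countably many points and mean square
  errors of order 2^-q, summable in q; hence the covariation limits hold almost surely, off one null
  set for each t. The obstacle is that J is rough in time and no martingale decomposition of it is
  given. Its roughness, however, comes from integrals of quantities linear in \<rho>, which is C1 in
  time: over a mesh interval such an integral is the left value of the integrand times the Brownian
  increment, up to an error of the order of the mesh. So the increments of the energy integrand are
  known path by path, and only covariations of Brownian motions remain to be computed. The factor
  1/2 of the trace term is the gap between trapezoidal and left-point sums. The constant \<alpha>_2
  in \<chi>_2 adds a multiple of the conserved mass to the kinetic energy. The field energy is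
  treated by increments in time, because the potential enters with no time regularity beyond the
  continuity of E.\<close>

lemma frechet_derivative_vec_sum:
  fixes g :: "real^'d \<Rightarrow> 'b::real_normed_vector"
  assumes "g differentiable (at x)"
  shows "frechet_derivative g (at x) h = (\<Sum>i\<in>UNIV. h $ i *\<^sub>R frechet_derivative g (at x) (axis i 1))"
proof -
  have "(g has_derivative frechet_derivative g (at x)) (at x)"
    using assms frechet_derivative_works by blast
  then interpret bounded_linear "frechet_derivative g (at x)"
    by (rule has_derivative_bounded_linear)
  have "frechet_derivative g (at x) h =
      frechet_derivative g (at x) (\<Sum>i\<in>UNIV. h $ i *\<^sub>R axis i 1)"
    using basis_expansion[of h] by (simp add: scalar_mult_eq_scaleR)
  also have "\<dots> = (\<Sum>i\<in>UNIV. h $ i *\<^sub>R frechet_derivative g (at x) (axis i 1))"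
    by (simp add: sum scaleR)
  finally show ?thesis .
qed

text \<open>\<open>grad\<close> collects the directional derivatives along the axes; for a
  differentiable function linearity recovers the full derivative from them.\<close>

lemma has_derivative_grad:
  fixes g :: "real^'d \<Rightarrow> real"
  assumes "g differentiable (at x)"
  shows "(g has_derivative (\<lambda>h. grad g x \<bullet> h)) (at x)"
proof -
  have "frechet_derivative g (at x) = (\<lambda>h. grad g x \<bullet> h)"
    by (rule ext, subst frechet_derivative_vec_sum[OF assms])
      (simp add: grad_def inner_vec_def mult.commute)
  then show ?thesis using assms frechet_derivative_works by metis
qed

lemma grad_eqI:
  fixes g :: "real^'d \<Rightarrow> real"
  assumes "(g has_derivative (\<lambda>h. G \<bullet> h)) (at x)"
  shows "grad g x = G"
  unfolding grad_def frechet_derivative_at[OF assms, symmetric]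
  by (simp add: vec_eq_iff inner_axis)

lemma grad_mult:
  fixes g h :: "real^'d \<Rightarrow> real"
  assumes "g differentiable (at x)" "h differentiable (at x)"
  shows "grad (\<lambda>x. g x * h x) x = g x *\<^sub>R grad h x + h x *\<^sub>R grad g x"
proof (rule grad_eqI)
  show "((\<lambda>x. g x * h x) has_derivative (\<lambda>y. (g x *\<^sub>R grad h x + h x *\<^sub>R grad g x) \<bullet> y)) (at x)"
    by (rule has_derivative_eq_rhs, rule has_derivative_mult[OF has_derivative_grad has_derivative_grad])
      (use assms in \<open>auto simp: inner_add_left algebra_simps\<close>)
qed

lemma grad_add:
  fixes g h :: "real^'d \<Rightarrow> real"
  assumes "g differentiable (at x)" "h differentiable (at x)"
  shows "grad (\<lambda>x. g x + h x) x = grad g x + grad h x"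
  by (rule grad_eqI, rule has_derivative_eq_rhs,
      rule has_derivative_add[OF has_derivative_grad has_derivative_grad])
    (use assms in \<open>auto simp: inner_add_left\<close>)

lemma grad_const [simp]: "grad (\<lambda>_. c) x = 0"
  by (rule grad_eqI) simp

lemma grad_cmult:
  fixes g :: "real^'d \<Rightarrow> real"
  assumes "g differentiable (at x)"
  shows "grad (\<lambda>x. c * g x) x = c *\<^sub>R grad g x"
  using grad_mult[of "\<lambda>_. c" x g] assms by simp

lemma grad_sum:
  fixes g :: "'i \<Rightarrow> real^'d \<Rightarrow> real"
  assumes "\<And>i. i \<in> A \<Longrightarrow> g i differentiable (at x)"
  shows "grad (\<lambda>x. \<Sum>i\<in>A. g i x) x = (\<Sum>i\<in>A. grad (g i) x)"
  by (rule grad_eqI, rule has_derivative_eq_rhs, rule has_derivative_sum[OF has_derivative_grad])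
    (use assms in \<open>auto simp: inner_sum_left\<close>)

lemma grad_coordinate: "grad (\<lambda>v. v $ b) v = axis b 1"
  by (rule grad_eqI, rule has_derivative_eq_rhs,
      rule bounded_linear.has_derivative[OF bounded_linear_vec_nth has_derivative_ident])
    (simp add: inner_axis_axis inner_axis inner_commute)

lemma differentiable_coordinate: "(\<lambda>v. v $ b) differentiable (at (v::real^'d))"
  by (rule bounded_linear_imp_differentiable[OF bounded_linear_vec_nth])

lemma has_derivative_norm_sq:
  "((\<lambda>v::real^'d. (norm v)\<^sup>2) has_derivative (\<lambda>h. (2 *\<^sub>R v) \<bullet> h)) (at v)"
  unfolding power2_norm_eq_inner
  by (rule has_derivative_eq_rhs, rule has_derivative_inner[OF has_derivative_ident has_derivative_ident])
    (auto simp: inner_commute)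

lemma grad_norm_sq: "grad (\<lambda>v::real^'d. (norm v)\<^sup>2) v = 2 *\<^sub>R v"
  by (rule grad_eqI, rule has_derivative_norm_sq)

text \<open>The fundamental theorem of calculus on a coordinate line. The translation arguments in
  velocity space, on the cell and for the electric force all turn a derivative into a difference of
  translates through it.\<close>

lemma frechet_derivative_along:
  fixes g :: "real^'d \<Rightarrow> real"
  assumes "\<And>x. g differentiable (at x)" "continuous_on UNIV (\<lambda>x. grad g x $ a)" "0 \<le> s"
  shows "g (x + s *\<^sub>R axis a 1) - g x = integral {0..s} (\<lambda>\<tau>. grad g (x + \<tau> *\<^sub>R axis a 1) $ a)"
proof -
  have "((\<lambda>\<tau>. grad g (x + \<tau> *\<^sub>R axis a 1) $ a) has_integral
      g (x + s *\<^sub>R axis a 1) - g (x + 0 *\<^sub>R axis a 1)) {0..s}"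
  proof (rule fundamental_theorem_of_calculus[OF assms(3)])
    fix \<tau> assume "\<tau> \<in> {0..s}"
    have "((g \<circ> (\<lambda>\<tau>. x + \<tau> *\<^sub>R axis a 1)) has_derivative
        ((\<lambda>h. grad g (x + \<tau> *\<^sub>R axis a 1) \<bullet> h) \<circ> (\<lambda>h. h *\<^sub>R axis a 1))) (at \<tau>)"
      by (rule diff_chain_at[OF _ has_derivative_grad[OF assms(1)]]) (auto intro!: derivative_eq_intros)
    then have "(g \<circ> (\<lambda>\<tau>. x + \<tau> *\<^sub>R axis a 1) has_vector_derivative
        grad g (x + \<tau> *\<^sub>R axis a 1) $ a) (at \<tau>)"
      unfolding has_vector_derivative_def by (simp add: o_def inner_axis)
    then show "((\<lambda>\<tau>. g (x + \<tau> *\<^sub>R axis a 1)) has_vector_derivative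
        grad g (x + \<tau> *\<^sub>R axis a 1) $ a) (at \<tau> within {0..s})"
      by (simp add: o_def has_vector_derivative_at_within)
  qed
  then show ?thesis by (simp add: integral_unique)
qed

text \<open>Bridge between the two integrals in use: the definitions are stated with Lebesgue
  integrals over sets, while the fundamental theorem and the interchange of continuous integrals are
  carried out for the gauge integral.\<close>

lemma set_lborel_integral_continuous:
  fixes f :: "'a::euclidean_space \<Rightarrow> 'b::euclidean_space"
  assumes "compact A" "continuous_on A f"
  shows "(LBINT x:A. f x) = integral A f"
  by (rule set_borel_integral_eq_integral(2))
    (use borel_integrable_compact[OF assms] in \<open>simp add: set_integrable_def\<close>)

lemma integral_lborel_shift:
  fixes h :: "'a::euclidean_space \<Rightarrow> real"
  assumes [measurable]: "h \<in> borel_measurable borel"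
  shows "(\<integral>x. h (x + c) \<partial>lborel) = (\<integral>x. h x \<partial>lborel)"
proof -
  have "(\<integral>x. h x \<partial>lborel) = (\<integral>x. h x \<partial>distr lborel borel ((+) c))"
    by (simp add: lborel_distr_plus)
  also have "\<dots> = (\<integral>x. h (c + x) \<partial>lborel)"
    by (rule integral_distr) auto
  finally show ?thesis by (simp add: add.commute)
qed

lemma integrable_lborel_shift:
  fixes h :: "'a::euclidean_space \<Rightarrow> real"
  assumes "integrable lborel h"
  shows "integrable lborel (\<lambda>x. h (x + c))"
proof -
  have [measurable]: "h \<in> borel_measurable borel" using borel_measurable_integrable[OF assms] by simp
  have "integrable (distr lborel borel ((+) c)) h"
    using assms by (simp add: lborel_distr_plus)
  then show ?thesis
    by (subst (asm) integrable_distr_eq) (auto simp: add.commute)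
qed

text \<open>Averaging the directional derivative over a unit translation gives a difference of two
  translates, whose integrals agree; Fubini then yields the claim without boundary terms.\<close>

lemma integral_grad_zero:
  fixes h :: "real^'d \<Rightarrow> real"
  assumes diff: "\<And>v. h differentiable (at v)" and cont: "continuous_on UNIV (\<lambda>v. grad h v $ a)"
    and int: "integrable lborel h" and intD: "integrable lborel (\<lambda>v. grad h v $ a)"
  shows "(\<integral>v. grad h v $ a \<partial>lborel) = 0"
proof -
  define D where "D v = grad h v $ a" for v
  define G where "G \<tau> v = indicator {0..1} \<tau> * D (v + \<tau> *\<^sub>R axis a 1)" for \<tau> :: real and v
  have cD: "continuous_on UNIV D" using cont unfolding D_def .
  have mD [measurable]: "D \<in> borel_measurable borel" using cD by (rule borel_measurable_continuous_onI)
  have "isCont h v" for v using differentiable_imp_continuous_within[OF diff[of v]] .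
  then have "continuous_on UNIV h" by (simp add: continuous_at_imp_continuous_on)
  then have mh [measurable]: "h \<in> borel_measurable borel" by (rule borel_measurable_continuous_onI)
  have intD': "integrable lborel D" using intD unfolding D_def .
  have "continuous_on UNIV (\<lambda>(\<tau>::real, v). D (v + \<tau> *\<^sub>R axis a 1))"
    unfolding split_beta by (intro continuous_on_compose2[OF cD] continuous_intros) auto
  then have mG0: "(\<lambda>(\<tau>::real, v). D (v + \<tau> *\<^sub>R axis a 1)) \<in> borel_measurable (lborel \<Otimes>\<^sub>M lborel)"
    by (simp add: lborel_prod borel_measurable_continuous_onI)
  have mG: "case_prod G \<in> borel_measurable (lborel \<Otimes>\<^sub>M lborel)"
  proof -
    have "(\<lambda>p. indicator {0..1} (fst p) * (case p of (\<tau>::real, v) \<Rightarrow> D (v + \<tau> *\<^sub>R axis a 1)))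
        \<in> borel_measurable (lborel \<Otimes>\<^sub>M lborel)"
      by (intro borel_measurable_times mG0) measurable
    moreover have "case_prod G = (\<lambda>p. indicator {0..1} (fst p) * (case p of (\<tau>::real, v) \<Rightarrow> D (v + \<tau> *\<^sub>R axis a 1)))"
      by (auto simp: G_def fun_eq_iff)
    ultimately show ?thesis by simp
  qed
  have intG: "integrable (lborel \<Otimes>\<^sub>M lborel) (case_prod G)"
  proof (rule lborel_pair.Fubini_integrable[OF mG])
    \<comment> \<open>Translation does not change the L1 norm of \<open>D\<close>, so integrability
      over the unit interval of translations reduces to that of \<open>D\<close>.\<close>
    have "(\<integral>v. norm (case_prod G (\<tau>, v)) \<partial>lborel) = indicator {0..1} \<tau> * (\<integral>v. \<bar>D v\<bar> \<partial>lborel)" for \<tau>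
      using integral_lborel_shift[of "\<lambda>v. \<bar>D v\<bar>" "\<tau> *\<^sub>R axis a 1"] by (simp add: G_def abs_mult)
    then show "integrable lborel (\<lambda>\<tau>. \<integral>v. norm (case_prod G (\<tau>, v)) \<partial>lborel)"
      by (simp add: mult.commute)
    show "AE \<tau> in lborel. integrable lborel (\<lambda>v. case_prod G (\<tau>, v))"
      using integrable_lborel_shift[OF intD'] by (simp add: G_def)
  qed
  have inner: "(\<integral>\<tau>. G \<tau> v \<partial>lborel) = h (v + axis a 1) - h v" for v
  proof -
    have "(\<integral>\<tau>. G \<tau> v \<partial>lborel) = (LBINT \<tau>:{0..1}. D (v + \<tau> *\<^sub>R axis a 1))"
      by (simp add: G_def set_lebesgue_integral_def)
    also have "\<dots> = integral {0..1} (\<lambda>\<tau>. D (v + \<tau> *\<^sub>R axis a 1))"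
      by (intro set_lborel_integral_continuous continuous_on_compose2[OF cD] continuous_intros) auto
    also have "\<dots> = h (v + axis a 1) - h v"
      using frechet_derivative_along[OF diff cont, of 1 v] by (simp add: D_def)
    finally show ?thesis .
  qed
  have "(\<integral>v. D v \<partial>lborel) = (\<integral>\<tau>. indicator {0..1} \<tau> * (\<integral>v. D v \<partial>lborel) \<partial>(lborel :: real measure))"
    by simp
  also have "\<dots> = (\<integral>\<tau>. (\<integral>v. G \<tau> v \<partial>lborel) \<partial>lborel)"
    by (intro Bochner_Integration.integral_cong refl) (simp add: G_def integral_lborel_shift)
  also have "\<dots> = (\<integral>v. (\<integral>\<tau>. G \<tau> v \<partial>lborel) \<partial>lborel)"
    by (rule lborel_pair.Fubini_integral[OF intG, symmetric])
  also have "\<dots> = (\<integral>v. h (v + axis a 1) \<partial>lborel) - (\<integral>v. h v \<partial>lborel)"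
    unfolding inner by (rule Bochner_Integration.integral_diff[OF integrable_lborel_shift[OF int] int])
  also have "\<dots> = 0" by (simp add: integral_lborel_shift)
  finally show ?thesis unfolding D_def .
qed

section \<open>Translation invariance and vanishing derivatives on the periodic cell\<close>

lemma compact_cell [simp]: "compact (cell L)" and closed_cell [simp]: "closed (cell L)"
  by (auto simp: cell_def compact_imp_closed)

text \<open>The shifted cell sticks out over the face x_a = L by a slab of thickness s. Periodicity
  moves this slab to the bottom of the cell, where the shift has left a gap. As s \<le> L, one cut
  is enough.\<close>

lemma integral_cell_shift:
  fixes q :: "real^'d \<Rightarrow> real"
  assumes per: "periodic L q" and cont: "continuous_on UNIV q" and s: "0 \<le> s" "s \<le> L"
  shows "integral (cell L) (\<lambda>x. q (x + s *\<^sub>R axis a 1)) = integral (cell L) q"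
proof -
  have int: "q integrable_on cbox u v" for u v
    by (rule integrable_continuous[OF continuous_on_subset[OF cont]]) simp
  \<comment> \<open>Stated for arbitrary corners because both boxes get cut: the shifted one at
    height L, the original one at height s.\<close>
  have split: "integral (cbox u v) q =
      integral (cbox u (\<chi> i. if i = a then min (v $ i) c else v $ i)) q +
      integral (cbox (\<chi> i. if i = a then max (u $ i) c else u $ i) v) q" for u v :: "real^'d" and c
  proof -
    have eq1: "cbox u v \<inter> {x. x \<bullet> axis a 1 \<le> c} = cbox u (\<chi> i. if i = a then min (v $ i) c else v $ i)"
      by (auto simp: mem_box_cart inner_axis split: if_splits)
    have eq2: "cbox u v \<inter> {x. x \<bullet> axis a 1 \<ge> c} = cbox (\<chi> i. if i = a then max (u $ i) c else u $ i) v"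
      by (auto simp: mem_box_cart inner_axis split: if_splits)
    have "(q has_integral (integral (cbox u (\<chi> i. if i = a then min (v $ i) c else v $ i)) q +
      integral (cbox (\<chi> i. if i = a then max (u $ i) c else u $ i) v) q)) (cbox u v)"
      by (rule has_integral_split[where k = "axis a 1" and c = c])
        (unfold eq1 eq2, auto intro: integrable_integral[OF int] simp: axis_in_Basis_iff)
    then show ?thesis by (rule integral_unique)
  qed
  let ?e = "axis a 1 :: real^'d"
  have "integral (cell L) (\<lambda>x. q (x + s *\<^sub>R ?e)) = integral (cbox (s *\<^sub>R ?e) ((\<chi> i. L) + s *\<^sub>R ?e)) q"
    using integral_shift_cbox[of "s *\<^sub>R ?e" "s *\<^sub>R ?e" "(\<chi> i. L) + s *\<^sub>R ?e" q] by (simp add: cell_def)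
  also have "\<dots> = integral (cbox (s *\<^sub>R ?e) (\<chi> i. L)) q +
      integral (cbox (L *\<^sub>R ?e) ((\<chi> i. L) + s *\<^sub>R ?e)) q"
  proof -
    have 1: "(\<chi> i. if i = a then min (((\<chi> i. L) + s *\<^sub>R ?e) $ i) L else ((\<chi> i. L) + s *\<^sub>R ?e) $ i) = (\<chi> i. L)"
      using s by (simp add: vec_eq_iff axis_def)
    have 2: "(\<chi> i. if i = a then max ((s *\<^sub>R ?e) $ i) L else (s *\<^sub>R ?e) $ i) = L *\<^sub>R ?e"
      using s by (simp add: vec_eq_iff axis_def)
    show ?thesis by (subst split[where c = L]) (simp only: 1 2)
  qed
  also have "integral (cbox (L *\<^sub>R ?e) ((\<chi> i. L) + s *\<^sub>R ?e)) q =
      integral (cbox 0 ((\<chi> i. L) + (s - L) *\<^sub>R ?e)) q"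
  proof -
    have "q (x + L *\<^sub>R ?e) = q x" for x
      using per by (simp add: periodic_def axis_def scaleR_vec_def if_distrib cong: if_cong)
    then show ?thesis
      using integral_shift_cbox[of "L *\<^sub>R ?e" "L *\<^sub>R ?e" "(\<chi> i. L) + s *\<^sub>R ?e" q]
      by (simp add: scaleR_diff_left algebra_simps)
  qed
  also have "integral (cbox (s *\<^sub>R ?e) (\<chi> i. L)) q + \<dots> = integral (cell L) q"
  proof -
    have 1: "(\<chi> i. if i = a then min ((\<chi> i. L) $ i) s else (\<chi> i. L) $ i) = (\<chi> i. L) + (s - L) *\<^sub>R ?e"
      using s by (simp add: vec_eq_iff axis_def)
    have 2: "(\<chi> i. if i = a then max ((0::real^'d) $ i) s else 0 $ i) = s *\<^sub>R ?e"
      using s by (simp add: vec_eq_iff axis_def)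
    show ?thesis unfolding cell_def by (subst split[of 0 "\<chi> i. L" s]) (simp only: 1 2 add.commute)
  qed
  finally show ?thesis .
qed

lemma integral_cell_swap:
  fixes F :: "real \<Rightarrow> real^'d \<Rightarrow> 'b::banach"
  assumes "continuous_on ({a..b} \<times> cell L) (\<lambda>(t, x). F t x)"
  shows "integral {a..b} (\<lambda>t. integral (cell L) (F t)) = integral (cell L) (\<lambda>x. integral {a..b} (\<lambda>t. F t x))"
  using integral_swap_continuous[of a 0 b "\<chi> i. L" F] assms by (simp add: cell_def cbox_Pair_eq)

text \<open>Average the derivative over the translations by s in [0, L]: every translate has the
  same cell integral, while integrating in s first yields a difference over a full period, which is
  zero.\<close>

lemma integral_cell_grad_zero:
  fixes g :: "real^'d \<Rightarrow> real"
  assumes L: "0 < L" and per: "periodic L g" and diff: "\<And>x. g differentiable (at x)"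
    and cont: "continuous_on UNIV (\<lambda>x. grad g x $ a)"
  shows "integral (cell L) (\<lambda>x. grad g x $ a) = 0"
proof -
  define D where "D x = grad g x $ a" for x
  have cD: "continuous_on UNIV D" using cont unfolding D_def .
  have perD: "periodic L D"
    unfolding periodic_def D_def grad_def
  proof (intro allI, simp)
    fix x :: "real^'d" and i
    have "g \<circ> (\<lambda>y. y + axis i L) = g" using per by (auto simp: periodic_def)
    moreover have "((g \<circ> (\<lambda>y. y + axis i L)) has_derivative
        (\<lambda>h. grad g (x + axis i L) \<bullet> h) \<circ> (\<lambda>h. h)) (at x)"
      by (rule diff_chain_at[OF _ has_derivative_grad[OF diff]]) (auto intro!: derivative_eq_intros)
    ultimately have "(g has_derivative (\<lambda>h. grad g (x + axis i L) \<bullet> h)) (at x)" by (simp add: o_def)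
    from grad_eqI[OF this] show "frechet_derivative g (at (x + axis i L)) (axis a 1) =
        frechet_derivative g (at x) (axis a 1)"
      by (simp add: grad_def vec_eq_iff)
  qed
  have "L * integral (cell L) D = integral {0..L} (\<lambda>s. integral (cell L) (\<lambda>x. D (x + s *\<^sub>R axis a 1)))"
  proof -
    have "integral {0..L} (\<lambda>s. integral (cell L) (\<lambda>x. D (x + s *\<^sub>R axis a 1))) =
        integral {0..L} (\<lambda>s. integral (cell L) D)"
      by (rule integral_cong) (simp add: integral_cell_shift[OF perD cD])
    then show ?thesis using L by simp
  qed
  also have "\<dots> = integral (cell L) (\<lambda>x. integral {0..L} (\<lambda>s. D (x + s *\<^sub>R axis a 1)))"
    by (rule integral_cell_swap)
      (unfold split_beta, intro continuous_on_compose2[OF cD] continuous_intros, auto)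
  also have "\<dots> = integral (cell L) (\<lambda>x. g (x + L *\<^sub>R axis a 1) - g x)"
    using frechet_derivative_along[OF diff cont] L by (simp add: D_def)
  also have "\<dots> = 0"
  proof -
    have "g (x + L *\<^sub>R axis a 1) = g x" for x
      using per by (simp add: periodic_def axis_def scaleR_vec_def if_distrib cong: if_cong)
    then show ?thesis by simp
  qed
  finally show ?thesis using L by (simp add: D_def[abs_def])
qed

section \<open>Periodic C1 functions and integration by parts on the torus\<close>

lemma grad_shift:
  fixes g :: "real^'d \<Rightarrow> real"
  assumes "\<And>x. g differentiable (at x)"
  shows "((\<lambda>x. g (x + c)) has_derivative (\<lambda>h. grad g (x + c) \<bullet> h)) (at x)"
    and "grad (\<lambda>x. g (x + c)) x = grad g (x + c)"
proof -
  have "((g \<circ> (\<lambda>y. y + c)) has_derivative (\<lambda>h. grad g (x + c) \<bullet> h) \<circ> (\<lambda>h. h)) (at x)"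
    by (rule diff_chain_at[OF _ has_derivative_grad[OF assms]]) (auto intro!: derivative_eq_intros)
  then show "((\<lambda>x. g (x + c)) has_derivative (\<lambda>h. grad g (x + c) \<bullet> h)) (at x)" by (simp add: o_def)
  then show "grad (\<lambda>x. g (x + c)) x = grad g (x + c)" by (rule grad_eqI)
qed

lemma periodic_grad:
  assumes "periodic L g" "\<And>x. g differentiable (at x)"
  shows "periodic L (grad g)"
  unfolding periodic_def
proof (intro allI)
  fix x i
  have "(\<lambda>x. g (x + axis i L)) = g" using assms(1) by (auto simp: periodic_def)
  then show "grad g (x + axis i L) = grad g x" using grad_shift(2)[OF assms(2), of "axis i L" x] by simp
qed

text \<open>The class in which integration by parts on the torus is carried out: closed under sums
  and products, and periodic, so that derivatives integrate to zero over the cell.\<close>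

definition C1_periodic :: "real \<Rightarrow> (real^'d \<Rightarrow> real) \<Rightarrow> bool" where
  "C1_periodic L g \<longleftrightarrow> periodic L g \<and> (\<forall>x. g differentiable (at x)) \<and> continuous_on UNIV (grad g)"

lemma C1_periodicD:
  assumes "C1_periodic L g"
  shows "periodic L g" "g differentiable (at x)" "continuous_on UNIV (grad g)"
    "continuous_on A (\<lambda>x. grad g x $ a)" "continuous_on A g"
proof -
  show "periodic L g" "g differentiable (at x)" "continuous_on UNIV (grad g)"
    using assms by (auto simp: C1_periodic_def)
  then show "continuous_on A (\<lambda>x. grad g x $ a)"
    using continuous_on_component[OF continuous_on_subset[of UNIV "grad g" A]] by auto
  have "isCont g x" for x
    using assms differentiable_imp_continuous_within by (auto simp: C1_periodic_def)
  then show "continuous_on A g" by (simp add: continuous_at_imp_continuous_on)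
qed

lemma C1_periodic_mult:
  assumes "C1_periodic L g" "C1_periodic L h"
  shows "C1_periodic L (\<lambda>x. g x * h x)"
  unfolding C1_periodic_def
proof (intro conjI allI)
  show "periodic L (\<lambda>x. g x * h x)" using assms by (auto simp: C1_periodic_def periodic_def)
  show "(\<lambda>x. g x * h x) differentiable (at x)" for x
    using assms by (intro differentiable_mult) (auto simp: C1_periodic_def)
  have "grad (\<lambda>x. g x * h x) = (\<lambda>x. g x *\<^sub>R grad h x + h x *\<^sub>R grad g x)"
    using assms by (auto simp: C1_periodic_def grad_mult)
  then show "continuous_on UNIV (grad (\<lambda>x. g x * h x))"
    using C1_periodicD[OF assms(1)] C1_periodicD[OF assms(2)] by (simp add: continuous_intros)
qed

lemma C1_periodic_add:
  assumes "C1_periodic L g" "C1_periodic L h"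
  shows "C1_periodic L (\<lambda>x. g x + h x)"
  unfolding C1_periodic_def
proof (intro conjI allI)
  show "periodic L (\<lambda>x. g x + h x)" using assms by (auto simp: C1_periodic_def periodic_def)
  show "(\<lambda>x. g x + h x) differentiable (at x)" for x
    using assms by (intro differentiable_add) (auto simp: C1_periodic_def)
  have "grad (\<lambda>x. g x + h x) = (\<lambda>x. grad g x + grad h x)"
    using assms by (auto simp: C1_periodic_def grad_add)
  then show "continuous_on UNIV (grad (\<lambda>x. g x + h x))"
    using C1_periodicD[OF assms(1)] C1_periodicD[OF assms(2)] by (simp add: continuous_intros)
qed

lemma C1_periodic_const: "C1_periodic L (\<lambda>_. c)"
  by (auto simp: C1_periodic_def periodic_def grad_const[abs_def])

lemma C1_periodic_sum:
  "finite A \<Longrightarrow> (\<And>i. i \<in> A \<Longrightarrow> C1_periodic L (g i)) \<Longrightarrow> C1_periodic L (\<lambda>x. \<Sum>i\<in>A. g i x)"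
  by (induction A rule: finite_induct) (auto intro!: C1_periodic_const C1_periodic_add)

lemma integrable_on_cell: "continuous_on (cell L) f \<Longrightarrow> (f :: real^'d \<Rightarrow> 'b::banach) integrable_on cell L"
  unfolding cell_def by (rule integrable_continuous)

lemma integral_cell_by_parts:
  assumes "0 < L" "C1_periodic L g" "C1_periodic L h"
  shows "integral (cell L) (\<lambda>x. g x * grad h x $ a) = - integral (cell L) (\<lambda>x. grad g x $ a * h x)"
proof -
  note D = C1_periodicD[OF assms(2)] C1_periodicD[OF assms(3)] C1_periodicD[OF C1_periodic_mult[OF assms(2,3)]]
  have "0 = integral (cell L) (\<lambda>x. grad (\<lambda>x. g x * h x) x $ a)"
    by (rule integral_cell_grad_zero[symmetric]) (use D assms(1) in auto)
  also have "\<dots> = integral (cell L) (\<lambda>x. g x * grad h x $ a + grad g x $ a * h x)"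
    by (intro integral_cong) (simp add: grad_mult D)
  also have "\<dots> = integral (cell L) (\<lambda>x. g x * grad h x $ a) + integral (cell L) (\<lambda>x. grad g x $ a * h x)"
    by (intro Henstock_Kurzweil_Integration.integral_add integrable_on_cell continuous_intros D)
  finally show ?thesis by simp
qed

text \<open>The divergence is spelled out through gradients of the components, the form in which the
  regularity of the flux is available; \<open>divergence_eq\<close> later identifies it with
  \<open>divergence\<close>.\<close>

lemma integral_cell_divergence:
  assumes "0 < L" "C1_periodic L g" "\<And>b. C1_periodic L (\<lambda>x. J x $ b)"
  shows "integral (cell L) (\<lambda>x. g x * (\<Sum>b\<in>UNIV. grad (\<lambda>x. J x $ b) x $ b)) =
    - integral (cell L) (\<lambda>x. grad g x \<bullet> J x)"
proof -
  note D = C1_periodicD[OF assms(2)] C1_periodicD[OF assms(3)]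
  have "integral (cell L) (\<lambda>x. g x * (\<Sum>b\<in>UNIV. grad (\<lambda>x. J x $ b) x $ b)) =
      (\<Sum>b\<in>UNIV. integral (cell L) (\<lambda>x. g x * grad (\<lambda>x. J x $ b) x $ b))"
    unfolding sum_distrib_left
    by (intro integral_sum integrable_on_cell continuous_intros D) auto
  also have "\<dots> = - (\<Sum>b\<in>UNIV. integral (cell L) (\<lambda>x. grad g x $ b * J x $ b))"
    by (simp add: integral_cell_by_parts[OF assms] sum_negf)
  also have "(\<Sum>b\<in>UNIV. integral (cell L) (\<lambda>x. grad g x $ b * J x $ b)) = integral (cell L) (\<lambda>x. grad g x \<bullet> J x)"
    unfolding inner_vec_def inner_real_def
    by (intro integral_sum[symmetric] integrable_on_cell continuous_intros D) auto
  finally show ?thesis .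
qed

subsection \<open>The Poisson equation\<close>

text \<open>Besides the regularity of u this recovers the density from the potential, so that
  continuity of \<rho> in x comes from the second derivatives of u.\<close>

lemma poisson_potentialD:
  assumes "poisson_potential L \<rho> u"
  shows "C1_periodic L u" "C1_periodic L (\<lambda>x. grad u x $ b)"
    "\<rho> x = 1 - (\<Sum>b\<in>UNIV. grad (\<lambda>x. grad u x $ b) x $ b)" "continuous_on A \<rho>"
proof -
  from assms have per: "periodic L u" and du: "\<And>x. u differentiable (at x)"
    and d2: "\<And>x. grad u differentiable (at x)"
    and c2: "\<And>i. continuous_on UNIV (\<lambda>x. frechet_derivative (grad u) (at x) (axis i 1))"
    and lap: "\<And>x. - laplacian u x = \<rho> x - 1"
    by (auto simp: poisson_potential_def)
  have "isCont (grad u) x" for x using d2 differentiable_imp_continuous_within by blast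
  then show C1: "C1_periodic L u"
    using per du by (simp add: C1_periodic_def continuous_at_imp_continuous_on)
  have hd: "((\<lambda>x. grad u x $ b) has_derivative (\<lambda>h. frechet_derivative (grad u) (at x) h $ b)) (at x)" for x b
    by (rule bounded_linear.has_derivative[OF bounded_linear_vec_nth]) (use d2 frechet_derivative_works in blast)
  have dg: "grad (\<lambda>x. grad u x $ b) x = (\<chi> i. frechet_derivative (grad u) (at x) (axis i 1) $ b)" for x b
    unfolding grad_def[of "\<lambda>x. grad u x $ b"] frechet_derivative_at[OF hd, symmetric] ..
  show C2: "C1_periodic L (\<lambda>x. grad u x $ b)" for b
    unfolding C1_periodic_def
  proof (intro conjI allI)
    show "periodic L (\<lambda>x. grad u x $ b)" using periodic_grad[OF per du] by (simp add: periodic_def)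
    show "(\<lambda>x. grad u x $ b) differentiable (at x)" for x using hd unfolding differentiable_def by blast
    show "continuous_on UNIV (grad (\<lambda>x. grad u x $ b))"
      unfolding dg[abs_def] by (intro continuous_intros continuous_on_vec_lambda c2)
  qed
  show rho: "\<rho> x = 1 - (\<Sum>b\<in>UNIV. grad (\<lambda>x. grad u x $ b) x $ b)" for x
    using lap[of x] by (simp add: laplacian_def divergence_def dg)
  have "continuous_on A (\<lambda>x. 1 - (\<Sum>b\<in>UNIV. grad (\<lambda>x. grad u x $ b) x $ b))"
    by (intro continuous_intros C1_periodicD[OF C2])
  then show "continuous_on A \<rho>" by (simp add: rho[abs_def])
qed

text \<open>Integration by parts against a test function; the integral of g alone stems from the
  uniform background charge 1.\<close>

lemma poisson_weak:
  assumes L: "0 < L" and P: "poisson_potential L \<rho> u" and g: "C1_periodic L g"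
  shows "integral (cell L) (\<lambda>x. g x * \<rho> x) = integral (cell L) g + integral (cell L) (\<lambda>x. grad g x \<bullet> grad u x)"
proof -
  note D = poisson_potentialD[OF P]
  have "integral (cell L) (\<lambda>x. g x * \<rho> x) =
      integral (cell L) (\<lambda>x. g x - g x * (\<Sum>b\<in>UNIV. grad (\<lambda>x. grad u x $ b) x $ b))"
    by (simp add: D(3) algebra_simps)
  also have "\<dots> = integral (cell L) g - integral (cell L) (\<lambda>x. g x * (\<Sum>b\<in>UNIV. grad (\<lambda>x. grad u x $ b) x $ b))"
    by (intro Henstock_Kurzweil_Integration.integral_diff integrable_on_cell continuous_intros
        C1_periodicD[OF D(2)] C1_periodicD[OF g])
  finally show ?thesis using integral_cell_divergence[OF L g D(2)] by simp
qed

text \<open>Factor the difference of squares of the gradients into sum times difference and test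
  both weak equations with u1 + u2; the background terms cancel. Only the difference of the
  densities appears, which is what the continuity equation controls.\<close>

lemma poisson_energy_diff:
  assumes L: "0 < L" and P: "poisson_potential L \<rho>1 u1" "poisson_potential L \<rho>2 u2"
  shows "integral (cell L) (\<lambda>x. (norm (grad u1 x))\<^sup>2) - integral (cell L) (\<lambda>x. (norm (grad u2 x))\<^sup>2) =
    integral (cell L) (\<lambda>x. (u1 x + u2 x) * (\<rho>1 x - \<rho>2 x))"
proof -
  note C = poisson_potentialD(1)[OF P(1)] poisson_potentialD(1)[OF P(2)]
  note D = C1_periodicD[OF C(1)] C1_periodicD[OF C(2)] poisson_potentialD(4)[OF P(1)] poisson_potentialD(4)[OF P(2)]
  note cu = continuous_on_subset[OF D(3) subset_UNIV] continuous_on_subset[OF D(8) subset_UNIV]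
  note CC = C1_periodic_add[OF C]
  have "integral (cell L) (\<lambda>x. (u1 x + u2 x) * (\<rho>1 x - \<rho>2 x)) =
     integral (cell L) (\<lambda>x. (u1 x + u2 x) * \<rho>1 x) - integral (cell L) (\<lambda>x. (u1 x + u2 x) * \<rho>2 x)"
    unfolding right_diff_distrib
    by (intro Henstock_Kurzweil_Integration.integral_diff integrable_on_cell continuous_intros D)
  also have "\<dots> = integral (cell L) (\<lambda>x. (grad u1 x + grad u2 x) \<bullet> grad u1 x) -
      integral (cell L) (\<lambda>x. (grad u1 x + grad u2 x) \<bullet> grad u2 x)"
    by (simp add: poisson_weak[OF L P(1) CC] poisson_weak[OF L P(2) CC] grad_add D)
  also have "\<dots> = integral (cell L) (\<lambda>x. (grad u1 x + grad u2 x) \<bullet> grad u1 x - (grad u1 x + grad u2 x) \<bullet> grad u2 x)"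
    by (intro Henstock_Kurzweil_Integration.integral_diff[symmetric] integrable_on_cell continuous_intros cu)
  also have "\<dots> = integral (cell L) (\<lambda>x. (norm (grad u1 x))\<^sup>2 - (norm (grad u2 x))\<^sup>2)"
    by (simp add: power2_norm_eq_inner inner_add_left inner_commute[of "grad u2 _" "grad u1 _"])
  also have "\<dots> = integral (cell L) (\<lambda>x. (norm (grad u1 x))\<^sup>2) - integral (cell L) (\<lambda>x. (norm (grad u2 x))\<^sup>2)"
    by (intro Henstock_Kurzweil_Integration.integral_diff integrable_on_cell continuous_intros cu)
  finally show ?thesis by simp
qed

lemma poisson_potential_shift:
  assumes "poisson_potential L \<rho> u"
  shows "poisson_potential L (\<lambda>x. \<rho> (x + c)) (\<lambda>x. u (x + c))"
proof -
  from assms have per: "periodic L u" and du: "\<And>x. u differentiable (at x)"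
    and d2: "\<And>x. grad u differentiable (at x)"
    and c2: "\<And>i. continuous_on UNIV (\<lambda>x. frechet_derivative (grad u) (at x) (axis i 1))"
    and lap: "\<And>x. - laplacian u x = \<rho> x - 1"
    by (auto simp: poisson_potential_def)
  have g: "grad (\<lambda>x. u (x + c)) = (\<lambda>x. grad u (x + c))"
    using grad_shift(2)[OF du] by blast
  have hd: "((\<lambda>x. grad u (x + c)) has_derivative frechet_derivative (grad u) (at (x + c))) (at x)" for x
  proof -
    have "((grad u \<circ> (\<lambda>y. y + c)) has_derivative frechet_derivative (grad u) (at (x + c)) \<circ> (\<lambda>h. h)) (at x)"
      by (rule diff_chain_at) (use d2 frechet_derivative_works in \<open>auto intro!: derivative_eq_intros\<close>)
    then show ?thesis by (simp add: o_def)
  qed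
  have fd: "frechet_derivative (\<lambda>x. grad u (x + c)) (at x) = frechet_derivative (grad u) (at (x + c))" for x
    using frechet_derivative_at[OF hd] by simp
  show ?thesis
    unfolding poisson_potential_def g laplacian_def divergence_def fd
  proof (intro conjI allI)
    show "periodic L (\<lambda>x. u (x + c))"
      using per unfolding periodic_def by (metis add.assoc add.commute)
    show "(\<lambda>x. u (x + c)) differentiable (at x)" for x
      using grad_shift(1)[OF du] unfolding differentiable_def by blast
    show "(\<lambda>x. grad u (x + c)) differentiable (at x)" for x
      using hd unfolding differentiable_def by blast
    show "continuous_on UNIV (\<lambda>x. frechet_derivative (grad u) (at (x + c)) (axis i 1))" for i
      by (rule continuous_on_compose2[OF c2]) (auto intro!: continuous_intros)
    show "- (\<Sum>i\<in>UNIV. frechet_derivative (grad u) (at (x + c)) (axis i 1) $ i) = \<rho> (x + c) - 1" for x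
      using lap[of "x + c"] by (simp add: laplacian_def divergence_def)
  qed
qed

text \<open>Avoids the symmetry of second derivatives: the energy of a translate of \<open>u\<close> is that of \<open>u\<close>, so
  \<open>\<integral> (u\<^sub>s - u) (\<rho>\<^sub>s + \<rho>) = 0\<close> for the translates by \<open>s\<close>, and the claim is the derivative at \<open>s = 0\<close>.\<close>

lemma poisson_force_zero:
  assumes L: "0 < L" and P: "poisson_potential L \<rho> u"
  shows "integral (cell L) (\<lambda>x. \<rho> x * grad u x $ a) = 0"
proof -
  note C = poisson_potentialD(1)[OF P]
  note D = C1_periodicD[OF C]
  have c\<rho>: "continuous_on UNIV \<rho>" by (rule poisson_potentialD(4)[OF P])
  have cD: "continuous_on UNIV (\<lambda>x. grad u x $ a)" by (rule D)
  let ?e = "\<lambda>s. s *\<^sub>R axis a 1 :: real^'a"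
  \<comment> \<open>The two translations are kept apart: integrating in the first variable recovers
    the difference of u and its translate, while the second stays at s. The claim concerns the
    corner (0, 0).\<close>
  define \<Psi> where "\<Psi> s t = integral (cell L) (\<lambda>x. grad u (x + ?e s) $ a * (\<rho> (x + ?e t) + \<rho> x))" for s t
  have "continuous_on (({0..L} \<times> {0..L}) \<times> cbox 0 (\<chi> i. L))
      (\<lambda>(p, x). grad u (x + ?e (fst p)) $ a * (\<rho> (x + ?e (snd p)) + \<rho> x))"
    unfolding split_beta
    by (intro continuous_on_mult continuous_on_add continuous_on_compose2[OF cD] continuous_on_compose2[OF c\<rho>] continuous_intros) auto
  from integral_continuous_on_param[OF this]
  have c\<Psi>: "continuous_on ({0..L} \<times> {0..L}) (\<lambda>(s, t). \<Psi> s t)"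
    by (simp add: \<Psi>_def cell_def split_beta)
  \<comment> \<open>Testing the equations of u and of its translate with both potentials gives four
    terms: the mixed gradient integrals cancel, and the two diagonal ones agree by translation
    invariance.\<close>
  have zero: "integral {0..s} (\<lambda>\<sigma>. \<Psi> \<sigma> s) = 0" if s: "s \<in> {0..L}" for s
  proof -
    note Ps = poisson_potential_shift[OF P, of "?e s"]
    note Cs = poisson_potentialD(1)[OF Ps]
    note Ds = C1_periodicD[OF Cs] poisson_potentialD(4)[OF Ps]
    note cg = continuous_on_subset[OF D(3) subset_UNIV] continuous_on_subset[OF Ds(3) subset_UNIV]
    have cu: "continuous_on UNIV u" by (rule D)
    have sh: "integral (cell L) (\<lambda>x. q (x + ?e s)) = integral (cell L) q"
      if "periodic L q" "continuous_on UNIV q" for q :: "real^'a \<Rightarrow> real"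
      using integral_cell_shift[OF that, of s a] s by auto
    have "integral {0..s} (\<lambda>\<sigma>. \<Psi> \<sigma> s) =
        integral (cell L) (\<lambda>x. integral {0..s} (\<lambda>\<sigma>. grad u (x + ?e \<sigma>) $ a * (\<rho> (x + ?e s) + \<rho> x)))"
      unfolding \<Psi>_def
      by (rule integral_cell_swap) (unfold split_beta,
        intro continuous_on_mult continuous_on_add continuous_on_compose2[OF cD] continuous_on_compose2[OF c\<rho>] continuous_intros, auto)
    also have "\<dots> = integral (cell L) (\<lambda>x. (u (x + ?e s) - u x) * (\<rho> (x + ?e s) + \<rho> x))"
      using frechet_derivative_along[OF D(2) cD, of s] s by simp
    also have "\<dots> = integral (cell L) (\<lambda>x. (u (x + ?e s) * \<rho> (x + ?e s) + u (x + ?e s) * \<rho> x) - (u x * \<rho> (x + ?e s) + u x * \<rho> x))"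
      by (simp add: algebra_simps)
    also have "\<dots> = (integral (cell L) (\<lambda>x. u (x + ?e s) * \<rho> (x + ?e s)) + integral (cell L) (\<lambda>x. u (x + ?e s) * \<rho> x))
       - (integral (cell L) (\<lambda>x. u x * \<rho> (x + ?e s)) + integral (cell L) (\<lambda>x. u x * \<rho> x))"
    proof -
      have c: "continuous_on (cell L) u" "continuous_on (cell L) (\<lambda>x. u (x + ?e s))"
        "continuous_on (cell L) \<rho>" "continuous_on (cell L) (\<lambda>x. \<rho> (x + ?e s))"
        by (auto intro: D Ds continuous_on_subset[OF c\<rho>])
      show ?thesis
        by (subst Henstock_Kurzweil_Integration.integral_diff,
            (intro integrable_on_cell continuous_intros c)+,
            subst Henstock_Kurzweil_Integration.integral_add,
            (intro integrable_on_cell continuous_intros c)+,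
            subst Henstock_Kurzweil_Integration.integral_add,
            (intro integrable_on_cell continuous_intros c)+, rule refl)
    qed
    also have "integral (cell L) (\<lambda>x. u (x + ?e s) * \<rho> (x + ?e s)) = integral (cell L) (\<lambda>x. u (x + ?e s)) +
        integral (cell L) (\<lambda>x. grad u (x + ?e s) \<bullet> grad u (x + ?e s))"
      using poisson_weak[OF L Ps Cs] by (simp add: grad_shift D)
    also have "integral (cell L) (\<lambda>x. u (x + ?e s) * \<rho> x) = integral (cell L) (\<lambda>x. u (x + ?e s)) +
        integral (cell L) (\<lambda>x. grad u (x + ?e s) \<bullet> grad u x)"
      using poisson_weak[OF L P Cs] by (simp add: grad_shift D)
    also have "integral (cell L) (\<lambda>x. u x * \<rho> (x + ?e s)) = integral (cell L) u +
        integral (cell L) (\<lambda>x. grad u (x + ?e s) \<bullet> grad u x)"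
      using poisson_weak[OF L Ps C] by (simp add: grad_shift D inner_commute)
    also have "integral (cell L) (\<lambda>x. u x * \<rho> x) = integral (cell L) u +
        integral (cell L) (\<lambda>x. grad u x \<bullet> grad u x)"
      using poisson_weak[OF L P C] .
    also have "integral (cell L) (\<lambda>x. u (x + ?e s)) = integral (cell L) u"
      by (rule sh) (use D in auto)
    also have "integral (cell L) (\<lambda>x. grad u (x + ?e s) \<bullet> grad u (x + ?e s)) = integral (cell L) (\<lambda>x. grad u x \<bullet> grad u x)"
      using periodic_grad[OF D(1,2)] by (intro sh continuous_intros D) (simp add: periodic_def)
    finally show ?thesis by simp
  qed
  have "\<bar>\<Psi> 0 0\<bar> \<le> \<epsilon>" if "\<epsilon> > 0" for \<epsilon>
  proof -
    have "(0::real, 0::real) \<in> {0..L} \<times> {0..L}" using L by auto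
    with c\<Psi> that obtain d where d: "d > 0"
      "\<And>p. p \<in> {0..L} \<times> {0..L} \<Longrightarrow> dist p (0, 0) < d \<Longrightarrow> dist (case p of (s, t) \<Rightarrow> \<Psi> s t) (\<Psi> 0 0) < \<epsilon>"
      unfolding continuous_on_iff by (metis case_prod_conv)
    \<comment> \<open>With \<sigma> and s both at most d / 4 the distance of (\<sigma>, s) to the
      corner stays below d.\<close>
    define s where "s = min L (d / 4)"
    have s: "0 < s" "s \<le> L" "s < d / 2" using L d by (auto simp: s_def)
    have near: "norm (\<Psi> \<sigma> s - \<Psi> 0 0) \<le> \<epsilon>" if "\<sigma> \<in> {0..s}" for \<sigma>
    proof -
      have "dist (\<sigma>, s) (0, 0) \<le> \<bar>\<sigma>\<bar> + \<bar>s\<bar>"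
        unfolding dist_Pair_Pair by (simp add: dist_norm) (rule sqrt_sum_squares_le_sum_abs)
      then have "dist (\<sigma>, s) (0, 0) < d" using s that by auto
      with d(2)[of "(\<sigma>, s)"] s that show ?thesis by (auto simp: dist_norm)
    qed
    have c1: "continuous_on {0..s} (\<lambda>\<sigma>. \<Psi> \<sigma> s)"
      by (rule continuous_on_compose2[OF c\<Psi>, of _ "\<lambda>\<sigma>. (\<sigma>, s)", simplified]) (use s in \<open>auto intro!: continuous_intros\<close>)
    have "norm (integral {0..s} (\<lambda>\<sigma>. \<Psi> \<sigma> s - \<Psi> 0 0)) \<le> \<epsilon> * (s - 0)"
      by (rule integral_bound) (use s near c1 in \<open>auto intro!: continuous_intros\<close>)
    moreover have "integral {0..s} (\<lambda>\<sigma>. \<Psi> \<sigma> s - \<Psi> 0 0) = - s * \<Psi> 0 0"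
      using zero[of s] s c1
      by (subst Henstock_Kurzweil_Integration.integral_diff) (auto intro!: integrable_continuous_real)
    ultimately show ?thesis using s by (simp add: abs_mult)
  qed
  then have "\<Psi> 0 0 = 0" by (meson abs_le_zero_iff dense_ge)
  moreover have "\<Psi> 0 0 = integral (cell L) (\<lambda>x. 2 * (\<rho> x * grad u x $ a))"
    by (simp add: \<Psi>_def algebra_simps)
  ultimately show ?thesis by simp
qed

section \<open>Time evolution of the electric energy\<close>

lemma constant_if_locally_flat:
  fixes D :: "real \<Rightarrow> real"
  assumes "\<And>\<epsilon>. \<epsilon> > 0 \<Longrightarrow> \<exists>\<delta>>0. \<forall>s\<in>{0..T}. \<forall>t\<in>{0..T}. s \<le> t \<and> t - s < \<delta> \<longrightarrow> \<bar>D t - D s\<bar> \<le> \<epsilon> * (t - s)"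
    and t: "t \<in> {0..T}"
  shows "D t = D 0"
proof -
  have "(D has_derivative (\<lambda>h. 0)) (at x within {0..T})" if x: "x \<in> {0..T}" for x
    unfolding has_derivative_within_alt
  proof (intro conjI allI impI)
    fix \<epsilon> :: real assume "\<epsilon> > 0"
    from assms(1)[OF this] obtain \<delta> where \<delta>: "\<delta> > 0"
      "\<And>s t. s \<in> {0..T} \<Longrightarrow> t \<in> {0..T} \<Longrightarrow> s \<le> t \<Longrightarrow> t - s < \<delta> \<Longrightarrow> \<bar>D t - D s\<bar> \<le> \<epsilon> * (t - s)"
      by blast
    have "norm (D y - D x - 0) \<le> \<epsilon> * norm (y - x)" if "y \<in> {0..T}" "norm (y - x) < \<delta>" for y
      using \<delta>(2)[of x y] \<delta>(2)[of y x] x that by (cases "x \<le> y") (auto simp: abs_minus_commute)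
    then show "\<exists>d>0. \<forall>y\<in>{0..T}. norm (y - x) < d \<longrightarrow> norm (D y - D x - 0) \<le> \<epsilon> * norm (y - x)"
      using \<delta>(1) by blast
  qed simp
  then show ?thesis
    using has_derivative_zero_unique[of "{0..T}" D 0 t] t by (simp add: convex_real_interval)
qed

text \<open>Time derivatives of the potential are avoided. The exact energy increment between s and
  t pairs the fluxes in between with the average of the fields at the two ends. Uniform continuity
  replaces this average by the field at the intermediate time with an error of at most \<epsilon> (t
  - s), so the difference of both sides has zero derivative in time.\<close>

lemma electric_energy_balance:
  fixes J :: "real \<Rightarrow> real^'d \<Rightarrow> real^'d"
  assumes L: "0 < L" and P: "\<And>t. t \<in> {0..T} \<Longrightarrow> poisson_potential L (\<rho> t) (u t)"
    and E: "\<And>t x. E t x = - grad (u t) x" and cE: "continuous_on ({0..T} \<times> UNIV) (\<lambda>(t, x). E t x)"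
    and J: "\<And>t b. t \<in> {0..T} \<Longrightarrow> C1_periodic L (\<lambda>x. J t x $ b)"
    and cJ: "continuous_on ({0..T} \<times> UNIV) (\<lambda>(t, x). J t x)"
    and cdJ: "continuous_on ({0..T} \<times> UNIV) (\<lambda>(t, x). \<Sum>b\<in>UNIV. grad (\<lambda>x. J t x $ b) x $ b)"
    and \<rho>: "\<And>t x. t \<in> {0..T} \<Longrightarrow>
      \<rho> t x - \<rho> 0 x = - integral {0..t} (\<lambda>s. \<Sum>b\<in>UNIV. grad (\<lambda>x. J s x $ b) x $ b)"
    and t: "t \<in> {0..T}"
  shows "1/2 * integral (cell L) (\<lambda>x. (norm (E t x))\<^sup>2) - 1/2 * integral (cell L) (\<lambda>x. (norm (E 0 x))\<^sup>2) =
    - integral {0..t} (\<lambda>s. integral (cell L) (\<lambda>x. E s x \<bullet> J s x))"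
proof -
  define dJ where "dJ t x = (\<Sum>b\<in>UNIV. grad (\<lambda>x. J t x $ b) x $ b)" for t x
  define \<Phi> where "\<Phi> t = 1/2 * integral (cell L) (\<lambda>x. (norm (E t x))\<^sup>2)" for t
  \<comment> \<open>Field and flux are taken at independent times, since the increments produce the
    field at the endpoints and the flux in between.\<close>
  define \<Psi> where "\<Psi> p = integral (cell L) (\<lambda>x. E (fst p) x \<bullet> J (snd p) x)" for p
  have cdJ': "continuous_on ({0..T} \<times> UNIV) (\<lambda>p. dJ (fst p) (snd p))"
    using cdJ by (simp add: dJ_def split_beta)
  have cE': "continuous_on ({0..T} \<times> UNIV) (\<lambda>p. E (fst p) (snd p))"
    and cJ': "continuous_on ({0..T} \<times> UNIV) (\<lambda>p. J (fst p) (snd p))"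
    using cE cJ by (simp_all add: split_beta)
  have c\<Psi>: "continuous_on ({0..T} \<times> {0..T}) \<Psi>"
    unfolding \<Psi>_def[abs_def] cell_def
    by (rule integral_continuous_on_param, unfold split_beta,
      intro continuous_on_inner continuous_on_compose2[OF cE', of _ "\<lambda>p. (fst (fst p), snd p)", simplified]
        continuous_on_compose2[OF cJ', of _ "\<lambda>p. (snd (fst p), snd p)", simplified] continuous_intros) auto
  have incr: "\<Phi> t - \<Phi> s = - 1/2 * integral {s..t} (\<lambda>\<tau>. \<Psi> (t, \<tau>) + \<Psi> (s, \<tau>))"
    if st: "s \<in> {0..T}" "t \<in> {0..T}" "s \<le> t" for s t
  proof -
    note Pt = P[OF st(2)] and Ps = P[OF st(1)]
    note Ct = poisson_potentialD(1)[OF Pt] and Cs = poisson_potentialD(1)[OF Ps]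
    note D = C1_periodicD[OF Ct] C1_periodicD[OF Cs]
    have \<rho>ts: "\<rho> t x - \<rho> s x = - integral {s..t} (\<lambda>\<tau>. dJ \<tau> x)" for x
    proof -
      have "continuous_on {0..t} (\<lambda>\<tau>. dJ \<tau> x)"
        by (rule continuous_on_compose2[OF cdJ', of _ "\<lambda>\<tau>. (\<tau>, x)", simplified]) (use st in \<open>auto intro!: continuous_intros\<close>)
      then have "integral {0..s} (\<lambda>\<tau>. dJ \<tau> x) + integral {s..t} (\<lambda>\<tau>. dJ \<tau> x) = integral {0..t} (\<lambda>\<tau>. dJ \<tau> x)"
        using st by (intro Henstock_Kurzweil_Integration.integral_combine integrable_continuous_real) auto
      then show ?thesis using \<rho>[OF st(1), of x] \<rho>[OF st(2), of x] by (simp add: dJ_def)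
    qed
    have cE_s: "continuous_on (cell L) (E r)" if "r \<in> {0..T}" for r
      by (rule continuous_on_compose2[OF cE', of _ "\<lambda>x. (r, x)", simplified]) (use that in \<open>auto intro!: continuous_intros\<close>)
    have cJ_s: "continuous_on (cell L) (J r)" if "r \<in> {0..T}" for r
      by (rule continuous_on_compose2[OF cJ', of _ "\<lambda>x. (r, x)", simplified]) (use that in \<open>auto intro!: continuous_intros\<close>)
    have "2 * (\<Phi> t - \<Phi> s) = integral (cell L) (\<lambda>x. (u t x + u s x) * (\<rho> t x - \<rho> s x))"
      using poisson_energy_diff[OF L Pt Ps] by (simp add: \<Phi>_def E)
    also have "\<dots> = integral (cell L) (\<lambda>x. integral {s..t} (\<lambda>\<tau>. - ((u t x + u s x) * dJ \<tau> x)))"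
      by (simp add: \<rho>ts)
    also have "\<dots> = integral {s..t} (\<lambda>\<tau>. integral (cell L) (\<lambda>x. - ((u t x + u s x) * dJ \<tau> x)))"
    proof (rule integral_cell_swap[symmetric], unfold split_beta)
      have cu: "continuous_on UNIV (u t)" "continuous_on UNIV (u s)" by (rule D)+
      show "continuous_on ({s..t} \<times> cell L) (\<lambda>p. - ((u t (snd p) + u s (snd p)) * dJ (fst p) (snd p)))"
        by (intro continuous_on_minus continuous_on_mult continuous_on_add
          continuous_on_compose2[OF cu(1)] continuous_on_compose2[OF cu(2)] continuous_intros
          continuous_on_subset[OF cdJ']) (use st in auto)
    qed
    also have "\<dots> = integral {s..t} (\<lambda>\<tau>. - (\<Psi> (t, \<tau>) + \<Psi> (s, \<tau>)))"
    proof (rule integral_cong)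
      fix \<tau> assume "\<tau> \<in> {s..t}"
      then have \<tau>: "\<tau> \<in> {0..T}" using st by auto
      have "integral (cell L) (\<lambda>x. - ((u t x + u s x) * dJ \<tau> x)) =
          integral (cell L) (\<lambda>x. grad (\<lambda>x. u t x + u s x) x \<bullet> J \<tau> x)"
        using integral_cell_divergence[OF L C1_periodic_add[OF Ct Cs] J[OF \<tau>]] by (simp add: dJ_def)
      also have "\<dots> = integral (cell L) (\<lambda>x. - (E t x \<bullet> J \<tau> x) + - (E s x \<bullet> J \<tau> x))"
        by (simp add: grad_add D E inner_add_left)
      also have "\<dots> = - (\<Psi> (t, \<tau>) + \<Psi> (s, \<tau>))"
        unfolding \<Psi>_def
        by (subst Henstock_Kurzweil_Integration.integral_add)
          (auto intro!: integrable_on_cell continuous_intros cE_s cJ_s st \<tau>)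
      finally show "integral (cell L) (\<lambda>x. - ((u t x + u s x) * dJ \<tau> x)) = - (\<Psi> (t, \<tau>) + \<Psi> (s, \<tau>))" .
    qed
    also have "\<dots> = - integral {s..t} (\<lambda>\<tau>. \<Psi> (t, \<tau>) + \<Psi> (s, \<tau>))" by (rule integral_neg)
    finally show ?thesis by simp
  qed
  have cdiag: "continuous_on {a..b} (\<lambda>\<tau>. \<Psi> (\<tau>, \<tau>))" if "0 \<le> a" "b \<le> T" for a b
    by (rule continuous_on_compose2[OF c\<Psi>]) (use that in \<open>auto intro!: continuous_intros\<close>)
  have "\<Phi> t + integral {0..t} (\<lambda>\<tau>. \<Psi> (\<tau>, \<tau>)) = \<Phi> 0 + integral {0..0} (\<lambda>\<tau>. \<Psi> (\<tau>, \<tau>))"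
  proof (rule constant_if_locally_flat[of T "\<lambda>t. \<Phi> t + integral {0..t} (\<lambda>\<tau>. \<Psi> (\<tau>, \<tau>))", OF _ t])
    fix \<epsilon> :: real assume \<epsilon>: "\<epsilon> > 0"
    have "uniformly_continuous_on ({0..T} \<times> {0..T}) \<Psi>"
      by (rule compact_uniformly_continuous[OF c\<Psi>]) (auto intro!: compact_Times)
    with \<epsilon> obtain \<delta> where \<delta>: "\<delta> > 0" "\<And>p q. p \<in> {0..T} \<times> {0..T} \<Longrightarrow> q \<in> {0..T} \<times> {0..T} \<Longrightarrow>
        dist q p < \<delta> \<Longrightarrow> dist (\<Psi> q) (\<Psi> p) < \<epsilon>"
      unfolding uniformly_continuous_on_def by metis
    show "\<exists>\<delta>>0. \<forall>s\<in>{0..T}. \<forall>t\<in>{0..T}. s \<le> t \<and> t - s < \<delta> \<longrightarrow>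
       \<bar>\<Phi> t + integral {0..t} (\<lambda>\<tau>. \<Psi> (\<tau>, \<tau>)) - (\<Phi> s + integral {0..s} (\<lambda>\<tau>. \<Psi> (\<tau>, \<tau>)))\<bar> \<le> \<epsilon> * (t - s)"
    proof (intro exI[of _ \<delta>] conjI ballI impI \<delta>(1))
      fix s t assume st: "s \<in> {0..T}" "t \<in> {0..T}" "s \<le> t \<and> t - s < \<delta>"
      have c1: "continuous_on {s..t} (\<lambda>\<tau>. \<Psi> (r, \<tau>))" if "r \<in> {0..T}" for r
        by (rule continuous_on_compose2[OF c\<Psi>]) (use st that in \<open>auto intro!: continuous_intros\<close>)
      have "integral {0..s} (\<lambda>\<tau>. \<Psi> (\<tau>, \<tau>)) + integral {s..t} (\<lambda>\<tau>. \<Psi> (\<tau>, \<tau>)) = integral {0..t} (\<lambda>\<tau>. \<Psi> (\<tau>, \<tau>))"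
        using st by (intro Henstock_Kurzweil_Integration.integral_combine integrable_continuous_real cdiag) auto
      moreover have "integral {s..t} (\<lambda>\<tau>. \<Psi> (\<tau>, \<tau>) - 1/2 * (\<Psi> (t, \<tau>) + \<Psi> (s, \<tau>))) =
          integral {s..t} (\<lambda>\<tau>. \<Psi> (\<tau>, \<tau>)) - 1/2 * integral {s..t} (\<lambda>\<tau>. \<Psi> (t, \<tau>) + \<Psi> (s, \<tau>))"
        using st by (subst Henstock_Kurzweil_Integration.integral_diff)
          (auto intro!: integrable_continuous_real cdiag continuous_intros c1)
      ultimately have "\<Phi> t + integral {0..t} (\<lambda>\<tau>. \<Psi> (\<tau>, \<tau>)) - (\<Phi> s + integral {0..s} (\<lambda>\<tau>. \<Psi> (\<tau>, \<tau>))) =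
          integral {s..t} (\<lambda>\<tau>. \<Psi> (\<tau>, \<tau>) - 1/2 * (\<Psi> (t, \<tau>) + \<Psi> (s, \<tau>)))"
        using incr[of s t] st by simp
      moreover have "norm (integral {s..t} (\<lambda>\<tau>. \<Psi> (\<tau>, \<tau>) - 1/2 * (\<Psi> (t, \<tau>) + \<Psi> (s, \<tau>)))) \<le> \<epsilon> * (t - s)"
      proof (rule integral_bound)
        show "continuous_on {s..t} (\<lambda>\<tau>. \<Psi> (\<tau>, \<tau>) - 1/2 * (\<Psi> (t, \<tau>) + \<Psi> (s, \<tau>)))"
          using st by (intro continuous_intros cdiag c1) auto
        fix \<tau> assume \<tau>: "\<tau> \<in> {s..t}"
        have "dist (\<Psi> (t, \<tau>)) (\<Psi> (\<tau>, \<tau>)) < \<epsilon>" "dist (\<Psi> (s, \<tau>)) (\<Psi> (\<tau>, \<tau>)) < \<epsilon>"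
          using st \<tau> \<delta>(2)[of "(\<tau>, \<tau>)" "(t, \<tau>)"] \<delta>(2)[of "(\<tau>, \<tau>)" "(s, \<tau>)"]
          by (auto simp: dist_Pair_Pair dist_real_def)
        then show "norm (\<Psi> (\<tau>, \<tau>) - 1/2 * (\<Psi> (t, \<tau>) + \<Psi> (s, \<tau>))) \<le> \<epsilon>"

            by (auto simp: dist_real_def abs_less_iff abs_le_iff field_simps)
      qed (use st in auto)
      ultimately show "\<bar>\<Phi> t + integral {0..t} (\<lambda>\<tau>. \<Psi> (\<tau>, \<tau>)) - (\<Phi> s + integral {0..s} (\<lambda>\<tau>. \<Psi> (\<tau>, \<tau>)))\<bar> \<le> \<epsilon> * (t - s)"
        by simp
    qed
  qed
  then show ?thesis by (simp add: \<Phi>_def \<Psi>_def)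
qed

subsection \<open>Sums along dyadic partitions\<close>

text \<open>Dyadic partitions with 2^q intervals: coarse intervals are unions of fine ones, and
  second moments of order 2^-q can be summed over q, which yields almost sure convergence of the
  whole sequence.\<close>

definition grid :: "real \<Rightarrow> nat \<Rightarrow> nat \<Rightarrow> real" where
  "grid t q i = t * real i / 2 ^ q"

abbreviation incr :: "(real \<Rightarrow> real) \<Rightarrow> real \<Rightarrow> nat \<Rightarrow> nat \<Rightarrow> real" where
  "incr b t q i \<equiv> b (grid t q (Suc i)) - b (grid t q i)"

lemma grid_0 [simp]: "grid t q 0 = 0" and grid_end [simp]: "grid t q (2 ^ q) = t"
  and grid_Suc: "grid t q (Suc i) = grid t q i + t / 2 ^ q"
  by (simp_all add: grid_def field_simps)

lemma grid_mono: "0 \<le> t \<Longrightarrow> i \<le> j \<Longrightarrow> grid t q i \<le> grid t q j"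
  by (auto simp: grid_def intro!: divide_right_mono mult_left_mono)

lemma grid_bounds: "0 \<le> t \<Longrightarrow> i \<le> 2 ^ q \<Longrightarrow> 0 \<le> grid t q i \<and> grid t q i \<le> t"
  using grid_mono[of t 0 i q] grid_mono[of t i "2 ^ q" q] by simp

lemma grid_interval: "0 \<le> t \<Longrightarrow> i < 2 ^ q \<Longrightarrow> {grid t q i..grid t q (Suc i)} \<subseteq> {0..t}"
  using grid_bounds[of t i q] grid_bounds[of t "Suc i" q] by auto

lemma grid_mesh_zero: "(\<lambda>q. c / 2 ^ q) \<longlonglongrightarrow> (0::real)"
proof -
  have "(\<lambda>q. c * (1 / 2) ^ q) \<longlonglongrightarrow> c * (0::real)"
    by (intro tendsto_mult tendsto_const LIMSEQ_power_zero) simp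
  then show ?thesis by (simp add: power_divide)
qed

lemma grid_partition: "0 \<le> t \<Longrightarrow> partition_of t (2 ^ q) (grid t q)"
  by (auto simp: partition_of_def intro!: grid_mono)

text \<open>Passes from convergence over all partitions of small mesh to the dyadic sequence, on
  which almost sure arguments are possible.\<close>

lemma filterlim_grid_mesh:
  assumes "0 \<le> t"
  shows "filterlim (\<lambda>q. (2 ^ q, grid t q)) (mesh_to_zero t) sequentially"
  unfolding mesh_to_zero_def filterlim_INF filterlim_principal
proof
  fix \<delta> :: real assume "\<delta> \<in> {0<..}"
  then have "\<forall>\<^sub>F q in sequentially. t / 2 ^ q < \<delta>"
    by (intro order_tendstoD(2)[OF grid_mesh_zero]) simp
  then show "\<forall>\<^sub>F q in sequentially. (2 ^ q, grid t q) \<in>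
      {(n, \<pi>). partition_of t n \<pi> \<and> (\<forall>i<n. \<pi> (Suc i) - \<pi> i < \<delta>)}"
    by eventually_elim (auto simp: grid_partition assms grid_Suc)
qed

lemma grid_oscillation:
  fixes b :: "real \<Rightarrow> real"
  assumes t: "0 \<le> t" and b: "continuous_on {0..t} b" and \<epsilon>: "\<epsilon> > 0"
  shows "\<forall>\<^sub>F q in sequentially. \<forall>i<2 ^ q. \<forall>r\<in>{grid t q i..grid t q (Suc i)}.
    \<forall>s\<in>{grid t q i..grid t q (Suc i)}. \<bar>b r - b s\<bar> < \<epsilon>"
proof -
  have "uniformly_continuous_on {0..t} b" by (rule compact_uniformly_continuous[OF b]) simp
  with \<epsilon> obtain \<delta> where \<delta>: "\<delta> > 0" "\<And>r s. r \<in> {0..t} \<Longrightarrow> s \<in> {0..t} \<Longrightarrow> \<bar>s - r\<bar> < \<delta> \<Longrightarrow> \<bar>b s - b r\<bar> < \<epsilon>"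
    unfolding uniformly_continuous_on_def dist_real_def by metis
  have "\<forall>\<^sub>F q in sequentially. t / 2 ^ q < \<delta>"
    using \<delta>(1) by (rule order_tendstoD(2)[OF grid_mesh_zero])
  then show ?thesis
  proof eventually_elim
    case (elim q)
    show ?case
    proof (intro allI impI ballI)
      fix i r s assume i: "i < 2 ^ q" and r: "r \<in> {grid t q i..grid t q (Suc i)}" and s: "s \<in> {grid t q i..grid t q (Suc i)}"
      have "r \<in> {0..t}" "s \<in> {0..t}" using grid_interval[OF t i] r s by blast+
      moreover have "\<bar>r - s\<bar> < \<delta>" using r s elim by (auto simp: grid_Suc abs_le_iff)
      ultimately show "\<bar>b r - b s\<bar> < \<epsilon>" using \<delta>(2) by blast
    qed
  qed
qed

text \<open>There are 2^q coefficients of size C / 2^q, so their total weight stays bounded while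
  the increments of a continuous path shrink uniformly. This disposes of errors of the order of the
  mesh in sums against a Brownian path.\<close>

lemma grid_sum_small_incr:
  fixes b :: "real \<Rightarrow> real"
  assumes t: "0 \<le> t" and b: "continuous_on {0..t} b"
    and c: "\<And>q i. i < 2 ^ q \<Longrightarrow> \<bar>c q i\<bar> \<le> C / 2 ^ q"
  shows "(\<lambda>q. \<Sum>i<2 ^ q. c q i * incr b t q i) \<longlonglongrightarrow> 0"
proof (rule LIMSEQ_I, rule eventually_sequentially[THEN iffD1])
  fix \<epsilon> :: real assume \<epsilon>: "\<epsilon> > 0"
  have C: "0 \<le> C" using c[of 0 0] by simp
  have "\<epsilon> / (C + 1) > 0" using \<epsilon> C by simp
  from grid_oscillation[OF t b this]
  show "\<forall>\<^sub>F q in sequentially. norm ((\<Sum>i<2 ^ q. c q i * incr b t q i) - 0) < \<epsilon>"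
  proof eventually_elim
    case (elim q)
    have "\<bar>c q i * incr b t q i\<bar> \<le> C / 2 ^ q * (\<epsilon> / (C + 1))" if i: "i < 2 ^ q" for i
    proof -
      have "\<bar>incr b t q i\<bar> \<le> \<epsilon> / (C + 1)"
        using elim i t by (intro less_imp_le) (auto simp: grid_Suc)
      then show ?thesis unfolding abs_mult by (intro mult_mono c i) (use C in auto)
    qed
    then have "\<bar>\<Sum>i<2 ^ q. c q i * incr b t q i\<bar> \<le> (\<Sum>i<(2::nat) ^ q. C / 2 ^ q * (\<epsilon> / (C + 1)))"
      by (intro order.trans[OF sum_abs] sum_mono) auto
    also have "\<dots> = C * \<epsilon> / (C + 1)" by simp
    also have "\<dots> < \<epsilon>" using C \<epsilon> by (simp add: field_simps)
    finally show ?case by simp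
  qed
qed

lemma integral_grid:
  fixes f :: "real \<Rightarrow> real"
  assumes t: "0 \<le> t" and f: "continuous_on {0..t} f"
  shows "integral {0..t} f = (\<Sum>i<2 ^ q. integral {grid t q i..grid t q (Suc i)} f)"
proof -
  have "integral {0..grid t q n} f = (\<Sum>i<n. integral {grid t q i..grid t q (Suc i)} f)" if "n \<le> 2 ^ q" for n
    using that
  proof (induction n)
    case (Suc n)
    have "f integrable_on {0..grid t q (Suc n)}"
      using grid_bounds[OF t Suc.prems] by (intro integrable_continuous_real continuous_on_subset[OF f]) auto
    then have "integral {0..grid t q n} f + integral {grid t q n..grid t q (Suc n)} f = integral {0..grid t q (Suc n)} f"
      using grid_bounds[of t n q] Suc.prems t by (intro Henstock_Kurzweil_Integration.integral_combine grid_mono) auto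
    with Suc show ?case by simp
  qed simp
  from this[of "2 ^ q"] show ?thesis by simp
qed

text \<open>The weight may be the average of any two values of b on the interval: r = s covers
  left-point sums, the two endpoints cover trapezoidal sums.\<close>

lemma grid_sum_integral:
  fixes b k :: "real \<Rightarrow> real"
  assumes t: "0 \<le> t" and b: "continuous_on {0..t} b" and k: "continuous_on {0..t} k"
    and c: "\<And>q i. i < 2 ^ q \<Longrightarrow> \<exists>r\<in>{grid t q i..grid t q (Suc i)}. \<exists>s\<in>{grid t q i..grid t q (Suc i)}. c q i = (b r + b s) / 2"
  shows "(\<lambda>q. \<Sum>i<2 ^ q. c q i * integral {grid t q i..grid t q (Suc i)} k) \<longlonglongrightarrow> integral {0..t} (\<lambda>s. b s * k s)"
proof (rule LIMSEQ_I, rule eventually_sequentially[THEN iffD1])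
  fix \<epsilon> :: real assume \<epsilon>: "\<epsilon> > 0"
  have "compact (k ` {0..t})" by (rule compact_continuous_image[OF k]) simp
  then obtain K where K: "\<And>s. s \<in> {0..t} \<Longrightarrow> \<bar>k s\<bar> \<le> K"
    by (metis compact_imp_bounded bounded_iff image_eqI real_norm_def)
  then have K0: "0 \<le> K" using t by (metis abs_ge_zero atLeastAtMost_iff order.refl order.trans)
  define \<eta> where "\<eta> = \<epsilon> / (K * t + 1)"
  have \<eta>: "\<eta> > 0" using \<epsilon> K0 t by (simp add: \<eta>_def add_nonneg_pos)
  from grid_oscillation[OF t b \<eta>]
  show "\<forall>\<^sub>F q in sequentially. norm ((\<Sum>i<2 ^ q. c q i * integral {grid t q i..grid t q (Suc i)} k) - integral {0..t} (\<lambda>s. b s * k s)) < \<epsilon>"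
  proof eventually_elim
    case (elim q)
    let ?I = "\<lambda>i. {grid t q i..grid t q (Suc i)}"
    have cont: "continuous_on (?I i) k" "continuous_on (?I i) b" if "i < 2 ^ q" for i
      using grid_interval[OF t that] by (auto intro: continuous_on_subset[OF k] continuous_on_subset[OF b])
    have "\<bar>c q i * integral (?I i) k - integral (?I i) (\<lambda>s. b s * k s)\<bar> \<le> \<eta> * K * (t / 2 ^ q)" if i: "i < 2 ^ q" for i
    proof -
      from c[OF i] obtain r s where rs: "r \<in> ?I i" "s \<in> ?I i" "c q i = (b r + b s) / 2" by blast
      have "c q i * integral (?I i) k - integral (?I i) (\<lambda>s. b s * k s) = integral (?I i) (\<lambda>s. (c q i - b s) * k s)"
        unfolding left_diff_distrib
        by (subst Henstock_Kurzweil_Integration.integral_diff)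
          (auto intro!: integrable_continuous_real continuous_intros cont i)
      also have "norm \<dots> \<le> (\<eta> * K) * (grid t q (Suc i) - grid t q i)"
      proof (rule integral_bound)
        show "continuous_on (?I i) (\<lambda>s. (c q i - b s) * k s)" by (intro continuous_intros cont i)
        fix \<tau> assume \<tau>: "\<tau> \<in> ?I i"
        have "\<bar>b r - b \<tau>\<bar> < \<eta>" "\<bar>b s - b \<tau>\<bar> < \<eta>" using elim i rs \<tau> by blast+
        then have "\<bar>c q i - b \<tau>\<bar> \<le> \<eta>" unfolding rs(3) by (auto simp: abs_less_iff abs_le_iff field_simps)
        moreover have "\<bar>k \<tau>\<bar> \<le> K" using \<tau> grid_interval[OF t i] by (intro K) auto
        ultimately show "norm ((c q i - b \<tau>) * k \<tau>) \<le> \<eta> * K"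
          unfolding real_norm_def abs_mult by (intro mult_mono) (use \<eta> in auto)
      qed (use t in \<open>auto intro: grid_mono\<close>)
      finally show ?thesis by (simp add: grid_Suc)
    qed
    then have "(\<Sum>i<2 ^ q. \<bar>c q i * integral (?I i) k - integral (?I i) (\<lambda>s. b s * k s)\<bar>) \<le> (\<Sum>i<(2::nat) ^ q. \<eta> * K * (t / 2 ^ q))"
      by (intro sum_mono) auto
    also have "\<dots> = \<eta> * (K * t)" by simp
    also have "\<dots> < \<epsilon>"
    proof -
      have "0 < 1 + K * t" using K0 t by (simp add: add_pos_nonneg)
      then show ?thesis using \<epsilon> by (simp add: \<eta>_def field_simps)
    qed
    finally have "(\<Sum>i<2 ^ q. \<bar>c q i * integral (?I i) k - integral (?I i) (\<lambda>s. b s * k s)\<bar>) < \<epsilon>" .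
    moreover have "integral {0..t} (\<lambda>s. b s * k s) = (\<Sum>i<2 ^ q. integral (?I i) (\<lambda>s. b s * k s))"
      by (intro integral_grid t continuous_intros b k)
    ultimately show ?case
      using sum_abs[of "\<lambda>i. c q i * integral (?I i) k - integral (?I i) (\<lambda>s. b s * k s)" "{..<2 ^ q}"]
      by (simp add: sum_subtractf)
  qed
qed

lemma grid_riemann_sum:
  fixes h :: "real \<Rightarrow> real"
  assumes t: "0 \<le> t" and h: "continuous_on {0..t} h"
  shows "(\<lambda>q. \<Sum>i<2 ^ q. h (grid t q i) * (t / 2 ^ q)) \<longlonglongrightarrow> integral {0..t} h"
proof -
  have "(\<lambda>q. \<Sum>i<2 ^ q. h (grid t q i) * integral {grid t q i..grid t q (Suc i)} (\<lambda>_. 1)) \<longlonglongrightarrow> integral {0..t} (\<lambda>s. h s * 1)"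
  proof (rule grid_sum_integral[OF t h])
    fix q i :: nat
    show "\<exists>r\<in>{grid t q i..grid t q (Suc i)}. \<exists>s\<in>{grid t q i..grid t q (Suc i)}. h (grid t q i) = (h r + h s) / 2"
      using grid_mono[OF t, of i "Suc i" q]
      by (intro bexI[of _ "grid t q i"]) auto
  qed simp
  then show ?thesis using t by (simp add: grid_Suc content_real)
qed

section \<open>Pathwise integrals of C1 integrands against continuous paths\<close>

lemma sum_by_parts_midpoint:
  fixes b h :: "nat \<Rightarrow> real"
  shows "(\<Sum>i<n. (b (Suc i) - b i) * (1/2 * (h i + h (Suc i)))) =
    h n * b n - h 0 * b 0 - (\<Sum>i<n. (b i + b (Suc i)) / 2 * (h (Suc i) - h i))"
  by (induction n) (simp_all add: field_simps)

text \<open>The integrand h is C1 with derivative k, the integrator b merely continuous, as a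
  Brownian path is.\<close>

locale C1_integrand =
  fixes t :: real and h k b :: "real \<Rightarrow> real"
  assumes t: "0 \<le> t" and k: "continuous_on {0..t} k" and b: "continuous_on {0..t} b"
    and h: "\<And>s. s \<in> {0..t} \<Longrightarrow> h s = h 0 + integral {0..s} k"
begin

lemma h_diff: "r \<in> {0..t} \<Longrightarrow> s \<in> {0..t} \<Longrightarrow> r \<le> s \<Longrightarrow> h s - h r = integral {r..s} k"
proof -
  assume rs: "r \<in> {0..t}" "s \<in> {0..t}" "r \<le> s"
  have "integral {0..r} k + integral {r..s} k = integral {0..s} k"
    using rs by (intro Henstock_Kurzweil_Integration.integral_combine integrable_continuous_real continuous_on_subset[OF k]) auto
  then show ?thesis using h[of r] h[of s] rs by simp
qed

lemma h_lipschitz: "\<exists>K\<ge>0. \<forall>r\<in>{0..t}. \<forall>s\<in>{0..t}. \<bar>h s - h r\<bar> \<le> K * \<bar>s - r\<bar>"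
proof -
  have "compact (k ` {0..t})" by (rule compact_continuous_image[OF k]) simp
  then obtain K where K: "\<And>s. s \<in> {0..t} \<Longrightarrow> \<bar>k s\<bar> \<le> K"
    by (metis compact_imp_bounded bounded_iff image_eqI real_norm_def)
  then have K0: "0 \<le> K" using t by (metis abs_ge_zero atLeastAtMost_iff order.refl order.trans)
  have *: "\<bar>h s - h r\<bar> \<le> K * \<bar>s - r\<bar>" if "r \<in> {0..t}" "s \<in> {0..t}" "r \<le> s" for r s
  proof -
    have "norm (integral {r..s} k) \<le> K * (s - r)"
      by (rule integral_bound) (use that K in \<open>auto intro!: continuous_on_subset[OF k]\<close>)
    then show ?thesis using h_diff[OF that] that by simp
  qed
  have "\<bar>h s - h r\<bar> \<le> K * \<bar>s - r\<bar>" if "r \<in> {0..t}" "s \<in> {0..t}" for r s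
    using *[OF that] *[OF that(2,1)] by (cases "r \<le> s") (simp_all add: abs_minus_commute)
  with K0 show ?thesis by blast
qed

lemma h_continuous: "continuous_on {0..t} h"
proof -
  obtain K where "K \<ge> 0" "\<forall>r\<in>{0..t}. \<forall>s\<in>{0..t}. \<bar>h s - h r\<bar> \<le> K * \<bar>s - r\<bar>" using h_lipschitz by blast
  then have "K-lipschitz_on {0..t} h" by (intro lipschitz_onI) (auto simp: dist_real_def)
  then show ?thesis by (rule lipschitz_on_continuous_on)
qed

text \<open>Integration by parts serves as the definition, since b need not have bounded
  variation.\<close>

definition "stieltjes = h t * b t - h 0 * b 0 - integral {0..t} (\<lambda>s. b s * k s)"

text \<open>Summation by parts moves the increments from b to h without a correction term, because
  the trapezoidal weights are symmetric; the increments of h are integrals of k.\<close>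

lemma trapezoid_limit:
  "(\<lambda>q. \<Sum>i<2 ^ q. incr b t q i * (1/2 * (h (grid t q i) + h (grid t q (Suc i))))) \<longlonglongrightarrow> stieltjes"
proof -
  have "(\<lambda>q. h t * b t - h 0 * b 0 - (\<Sum>i<2 ^ q. (b (grid t q i) + b (grid t q (Suc i))) / 2 *
      integral {grid t q i..grid t q (Suc i)} k)) \<longlonglongrightarrow> stieltjes"
    unfolding stieltjes_def
  proof (intro tendsto_intros grid_sum_integral t b k)
    fix q i :: nat
    show "\<exists>r\<in>{grid t q i..grid t q (Suc i)}. \<exists>s\<in>{grid t q i..grid t q (Suc i)}.
        (b (grid t q i) + b (grid t q (Suc i))) / 2 = (b r + b s) / 2"
      using grid_mono[OF t, of i "Suc i" q]
      by (intro bexI[of _ "grid t q i"] bexI[of _ "grid t q (Suc i)"]) auto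
  qed
  also have "(\<lambda>q. h t * b t - h 0 * b 0 - (\<Sum>i<2 ^ q. (b (grid t q i) + b (grid t q (Suc i))) / 2 *
      integral {grid t q i..grid t q (Suc i)} k)) =
      (\<lambda>q. \<Sum>i<2 ^ q. incr b t q i * (1/2 * (h (grid t q i) + h (grid t q (Suc i)))))"
  proof
    fix q :: nat
    have "(\<Sum>i<2 ^ q. (b (grid t q i) + b (grid t q (Suc i))) / 2 * integral {grid t q i..grid t q (Suc i)} k) =
        (\<Sum>i<2 ^ q. (b (grid t q i) + b (grid t q (Suc i))) / 2 * (h (grid t q (Suc i)) - h (grid t q i)))"
      using grid_bounds[OF t, of _ q] grid_mono[OF t] by (intro sum.cong refl) (subst h_diff, auto)
    then show "h t * b t - h 0 * b 0 - (\<Sum>i<2 ^ q. (b (grid t q i) + b (grid t q (Suc i))) / 2 *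
      integral {grid t q i..grid t q (Suc i)} k) =
      (\<Sum>i<2 ^ q. incr b t q i * (1/2 * (h (grid t q i) + h (grid t q (Suc i)))))"
      using sum_by_parts_midpoint[of "\<lambda>i. b (grid t q i)" "\<lambda>i. h (grid t q i)" "2 ^ q"] by simp
  qed
  finally show ?thesis .
qed

text \<open>Replacing trapezoidal weights by approximate left values changes the coefficients by the
  order of the mesh. The first coefficient is zero instead of close to \<open>h 0\<close>, but it
  multiplies a single increment, which vanishes in the limit by continuity. Averages over preceding
  mesh intervals have this form.\<close>

lemma approximate_left_limit:
  assumes a: "\<And>q i. i < 2 ^ q \<Longrightarrow> 0 < i \<Longrightarrow> \<bar>a q i - h (grid t q i)\<bar> \<le> C / 2 ^ q"
    and a0: "\<And>q. a q 0 = 0"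
  shows "(\<lambda>q. \<Sum>i<2 ^ q. a q i * incr b t q i) \<longlonglongrightarrow> stieltjes"
proof -
  obtain K where K: "K \<ge> 0" "\<And>r s. r \<in> {0..t} \<Longrightarrow> s \<in> {0..t} \<Longrightarrow> \<bar>h s - h r\<bar> \<le> K * \<bar>s - r\<bar>"
    using h_lipschitz by blast
  \<comment> \<open>Read off at q = 1 and i = 1: at q = 0 no index satisfies 0 < i < 2^q.\<close>
  have "0 \<le> C / 2 ^ 1" by (rule order.trans[OF abs_ge_zero a]) auto
  then have C: "0 \<le> C" by simp
  \<comment> \<open>The deviation from the trapezoidal weight; at i = 0 it leads to the weight
    \<open>h 0\<close>, whose contribution is subtracted afterwards.\<close>
  define c where "c q i = (if i = 0 then 0 else a q i - h (grid t q i)) - (h (grid t q (Suc i)) - h (grid t q i)) / 2" for q i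
  have "(\<lambda>q. \<Sum>i<2 ^ q. c q i * incr b t q i) \<longlonglongrightarrow> 0"
  proof (rule grid_sum_small_incr[OF t b])
    fix q i :: nat assume i: "i < 2 ^ q"
    have "\<bar>h (grid t q (Suc i)) - h (grid t q i)\<bar> \<le> K * (t / 2 ^ q)"
      using K(2)[of "grid t q i" "grid t q (Suc i)"] grid_bounds[OF t, of i q] grid_bounds[OF t, of "Suc i" q] i t
      by (auto simp: grid_Suc)
    moreover have "\<bar>if i = 0 then 0 else a q i - h (grid t q i)\<bar> \<le> C / 2 ^ q" using a[OF i] C by auto
    moreover have "0 \<le> K * (t / 2 ^ q)" using K t by simp
    moreover have "\<bar>x - y / 2\<bar> \<le> A + B" if "\<bar>x\<bar> \<le> A" "\<bar>y\<bar> \<le> B" "0 \<le> B" for x y A B :: real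
      using that by linarith
    ultimately have "\<bar>c q i\<bar> \<le> C / 2 ^ q + K * (t / 2 ^ q)" unfolding c_def by blast
    then show "\<bar>c q i\<bar> \<le> (C + K * t) / 2 ^ q" by (simp add: add_divide_distrib)
  qed
  moreover have b0: "(\<lambda>q. b (t / 2 ^ q)) \<longlonglongrightarrow> b 0"
  proof (rule continuous_on_tendsto_compose[OF b grid_mesh_zero])
    have "t / 2 ^ q \<in> {0..t}" for q using grid_bounds[OF t, of 1 q] by (simp add: grid_def)
    then show "\<forall>\<^sub>F q in sequentially. t / 2 ^ q \<in> {0..t}" by simp
  qed (use t in simp)
  ultimately have "(\<lambda>q. (\<Sum>i<2 ^ q. incr b t q i * (1/2 * (h (grid t q i) + h (grid t q (Suc i))))) +
      (\<Sum>i<2 ^ q. c q i * incr b t q i) - h 0 * (b (t / 2 ^ q) - b 0)) \<longlonglongrightarrow> stieltjes + 0 - h 0 * (b 0 - b 0)"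
    by (intro tendsto_intros trapezoid_limit b0)
  also have "(\<lambda>q. (\<Sum>i<2 ^ q. incr b t q i * (1/2 * (h (grid t q i) + h (grid t q (Suc i))))) +
      (\<Sum>i<2 ^ q. c q i * incr b t q i) - h 0 * (b (t / 2 ^ q) - b 0)) = (\<lambda>q. \<Sum>i<2 ^ q. a q i * incr b t q i)"
  proof
    fix q :: nat
    have "(\<Sum>i<2 ^ q. incr b t q i * (1/2 * (h (grid t q i) + h (grid t q (Suc i))))) + (\<Sum>i<2 ^ q. c q i * incr b t q i) =
        (\<Sum>i<2 ^ q. (if i = 0 then h 0 else a q i) * incr b t q i)"
      unfolding sum.distrib[symmetric] by (intro sum.cong refl) (auto simp: c_def field_simps)
    also have "\<dots> = (\<Sum>i<2 ^ q. a q i * incr b t q i + (if i = 0 then h 0 * incr b t q i else 0))"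
      by (intro sum.cong refl) (auto simp: a0)
    also have "\<dots> = (\<Sum>i<2 ^ q. a q i * incr b t q i) + h 0 * incr b t q 0"
      by (simp add: sum.distrib)
    finally show "(\<Sum>i<2 ^ q. incr b t q i * (1/2 * (h (grid t q i) + h (grid t q (Suc i))))) +
      (\<Sum>i<2 ^ q. c q i * incr b t q i) - h 0 * (b (t / 2 ^ q) - b 0) = (\<Sum>i<2 ^ q. a q i * incr b t q i)"
      by (simp add: grid_Suc)
  qed
  finally show ?thesis by simp
qed

end

text \<open>The remainder is the integral of (b s - b \<tau>) k \<tau> over [r, s], whose integrand
  is bounded. The increments of the pathwise integral are thus known to first order from the left
  value of h.\<close>

lemma stieltjes_increment:
  fixes h k b :: "real \<Rightarrow> real"
  assumes "C1_integrand T h k b"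
  shows "\<exists>C\<ge>0. \<forall>r\<in>{0..T}. \<forall>s\<in>{0..T}. r \<le> s \<longrightarrow>
    \<bar>C1_integrand.stieltjes s h k b - C1_integrand.stieltjes r h k b - h r * (b s - b r)\<bar> \<le> C * (s - r)"
proof -
  interpret C1_integrand T h k b by fact
  have "continuous_on ({0..T} \<times> {0..T}) (\<lambda>p. (b (fst p) - b (snd p)) * k (snd p))"
    by (intro continuous_intros continuous_on_compose2[OF b] continuous_on_compose2[OF k]) auto
  then have "compact ((\<lambda>p. (b (fst p) - b (snd p)) * k (snd p)) ` ({0..T} \<times> {0..T}))"
    by (rule compact_continuous_image) (intro compact_Times, auto)
  then obtain C where C: "\<And>p. p \<in> {0..T} \<times> {0..T} \<Longrightarrow> \<bar>(b (fst p) - b (snd p)) * k (snd p)\<bar> \<le> C"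
    by (metis (no_types, lifting) compact_imp_bounded bounded_iff image_eqI real_norm_def)
  have C0: "0 \<le> C" using C[of "(0, 0)"] t by simp
  have "\<bar>C1_integrand.stieltjes s h k b - C1_integrand.stieltjes r h k b - h r * (b s - b r)\<bar> \<le> C * (s - r)"
    if rs: "r \<in> {0..T}" "s \<in> {0..T}" "r \<le> s" for r s
  proof -
    have sub: "C1_integrand u h k b" if "u \<in> {0..T}" for u
      by unfold_locales (use that in \<open>auto intro!: continuous_on_subset[OF b] continuous_on_subset[OF k] h\<close>)
    have cs: "continuous_on {r..s} b" "continuous_on {r..s} k" "continuous_on {0..s} (\<lambda>\<tau>. b \<tau> * k \<tau>)"
      using rs by (auto intro!: continuous_intros continuous_on_subset[OF b] continuous_on_subset[OF k])
    have "integral {0..r} (\<lambda>\<tau>. b \<tau> * k \<tau>) + integral {r..s} (\<lambda>\<tau>. b \<tau> * k \<tau>) = integral {0..s} (\<lambda>\<tau>. b \<tau> * k \<tau>)"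
      using rs by (intro Henstock_Kurzweil_Integration.integral_combine integrable_continuous_real cs) auto
    moreover have "integral {r..s} (\<lambda>\<tau>. (b s - b \<tau>) * k \<tau>) = b s * integral {r..s} k - integral {r..s} (\<lambda>\<tau>. b \<tau> * k \<tau>)"
      unfolding left_diff_distrib using cs
      by (subst Henstock_Kurzweil_Integration.integral_diff) (auto intro!: integrable_continuous_real continuous_intros)
    ultimately have "C1_integrand.stieltjes s h k b - C1_integrand.stieltjes r h k b - h r * (b s - b r) =
        integral {r..s} (\<lambda>\<tau>. (b s - b \<tau>) * k \<tau>)"
      using h_diff[OF rs]
      by (simp add: C1_integrand.stieltjes_def[OF sub[OF rs(1)]] C1_integrand.stieltjes_def[OF sub[OF rs(2)]] algebra_simps)
    moreover have "norm (integral {r..s} (\<lambda>\<tau>. (b s - b \<tau>) * k \<tau>)) \<le> C * (s - r)"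
    proof (rule integral_bound)
      show "norm ((b s - b \<tau>) * k \<tau>) \<le> C" if "\<tau> \<in> {r..s}" for \<tau>
        using C[of "(s, \<tau>)"] rs that by simp
    qed (use rs cs in \<open>auto intro!: continuous_intros\<close>)
    ultimately show ?thesis by simp
  qed
  with C0 show ?thesis by blast
qed

text \<open>Freeze h on the 2^N intervals of a coarse level. The block sums tend to zero for each
  fixed N, and the freezing error is the oscillation of h times the total absolute weight, hence
  small uniformly in q.\<close>

lemma grid_weighted_sum_zero:
  fixes h :: "real \<Rightarrow> real" and \<xi> :: "nat \<Rightarrow> nat \<Rightarrow> real"
  assumes t: "0 \<le> t" and h: "continuous_on {0..t} h"
    and block: "\<And>N j. (\<lambda>q. \<Sum>i\<in>{i\<in>{..<2 ^ q}. i div 2 ^ (q - N) = j}. \<xi> q i) \<longlonglongrightarrow> 0"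
    and bound: "\<forall>\<^sub>F q in sequentially. (\<Sum>i<2 ^ q. \<bar>\<xi> q i\<bar>) \<le> B"
  shows "(\<lambda>q. \<Sum>i<2 ^ q. h (grid t q i) * \<xi> q i) \<longlonglongrightarrow> 0"
proof (rule LIMSEQ_I, rule eventually_sequentially[THEN iffD1])
  fix \<epsilon> :: real assume \<epsilon>: "\<epsilon> > 0"
  define B' where "B' = \<bar>B\<bar> + 1"
  have B': "B' > 0" by (simp add: B'_def)
  have "\<epsilon> / (2 * B') > 0" using \<epsilon> B' by simp
  from eventually_happens'[OF sequentially_bot grid_oscillation[OF t h this]]
  obtain N where "\<forall>i<2 ^ N. \<forall>r\<in>{grid t N i..grid t N (Suc i)}.
      \<forall>s\<in>{grid t N i..grid t N (Suc i)}. \<bar>h r - h s\<bar> < \<epsilon> / (2 * B')" by blast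
  then have N: "i < 2 ^ N \<Longrightarrow> r \<in> {grid t N i..grid t N (Suc i)} \<Longrightarrow>
      s \<in> {grid t N i..grid t N (Suc i)} \<Longrightarrow> \<bar>h r - h s\<bar> < \<epsilon> / (2 * B')" for i r s by blast
  \<comment> \<open>The fine index i lies in the coarse interval \<open>i div 2 ^ (q - N)\<close>;
    the estimate is made for q \<ge> N, where the subtraction is genuine.\<close>
  let ?blk = "\<lambda>q j. {i\<in>{..<2 ^ q}. i div 2 ^ (q - N) = j}"
  have "(\<lambda>q. \<Sum>j<2 ^ N. h (grid t N j) * (\<Sum>i\<in>?blk q j. \<xi> q i)) \<longlonglongrightarrow> (\<Sum>j<(2::nat) ^ N. h (grid t N j) * 0)"
    by (intro tendsto_intros block)
  then have "\<forall>\<^sub>F q in sequentially. \<bar>\<Sum>j<2 ^ N. h (grid t N j) * (\<Sum>i\<in>?blk q j. \<xi> q i)\<bar> < \<epsilon> / 2"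
    using \<epsilon> by (auto dest!: tendstoD[where e = "\<epsilon> / 2"] simp: dist_real_def)
  with bound eventually_ge_at_top[of N]
  show "\<forall>\<^sub>F q in sequentially. norm ((\<Sum>i<2 ^ q. h (grid t q i) * \<xi> q i) - 0) < \<epsilon>"
  proof eventually_elim
    case (elim q)
    have pq: "(2::nat) ^ q = 2 ^ N * 2 ^ (q - N)" using elim(2) by (simp flip: power_add)
    have j: "i div 2 ^ (q - N) < 2 ^ N" if "i < 2 ^ q" for i :: nat
      using that by (simp add: less_mult_imp_div_less pq)
    have group: "(\<Sum>i<2 ^ q. g i) = (\<Sum>j<2 ^ N. \<Sum>i\<in>?blk q j. g i)" for g :: "nat \<Rightarrow> real"
      by (rule sum.group[symmetric]) (use j in auto)
    have near: "\<bar>h (grid t q i) - h (grid t N (i div 2 ^ (q - N)))\<bar> \<le> \<epsilon> / (2 * B')" if i: "i < 2 ^ q" for i :: nat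
    proof (rule less_imp_le, rule N[OF j[OF i]])
      let ?j = "i div 2 ^ (q - N)"
      have g: "grid t q (n * 2 ^ (q - N)) = grid t N n" for n
      proof -
        have "(2::real) ^ q = 2 ^ N * 2 ^ (q - N)" using elim(2) by (simp flip: power_add)
        then show ?thesis by (simp add: grid_def)
      qed
      have "?j * 2 ^ (q - N) \<le> i" by simp
      moreover have "i \<le> Suc ?j * 2 ^ (q - N)"
        using dividend_less_div_times[of "2 ^ (q - N)" i] by simp
      ultimately show "grid t q i \<in> {grid t N ?j..grid t N (Suc ?j)}"
        using grid_mono[OF t] g by (metis atLeastAtMost_iff)
      show "grid t N ?j \<in> {grid t N ?j..grid t N (Suc ?j)}" using grid_mono[OF t] by simp
    qed
    have "\<bar>\<Sum>i<2 ^ q. (h (grid t q i) - h (grid t N (i div 2 ^ (q - N)))) * \<xi> q i\<bar> \<le> (\<Sum>i<2 ^ q. \<epsilon> / (2 * B') * \<bar>\<xi> q i\<bar>)"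
      by (intro order.trans[OF sum_abs] sum_mono, unfold abs_mult, intro mult_right_mono near) auto
    also have "\<dots> = \<epsilon> / (2 * B') * (\<Sum>i<2 ^ q. \<bar>\<xi> q i\<bar>)" by (simp add: sum_distrib_left)
    also have "\<dots> \<le> \<epsilon> / (2 * B') * B'"
      using elim(1) \<epsilon> B' by (intro mult_left_mono) (auto simp: B'_def)
    also have "\<dots> = \<epsilon> / 2" using B' by simp
    finally have 1: "\<bar>\<Sum>i<2 ^ q. (h (grid t q i) - h (grid t N (i div 2 ^ (q - N)))) * \<xi> q i\<bar> \<le> \<epsilon> / 2" .
    have "(\<Sum>i<2 ^ q. h (grid t N (i div 2 ^ (q - N))) * \<xi> q i) = (\<Sum>j<2 ^ N. h (grid t N j) * (\<Sum>i\<in>?blk q j. \<xi> q i))"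
      unfolding group sum_distrib_left by (intro sum.cong refl) auto
    then have "(\<Sum>i<2 ^ q. h (grid t q i) * \<xi> q i) = (\<Sum>i<2 ^ q. (h (grid t q i) - h (grid t N (i div 2 ^ (q - N)))) * \<xi> q i) +
        (\<Sum>j<2 ^ N. h (grid t N j) * (\<Sum>i\<in>?blk q j. \<xi> q i))"
      by (simp add: left_diff_distrib sum_subtractf)
    with 1 elim(3) show ?case unfolding diff_0_right real_norm_def by linarith
  qed
qed

subsection \<open>Convergence in probability\<close>

text \<open>The exceptional null set is joined to the covering event, which then covers for
  \<open>D'\<close> whatever its measurability.\<close>

lemma null_in_prob_mono_AE:
  assumes "null_in_prob M G D" "AE \<omega> in M. \<forall>q. D' q \<omega> \<le> D q \<omega>"
  shows "null_in_prob M G D'"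
  unfolding null_in_prob_def
proof (intro allI impI)
  fix \<epsilon> \<eta> :: real assume "\<epsilon> > 0" "\<eta> > 0"
  from assms(2) obtain N where N: "N \<in> null_sets M" "{\<omega>\<in>space M. \<not> (\<forall>q. D' q \<omega> \<le> D q \<omega>)} \<subseteq> N"
    by (auto simp: eventually_ae_filter)
  from assms(1) \<open>\<epsilon> > 0\<close> \<open>\<eta> > 0\<close> have "\<forall>\<^sub>F q in G. \<exists>A\<in>sets M. measure M A < \<eta> \<and> (\<forall>\<omega>\<in>space M - A. D q \<omega> \<le> ennreal \<epsilon>)"
    by (auto simp: null_in_prob_def)
  then show "\<forall>\<^sub>F q in G. \<exists>A\<in>sets M. measure M A < \<eta> \<and> (\<forall>\<omega>\<in>space M - A. D' q \<omega> \<le> ennreal \<epsilon>)"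
  proof eventually_elim
    case (elim q)
    then obtain A where A: "A \<in> sets M" "measure M A < \<eta>" "\<And>\<omega>. \<omega> \<in> space M - A \<Longrightarrow> D q \<omega> \<le> ennreal \<epsilon>" by blast
    have "emeasure M (A \<union> N) = emeasure M A" using A(1) N(1) by (rule emeasure_Un_null_set)
    then have "measure M (A \<union> N) < \<eta>" using A(2) by (simp add: measure_def)
    moreover have "D' q \<omega> \<le> ennreal \<epsilon>" if "\<omega> \<in> space M - (A \<union> N)" for \<omega>
    proof -
      have "D' q \<omega> \<le> D q \<omega>" using that N(2) by blast
      then show ?thesis using A(3)[of \<omega>] that by (auto intro: order.trans)
    qed
    ultimately show ?case using A(1) N(1) by (intro bexI[of _ "A \<union> N"]) auto
  qed
qed

lemma null_in_prob_filterlim: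
  assumes "null_in_prob M G D" "filterlim g G H"
  shows "null_in_prob M H (\<lambda>q. D (g q))"
  using assms unfolding null_in_prob_def filterlim_iff by blast

lemma (in prob_space) null_in_prob_add:
  assumes "null_in_prob M G D1" "null_in_prob M G D2"
  shows "null_in_prob M G (\<lambda>q \<omega>. D1 q \<omega> + D2 q \<omega>)"
  unfolding null_in_prob_def
proof (intro allI impI)
  fix \<epsilon> \<eta> :: real assume pos: "\<epsilon> > 0" "\<eta> > 0"
  from assms(1) pos have 1: "\<forall>\<^sub>F q in G. \<exists>A\<in>sets M. measure M A < \<eta>/2 \<and> (\<forall>\<omega>\<in>space M - A. D1 q \<omega> \<le> ennreal (\<epsilon>/2))"
    unfolding null_in_prob_def by (meson half_gt_zero)
  from assms(2) pos have 2: "\<forall>\<^sub>F q in G. \<exists>A\<in>sets M. measure M A < \<eta>/2 \<and> (\<forall>\<omega>\<in>space M - A. D2 q \<omega> \<le> ennreal (\<epsilon>/2))"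
    unfolding null_in_prob_def by (meson half_gt_zero)
  from 1 2 show "\<forall>\<^sub>F q in G. \<exists>A\<in>sets M. measure M A < \<eta> \<and> (\<forall>\<omega>\<in>space M - A. D1 q \<omega> + D2 q \<omega> \<le> ennreal \<epsilon>)"
  proof eventually_elim
    case (elim q)
    then obtain A B where A: "A \<in> sets M" "measure M A < \<eta>/2" "\<And>\<omega>. \<omega> \<in> space M - A \<Longrightarrow> D1 q \<omega> \<le> ennreal (\<epsilon>/2)"
      and B: "B \<in> sets M" "measure M B < \<eta>/2" "\<And>\<omega>. \<omega> \<in> space M - B \<Longrightarrow> D2 q \<omega> \<le> ennreal (\<epsilon>/2)" by blast
    have "measure M (A \<union> B) < \<eta>" using measure_Un_le[OF A(1) B(1)] A(2) B(2) by simp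
    moreover have "D1 q \<omega> + D2 q \<omega> \<le> ennreal \<epsilon>" if "\<omega> \<in> space M - (A \<union> B)" for \<omega>
    proof -
      have "D1 q \<omega> + D2 q \<omega> \<le> ennreal (\<epsilon>/2) + ennreal (\<epsilon>/2)" using A(3) B(3) that by (intro add_mono) auto
      also have "\<dots> = ennreal \<epsilon>" using pos by (simp flip: ennreal_plus)
      finally show ?thesis .
    qed
    ultimately show ?case using A(1) B(1) by (intro bexI[of _ "A \<union> B"]) auto
  qed
qed

lemma null_in_prob_zero [simp]: "null_in_prob M G (\<lambda>q \<omega>. 0)"
  unfolding null_in_prob_def by (auto intro!: always_eventually bexI[of _ "{}"])

lemma (in prob_space) null_in_prob_sum:
  "finite I \<Longrightarrow> (\<And>i. i \<in> I \<Longrightarrow> null_in_prob M G (D i)) \<Longrightarrow> null_in_prob M G (\<lambda>q \<omega>. \<Sum>i\<in>I. D i q \<omega>)"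
  by (induction I rule: finite_induct) (auto intro!: null_in_prob_add)

lemma null_in_prob_cmult:
  assumes "null_in_prob M G D" "0 \<le> c"
  shows "null_in_prob M G (\<lambda>q \<omega>. ennreal c * D q \<omega>)"
  unfolding null_in_prob_def
proof (intro allI impI)
  fix \<epsilon> \<eta> :: real assume pos: "\<epsilon> > 0" "\<eta> > 0"
  then have "\<epsilon> / (c + 1) > 0" using assms(2) by simp
  with assms(1) pos have "\<forall>\<^sub>F q in G. \<exists>A\<in>sets M. measure M A < \<eta> \<and> (\<forall>\<omega>\<in>space M - A. D q \<omega> \<le> ennreal (\<epsilon> / (c + 1)))"
    unfolding null_in_prob_def by blast
  moreover have "ennreal c * x \<le> ennreal \<epsilon>" if "x \<le> ennreal (\<epsilon> / (c + 1))" for x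
  proof -
    have "ennreal c * x \<le> ennreal c * ennreal (\<epsilon> / (c + 1))" using that by (rule mult_left_mono) simp
    also have "\<dots> = ennreal (c * (\<epsilon> / (c + 1)))" using assms(2) pos by (subst ennreal_mult[symmetric]) auto
    also have "\<dots> \<le> ennreal \<epsilon>" using assms(2) pos by (intro ennreal_leI) (simp add: field_simps)
    finally show ?thesis .
  qed
  ultimately show "\<forall>\<^sub>F q in G. \<exists>A\<in>sets M. measure M A < \<eta> \<and> (\<forall>\<omega>\<in>space M - A. ennreal c * D q \<omega> \<le> ennreal \<epsilon>)"
    by (auto elim!: eventually_mono)
qed

text \<open>Borel-Cantelli for covering events of probability below 2^-n, along a subsequence on
  which the error is at most 2^-n off these events.\<close>

lemma (in prob_space) null_in_prob_subseq_AE: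
  fixes X :: "nat \<Rightarrow> 'a \<Rightarrow> real"
  assumes "null_in_prob M sequentially (\<lambda>q \<omega>. ennreal \<bar>X q \<omega> - Y \<omega>\<bar>)"
  shows "\<exists>r. strict_mono r \<and> (AE \<omega> in M. (\<lambda>n. X (r n) \<omega>) \<longlonglongrightarrow> Y \<omega>)"
proof -
  let ?P = "\<lambda>n q. \<exists>A\<in>sets M. measure M A < (1/2) ^ n \<and> (\<forall>\<omega>\<in>space M - A. \<bar>X q \<omega> - Y \<omega>\<bar> \<le> (1/2) ^ n)"
  have ev: "\<forall>\<^sub>F q in sequentially. ?P n q" for n
  proof -
    have "(1/2::real) ^ n > 0" by simp
    with assms show ?thesis unfolding null_in_prob_def by (auto simp: ennreal_le_iff)
  qed
  have "\<exists>r. strict_mono r \<and> (\<forall>n. ?P n (r n))"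
  proof -
    have "\<forall>n. \<exists>Q. \<forall>q\<ge>Q. ?P n q" using ev by (simp add: eventually_sequentially)
    then obtain Q where Q: "\<And>n q. q \<ge> Q n \<Longrightarrow> ?P n q" by metis
    define r where "r = rec_nat (Q 0) (\<lambda>n x. max (Suc x) (Q (Suc n)))"
    have "r (Suc n) = max (Suc (r n)) (Q (Suc n))" "r 0 = Q 0" for n by (simp_all add: r_def)
    then have "r n < r (Suc n)" "Q n \<le> r n" for n by (auto, cases n, auto)
    then show ?thesis using Q by (intro exI[of _ r]) (auto simp: strict_mono_Suc_iff)
  qed
  then obtain r where r: "strict_mono r" "\<And>n. ?P n (r n)" by blast
  then obtain A where A: "\<And>n. A n \<in> sets M" "\<And>n. measure M (A n) < (1/2) ^ n"
    "\<And>n \<omega>. \<omega> \<in> space M - A n \<Longrightarrow> \<bar>X (r n) \<omega> - Y \<omega>\<bar> \<le> (1/2) ^ n" by metis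
  have "summable (\<lambda>n. measure M (A n))"
    by (rule summable_comparison_test'[OF summable_geometric[of "1/2::real"]]) (use A(2) in \<open>auto intro: less_imp_le\<close>)
  then have "AE \<omega> in M. eventually (\<lambda>n. \<omega> \<in> space M - A n) sequentially"
    by (intro borel_cantelli_AE1 A(1)) (auto simp: emeasure_eq_measure)
  then have "AE \<omega> in M. (\<lambda>n. X (r n) \<omega>) \<longlonglongrightarrow> Y \<omega>"
  proof eventually_elim
    case (elim \<omega>)
    then have "\<forall>\<^sub>F n in sequentially. norm (X (r n) \<omega> - Y \<omega>) \<le> (1/2) ^ n"
      by eventually_elim (use A(3) in auto)
    then have "(\<lambda>n. X (r n) \<omega> - Y \<omega>) \<longlonglongrightarrow> 0"
      by (rule Lim_null_comparison) (simp add: LIMSEQ_power_zero)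
    then show ?case by (rule Lim_null[THEN iffD2])
  qed
  with r(1) show ?thesis by blast
qed

text \<open>Identifies a noise term, known as a limit in probability, with whatever its
  approximating sums converge to path by path.\<close>

lemma (in prob_space) null_in_prob_limit_unique:
  fixes X :: "nat \<Rightarrow> 'a \<Rightarrow> real"
  assumes "null_in_prob M sequentially (\<lambda>q \<omega>. ennreal \<bar>X q \<omega> - Y \<omega>\<bar>)"
    and "AE \<omega> in M. (\<lambda>q. X q \<omega>) \<longlonglongrightarrow> Z \<omega>"
  shows "AE \<omega> in M. Y \<omega> = Z \<omega>"
proof -
  obtain r where r: "strict_mono r" "AE \<omega> in M. (\<lambda>n. X (r n) \<omega>) \<longlonglongrightarrow> Y \<omega>"
    using null_in_prob_subseq_AE[OF assms(1)] by blast
  from r(2) assms(2) show ?thesis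
  proof eventually_elim
    case (elim \<omega>)
    from LIMSEQ_subseq_LIMSEQ[OF elim(2) r(1)] elim(1) show ?case
      by (auto simp: o_def intro: LIMSEQ_unique)
  qed
qed

text \<open>Dominated convergence for the indicators of the exceptional events; measurability of
  \<open>D q\<close> makes these events admissible covers.\<close>

lemma (in prob_space) AE_eventually_imp_null_in_prob:
  assumes D [measurable]: "\<And>q. D q \<in> borel_measurable M"
    and lim: "AE \<omega> in M. \<forall>\<epsilon>>0. \<forall>\<^sub>F q in sequentially. D q \<omega> \<le> ennreal \<epsilon>"
  shows "null_in_prob M sequentially D"
  unfolding null_in_prob_def
proof (intro allI impI)
  fix \<epsilon> \<eta> :: real assume pos: "\<epsilon> > 0" "\<eta> > 0"
  define A where "A q = {\<omega>\<in>space M. ennreal \<epsilon> < D q \<omega>}" for q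
  have [measurable]: "A q \<in> sets M" for q unfolding A_def by measurable
  have "(\<lambda>q. \<integral>\<omega>. indicator (A q) \<omega> \<partial>M) \<longlonglongrightarrow> (\<integral>\<omega>. (0::real) \<partial>M)"
  proof (rule integral_dominated_convergence[where w = "\<lambda>_. 1"])
    show "AE \<omega> in M. (\<lambda>q. indicator (A q) \<omega>) \<longlonglongrightarrow> (0::real)"
      using lim
    proof eventually_elim
      case (elim \<omega>)
      then have "\<forall>\<^sub>F q in sequentially. D q \<omega> \<le> ennreal \<epsilon>" using pos by blast
      then have "\<forall>\<^sub>F q in sequentially. indicator (A q) \<omega> = (0::real)"
        by eventually_elim (auto simp: A_def indicator_def)
      then show ?case by (rule tendsto_eventually)
    qed
  qed (auto simp: indicator_def)
  then have "(\<lambda>q. measure M (A q)) \<longlonglongrightarrow> 0" by simp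
  from order_tendstoD(2)[OF this pos(2)]
  show "\<forall>\<^sub>F q in sequentially. \<exists>A\<in>sets M. measure M A < \<eta> \<and> (\<forall>\<omega>\<in>space M - A. D q \<omega> \<le> ennreal \<epsilon>)"
    by eventually_elim (rule bexI[of _ "A _"], auto simp: A_def)
qed

lemma (in prob_space) AE_tendsto_imp_null_in_prob:
  fixes X :: "nat \<Rightarrow> 'a \<Rightarrow> real"
  assumes X [measurable]: "\<And>q. X q \<in> borel_measurable M"
    and lim: "AE \<omega> in M. (\<lambda>q. X q \<omega>) \<longlonglongrightarrow> Y \<omega>"
  shows "null_in_prob M sequentially (\<lambda>q \<omega>. ennreal \<bar>X q \<omega> - Y \<omega>\<bar>)"
proof -
  \<comment> \<open>A measurable substitute for Y, equal to it almost everywhere.\<close>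
  define Z where "Z \<omega> = lim (\<lambda>q. X q \<omega>)" for \<omega>
  have [measurable]: "Z \<in> borel_measurable M" unfolding Z_def by measurable
  have "null_in_prob M sequentially (\<lambda>q \<omega>. ennreal \<bar>X q \<omega> - Z \<omega>\<bar>)"
  proof (rule AE_eventually_imp_null_in_prob)
    show "AE \<omega> in M. \<forall>\<epsilon>>0. \<forall>\<^sub>F q in sequentially. ennreal \<bar>X q \<omega> - Z \<omega>\<bar> \<le> ennreal \<epsilon>"
      using lim
    proof eventually_elim
      case (elim \<omega>)
      then have "(\<lambda>q. X q \<omega>) \<longlonglongrightarrow> Z \<omega>" unfolding Z_def by (simp add: limI)
      from tendstoD[OF this] show ?case
        by (auto simp: dist_real_def) (meson eventually_mono less_imp_le)
    qed
  qed measurable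
  moreover have "AE \<omega> in M. \<forall>q. ennreal \<bar>X q \<omega> - Y \<omega>\<bar> \<le> ennreal \<bar>X q \<omega> - Z \<omega>\<bar>"
    using lim by eventually_elim (simp add: Z_def limI)
  ultimately show ?thesis by (rule null_in_prob_mono_AE)
qed

subsection \<open>Adapted processes on a complete filtration\<close>

text \<open>Replace x by the first point of a dense sequence within distance 1 / (n + 1): only
  countably many points occur, so the composition is measurable, and continuity in x gives the
  limit.\<close>

lemma caratheodory_measurable:
  fixes g :: "'w \<Rightarrow> 'a::euclidean_space \<Rightarrow> real"
  assumes g: "\<And>x. (\<lambda>\<omega>. g \<omega> x) \<in> borel_measurable N"
    and cont: "\<And>\<omega>. \<omega> \<in> space N \<Longrightarrow> continuous_on UNIV (g \<omega>)"
  shows "(\<lambda>p. g (fst p) (snd p)) \<in> borel_measurable (N \<Otimes>\<^sub>M borel)"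
proof -
  obtain D :: "'a set" where D: "countable D" "\<And>X. open X \<Longrightarrow> X \<noteq> {} \<Longrightarrow> \<exists>d\<in>D. d \<in> X"
    using countable_dense_setE by metis
  define d where "d = from_nat_into D"
  have ex: "\<exists>k. dist (d k) x < 1 / real (Suc n)" for x n
  proof -
    obtain y where y: "y \<in> D" "y \<in> ball x (1 / real (Suc n))" using D(2)[of "ball x (1 / real (Suc n))"] by auto
    then obtain k where "d k = y" using from_nat_into_surj[OF D(1)] unfolding d_def by metis
    with y(2) show ?thesis by (auto simp: dist_commute)
  qed
  define k where "k n x = (LEAST k. dist (d k) x < 1 / real (Suc n))" for n x
  have kd: "dist (d (k n x)) x < 1 / real (Suc n)" for n x
    unfolding k_def using LeastI_ex[OF ex] by blast
  have [measurable]: "k n \<in> measurable borel (count_space UNIV)" for n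
    unfolding k_def by measurable
  have "(\<lambda>p. g (fst p) (d (k n (snd p)))) \<in> borel_measurable (N \<Otimes>\<^sub>M borel)" for n
    by (rule measurable_compose_countable[where f = "\<lambda>i p. g (fst p) (d i)"])
      (auto intro: measurable_compose[OF measurable_fst g])
  then show ?thesis
  proof (rule borel_measurable_LIMSEQ_real[rotated])
    fix p assume "p \<in> space (N \<Otimes>\<^sub>M (borel :: 'a measure))"
    then have "continuous_on UNIV (g (fst p))" by (auto simp: space_pair_measure intro: cont)
    moreover have "(\<lambda>n. d (k n (snd p))) \<longlonglongrightarrow> snd p"
    proof (rule metric_tendsto_imp_tendsto[OF LIMSEQ_inverse_real_of_nat])
      show "\<forall>\<^sub>F n in sequentially. dist (d (k n (snd p))) (snd p) \<le> dist (inverse (real (Suc n))) 0"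
        using kd by (intro always_eventually allI less_imp_le) (simp add: inverse_eq_divide)
    qed
    ultimately show "(\<lambda>n. g (fst p) (d (k n (snd p)))) \<longlonglongrightarrow> g (fst p) (snd p)"
      by (auto intro: continuous_on_tendsto_compose)
  qed
qed

locale filtered_space =
  fixes M :: "'w measure" and F :: "real \<Rightarrow> 'w measure"
  assumes complete_filtered: "complete_filtered_space M F"
begin

sublocale prob_space M using complete_filtered by (simp add: complete_filtered_space_def)

sublocale filtration "space M" F using complete_filtered by (simp add: complete_filtered_space_def)

lemma sets_F_subset: "sets (F t) \<subseteq> sets M"
  using complete_filtered by (simp add: complete_filtered_space_def)

lemma null_subset_F: "A \<in> null_sets M \<Longrightarrow> B \<subseteq> A \<Longrightarrow> 0 \<le> t \<Longrightarrow> B \<in> sets (F t)"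
  using complete_filtered sets_F_mono[of 0 t] unfolding complete_filtered_space_def by blast

lemma measurable_F_M: "f \<in> measurable (F t) N \<Longrightarrow> f \<in> measurable M N"
  using sets_F_subset[of t] space_F[of t] by (auto simp: measurable_def)

lemma measurable_F_mono: "f \<in> measurable (F s) N \<Longrightarrow> s \<le> t \<Longrightarrow> f \<in> measurable (F t) N"
  using sets_F_mono[of s t] space_F by (auto simp: measurable_def)

text \<open>Every subset of a null set lies in F 0, hence in F t for t \<ge> 0, so altering a
  function on a null set keeps it adapted. Pathwise identities valid only almost surely thereby
  transfer adaptedness.\<close>

lemma measurable_F_AE_cong:
  assumes f: "f \<in> measurable (F t) N" and eq: "AE \<omega> in M. f \<omega> = g \<omega>" and t: "0 \<le> t"
    and g: "\<And>\<omega>. \<omega> \<in> space M \<Longrightarrow> g \<omega> \<in> space N"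
  shows "g \<in> measurable (F t) N"
proof (rule measurableI)
  from eq obtain Z where Z: "Z \<in> null_sets M" "{\<omega>\<in>space M. f \<omega> \<noteq> g \<omega>} \<subseteq> Z"
    by (auto simp: eventually_ae_filter)
  fix A assume A: "A \<in> sets N"
  have "g -` A \<inter> space (F t) = (f -` A \<inter> space (F t) - Z) \<union> (g -` A \<inter> space M \<inter> Z)"
    using Z(2) by (auto simp: space_F)
  also have "\<dots> \<in> sets (F t)"
    by (intro sets.Un sets.Diff measurable_sets[OF f A] null_subset_F[OF Z(1) _ t]) auto
  finally show "g -` A \<inter> space (F t) \<in> sets (F t)" .
qed (use g in \<open>simp add: space_F\<close>)

text \<open>Setting the integrand to zero on the exceptional null set makes it continuous in x on
  every path, hence jointly measurable; completeness carries the result back to the original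
  integrand.\<close>

lemma borel_measurable_F_integral:
  fixes g :: "'w \<Rightarrow> 'a::euclidean_space \<Rightarrow> real"
  assumes t: "0 \<le> t" and K: "compact K" and g: "\<And>x. (\<lambda>\<omega>. g \<omega> x) \<in> borel_measurable (F t)"
    and cont: "AE \<omega> in M. continuous_on UNIV (g \<omega>)"
  shows "(\<lambda>\<omega>. integral K (g \<omega>)) \<in> borel_measurable (F t)"
proof -
  from cont obtain Z where Z: "Z \<in> null_sets M" "{\<omega>\<in>space M. \<not> continuous_on UNIV (g \<omega>)} \<subseteq> Z"
    by (auto simp: eventually_ae_filter)
  have Zt: "Z \<in> sets (F t)" using null_subset_F[OF Z(1) _ t] by blast
  define g' where "g' \<omega> x = (if \<omega> \<in> Z then 0 else g \<omega> x)" for \<omega> x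
  have g'c: "continuous_on UNIV (g' \<omega>)" if "\<omega> \<in> space M" for \<omega>
    using that Z(2) by (cases "\<omega> \<in> Z") (auto simp: g'_def[abs_def])
  have [measurable]: "(\<lambda>p. g' (fst p) (snd p)) \<in> borel_measurable (F t \<Otimes>\<^sub>M lborel)"
  proof -
    have "(\<lambda>p. g' (fst p) (snd p)) \<in> borel_measurable (F t \<Otimes>\<^sub>M borel)"
    proof (rule caratheodory_measurable)
      show "(\<lambda>\<omega>. g' \<omega> x) \<in> borel_measurable (F t)" for x
        unfolding g'_def using g Zt by measurable
    qed (use g'c in \<open>simp add: space_F\<close>)
    then show ?thesis by simp
  qed
  have [measurable]: "K \<in> sets borel" using K by (simp add: borel_compact)
  have "(\<lambda>\<omega>. LBINT x:K. g' \<omega> x) \<in> borel_measurable (F t)"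
    unfolding set_lebesgue_integral_def
    by (rule lborel.borel_measurable_lebesgue_integral) (simp add: split_beta, measurable)
  then show ?thesis
  proof (rule measurable_F_AE_cong[OF _ _ t])
    show "AE \<omega> in M. (LBINT x:K. g' \<omega> x) = integral K (g \<omega>)"
      using AE_not_in[OF Z(1)] AE_space
    proof eventually_elim
      case (elim \<omega>)
      then have "g' \<omega> = g \<omega>" by (simp add: g'_def[abs_def])
      with elim show ?case
        using set_lborel_integral_continuous[OF K continuous_on_subset[OF g'c[of \<omega>]]] by simp
    qed
  qed simp
qed

end

subsection \<open>Brownian motion\<close>

lemma abs_mult_le_squares: "\<bar>a * b\<bar> \<le> a\<^sup>2 + (b::real)\<^sup>2"
proof -
  have "0 \<le> (\<bar>a\<bar> - \<bar>b\<bar>)\<^sup>2" by simp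
  also have "\<dots> = a\<^sup>2 + b\<^sup>2 - 2 * \<bar>a * b\<bar>" by (simp add: power2_diff abs_mult)
  finally show ?thesis using abs_ge_zero[of "a * b"] by linarith
qed

lemma integrable_mult_of_squares:
  fixes f g :: "'a \<Rightarrow> real"
  assumes [measurable]: "f \<in> borel_measurable M" "g \<in> borel_measurable M"
    and "integrable M (\<lambda>x. (f x)\<^sup>2)" "integrable M (\<lambda>x. (g x)\<^sup>2)"
  shows "integrable M (\<lambda>x. f x * g x)"
proof (rule Bochner_Integration.integrable_bound)
  show "integrable M (\<lambda>x. (f x)\<^sup>2 + (g x)\<^sup>2)" using assms by simp
  show "AE x in M. norm (f x * g x) \<le> norm ((f x)\<^sup>2 + (g x)\<^sup>2)" using abs_mult_le_squares by simp
qed measurable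

lemma (in prob_space) integrable_of_square:
  fixes f :: "'a \<Rightarrow> real"
  assumes "f \<in> borel_measurable M" "integrable M (\<lambda>x. (f x)\<^sup>2)"
  shows "integrable M f"
  using integrable_mult_of_squares[of f M "\<lambda>_. 1"] assms by simp

locale brownian = filtered_space M F for M :: "'w measure" and F +
  fixes B :: "real \<Rightarrow> 'w \<Rightarrow> real"
  assumes brownian_motion: "brownian_motion M F B"
begin

lemma B_adapted: "0 \<le> t \<Longrightarrow> B t \<in> borel_measurable (F t)"
  using brownian_motion by (simp add: brownian_motion_def)

lemma B_measurable: "0 \<le> t \<Longrightarrow> B t \<in> borel_measurable M"
  using B_adapted measurable_F_M by blast

lemma B_continuous: "AE \<omega> in M. continuous_on {0..} (\<lambda>t. B t \<omega>)"
  using brownian_motion by (simp add: brownian_motion_def)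

context
  fixes s t :: real
  assumes st: "0 \<le> s" "s < t"
begin

lemma distributed_incr: "distributed M lborel (\<lambda>\<omega>. B t \<omega> - B s \<omega>) (normal_density 0 (sqrt (t - s)))"
  using brownian_motion st by (simp add: brownian_motion_def)

lemma incr_moment: "integrable M (\<lambda>\<omega>. (B t \<omega> - B s \<omega>) ^ k)"
  using distributed_integrable[OF distributed_incr, of "\<lambda>x. x ^ k"] st
    integrable_normal_moment[of "sqrt (t - s)" 0 k] by simp

lemma expectation_incr_pow:
  "expectation (\<lambda>\<omega>. (B t \<omega> - B s \<omega>) ^ k) = (\<integral>x. normal_density 0 (sqrt (t - s)) x * x ^ k \<partial>lborel)"
  using distributed_integral[OF distributed_incr, of "\<lambda>x. x ^ k"] st by simp

lemma expectation_incr: "expectation (\<lambda>\<omega>. B t \<omega> - B s \<omega>) = 0"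
  using expectation_incr_pow[of 1] integral_normal_moment_odd[of "sqrt (t - s)" 0 0] st by simp

lemma expectation_incr_sq: "expectation (\<lambda>\<omega>. (B t \<omega> - B s \<omega>)\<^sup>2) = t - s"
  using expectation_incr_pow[of 2] integral_normal_moment_even[of "sqrt (t - s)" 0 1] st by simp

lemma expectation_incr_4: "expectation (\<lambda>\<omega>. (B t \<omega> - B s \<omega>) ^ 4) = 3 * (t - s)\<^sup>2"
  using expectation_incr_pow[of 4] integral_normal_moment_even[of "sqrt (t - s)" 0 2] st
  by (simp add: fact_numeral field_simps power2_eq_square)

text \<open>The preimages under the increment already form a sigma-algebra, and the one generated by
  Z is part of F s; independence passes to both.\<close>

lemma indep_incr:
  assumes Z: "Z \<in> borel_measurable (F s)"
  shows "indep_var borel Z borel (\<lambda>\<omega>. B t \<omega> - B s \<omega>)"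
proof -
  let ?D = "\<lambda>\<omega>. B t \<omega> - B s \<omega>"
  have D: "?D \<in> borel_measurable M" using st by (intro borel_measurable_diff B_measurable) auto
  have 1: "indep_set (sets (F s)) {?D -` A \<inter> space M | A. A \<in> sets borel}"
    using brownian_motion st by (simp add: brownian_motion_def)
  have 2: "sigma_sets (space M) {Z -` A \<inter> space M | A. A \<in> sets borel} \<subseteq> sets (F s)"
    using sets.sigma_sets_subset[of "{Z -` A \<inter> space M | A. A \<in> sets borel}" "F s"] measurable_sets[OF Z]
    by (auto simp: space_F)
  have 3: "sigma_sets (space M) {?D -` A \<inter> space M | A. A \<in> sets borel} = {?D -` A \<inter> space M | A. A \<in> sets borel}"
  proof -
    have "sets (vimage_algebra (space M) ?D borel) = {?D -` A \<inter> space M | A. A \<in> sets borel}"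
      by (rule sets_vimage_algebra2) auto
    then show ?thesis using sets.sigma_sets_eq[of "vimage_algebra (space M) ?D borel"] by simp
  qed
  have "indep_set (sigma_sets (space M) {Z -` A \<inter> space M | A. A \<in> sets borel})
      (sigma_sets (space M) {?D -` A \<inter> space M | A. A \<in> sets borel})"
    unfolding 3 using 1 2 unfolding indep_sets2_eq by blast
  then show ?thesis
    unfolding indep_var_eq using measurable_F_M[OF Z] D by blast
qed

text \<open>Powers of a future increment factor out of the expectation. Exponent 1 gives
  orthogonality to the past, exponent 2 the isometry.\<close>

lemma
  assumes Z: "Z \<in> borel_measurable (F s)" "integrable M Z"
  shows integrable_mult_incr: "integrable M (\<lambda>\<omega>. Z \<omega> * (B t \<omega> - B s \<omega>) ^ k)"
    and expectation_mult_incr: "expectation (\<lambda>\<omega>. Z \<omega> * (B t \<omega> - B s \<omega>) ^ k) =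
      expectation Z * expectation (\<lambda>\<omega>. (B t \<omega> - B s \<omega>) ^ k)"
proof -
  have "indep_var borel ((\<lambda>x. x) \<circ> Z) borel ((\<lambda>x. x ^ k) \<circ> (\<lambda>\<omega>. B t \<omega> - B s \<omega>))"
    by (rule indep_var_compose[OF indep_incr[OF Z(1)]]) auto
  then have "indep_var borel Z borel (\<lambda>\<omega>. (B t \<omega> - B s \<omega>) ^ k)" by (simp add: o_def)
  from indep_var_lebesgue_integral[OF this Z(2) incr_moment] indep_var_integrable[OF this Z(2) incr_moment]
  show "integrable M (\<lambda>\<omega>. Z \<omega> * (B t \<omega> - B s \<omega>) ^ k)"
    "expectation (\<lambda>\<omega>. Z \<omega> * (B t \<omega> - B s \<omega>) ^ k) = expectation Z * expectation (\<lambda>\<omega>. (B t \<omega> - B s \<omega>) ^ k)"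
    by auto
qed

end

text \<open>Induction on the number of intervals: the new term has mean zero and is orthogonal to
  the sum so far, because that sum times the new coefficient is known before the increment.\<close>

lemma ito_isometry_grid:
  fixes a :: "nat \<Rightarrow> 'w \<Rightarrow> real"
  assumes t: "0 < t" and n: "n \<le> 2 ^ q"
    and a: "\<And>i. i < n \<Longrightarrow> a i \<in> borel_measurable (F (grid t q i))" "\<And>i. i < n \<Longrightarrow> integrable M (\<lambda>\<omega>. (a i \<omega>)\<^sup>2)"
  defines "R \<equiv> \<lambda>n \<omega>. \<Sum>i<n. a i \<omega> * incr (\<lambda>s. B s \<omega>) t q i"
  shows "R n \<in> borel_measurable (F (grid t q n)) \<and> integrable M (\<lambda>\<omega>. (R n \<omega>)\<^sup>2) \<and> expectation (R n) = 0 \<and>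
    expectation (\<lambda>\<omega>. (R n \<omega>)\<^sup>2) = (\<Sum>i<n. expectation (\<lambda>\<omega>. (a i \<omega>)\<^sup>2) * (t / 2 ^ q))"
  using n a
proof (induction n)
  case 0
  then show ?case by (simp add: R_def)
next
  case (Suc n)
  have IH: "R n \<in> borel_measurable (F (grid t q n))" "integrable M (\<lambda>\<omega>. (R n \<omega>)\<^sup>2)" "expectation (R n) = 0"
    "expectation (\<lambda>\<omega>. (R n \<omega>)\<^sup>2) = (\<Sum>i<n. expectation (\<lambda>\<omega>. (a i \<omega>)\<^sup>2) * (t / 2 ^ q))"
    using Suc by auto
  let ?s = "grid t q n" and ?s' = "grid t q (Suc n)"
  have st: "0 \<le> ?s" "?s < ?s'" using t by (auto simp: grid_def divide_strict_right_mono)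
  have step: "?s' - ?s = t / 2 ^ q" by (simp add: grid_Suc)
  let ?D = "\<lambda>\<omega>. B ?s' \<omega> - B ?s \<omega>"
  note am = Suc.prems(2)[of n, simplified] and ai = Suc.prems(3)[of n, simplified]
  note meas = measurable_F_M[OF IH(1)] measurable_F_M[OF am]
  have aI: "integrable M (a n)" by (rule integrable_of_square[OF meas(2) ai])
  have RI: "integrable M (R n)" by (rule integrable_of_square[OF meas(1) IH(2)])
  have RaI: "integrable M (\<lambda>\<omega>. R n \<omega> * a n \<omega>)" by (rule integrable_mult_of_squares[OF meas IH(2) ai])
  have R_Suc: "R (Suc n) \<omega> = R n \<omega> + a n \<omega> * ?D \<omega>" for \<omega> by (simp add: R_def)
  \<comment> \<open>The increment in the cross term is written to the power 1 so that
    \<open>expectation_mult_incr\<close> applies to it.\<close>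
  have R_Suc2: "(R (Suc n) \<omega>)\<^sup>2 = (R n \<omega>)\<^sup>2 + 2 * ((R n \<omega> * a n \<omega>) * ?D \<omega> ^ 1) + (a n \<omega>)\<^sup>2 * (?D \<omega>)\<^sup>2" for \<omega>
    by (simp add: R_Suc power2_eq_square algebra_simps)
  have m1: "(\<lambda>\<omega>. R n \<omega> * a n \<omega>) \<in> borel_measurable (F ?s)" "(\<lambda>\<omega>. (a n \<omega>)\<^sup>2) \<in> borel_measurable (F ?s)"
    using IH(1) am by auto
  note i = integrable_mult_incr[OF st m1(1) RaI, of 1] integrable_mult_incr[OF st m1(2) ai, of 2]
    integrable_mult_incr[OF st am aI, of 1]
  note e = expectation_mult_incr[OF st m1(1) RaI, of 1] expectation_mult_incr[OF st m1(2) ai, of 2]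
    expectation_mult_incr[OF st am aI, of 1]
  have "R (Suc n) \<in> borel_measurable (F ?s')"
    unfolding R_Suc[abs_def]
    using measurable_F_mono[OF IH(1), of ?s'] measurable_F_mono[OF am, of ?s'] B_adapted[of ?s']
      measurable_F_mono[OF B_adapted[of ?s], of ?s'] st by (intro borel_measurable_add borel_measurable_times borel_measurable_diff) auto
  moreover have "integrable M (\<lambda>\<omega>. (R (Suc n) \<omega>)\<^sup>2)"
    unfolding R_Suc2 by (intro Bochner_Integration.integrable_add integrable_mult_right IH(2) i)
  moreover have "expectation (R (Suc n)) = 0"
    unfolding R_Suc[abs_def] using IH(3) RI i(3) e(3) expectation_incr[OF st] by simp
  moreover have "expectation (\<lambda>\<omega>. (R (Suc n) \<omega>)\<^sup>2) = expectation (\<lambda>\<omega>. (R n \<omega>)\<^sup>2) + 2 * 0 + expectation (\<lambda>\<omega>. (a n \<omega>)\<^sup>2) * (t / 2 ^ q)"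
    unfolding R_Suc2 using IH(2) i(1,2) e(1,2) expectation_incr[OF st] expectation_incr_sq[OF st] step
    by (simp del: power_one_right)
  ultimately show ?case using IH(4) by simp
qed

end

text \<open>Uniform integrability, in the form of a second moment bound, lets the mean pass to the limit.\<close>

lemma (in prob_space) mean_zero_limit:
  fixes X :: "nat \<Rightarrow> 'a \<Rightarrow> real"
  assumes X [measurable]: "\<And>q. X q \<in> borel_measurable M" and A [measurable]: "A \<in> borel_measurable M"
    and lim: "AE \<omega> in M. (\<lambda>q. X q \<omega>) \<longlonglongrightarrow> A \<omega>"
    and sq: "\<And>q. integrable M (\<lambda>\<omega>. (X q \<omega>)\<^sup>2)" "\<And>q. expectation (\<lambda>\<omega>. (X q \<omega>)\<^sup>2) \<le> C"
    and mean: "\<And>q. expectation (X q) = 0"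
  shows "integrable M A" "expectation A = 0"
proof -
  have "0 \<le> expectation (\<lambda>\<omega>. (X 0 \<omega>)\<^sup>2)" by simp
  then have C0: "0 \<le> C" using sq(2)[of 0] by linarith
  have XI: "integrable M (X q)" for q by (rule integrable_of_square[OF X sq(1)])
  have "(\<integral>\<^sup>+\<omega>. ennreal ((A \<omega>)\<^sup>2) \<partial>M) = (\<integral>\<^sup>+\<omega>. liminf (\<lambda>q. ennreal ((X q \<omega>)\<^sup>2)) \<partial>M)"
  proof (rule nn_integral_cong_AE)
    show "AE \<omega> in M. ennreal ((A \<omega>)\<^sup>2) = liminf (\<lambda>q. ennreal ((X q \<omega>)\<^sup>2))"
      using lim
    proof eventually_elim
      case (elim \<omega>)
      then have "(\<lambda>q. ennreal ((X q \<omega>)\<^sup>2)) \<longlonglongrightarrow> ennreal ((A \<omega>)\<^sup>2)"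
        by (intro tendsto_ennrealI tendsto_power)
      then show ?case by (rule lim_imp_Liminf[OF trivial_limit_sequentially, symmetric])
    qed
  qed
  also have "\<dots> \<le> liminf (\<lambda>q. \<integral>\<^sup>+\<omega>. ennreal ((X q \<omega>)\<^sup>2) \<partial>M)"
    by (rule nn_integral_liminf) measurable
  also have "\<dots> \<le> ennreal C"
  proof -
    have "(\<integral>\<^sup>+\<omega>. ennreal ((X q \<omega>)\<^sup>2) \<partial>M) \<le> ennreal C" for q
      using sq by (subst nn_integral_eq_integral) (auto intro: ennreal_leI)
    then have "liminf (\<lambda>q. \<integral>\<^sup>+\<omega>. ennreal ((X q \<omega>)\<^sup>2) \<partial>M) \<le> liminf (\<lambda>q::nat. ennreal C)"
      by (intro Liminf_mono always_eventually allI)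
    then show ?thesis by (simp add: Liminf_const)
  qed
  finally have nn: "(\<integral>\<^sup>+\<omega>. ennreal ((A \<omega>)\<^sup>2) \<partial>M) \<le> ennreal C" .
  have A2: "integrable M (\<lambda>\<omega>. (A \<omega>)\<^sup>2)"
    by (rule integrableI_nonneg) (use nn in \<open>auto intro: order.strict_trans1\<close>)
  have A2C: "expectation (\<lambda>\<omega>. (A \<omega>)\<^sup>2) \<le> C"
    using nn A2 C0 by (subst (asm) nn_integral_eq_integral) auto
  show AI: "integrable M A" by (rule integrable_of_square[OF A A2])
  \<comment> \<open>Truncation at level K makes dominated convergence available and changes the mean
    by at most C / K.\<close>
  define cl where "cl K x = max (- K) (min K x)" for K x :: real
  have cl_cont: "isCont (cl K) x" for K x unfolding cl_def[abs_def] by (intro continuous_intros)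
  have cl_bd: "\<bar>cl K x\<bar> \<le> K" if "K > 0" for K x using that by (auto simp: cl_def)
  have cl_err: "\<bar>x - cl K x\<bar> \<le> x\<^sup>2 / K" if "K > 0" for K x
  proof (cases "\<bar>x\<bar> \<le> K")
    case True
    then show ?thesis using that by (auto simp: cl_def)
  next
    case False
    then have "\<bar>x - cl K x\<bar> \<le> \<bar>x\<bar>" using that by (auto simp: cl_def)
    also have "\<dots> \<le> \<bar>x\<bar> * (\<bar>x\<bar> / K)" using False that mult_left_mono[of 1 "\<bar>x\<bar> / K" "\<bar>x\<bar>"] by simp
    finally show ?thesis by (simp add: power2_eq_square)
  qed
  have [measurable]: "cl K \<in> borel_measurable borel" for K unfolding cl_def[abs_def] by measurable
  have trunc: "\<bar>expectation Y - expectation (\<lambda>\<omega>. cl K (Y \<omega>))\<bar> \<le> C / K"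
    if K: "K > 0" and Y [measurable]: "Y \<in> borel_measurable M" and Y2: "integrable M (\<lambda>\<omega>. (Y \<omega>)\<^sup>2)" "expectation (\<lambda>\<omega>. (Y \<omega>)\<^sup>2) \<le> C" for K Y
  proof -
    have YI: "integrable M Y" by (rule integrable_of_square[OF Y Y2(1)])
    have clI: "integrable M (\<lambda>\<omega>. cl K (Y \<omega>))"
      by (rule integrable_const_bound[where B = K]) (use cl_bd[OF K] in auto)
    have "\<bar>expectation Y - expectation (\<lambda>\<omega>. cl K (Y \<omega>))\<bar> = \<bar>expectation (\<lambda>\<omega>. Y \<omega> - cl K (Y \<omega>))\<bar>"
      using YI clI by simp
    also have "\<dots> \<le> expectation (\<lambda>\<omega>. \<bar>Y \<omega> - cl K (Y \<omega>)\<bar>)" by (rule integral_abs_bound)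
    also have "\<dots> \<le> expectation (\<lambda>\<omega>. (Y \<omega>)\<^sup>2 / K)"
      by (rule integral_mono) (use YI clI Y2 cl_err[OF K] in auto)
    also have "\<dots> \<le> C / K" using Y2 K by (simp add: divide_right_mono)
    finally show ?thesis .
  qed
  have bound: "\<bar>expectation A\<bar> \<le> 2 * C / K" if K: "K > 0" for K
  proof -
    have "(\<lambda>q. expectation (\<lambda>\<omega>. cl K (X q \<omega>))) \<longlonglongrightarrow> expectation (\<lambda>\<omega>. cl K (A \<omega>))"
    proof (rule integral_dominated_convergence[where w = "\<lambda>_. K"])
      show "AE \<omega> in M. (\<lambda>q. cl K (X q \<omega>)) \<longlonglongrightarrow> cl K (A \<omega>)"
        using lim by eventually_elim (rule isCont_tendsto_compose[OF cl_cont])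
      show "AE \<omega> in M. norm (cl K (X q \<omega>)) \<le> K" for q using cl_bd[OF K] by simp
    qed auto
    then have "\<bar>expectation (\<lambda>\<omega>. cl K (A \<omega>))\<bar> \<le> C / K"
      by (rule Lim_bounded[OF tendsto_rabs, rule_format, where M = 0])
        (use trunc[OF K X sq] mean in simp)
    with trunc[OF K A A2 A2C] show ?thesis by simp
  qed
  have "(\<lambda>n. 2 * C / real (Suc n)) \<longlonglongrightarrow> 0"
    using tendsto_mult_right_zero[OF LIMSEQ_inverse_real_of_nat, of "2 * C"] by (simp add: divide_inverse)
  then have "\<bar>expectation A\<bar> \<le> 0"
    by (rule LIMSEQ_le_const) (use bound in auto)
  then show "expectation A = 0" by simp
qed

subsection \<open>Quadratic covariation along dyadic partitions\<close>

text \<open>The expected sum of the squares is finite, so the squares are almost surely summable and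
  tend to zero.\<close>

lemma (in prob_space) AE_tendsto_zero_of_summable_squares:
  fixes S :: "nat \<Rightarrow> 'a \<Rightarrow> real"
  assumes S: "\<And>q. integrable M (\<lambda>\<omega>. (S q \<omega>)\<^sup>2)" and b: "\<And>q. expectation (\<lambda>\<omega>. (S q \<omega>)\<^sup>2) \<le> b q" "summable b"
  shows "AE \<omega> in M. (\<lambda>q. S q \<omega>) \<longlonglongrightarrow> 0"
proof -
  have b0: "0 \<le> b q" for q using order.trans[OF Bochner_Integration.integral_nonneg b(1)[of q]] by simp
  have "(\<integral>\<^sup>+\<omega>. (\<Sum>q. ennreal ((S q \<omega>)\<^sup>2)) \<partial>M) = (\<Sum>q. \<integral>\<^sup>+\<omega>. ennreal ((S q \<omega>)\<^sup>2) \<partial>M)"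
    by (rule nn_integral_suminf) (use borel_measurable_integrable[OF S] in auto)
  also have "\<dots> \<le> (\<Sum>q. ennreal (b q))"
  proof (rule suminf_le)
    show "(\<integral>\<^sup>+\<omega>. ennreal ((S q \<omega>)\<^sup>2) \<partial>M) \<le> ennreal (b q)" for q
      using S b by (subst nn_integral_eq_integral) (auto intro: ennreal_leI)
  qed auto
  also have "\<dots> < \<infinity>" using b(2) b0 by (simp add: suminf_ennreal2)
  finally have "AE \<omega> in M. (\<Sum>q. ennreal ((S q \<omega>)\<^sup>2)) \<noteq> \<infinity>"
    using borel_measurable_integrable[OF S] by (intro nn_integral_PInf_AE) auto
  then show ?thesis
  proof eventually_elim
    case (elim \<omega>)
    then have "summable (\<lambda>q. (S q \<omega>)\<^sup>2)" by (intro summable_suminf_not_top) auto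
    then have "(\<lambda>q. (S q \<omega>)\<^sup>2) \<longlonglongrightarrow> 0" by (rule summable_LIMSEQ_zero)
    then have "(\<lambda>q. sqrt ((S q \<omega>)\<^sup>2)) \<longlonglongrightarrow> sqrt 0" by (rule tendsto_real_sqrt)
    then show ?case by (simp add: tendsto_rabs_zero_iff)
  qed
qed

text \<open>At most 2^q orthogonal terms of mean square C 4^-q add up to C 2^-q, which is summable.
  The index sets are left free so that the result applies to each coarse block separately.\<close>

lemma (in prob_space) AE_orthogonal_sums_tendsto_zero:
  fixes \<xi> :: "nat \<Rightarrow> nat \<Rightarrow> 'a \<Rightarrow> real"
  assumes int: "\<And>q i j. i < 2 ^ q \<Longrightarrow> j < 2 ^ q \<Longrightarrow> integrable M (\<lambda>\<omega>. \<xi> q i \<omega> * \<xi> q j \<omega>)"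
    and orth: "\<And>q i j. i < 2 ^ q \<Longrightarrow> j < 2 ^ q \<Longrightarrow> i < j \<Longrightarrow> expectation (\<lambda>\<omega>. \<xi> q i \<omega> * \<xi> q j \<omega>) = 0"
    and sq: "\<And>q i. i < 2 ^ q \<Longrightarrow> expectation (\<lambda>\<omega>. \<xi> q i \<omega> * \<xi> q i \<omega>) \<le> C * (1 / 2 ^ q)\<^sup>2"
    and I: "\<And>q. I q \<subseteq> {..<2 ^ q}"
  shows "AE \<omega> in M. (\<lambda>q. \<Sum>i\<in>I q. \<xi> q i \<omega>) \<longlonglongrightarrow> 0"
proof (rule AE_tendsto_zero_of_summable_squares)
  have fin: "finite (I q)" for q using I finite_subset by blast
  have expand: "(\<Sum>i\<in>I q. \<xi> q i \<omega>)\<^sup>2 = (\<Sum>i\<in>I q. \<Sum>j\<in>I q. \<xi> q i \<omega> * \<xi> q j \<omega>)" for q \<omega>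
    by (simp add: power2_eq_square sum_product)
  show "integrable M (\<lambda>\<omega>. (\<Sum>i\<in>I q. \<xi> q i \<omega>)\<^sup>2)" for q
    unfolding expand by (intro Bochner_Integration.integrable_sum int) (use I in auto)
  have C: "0 \<le> C" using order.trans[OF Bochner_Integration.integral_nonneg sq[of 0 0]] by simp
  show "expectation (\<lambda>\<omega>. (\<Sum>i\<in>I q. \<xi> q i \<omega>)\<^sup>2) \<le> C * (1/2) ^ q" for q
  proof -
    have "expectation (\<lambda>\<omega>. (\<Sum>i\<in>I q. \<xi> q i \<omega>)\<^sup>2) = (\<Sum>i\<in>I q. \<Sum>j\<in>I q. expectation (\<lambda>\<omega>. \<xi> q i \<omega> * \<xi> q j \<omega>))"
      unfolding expand using I
      by (subst Bochner_Integration.integral_sum, (intro Bochner_Integration.integrable_sum int; auto),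
          intro sum.cong refl, subst Bochner_Integration.integral_sum) (auto intro!: int)
    also have "\<dots> = (\<Sum>i\<in>I q. \<Sum>j\<in>I q. if i = j then expectation (\<lambda>\<omega>. \<xi> q i \<omega> * \<xi> q i \<omega>) else 0)"
    proof (intro sum.cong refl)
      fix i j assume "i \<in> I q" "j \<in> I q"
      then have ij: "i < 2 ^ q" "j < 2 ^ q" using I by auto
      show "expectation (\<lambda>\<omega>. \<xi> q i \<omega> * \<xi> q j \<omega>) = (if i = j then expectation (\<lambda>\<omega>. \<xi> q i \<omega> * \<xi> q i \<omega>) else 0)"
        using orth[OF ij] orth[OF ij(2,1)] by (cases i j rule: linorder_cases) (auto simp: mult.commute)
    qed
    also have "\<dots> = (\<Sum>i\<in>I q. expectation (\<lambda>\<omega>. \<xi> q i \<omega> * \<xi> q i \<omega>))" using fin by simp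
    also have "\<dots> \<le> (\<Sum>i\<in>I q. C * (1 / 2 ^ q)\<^sup>2)" using I by (intro sum_mono sq) auto
    also have "\<dots> \<le> (\<Sum>i<(2::nat) ^ q. C * (1 / 2 ^ q)\<^sup>2)" using I C by (intro sum_mono2) auto
    also have "\<dots> = C * (1/2) ^ q" by (simp add: power2_eq_square power_divide)
    finally show ?thesis .
  qed
  show "summable (\<lambda>q. C * (1/2) ^ q)" by (intro summable_mult summable_geometric) simp
qed

text \<open>Treats a Brownian motion paired with itself (\<delta> = 1) and two independent ones
  (\<delta> = 0) together. In the second case independence enters as a factorization of fourth order
  moments of increments.\<close>

locale brownian_pair = K: brownian M F B + L: brownian M F B' for M :: "'w measure" and F B B' +
  fixes \<delta> :: real
  assumes cases: "B' = B \<and> \<delta> = 1 \<or> \<delta> = 0 \<and> (\<forall>s t s' t'. 0 \<le> s \<longrightarrow> s < t \<longrightarrow> 0 \<le> s' \<longrightarrow> s' < t' \<longrightarrow>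
     (integrable M (\<lambda>\<omega>. (B t \<omega> - B s \<omega>) * (B t' \<omega> - B s' \<omega>) * ((B' t \<omega> - B' s \<omega>) * (B' t' \<omega> - B' s' \<omega>))) \<and>
      integral\<^sup>L M (\<lambda>\<omega>. (B t \<omega> - B s \<omega>) * (B t' \<omega> - B s' \<omega>) * ((B' t \<omega> - B' s \<omega>) * (B' t' \<omega> - B' s' \<omega>))) =
      integral\<^sup>L M (\<lambda>\<omega>. (B t \<omega> - B s \<omega>) * (B t' \<omega> - B s' \<omega>)) * integral\<^sup>L M (\<lambda>\<omega>. (B' t \<omega> - B' s \<omega>) * (B' t' \<omega> - B' s' \<omega>))))"
begin

lemma AE_covariation_blocks:
  assumes t: "0 < t" and I: "\<And>q. I q \<subseteq> {..<2 ^ q}"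
  shows "AE \<omega> in M. (\<lambda>q. \<Sum>i\<in>I q. incr (\<lambda>s. B s \<omega>) t q i * incr (\<lambda>s. B' s \<omega>) t q i - \<delta> * (t / 2 ^ q)) \<longlonglongrightarrow> 0"
proof -
  define \<xi> where "\<xi> q i \<omega> = incr (\<lambda>s. B s \<omega>) t q i * incr (\<lambda>s. B' s \<omega>) t q i - \<delta> * (t / 2 ^ q)" for q i \<omega>
  let ?g = "grid t"
  have g: "0 \<le> ?g q i" "?g q i < ?g q (Suc i)" "?g q (Suc i) - ?g q i = t / 2 ^ q" for q i
    using t by (auto simp: grid_def divide_strict_right_mono field_simps)
  have mono: "?g q (Suc i) \<le> ?g q j" if "i < j" for q i j using t that by (intro grid_mono) auto
  note incr_meas = borel_measurable_diff[OF K.B_measurable K.B_measurable]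
  have main: "integrable M (\<lambda>\<omega>. \<xi> q i \<omega> * \<xi> q j \<omega>) \<and> (i \<noteq> j \<longrightarrow> K.expectation (\<lambda>\<omega>. \<xi> q i \<omega> * \<xi> q j \<omega>) = 0) \<and>
      (i = j \<longrightarrow> K.expectation (\<lambda>\<omega>. \<xi> q i \<omega> * \<xi> q j \<omega>) \<le> 2 * (t / 2 ^ q)\<^sup>2)" if "i \<le> j" for q i j
  proof (cases "\<delta> = 1")
    case True
    then have BB: "B' = B" using cases by auto
    let ?D = "\<lambda>i \<omega>. B (?g q (Suc i)) \<omega> - B (?g q i) \<omega>"
    have \<xi>: "\<xi> q i \<omega> = (?D i \<omega>)\<^sup>2 - t / 2 ^ q" for i \<omega>
      unfolding \<xi>_def BB True by (simp add: power2_eq_square)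
    have m: "integrable M (\<lambda>\<omega>. ?D i \<omega> ^ k)" for i k by (rule K.incr_moment[OF g(1,2)])
    have e2: "K.expectation (\<lambda>\<omega>. (?D i \<omega>)\<^sup>2) = t / 2 ^ q" for i using K.expectation_incr_sq[OF g(1,2), of q i] g(3) by simp
    show ?thesis
    proof (cases "i = j")
      case True
      \<comment> \<open>With d = t / 2^q the Gaussian moments give the mean square 3 d^2 - 2 d^2 +
        d^2 = 2 d^2.\<close>
      have eq: "\<xi> q i \<omega> * \<xi> q i \<omega> = ?D i \<omega> ^ 4 - 2 * (t / 2 ^ q) * (?D i \<omega>)\<^sup>2 + (t / 2 ^ q)\<^sup>2" for \<omega>
        unfolding \<xi> by (simp add: power2_eq_square power4_eq_xxxx algebra_simps)
      have "integrable M (\<lambda>\<omega>. \<xi> q i \<omega> * \<xi> q i \<omega>)"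
        unfolding eq by (intro Bochner_Integration.integrable_add Bochner_Integration.integrable_diff integrable_mult_right m) simp
      moreover have "K.expectation (\<lambda>\<omega>. \<xi> q i \<omega> * \<xi> q i \<omega>) = 2 * (t / 2 ^ q)\<^sup>2"
        unfolding eq using m[of i 4] m[of i 2] e2[of i] K.expectation_incr_4[OF g(1,2), of q i] g(3)
        by (simp add: K.prob_space) (simp add: power2_eq_square)
      ultimately show ?thesis using True by simp
    next
      case False
      with that have ij: "i < j" by simp
      have \<xi>m: "\<xi> q i \<in> borel_measurable (F (?g q j))"
        unfolding \<xi>[abs_def] using mono[OF ij] g(1,2)[of q i]
        by (intro borel_measurable_diff borel_measurable_power K.measurable_F_mono[OF K.B_adapted] borel_measurable_const) (auto intro: order.trans less_imp_le)
      have \<xi>I: "integrable M (\<xi> q i)" unfolding \<xi>[abs_def] using m by simp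
      \<comment> \<open>The earlier factor is known before the later interval begins, and the
        centred later factor has mean zero.\<close>
      have "\<xi> q i \<omega> * \<xi> q j \<omega> = \<xi> q i \<omega> * (?D j \<omega>)\<^sup>2 - (t / 2 ^ q) * \<xi> q i \<omega>" for \<omega>
        unfolding \<xi>[of j] by (simp add: algebra_simps)
      then show ?thesis
        using K.integrable_mult_incr[OF g(1,2) \<xi>m \<xi>I, of 2] K.expectation_mult_incr[OF g(1,2) \<xi>m \<xi>I, of 2] e2[of j] \<xi>I False
        by simp
    qed
  next
    case False
    let ?D = "\<lambda>i \<omega>. B (?g q (Suc i)) \<omega> - B (?g q i) \<omega>" and ?D' = "\<lambda>i \<omega>. B' (?g q (Suc i)) \<omega> - B' (?g q i) \<omega>"
    have \<xi>: "\<xi> q i \<omega> * \<xi> q j \<omega> = ?D i \<omega> * ?D j \<omega> * (?D' i \<omega> * ?D' j \<omega>)" for \<omega>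
      using cases False by (auto simp: \<xi>_def)
    have *: "integrable M (\<lambda>\<omega>. \<xi> q i \<omega> * \<xi> q j \<omega>)"
      "K.expectation (\<lambda>\<omega>. \<xi> q i \<omega> * \<xi> q j \<omega>) = K.expectation (\<lambda>\<omega>. ?D i \<omega> * ?D j \<omega>) * K.expectation (\<lambda>\<omega>. ?D' i \<omega> * ?D' j \<omega>)"
      unfolding \<xi> using cases False g by blast+
    show ?thesis
    proof (cases "i = j")
      case True
      have "K.expectation (\<lambda>\<omega>. \<xi> q i \<omega> * \<xi> q j \<omega>) = (t / 2 ^ q)\<^sup>2" using *
        K.expectation_incr_sq[OF g(1,2), of q i] L.expectation_incr_sq[OF g(1,2), of q i] g(3) True
        by (simp add: power2_eq_square)
      then show ?thesis using True * by simp
    next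
      case False
      with that have ij: "i < j" by simp
      have Dm: "?D i \<in> borel_measurable (F (?g q j))"
        using mono[OF ij] g(1,2)[of q i]
        by (intro borel_measurable_diff K.measurable_F_mono[OF K.B_adapted]) (auto intro: order.trans less_imp_le)
      have DI: "integrable M (?D i)" using K.incr_moment[OF g(1,2), of q i 1] by simp
      have "K.expectation (\<lambda>\<omega>. ?D i \<omega> * ?D j \<omega>) = 0"
        using K.expectation_mult_incr[OF g(1,2) Dm DI, of 1] K.expectation_incr[OF g(1,2), of q j] by simp
      with * show ?thesis using False by simp
    qed
  qed
  have "AE \<omega> in M. (\<lambda>q. \<Sum>i\<in>I q. \<xi> q i \<omega>) \<longlonglongrightarrow> 0"
  proof (rule K.AE_orthogonal_sums_tendsto_zero[where C = "2 * t\<^sup>2", OF _ _ _ I])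
    fix q i j :: nat
    show "integrable M (\<lambda>\<omega>. \<xi> q i \<omega> * \<xi> q j \<omega>)"
      using main[of i j q] main[of j i q] by (cases "i \<le> j") (auto simp: mult.commute)
    show "K.expectation (\<lambda>\<omega>. \<xi> q i \<omega> * \<xi> q j \<omega>) = 0" if "i < j" using main[of i j q] that by simp
    show "K.expectation (\<lambda>\<omega>. \<xi> q i \<omega> * \<xi> q i \<omega>) \<le> 2 * t\<^sup>2 * (1 / 2 ^ q)\<^sup>2"
      using main[of i i q] by (simp add: power_divide)
  qed
  then show ?thesis by (simp add: \<xi>_def)
qed

end

text \<open>Block sums converge almost surely by orthogonality; continuity of the weight does the rest,
  pathwise, so no adaptedness of the weight is needed.\<close>

lemma (in brownian_pair) AE_weighted_covariation:
  assumes t: "0 \<le> t"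
  shows "AE \<omega> in M. \<forall>h. continuous_on {0..t} h \<longrightarrow>
    (\<lambda>q. \<Sum>i<2 ^ q. h (grid t q i) * (incr (\<lambda>s. B s \<omega>) t q i * incr (\<lambda>s. B' s \<omega>) t q i)) \<longlonglongrightarrow> \<delta> * integral {0..t} h"
proof (cases "t = 0")
  case True
  then show ?thesis by (simp add: grid_def)
next
  case False
  with t have t': "0 < t" by simp
  interpret KK: brownian_pair M F B B 1 by unfold_locales simp
  interpret LL: brownian_pair M F B' B' 1 by unfold_locales simp
  let ?blk = "\<lambda>N j q. {i\<in>{..<2 ^ q}. i div 2 ^ (q - N) = j}"
  have "AE \<omega> in M. \<forall>N j. (\<lambda>q. \<Sum>i\<in>?blk N j q. incr (\<lambda>s. B s \<omega>) t q i * incr (\<lambda>s. B' s \<omega>) t q i - \<delta> * (t / 2 ^ q)) \<longlonglongrightarrow> 0"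
    unfolding AE_all_countable by (intro allI AE_covariation_blocks[OF t']) auto
  moreover have "AE \<omega> in M. (\<lambda>q. \<Sum>i<2 ^ q. incr (\<lambda>s. B s \<omega>) t q i * incr (\<lambda>s. B s \<omega>) t q i - 1 * (t / 2 ^ q)) \<longlonglongrightarrow> 0"
    using KK.AE_covariation_blocks[OF t', of "\<lambda>q. {..<2 ^ q}"] by simp
  moreover have "AE \<omega> in M. (\<lambda>q. \<Sum>i<2 ^ q. incr (\<lambda>s. B' s \<omega>) t q i * incr (\<lambda>s. B' s \<omega>) t q i - 1 * (t / 2 ^ q)) \<longlonglongrightarrow> 0"
    using LL.AE_covariation_blocks[OF t', of "\<lambda>q. {..<2 ^ q}"] by simp
  ultimately show ?thesis
  proof eventually_elim
    case (elim \<omega>)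
    let ?a = "incr (\<lambda>s. B s \<omega>) t" and ?b = "incr (\<lambda>s. B' s \<omega>) t"
    show ?case
    proof (intro allI impI)
      fix h :: "real \<Rightarrow> real" assume h: "continuous_on {0..t} h"
      have "(\<lambda>q. \<Sum>i<2 ^ q. h (grid t q i) * (?a q i * ?b q i - \<delta> * (t / 2 ^ q))) \<longlonglongrightarrow> 0"
      proof (rule grid_weighted_sum_zero[OF t h])
        show "(\<lambda>q. \<Sum>i\<in>?blk N j q. ?a q i * ?b q i - \<delta> * (t / 2 ^ q)) \<longlonglongrightarrow> 0" for N j
          using elim(1) by blast
        have "\<forall>\<^sub>F q in sequentially. (\<Sum>i<2 ^ q. ?a q i * ?a q i - 1 * (t / 2 ^ q)) < 1"
          "\<forall>\<^sub>F q in sequentially. (\<Sum>i<2 ^ q. ?b q i * ?b q i - 1 * (t / 2 ^ q)) < 1"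
          using elim(2,3) by (auto intro: order_tendstoD)
        then show "\<forall>\<^sub>F q in sequentially. (\<Sum>i<2 ^ q. \<bar>?a q i * ?b q i - \<delta> * (t / 2 ^ q)\<bar>) \<le> 2 + 3 * t"
        proof eventually_elim
          case (elim q)
          \<comment> \<open>The sums of squared increments are below t + 1 for both paths and the
            centring adds at most t, hence the bound 2 + 3 t.\<close>
          have "(\<Sum>i<2 ^ q. \<bar>?a q i * ?b q i - \<delta> * (t / 2 ^ q)\<bar>) \<le> (\<Sum>i<2 ^ q. ?a q i * ?a q i + ?b q i * ?b q i + t / 2 ^ q)"
          proof (rule sum_mono)
            fix i
            from abs_mult_le_squares[of "?a q i" "?b q i"] t'
            show "\<bar>?a q i * ?b q i - \<delta> * (t / 2 ^ q)\<bar> \<le> ?a q i * ?a q i + ?b q i * ?b q i + t / 2 ^ q"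
              using cases by (auto simp: abs_le_iff power2_eq_square) (smt (verit) divide_nonneg_pos zero_less_power)+
          qed
          also have "\<dots> \<le> 2 + 3 * t"
            using elim by (simp add: sum.distrib sum_subtractf)
          finally show ?case .
        qed
      qed
      moreover have "(\<lambda>q. \<delta> * (\<Sum>i<2 ^ q. h (grid t q i) * (t / 2 ^ q))) \<longlonglongrightarrow> \<delta> * integral {0..t} h"
        by (intro tendsto_intros grid_riemann_sum t h)
      ultimately have "(\<lambda>q. (\<Sum>i<2 ^ q. h (grid t q i) * (?a q i * ?b q i - \<delta> * (t / 2 ^ q))) +
          \<delta> * (\<Sum>i<2 ^ q. h (grid t q i) * (t / 2 ^ q))) \<longlonglongrightarrow> 0 + \<delta> * integral {0..t} h"
        by (rule tendsto_add)
      then show "(\<lambda>q. \<Sum>i<2 ^ q. h (grid t q i) * (?a q i * ?b q i)) \<longlonglongrightarrow> \<delta> * integral {0..t} h"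
        by (simp add: right_diff_distrib sum_subtractf sum_distrib_left mult.left_commute)
    qed
  qed
qed

text \<open>Independence is assumed for whole paths; a product of two increments is a measurable
  function of finitely many coordinates of a path, so independence descends to such
  products.\<close>

lemma (in filtered_space) brownian_pair_of_independent:
  fixes \<beta> :: "'k::finite \<Rightarrow> real \<Rightarrow> 'w \<Rightarrow> real" and k l :: 'k
  assumes "independent_brownian_motions M F \<beta>"
  shows "brownian_pair M F (\<beta> k) (\<beta> l) (if k = l then 1 else 0)"
proof -
  from assms have bm: "\<And>l. brownian_motion M F (\<beta> l)"
    and ind: "indep_vars (\<lambda>_. PiM {0..} (\<lambda>_. borel)) (\<lambda>l \<omega>. \<lambda>t\<in>{0..}. \<beta> l t \<omega>) UNIV"
    by (auto simp: independent_brownian_motions_def)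
  have K: "brownian M F (\<beta> l)" for l by unfold_locales (rule bm)
  show ?thesis
  proof (cases "k = l")
    case True
    have "brownian_pair M F (\<beta> k) (\<beta> k) 1"
      by (rule brownian_pair.intro[OF K K], rule brownian_pair_axioms.intro) simp
    with True show ?thesis by simp
  next
    case False
      have "integrable M (\<lambda>\<omega>. (\<beta> k t \<omega> - \<beta> k s \<omega>) * (\<beta> k t' \<omega> - \<beta> k s' \<omega>) * ((\<beta> l t \<omega> - \<beta> l s \<omega>) * (\<beta> l t' \<omega> - \<beta> l s' \<omega>))) \<and>
        integral\<^sup>L M (\<lambda>\<omega>. (\<beta> k t \<omega> - \<beta> k s \<omega>) * (\<beta> k t' \<omega> - \<beta> k s' \<omega>) * ((\<beta> l t \<omega> - \<beta> l s \<omega>) * (\<beta> l t' \<omega> - \<beta> l s' \<omega>))) =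
        integral\<^sup>L M (\<lambda>\<omega>. (\<beta> k t \<omega> - \<beta> k s \<omega>) * (\<beta> k t' \<omega> - \<beta> k s' \<omega>)) * integral\<^sup>L M (\<lambda>\<omega>. (\<beta> l t \<omega> - \<beta> l s \<omega>) * (\<beta> l t' \<omega> - \<beta> l s' \<omega>))"
        if st: "0 \<le> s" "s < t" "0 \<le> s'" "s' < t'" for s t s' t'
      proof -
        define X where "X l \<omega> = (\<beta> l t \<omega> - \<beta> l s \<omega>) * (\<beta> l t' \<omega> - \<beta> l s' \<omega>)" for l \<omega>
        have "(\<lambda>f. (f t - f s) * (f t' - f s')) \<in> borel_measurable (PiM {0..} (\<lambda>_. borel :: real measure))"
          using st by (intro borel_measurable_times borel_measurable_diff measurable_component_singleton) auto
        then have "indep_vars (\<lambda>_. borel) (\<lambda>l \<omega>. (\<lambda>f. (f t - f s) * (f t' - f s')) (\<lambda>t\<in>{0..}. \<beta> l t \<omega>)) UNIV"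
          by (intro indep_vars_compose2[OF ind])
        then have "indep_vars (\<lambda>_. borel) X UNIV" using st by (simp add: X_def[abs_def])
        then have iX: "indep_vars (\<lambda>_. borel) X {k, l}" by (rule indep_vars_subset) auto
        have m: "(\<lambda>\<omega>. \<beta> l b \<omega> - \<beta> l a \<omega>) \<in> borel_measurable M" "integrable M (\<lambda>\<omega>. (\<beta> l b \<omega> - \<beta> l a \<omega>)\<^sup>2)"
          if "0 \<le> a" "a < b" for a b l
          using that brownian.incr_moment[OF K that] brownian.B_measurable[OF K] by (auto intro!: borel_measurable_diff)
        have XI: "integrable M (X l)" for l
          unfolding X_def[abs_def] by (intro integrable_mult_of_squares m st)
        show ?thesis
          using indep_vars_lebesgue_integral[OF _ iX XI] indep_vars_integrable[OF _ iX XI] False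
          by (simp add: X_def)
      qed
      then have "brownian_pair M F (\<beta> k) (\<beta> l) 0"
        by (intro brownian_pair.intro[OF K K] brownian_pair_axioms.intro) blast
      with False show ?thesis by simp
  qed
qed

subsection \<open>Stratonovich integrals\<close>

lemma has_strat_integral_grid:
  assumes "has_strat_integral M T Y Z I" "t \<in> {0..T}" "compact C"
  shows "null_in_prob M sequentially (\<lambda>q \<omega>. SUP p\<in>C. ennreal (norm (
    (\<Sum>i<2 ^ q. (Z (grid t q (Suc i)) \<omega> p - Z (grid t q i) \<omega> p) *\<^sub>R
      ((1/2) *\<^sub>R (Y (grid t q i) \<omega> p + Y (grid t q (Suc i)) \<omega> p))) - I t \<omega> p)))"
proof -
  from assms have "null_in_prob M (mesh_to_zero t) (\<lambda>(n, \<pi>) \<omega>. SUP p\<in>C. ennreal (norm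
          ((\<Sum>i<n. (Z (\<pi> (Suc i)) \<omega> p - Z (\<pi> i) \<omega> p) *\<^sub>R
                   ((1/2) *\<^sub>R (Y (\<pi> i) \<omega> p + Y (\<pi> (Suc i)) \<omega> p))) - I t \<omega> p)))"
    by (auto simp: has_strat_integral_def)
  from null_in_prob_filterlim[OF this filterlim_grid_mesh[of t]] assms(2) show ?thesis by simp
qed

abbreviation trapezoid_sum :: "(real \<Rightarrow> real) \<Rightarrow> (real \<Rightarrow> real) \<Rightarrow> real \<Rightarrow> nat \<Rightarrow> real" where
  "trapezoid_sum y b t q \<equiv> \<Sum>i<2 ^ q. incr b t q i * (1/2 * (y (grid t q i) + y (grid t q (Suc i))))"

lemma continuous_cell_integral:
  fixes Y :: "real \<Rightarrow> real^'d \<Rightarrow> real"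
  assumes "continuous_on ({0..T} \<times> UNIV) (\<lambda>(t, x). Y t x)" "continuous_on UNIV \<phi>"
  shows "continuous_on {0..T} (\<lambda>t. integral (cell L) (\<lambda>x. \<phi> x * Y t x))"
proof -
  have "continuous_on ({0..T} \<times> cell L) (\<lambda>p. \<phi> (snd p) * Y (fst p) (snd p))"
    by (intro continuous_on_mult continuous_on_compose2[OF assms(2)] continuous_intros
        continuous_on_subset[OF assms(1)[unfolded split_beta]]) auto
  then show ?thesis
    unfolding cell_def by (intro integral_continuous_on_param) (simp add: split_beta)
qed

text \<open>A stochastic Fubini theorem: convergence of the sums uniformly in x on the compact cell
  survives integration against the bounded weight \<phi>.\<close>

lemma (in filtered_space) cell_strat_integral:
  fixes Y N :: "real \<Rightarrow> 'w \<Rightarrow> real^'d \<Rightarrow> real"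
  assumes I: "has_strat_integral M T Y (\<lambda>t \<omega> _. b t \<omega>) N" and \<phi>: "continuous_on UNIV \<phi>"
    and Y: "AE \<omega> in M. continuous_on ({0..T} \<times> UNIV) (\<lambda>(t, x). Y t \<omega> x)" and t: "t \<in> {0..T}"
  shows "null_in_prob M sequentially (\<lambda>q \<omega>. ennreal \<bar>
    trapezoid_sum (\<lambda>s. integral (cell L) (\<lambda>x. \<phi> x * Y s \<omega> x)) (\<lambda>s. b s \<omega>) t q -
    integral (cell L) (\<lambda>x. \<phi> x * N t \<omega> x)\<bar>)"
proof -
  have "compact (\<phi> ` cell L)" by (intro compact_continuous_image continuous_on_subset[OF \<phi>]) auto
  then obtain B where "\<And>x. x \<in> cell L \<Longrightarrow> \<bar>\<phi> x\<bar> \<le> B"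
    by (metis compact_imp_bounded bounded_iff image_eqI real_norm_def)
  then have B: "\<And>x. x \<in> cell L \<Longrightarrow> \<bar>\<phi> x\<bar> \<le> \<bar>B\<bar>" by force
  \<comment> \<open>Bound of \<phi> times volume of the cell; the summand 1 keeps c positive, so
    that an infinite supremum still gives an infinite bound.\<close>
  define c where "c = \<bar>B\<bar> * measure lborel (cell L :: (real^'d) set) + 1"
  have c: "c > 0" by (simp add: c_def add_nonneg_pos)
  from I have N: "AE \<omega> in M. continuous_on ({0..T} \<times> UNIV) (\<lambda>(t, x). N t \<omega> x)"
    by (simp add: has_strat_integral_def)
  show ?thesis
  proof (rule null_in_prob_mono_AE[OF null_in_prob_cmult[OF has_strat_integral_grid[OF I t compact_cell[of L]] less_imp_le[OF c]]])
    show "AE \<omega> in M. \<forall>q. ennreal \<bar>trapezoid_sum (\<lambda>s. integral (cell L) (\<lambda>x. \<phi> x * Y s \<omega> x)) (\<lambda>s. b s \<omega>) t q -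
        integral (cell L) (\<lambda>x. \<phi> x * N t \<omega> x)\<bar> \<le> ennreal c * (SUP x\<in>cell L. ennreal (norm (
        (\<Sum>i<2 ^ q. incr (\<lambda>s. b s \<omega>) t q i *\<^sub>R ((1/2) *\<^sub>R (Y (grid t q i) \<omega> x + Y (grid t q (Suc i)) \<omega> x))) - N t \<omega> x)))"
      using Y N
    proof eventually_elim
      case (elim \<omega>)
      have cY: "continuous_on (cell L) (Y s \<omega>)" if "s \<in> {0..T}" for s
        by (rule continuous_on_compose2[OF elim(1)[unfolded split_beta], of _ "\<lambda>x. (s, x)", simplified])
          (use that in \<open>auto intro!: continuous_intros\<close>)
      have cN: "continuous_on (cell L) (N t \<omega>)"
        by (rule continuous_on_compose2[OF elim(2)[unfolded split_beta], of _ "\<lambda>x. (t, x)", simplified])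
          (use t in \<open>auto intro!: continuous_intros\<close>)
      have c\<phi>: "continuous_on (cell L) \<phi>" by (rule continuous_on_subset[OF \<phi>]) simp
      show ?case
      proof
        fix q
        let ?b = "incr (\<lambda>s. b s \<omega>) t q"
        define G where "G x = (\<Sum>i<2 ^ q. ?b i *\<^sub>R ((1/2) *\<^sub>R (Y (grid t q i) \<omega> x + Y (grid t q (Suc i)) \<omega> x))) - N t \<omega> x" for x
        define s where "s = (SUP x\<in>cell L. ennreal (norm (G x)))"
        have gT: "grid t q i \<in> {0..T}" if "i \<le> 2 ^ q" for i using grid_bounds[of t i q] t that by auto
        have int: "(\<lambda>x. \<phi> x * Y r \<omega> x) integrable_on cell L" if "r \<in> {0..T}" for r
          by (intro integrable_on_cell continuous_intros c\<phi> cY that)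
        have intN: "(\<lambda>x. \<phi> x * N t \<omega> x) integrable_on cell L" by (intro integrable_on_cell continuous_intros c\<phi> cN)
        have "((\<lambda>x. (\<Sum>i<2 ^ q. ?b i * (1/2 * (\<phi> x * Y (grid t q i) \<omega> x + \<phi> x * Y (grid t q (Suc i)) \<omega> x))) - \<phi> x * N t \<omega> x)
          has_integral trapezoid_sum (\<lambda>s. integral (cell L) (\<lambda>x. \<phi> x * Y s \<omega> x)) (\<lambda>s. b s \<omega>) t q -
            integral (cell L) (\<lambda>x. \<phi> x * N t \<omega> x)) (cell L)"
          by (intro has_integral_diff has_integral_sum has_integral_mult_right has_integral_add integrable_integral int intN gT) auto
        moreover have "(\<lambda>x. (\<Sum>i<2 ^ q. ?b i * (1/2 * (\<phi> x * Y (grid t q i) \<omega> x + \<phi> x * Y (grid t q (Suc i)) \<omega> x))) - \<phi> x * N t \<omega> x) =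
          (\<lambda>x. \<phi> x * G x)"
          unfolding G_def right_diff_distrib sum_distrib_left
          by (intro ext arg_cong2[where f = "(-)"] sum.cong refl) (simp add: field_simps)
        ultimately have hi: "((\<lambda>x. \<phi> x * G x) has_integral trapezoid_sum (\<lambda>s. integral (cell L) (\<lambda>x. \<phi> x * Y s \<omega> x)) (\<lambda>s. b s \<omega>) t q -
            integral (cell L) (\<lambda>x. \<phi> x * N t \<omega> x)) (cell L)" by simp
        have "ennreal \<bar>trapezoid_sum (\<lambda>s. integral (cell L) (\<lambda>x. \<phi> x * Y s \<omega> x)) (\<lambda>s. b s \<omega>) t q -
            integral (cell L) (\<lambda>x. \<phi> x * N t \<omega> x)\<bar> \<le> ennreal c * s"
        proof (cases "s = \<top>")
          case True
          then show ?thesis using c by (simp add: ennreal_mult_top)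
        next
          case False
          then obtain r where r: "s = ennreal r" "0 \<le> r" by (cases s) auto
          have Gr: "\<bar>G x\<bar> \<le> r" if "x \<in> cell L" for x
          proof -
            have "ennreal (norm (G x)) \<le> s" unfolding s_def using that by (rule SUP_upper)
            then show ?thesis using r by (simp add: ennreal_le_iff)
          qed
          have "norm (integral (cbox 0 (\<chi> i. L)) (\<lambda>x. \<phi> x * G x)) \<le> (\<bar>B\<bar> * r) * measure lborel (cbox 0 (\<chi> i. L) :: (real^'d) set)"
          proof (rule integrable_bound)
            show "norm (\<phi> x * G x) \<le> \<bar>B\<bar> * r" if "x \<in> cbox 0 (\<chi> i. L)" for x
              using B[of x] Gr[of x] that r unfolding cell_def by (auto simp: abs_mult intro!: mult_mono)
          qed (use hi r in \<open>auto simp: cell_def\<close>)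
          also have "\<dots> \<le> c * r" using r by (simp add: c_def cell_def algebra_simps)
          finally show ?thesis
            using hi r c by (simp add: integral_unique cell_def ennreal_leI flip: ennreal_mult)
        qed
        then show "ennreal \<bar>trapezoid_sum (\<lambda>s. integral (cell L) (\<lambda>x. \<phi> x * Y s \<omega> x)) (\<lambda>s. b s \<omega>) t q -
            integral (cell L) (\<lambda>x. \<phi> x * N t \<omega> x)\<bar> \<le> ennreal c * (SUP x\<in>cell L. ennreal (norm (
            (\<Sum>i<2 ^ q. ?b i *\<^sub>R ((1/2) *\<^sub>R (Y (grid t q i) \<omega> x + Y (grid t q (Suc i)) \<omega> x))) - N t \<omega> x)))"
          unfolding s_def G_def .
      qed
    qed
  qed
qed

lemma (in filtered_space) strat_limit_C1:
  assumes lim: "null_in_prob M sequentially (\<lambda>q \<omega>. ennreal \<bar>trapezoid_sum (\<lambda>s. y s \<omega>) (\<lambda>s. b s \<omega>) t q - A \<omega>\<bar>)"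
    and C1: "AE \<omega> in M. C1_integrand t (\<lambda>s. y s \<omega>) (k \<omega>) (\<lambda>s. b s \<omega>)"
  shows "AE \<omega> in M. A \<omega> = C1_integrand.stieltjes t (\<lambda>s. y s \<omega>) (k \<omega>) (\<lambda>s. b s \<omega>)"
proof (rule null_in_prob_limit_unique[OF lim])
  show "AE \<omega> in M. trapezoid_sum (\<lambda>s. y s \<omega>) (\<lambda>s. b s \<omega>) t \<longlonglongrightarrow> C1_integrand.stieltjes t (\<lambda>s. y s \<omega>) (k \<omega>) (\<lambda>s. b s \<omega>)"
    using C1 by eventually_elim (rule C1_integrand.trapezoid_limit)
qed

subsection \<open>From Stratonovich to Ito integrals\<close>

lemma sum_indicator_grid:
  assumes "0 \<le> t"
  shows "(\<Sum>i<n. indicator {grid t q i<..grid t q (Suc i)} s) = (indicator {0<..grid t q n} s :: real)"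
proof (induction n)
  case (Suc n)
  have "0 \<le> grid t q n" "grid t q n \<le> grid t q (Suc n)" using grid_mono[OF assms, of 0 n q] grid_mono[OF assms, of n "Suc n" q] by auto
  with Suc show ?case by (auto simp: indicator_def)
qed simp

text \<open>Simple integrands of the Ito integral must be bounded. The truncation level q grows with
  the refinement, so on a continuous path it eventually has no effect.\<close>

definition clamp :: "nat \<Rightarrow> real \<Rightarrow> real" where
  "clamp q x = max (- real q) (min (real q) x)"

lemma clamp_bound: "\<bar>clamp q x\<bar> \<le> real q" and clamp_id: "\<bar>x\<bar> \<le> real q \<Longrightarrow> clamp q x = x"
  by (auto simp: clamp_def)

lemma clamp_measurable [measurable]: "clamp q \<in> borel_measurable borel"
  unfolding clamp_def[abs_def] by measurable

lemma eventually_clamp_id: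
  fixes g :: "real \<Rightarrow> real"
  assumes "continuous_on {0..t} g"
  shows "\<forall>\<^sub>F q in sequentially. \<forall>s\<in>{0..t}. clamp q (g s) = g s"
proof -
  have "compact (g ` {0..t})" by (rule compact_continuous_image[OF assms]) simp
  then obtain K where K: "\<And>s. s \<in> {0..t} \<Longrightarrow> \<bar>g s\<bar> \<le> K"
    by (metis compact_imp_bounded bounded_iff image_eqI real_norm_def)
  have "\<forall>\<^sub>F q in sequentially. K \<le> real q"
    using eventually_ge_at_top[of "nat \<lceil>K\<rceil>"] by eventually_elim linarith
  then show ?thesis by eventually_elim (auto intro!: clamp_id order.trans[OF K])
qed

lemma eventually_step_approximation:
  fixes g :: "real \<Rightarrow> real"
  assumes t: "0 \<le> t" and g: "continuous_on {0..t} g" and \<epsilon>: "\<epsilon> > 0"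
  shows "\<forall>\<^sub>F q in sequentially. (\<integral>\<^sup>+s\<in>{0..t}. ennreal (((\<Sum>i<2 ^ q. clamp q (g (grid t q i)) *
    indicator {grid t q i<..grid t q (Suc i)} s) - g s)\<^sup>2) \<partial>lborel) \<le> ennreal \<epsilon>"
proof -
  \<comment> \<open>A uniform error \<eta> on [0, t] then has squared integral at most \<epsilon>;
    the denominator t + 1 covers t = 0.\<close>
  define \<eta> where "\<eta> = sqrt (\<epsilon> / (t + 1))"
  have \<eta>: "\<eta> > 0" "\<eta>\<^sup>2 * t \<le> \<epsilon>" using t \<epsilon> by (auto simp: \<eta>_def field_simps)
  from grid_oscillation[OF t g \<eta>(1)] eventually_clamp_id[OF g] show ?thesis
  proof eventually_elim
    case (elim q)
    have pt: "\<bar>(\<Sum>i<2 ^ q. clamp q (g (grid t q i)) * indicator {grid t q i<..grid t q (Suc i)} s) - g s\<bar> \<le> \<eta>"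
      if s: "s \<in> {0<..t}" for s
    proof -
      have one: "(\<Sum>i<2 ^ q. indicator {grid t q i<..grid t q (Suc i)} s) = (1::real)"
        using sum_indicator_grid[OF t, of q s "2 ^ q"] s by simp
      have eq: "(\<Sum>i<2 ^ q. clamp q (g (grid t q i)) * indicator {grid t q i<..grid t q (Suc i)} s) - g s =
        (\<Sum>i<2 ^ q. (clamp q (g (grid t q i)) - g s) * indicator {grid t q i<..grid t q (Suc i)} s)"
        using one by (simp add: left_diff_distrib sum_subtractf flip: sum_distrib_left)
      have "\<bar>\<Sum>i<2 ^ q. (clamp q (g (grid t q i)) - g s) * indicator {grid t q i<..grid t q (Suc i)} s\<bar>
        \<le> (\<Sum>i<2 ^ q. \<eta> * indicator {grid t q i<..grid t q (Suc i)} s)"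
      proof (intro order.trans[OF sum_abs] sum_mono)
        fix i :: nat assume i: "i \<in> {..<2 ^ q}"
        have "\<bar>clamp q (g (grid t q i)) - g s\<bar> \<le> \<eta>" if "s \<in> {grid t q i<..grid t q (Suc i)}"
        proof -
          have "clamp q (g (grid t q i)) = g (grid t q i)" using elim(2) grid_bounds[OF t, of i q] i by auto
          moreover have "grid t q i \<in> {grid t q i..grid t q (Suc i)}" using grid_mono[OF t, of i "Suc i" q] by simp
          ultimately show ?thesis using elim(1) i that by (metis greaterThanAtMost_iff atLeastAtMost_iff lessThan_iff less_imp_le)
        qed
        then show "\<bar>(clamp q (g (grid t q i)) - g s) * indicator {grid t q i<..grid t q (Suc i)} s\<bar> \<le> \<eta> * indicator {grid t q i<..grid t q (Suc i)} s"
          by (auto simp: indicator_def)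
      qed
      also have "\<dots> = \<eta>" unfolding sum_distrib_left[symmetric] one by simp
      finally show ?thesis unfolding eq .
    qed
    have "(\<integral>\<^sup>+s\<in>{0..t}. ennreal (((\<Sum>i<2 ^ q. clamp q (g (grid t q i)) *
        indicator {grid t q i<..grid t q (Suc i)} s) - g s)\<^sup>2) \<partial>lborel) \<le> (\<integral>\<^sup>+s. ennreal (\<eta>\<^sup>2) * indicator {0..t} s \<partial>lborel)"
    proof (rule nn_integral_mono_AE)
      \<comment> \<open>Almost every s suffices: the half-open mesh intervals miss the time
        0.\<close>
      show "AE s in lborel. ennreal (((\<Sum>i<2 ^ q. clamp q (g (grid t q i)) *
        indicator {grid t q i<..grid t q (Suc i)} s) - g s)\<^sup>2) * indicator {0..t} s \<le> ennreal (\<eta>\<^sup>2) * indicator {0..t} s"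
        using AE_lborel_singleton[of 0]
      proof eventually_elim
        case (elim s)
        show ?case
        proof (cases "s \<in> {0..t}")
          case True
          then have "((\<Sum>i<2 ^ q. clamp q (g (grid t q i)) * indicator {grid t q i<..grid t q (Suc i)} s) - g s)\<^sup>2 \<le> \<eta>\<^sup>2"
            using pt[of s] elim \<eta> by (simp add: abs_le_square_iff[symmetric])
          then show ?thesis using True by (simp add: ennreal_leI)
        qed simp
      qed
    qed
    also have "\<dots> = ennreal (\<eta>\<^sup>2 * t)" using t by (simp add: nn_integral_cmult_indicator ennreal_mult)
    also have "\<dots> \<le> ennreal \<epsilon>" using \<eta> by (intro ennreal_leI)
    finally show ?case .
  qed
qed

text \<open>The squared error has to be measurable in \<omega> before almost sure convergence yields
  convergence in probability. A version of G that is frozen outside [0, t] and zero on the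
  exceptional set is jointly measurable, and it changes the error only on a null set.\<close>

lemma (in filtered_space) null_in_prob_step_approximation:
  assumes adapted: "adapted_upto F T G" and cont: "AE \<omega> in M. continuous_on {0..T} (\<lambda>s. G s \<omega>)"
    and t: "t \<in> {0..T}"
  shows "null_in_prob M sequentially (\<lambda>q \<omega>. \<integral>\<^sup>+s\<in>{0..t}. ennreal (((\<Sum>i<2 ^ q. clamp q (G (grid t q i) \<omega>) *
    indicator {grid t q i<..grid t q (Suc i)} s) - G s \<omega>)\<^sup>2) \<partial>lborel)"
proof -
  from cont obtain Z where Z: "Z \<in> null_sets M" "{\<omega>\<in>space M. \<not> continuous_on {0..T} (\<lambda>s. G s \<omega>)} \<subseteq> Z"
    by (auto simp: eventually_ae_filter)
  have t0: "0 \<le> t" using t by simp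
  have Gm: "G s \<in> borel_measurable M" if "s \<in> {0..T}" for s
    using adapted that measurable_F_M unfolding adapted_upto_def by blast
  define G' where "G' \<omega> s = (if \<omega> \<in> Z then 0 else G (max 0 (min s t)) \<omega>)" for \<omega> s
  have clamp_in: "max 0 (min s t) \<in> {0..T}" for s using t by auto
  have [measurable]: "(\<lambda>p. G' (fst p) (snd p)) \<in> borel_measurable (M \<Otimes>\<^sub>M lborel)"
  proof -
    have "(\<lambda>p. G' (fst p) (snd p)) \<in> borel_measurable (M \<Otimes>\<^sub>M borel)"
    proof (rule caratheodory_measurable)
      have [measurable]: "Z \<in> sets M" using Z(1) by auto
      show "(\<lambda>\<omega>. G' \<omega> s) \<in> borel_measurable M" for s
        unfolding G'_def using Gm[OF clamp_in] by measurable
      fix \<omega> assume "\<omega> \<in> space M"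
      then have "\<omega> \<in> Z \<or> continuous_on {0..T} (\<lambda>s. G s \<omega>)" using Z(2) by blast
      then show "continuous_on UNIV (G' \<omega>)"
      proof
        assume c: "continuous_on {0..T} (\<lambda>s. G s \<omega>)"
        have "continuous_on UNIV (\<lambda>s. G (max 0 (min s t)) \<omega>)"
          by (rule continuous_on_compose2[OF c]) (use clamp_in in \<open>auto intro!: continuous_intros\<close>)
        then show ?thesis by (cases "\<omega> \<in> Z") (auto simp: G'_def[abs_def])
      qed (simp add: G'_def[abs_def])
    qed
    then show ?thesis by simp
  qed
  have m: "(\<lambda>\<omega>. clamp q (G (grid t q i) \<omega>)) \<in> borel_measurable M" if "i < 2 ^ q" for q i
    using Gm[of "grid t q i"] grid_bounds[OF t0, of i q] that t by (intro measurable_compose[OF _ clamp_measurable]) auto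
  define D where "D q \<omega> = (\<integral>\<^sup>+s. ennreal (((\<Sum>i<2 ^ q. clamp q (G (grid t q i) \<omega>) *
    indicator {grid t q i<..grid t q (Suc i)} s) - G' \<omega> s)\<^sup>2) * indicator {0..t} s \<partial>lborel)" for q \<omega>
  have Dm: "D q \<in> borel_measurable M" for q
    unfolding D_def
  proof (rule lborel.borel_measurable_nn_integral, unfold split_beta)
    have im: "(\<lambda>x. indicator {a<..b} (snd x) :: real) \<in> borel_measurable (M \<Otimes>\<^sub>M lborel)" for a b :: real
      by measurable
    have cm: "(\<lambda>x. clamp q (G (grid t q i) (fst x))) \<in> borel_measurable (M \<Otimes>\<^sub>M lborel)" if "i \<in> {..<2 ^ q}" for i
      using that by (intro measurable_compose[OF measurable_fst m]) auto
    have [measurable]: "(\<lambda>x. \<Sum>i<2 ^ q. clamp q (G (grid t q i) (fst x)) *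
      indicator {grid t q i<..grid t q (Suc i)} (snd x)) \<in> borel_measurable (M \<Otimes>\<^sub>M lborel)"
      by (intro borel_measurable_sum borel_measurable_times cm im)
    show "(\<lambda>x. ennreal (((\<Sum>i<2 ^ q. clamp q (G (grid t q i) (fst x)) *
      indicator {grid t q i<..grid t q (Suc i)} (snd x)) - G' (fst x) (snd x))\<^sup>2) * indicator {0..t} (snd x)) \<in> borel_measurable (M \<Otimes>\<^sub>M lborel)"
      by measurable
  qed
  have eq: "AE \<omega> in M. \<forall>q. (\<integral>\<^sup>+s\<in>{0..t}. ennreal (((\<Sum>i<2 ^ q. clamp q (G (grid t q i) \<omega>) *
    indicator {grid t q i<..grid t q (Suc i)} s) - G s \<omega>)\<^sup>2) \<partial>lborel) = D q \<omega>"
    using AE_not_in[OF Z(1)]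
  proof eventually_elim
    case (elim \<omega>)
    show ?case
      unfolding D_def using elim by (intro allI nn_integral_cong) (auto simp: indicator_def G'_def min_absorb1 max_absorb2)
  qed
  have "null_in_prob M sequentially D"
  proof (rule AE_eventually_imp_null_in_prob[OF Dm])
    show "AE \<omega> in M. \<forall>\<epsilon>>0. \<forall>\<^sub>F q in sequentially. D q \<omega> \<le> ennreal \<epsilon>"
      using eq cont
    proof eventually_elim
      case (elim \<omega>)
      have "continuous_on {0..t} (\<lambda>s. G s \<omega>)" using elim(2) by (rule continuous_on_subset) (use t in auto)
      from eventually_step_approximation[OF t0 this] elim(1) show ?case by simp
    qed
  qed
  then show ?thesis
    by (rule null_in_prob_mono_AE) (use eq in \<open>eventually_elim, simp\<close>)
qed

text \<open>Left-point sums are trapezoidal sums minus half the discrete covariation of the integrand with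
  the Brownian motion; the latter is governed by the martingale part \<open>\<Sum>\<^sub>k h k d\<beta>\<^sub>k\<close> of the integrand.\<close>

lemma (in filtered_space) has_ito_integral_of_strat:
  fixes \<beta> :: "'k::finite \<Rightarrow> real \<Rightarrow> 'w \<Rightarrow> real" and h :: "'k \<Rightarrow> real \<Rightarrow> 'w \<Rightarrow> real"
  assumes ind: "independent_brownian_motions M F \<beta>"
    and G: "adapted_upto F T G" "AE \<omega> in M. continuous_on {0..T} (\<lambda>s. G s \<omega>)"
    and A: "\<And>t. t \<in> {0..T} \<Longrightarrow> null_in_prob M sequentially
      (\<lambda>q \<omega>. ennreal \<bar>trapezoid_sum (\<lambda>s. G s \<omega>) (\<lambda>s. \<beta> l s \<omega>) t q - A t \<omega>\<bar>)"
    and A_cont: "AE \<omega> in M. continuous_on {0..T} (\<lambda>s. A s \<omega>)"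
    and h: "\<And>k. AE \<omega> in M. continuous_on {0..T} (\<lambda>s. h k s \<omega>)"
    and incr: "\<And>t. t \<in> {0..T} \<Longrightarrow> AE \<omega> in M. \<exists>C. \<forall>q. \<forall>i<2 ^ q.
      \<bar>incr (\<lambda>s. G s \<omega>) t q i - (\<Sum>k\<in>UNIV. h k (grid t q i) \<omega> * incr (\<lambda>s. \<beta> k s \<omega>) t q i)\<bar> \<le> C / 2 ^ q"
  shows "has_ito_integral M F T G (\<beta> l) (\<lambda>t \<omega>. A t \<omega> - 1/2 * integral {0..t} (\<lambda>s. h l s \<omega>))"
  unfolding has_ito_integral_def
proof (intro conjI G(1) ballI)
  show "AE \<omega> in M. continuous_on {0..T} (\<lambda>t. A t \<omega> - 1/2 * integral {0..t} (\<lambda>s. h l s \<omega>))"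
    using A_cont h[of l]
  proof eventually_elim
    case (elim \<omega>)
    then show ?case
      by (intro continuous_intros indefinite_integral_continuous_1 integrable_continuous_real)
  qed
next
  fix t assume t: "t \<in> {0..T}"
  then have t0: "0 \<le> t" by simp
  from ind have bm: "brownian M F (\<beta> k)" for k
    by unfold_locales (simp add: independent_brownian_motions_def)
  have Gm: "G s \<in> borel_measurable M" if "s \<in> {0..T}" for s
    using G(1) that measurable_F_M unfolding adapted_upto_def by blast
  have gT: "grid t q i \<in> {0..T}" if "i \<le> 2 ^ q" for q i using grid_bounds[OF t0 that] t by auto
  let ?\<xi> = "\<lambda>q i \<omega>. clamp q (G (grid t q i) \<omega>)"
  let ?b = "\<lambda>q i \<omega>. incr (\<lambda>s. \<beta> l s \<omega>) t q i"
  \<comment> \<open>\<open>X1\<close> is the effect of the truncation, eventually zero on almost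
    every path; \<open>X2\<close> is the discrete covariation of \<open>G\<close> with
    \<open>\<beta> l\<close>.\<close>
  define X1 where "X1 q \<omega> = (\<Sum>i<2 ^ q. (?\<xi> q i \<omega> - G (grid t q i) \<omega>) * ?b q i \<omega>)" for q \<omega>
  define X2 where "X2 q \<omega> = (\<Sum>i<2 ^ q. incr (\<lambda>s. G s \<omega>) t q i * ?b q i \<omega>)" for q \<omega>
  have bM: "\<beta> l (grid t q i) \<in> borel_measurable M" if "i \<le> 2 ^ q" for q i
    using brownian.B_measurable[OF bm] grid_bounds[OF t0 that] by blast
  have X1m: "X1 q \<in> borel_measurable M" for q
    unfolding X1_def[abs_def]
    by (intro borel_measurable_sum borel_measurable_times borel_measurable_diff measurable_compose[OF _ clamp_measurable] Gm gT bM) auto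
  have X2m: "X2 q \<in> borel_measurable M" for q
    unfolding X2_def[abs_def]
    by (intro borel_measurable_sum borel_measurable_times borel_measurable_diff Gm gT bM) auto
  have X1_lim: "AE \<omega> in M. (\<lambda>q. X1 q \<omega>) \<longlonglongrightarrow> 0"
    using G(2)
  proof eventually_elim
    case (elim \<omega>)
    have "continuous_on {0..t} (\<lambda>s. G s \<omega>)" using elim by (rule continuous_on_subset) (use t in auto)
    from eventually_clamp_id[OF this] have "\<forall>\<^sub>F q in sequentially. X1 q \<omega> = 0"
      by eventually_elim (use grid_bounds[OF t0] in \<open>auto simp: X1_def intro!: sum.neutral\<close>)
    then show ?case by (rule tendsto_eventually)
  qed
  have cov: "AE \<omega> in M. \<forall>k. \<forall>h. continuous_on {0..t} h \<longrightarrow>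
    (\<lambda>q. \<Sum>i<2 ^ q. h (grid t q i) * (incr (\<lambda>s. \<beta> k s \<omega>) t q i * ?b q i \<omega>)) \<longlonglongrightarrow> (if k = l then 1 else 0) * integral {0..t} h"
    unfolding AE_all_countable
    using brownian_pair.AE_weighted_covariation[OF brownian_pair_of_independent[OF ind] t0] by blast
  have h': "AE \<omega> in M. \<forall>k. continuous_on {0..T} (\<lambda>s. h k s \<omega>)"
    unfolding AE_all_countable using h by blast
  have X2_lim: "AE \<omega> in M. (\<lambda>q. X2 q \<omega>) \<longlonglongrightarrow> integral {0..t} (\<lambda>s. h l s \<omega>)"
    using cov h' incr[OF t] brownian.B_continuous[OF bm, of l]
  proof eventually_elim
    case (elim \<omega>)
    from elim(3) obtain C where C: "\<And>q i. i < 2 ^ q \<Longrightarrow>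
      \<bar>incr (\<lambda>s. G s \<omega>) t q i - (\<Sum>k\<in>UNIV. h k (grid t q i) \<omega> * incr (\<lambda>s. \<beta> k s \<omega>) t q i)\<bar> \<le> C / 2 ^ q" by blast
    have cb: "continuous_on {0..t} (\<lambda>s. \<beta> l s \<omega>)" using elim(4) by (rule continuous_on_subset) auto
    have "continuous_on {0..t} (\<lambda>s. h k s \<omega>)" for k
      using elim(2) t by (auto intro: continuous_on_subset)
    then have "(\<lambda>q. \<Sum>i<2 ^ q. h k (grid t q i) \<omega> * (incr (\<lambda>s. \<beta> k s \<omega>) t q i * ?b q i \<omega>)) \<longlonglongrightarrow>
        (if k = l then 1 else 0) * integral {0..t} (\<lambda>s. h k s \<omega>)" for k
      using elim(1) by blast
    \<comment> \<open>Independent Brownian motions have no covariation, so only k = l survives; the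
      remainder of the increments of \<open>G\<close> is of the order of the mesh.\<close>
    then have "(\<lambda>q. (\<Sum>k\<in>UNIV. \<Sum>i<2 ^ q. h k (grid t q i) \<omega> * (incr (\<lambda>s. \<beta> k s \<omega>) t q i * ?b q i \<omega>)) +
        (\<Sum>i<2 ^ q. (incr (\<lambda>s. G s \<omega>) t q i - (\<Sum>k\<in>UNIV. h k (grid t q i) \<omega> * incr (\<lambda>s. \<beta> k s \<omega>) t q i)) * ?b q i \<omega>))
       \<longlonglongrightarrow> (\<Sum>k\<in>UNIV. (if k = l then 1 else 0) * integral {0..t} (\<lambda>s. h k s \<omega>)) + 0"
      by (intro tendsto_add tendsto_sum grid_sum_small_incr[OF t0 cb C])
    moreover have "(\<Sum>k\<in>UNIV. \<Sum>i<2 ^ q. h k (grid t q i) \<omega> * (incr (\<lambda>s. \<beta> k s \<omega>) t q i * ?b q i \<omega>)) +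
        (\<Sum>i<2 ^ q. (incr (\<lambda>s. G s \<omega>) t q i - (\<Sum>k\<in>UNIV. h k (grid t q i) \<omega> * incr (\<lambda>s. \<beta> k s \<omega>) t q i)) * ?b q i \<omega>) = X2 q \<omega>" for q
      unfolding X2_def
      by (subst sum.swap) (simp add: left_diff_distrib sum_subtractf sum_distrib_right mult.assoc)
    moreover have "(\<Sum>k\<in>UNIV. (if k = l then 1 else 0) * integral {0..t} (\<lambda>s. h k s \<omega>)) = integral {0..t} (\<lambda>s. h l s \<omega>)"
      by (simp add: if_distrib[of "\<lambda>x. x * _"] cong: if_cong)
    ultimately show ?case by simp
  qed
  let ?I = "\<lambda>\<omega>. A t \<omega> - 1/2 * integral {0..t} (\<lambda>s. h l s \<omega>)"
  show "\<exists>n \<pi> \<xi>. (\<forall>q. partition_of t (n q) (\<pi> q)) \<and>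
    (\<forall>q. \<forall>i<n q. \<xi> q i \<in> borel_measurable (F (\<pi> q i)) \<and> (\<exists>c. \<forall>\<omega>\<in>space M. \<bar>\<xi> q i \<omega>\<bar> \<le> c)) \<and>
    null_in_prob M sequentially (\<lambda>q \<omega>. \<integral>\<^sup>+s\<in>{0..t}. ennreal
      (((\<Sum>i<n q. \<xi> q i \<omega> * indicator {\<pi> q i<..\<pi> q (Suc i)} s) - G s \<omega>)\<^sup>2) \<partial>lborel) \<and>
    null_in_prob M sequentially (\<lambda>q \<omega>. ennreal
      \<bar>(\<Sum>i<n q. \<xi> q i \<omega> * (\<beta> l (\<pi> q (Suc i)) \<omega> - \<beta> l (\<pi> q i) \<omega>)) - ?I \<omega>\<bar>)"
  proof (intro exI[of _ "\<lambda>q. 2 ^ q"] exI[of _ "grid t"] exI[of _ ?\<xi>] conjI allI impI)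
    show "partition_of t (2 ^ q) (grid t q)" for q using t0 by (rule grid_partition)
    show "?\<xi> q i \<in> borel_measurable (F (grid t q i))" if "i < 2 ^ q" for q i
      using G(1) gT[of i q] that by (intro measurable_compose[OF _ clamp_measurable]) (auto simp: adapted_upto_def)
    show "\<exists>c. \<forall>\<omega>\<in>space M. \<bar>?\<xi> q i \<omega>\<bar> \<le> c" for q i using clamp_bound by blast
    show "null_in_prob M sequentially (\<lambda>q \<omega>. \<integral>\<^sup>+s\<in>{0..t}. ennreal
      (((\<Sum>i<2 ^ q. ?\<xi> q i \<omega> * indicator {grid t q i<..grid t q (Suc i)} s) - G s \<omega>)\<^sup>2) \<partial>lborel)"
      by (rule null_in_prob_step_approximation[OF G t])
    have n: "null_in_prob M sequentially (\<lambda>q \<omega>. ennreal \<bar>X1 q \<omega> - 0\<bar> +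
        (ennreal \<bar>trapezoid_sum (\<lambda>s. G s \<omega>) (\<lambda>s. \<beta> l s \<omega>) t q - A t \<omega>\<bar> +
        ennreal (1/2) * ennreal \<bar>X2 q \<omega> - integral {0..t} (\<lambda>s. h l s \<omega>)\<bar>))"
      by (intro null_in_prob_add null_in_prob_cmult AE_tendsto_imp_null_in_prob X1m X2m X1_lim X2_lim A t) simp
    show "null_in_prob M sequentially (\<lambda>q \<omega>. ennreal
      \<bar>(\<Sum>i<2 ^ q. ?\<xi> q i \<omega> * (\<beta> l (grid t q (Suc i)) \<omega> - \<beta> l (grid t q i) \<omega>)) - ?I \<omega>\<bar>)"
    proof (rule null_in_prob_mono_AE[OF n], intro always_eventually allI)
      fix \<omega> q
      have "(\<Sum>i<2 ^ q. ?\<xi> q i \<omega> * ?b q i \<omega>) = X1 q \<omega> + (trapezoid_sum (\<lambda>s. G s \<omega>) (\<lambda>s. \<beta> l s \<omega>) t q - 1/2 * X2 q \<omega>)"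
        unfolding X1_def X2_def sum_distrib_left sum_subtractf[symmetric] sum.distrib[symmetric]
        by (intro sum.cong refl) (simp add: field_simps)
      then have "(\<Sum>i<2 ^ q. ?\<xi> q i \<omega> * ?b q i \<omega>) - ?I \<omega> = X1 q \<omega> +
          ((trapezoid_sum (\<lambda>s. G s \<omega>) (\<lambda>s. \<beta> l s \<omega>) t q - A t \<omega>) - 1/2 * (X2 q \<omega> - integral {0..t} (\<lambda>s. h l s \<omega>)))"
        by (simp add: diff_divide_distrib)
      moreover have "\<bar>x + (y - 1/2 * z)\<bar> \<le> \<bar>x - 0\<bar> + (\<bar>y\<bar> + 1/2 * \<bar>z\<bar>)" for x y z :: real by linarith
      ultimately have le: "\<bar>(\<Sum>i<2 ^ q. ?\<xi> q i \<omega> * ?b q i \<omega>) - ?I \<omega>\<bar> \<le> \<bar>X1 q \<omega> - 0\<bar> +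
          (\<bar>trapezoid_sum (\<lambda>s. G s \<omega>) (\<lambda>s. \<beta> l s \<omega>) t q - A t \<omega>\<bar> + 1/2 * \<bar>X2 q \<omega> - integral {0..t} (\<lambda>s. h l s \<omega>)\<bar>)"
        by (simp only:)
      have eq: "ennreal (x + (y + 1/2 * z)) = ennreal x + (ennreal y + ennreal (1/2) * ennreal z)"
        if "0 \<le> x" "0 \<le> y" "0 \<le> z" for x y z :: real
        using that by (subst ennreal_plus, simp, simp, subst ennreal_plus, simp, simp, subst ennreal_mult, simp_all)
      show "ennreal \<bar>(\<Sum>i<2 ^ q. ?\<xi> q i \<omega> * ?b q i \<omega>) - ?I \<omega>\<bar> \<le> ennreal \<bar>X1 q \<omega> - 0\<bar> +
        (ennreal \<bar>trapezoid_sum (\<lambda>s. G s \<omega>) (\<lambda>s. \<beta> l s \<omega>) t q - A t \<omega>\<bar> +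
        ennreal (1/2) * ennreal \<bar>X2 q \<omega> - integral {0..t} (\<lambda>s. h l s \<omega>)\<bar>)"
        using ennreal_leI[OF le] unfolding eq[OF abs_ge_zero abs_ge_zero abs_ge_zero] .
    qed
  qed
qed

section \<open>Expectation of the pathwise integrals\<close>

lemma C1_integrand_subinterval: "C1_integrand T h k b \<Longrightarrow> t \<in> {0..T} \<Longrightarrow> C1_integrand t h k b"
proof -
  assume "C1_integrand T h k b" and tT: "t \<in> {0..T}"
  then interpret C1_integrand T h k b by simp
  show ?thesis
    by unfold_locales (use tT in \<open>auto intro!: continuous_on_subset[OF b] continuous_on_subset[OF k] h\<close>)
qed

text \<open>Jensen's inequality, from integrating the nonnegative square of g minus its
  mean.\<close>

lemma mean_square_le:
  fixes g :: "real \<Rightarrow> real"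
  assumes "a < b" "continuous_on {a..b} g"
  shows "(integral {a..b} g / (b - a))\<^sup>2 * (b - a) \<le> integral {a..b} (\<lambda>s. (g s)\<^sup>2)"
proof -
  let ?c = "integral {a..b} g / (b - a)"
  have c: "continuous_on {a..b} (\<lambda>s. (g s)\<^sup>2)" "continuous_on {a..b} (\<lambda>s. 2 * ?c * g s)"
    by (intro continuous_intros assms)+
  have "0 \<le> integral {a..b} (\<lambda>s. (g s - ?c)\<^sup>2)"
    by (intro Henstock_Kurzweil_Integration.integral_nonneg integrable_continuous_real continuous_intros assms) simp
  also have "\<dots> = integral {a..b} (\<lambda>s. ((g s)\<^sup>2 - 2 * ?c * g s) + ?c\<^sup>2)"
    by (simp add: power2_diff algebra_simps)
  also have "\<dots> = integral {a..b} (\<lambda>s. (g s)\<^sup>2) - 2 * ?c * integral {a..b} g + ?c\<^sup>2 * (b - a)"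
    using assms(1)
    by (subst Henstock_Kurzweil_Integration.integral_add, intro integrable_continuous_real continuous_intros assms,
        intro integrable_continuous_real continuous_intros,
        subst Henstock_Kurzweil_Integration.integral_diff, intro integrable_continuous_real c,
        intro integrable_continuous_real c) (simp_all add: mult.assoc mult.commute)
  also have "2 * ?c * integral {a..b} g = 2 * (?c\<^sup>2 * (b - a))"
    using assms(1) by (simp add: power2_eq_square)
  finally show ?thesis by (simp add: mult.commute)
qed

text \<open>The integrand is approximated by averages over the preceding mesh interval: these are adapted
  and, by Jensen's inequality, bounded in mean square uniformly in the mesh.\<close>

lemma (in brownian) stieltjes_mean_zero:
  assumes H: "adapted_upto F T H" and C1: "AE \<omega> in M. C1_integrand T (\<lambda>s. H s \<omega>) (k \<omega>) (\<lambda>s. B s \<omega>)"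
    and sq: "(\<integral>\<^sup>+\<omega>. (\<integral>\<^sup>+s\<in>{0..T}. ennreal ((H s \<omega>)\<^sup>2) \<partial>lborel) \<partial>M) < \<infinity>" and t: "t \<in> {0..T}"
    and A [measurable]: "A \<in> borel_measurable M"
    and A_eq: "AE \<omega> in M. A \<omega> = C1_integrand.stieltjes t (\<lambda>s. H s \<omega>) (k \<omega>) (\<lambda>s. B s \<omega>)"
  shows "integrable M A \<and> expectation A = 0"
proof (cases "t = 0")
  case True
  have "AE \<omega> in M. A \<omega> = 0"
    using A_eq C1
  proof eventually_elim
    case (elim \<omega>)
    then show ?case using True C1_integrand.stieltjes_def[OF C1_integrand_subinterval[OF elim(2) t]] by simp
  qed
  moreover from this have "integrable M A" by (subst integrable_cong_AE[where g = "\<lambda>_. 0"]) auto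
  ultimately show ?thesis using integral_cong_AE[of A M "\<lambda>_. 0"] by auto
next
  case False
  with t have t0: "0 \<le> t" "0 < t" by auto
  let ?g = "grid t" and ?d = "\<lambda>q. t / 2 ^ q"
  \<comment> \<open>The average over the preceding interval is known at the left endpoint of the
    current one; the first interval has no predecessor and gets 0.\<close>
  define a where "a q i \<omega> = (if i = 0 then 0 else integral {?g q (i - 1)..?g q i} (\<lambda>s. H s \<omega>) / ?d q)" for q i \<omega>
  define Q where "Q \<omega> = (\<integral>\<^sup>+s\<in>{0..T}. ennreal ((H s \<omega>)\<^sup>2) \<partial>lborel)" for \<omega>
  have Hc: "AE \<omega> in M. continuous_on {0..T} (\<lambda>s. H s \<omega>)"
    using C1 by eventually_elim (rule C1_integrand.h_continuous)
  have gT: "0 \<le> ?g q i" "?g q i \<le> t" "?g q i \<le> T" if "i \<le> 2 ^ q" for q i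
    using grid_bounds[OF t0(1) that] t by auto
  have gstep: "?g q i - ?g q (i - 1) = ?d q" "?g q (i - 1) < ?g q i" if "0 < i" for q i
    using that grid_Suc[of t q "i - 1"] t0 by auto
  have a_adapted: "a q i \<in> borel_measurable (F (?g q i))" if i: "i < 2 ^ q" for q i
  proof -
    \<comment> \<open>Times are clamped to [0, \<open>grid t q i\<close>], so that the integrand is
      measurable at that time and continuous for all real s.\<close>
    have "(\<lambda>\<omega>. integral {?g q (i - 1)..?g q i} (\<lambda>s. H (max 0 (min s (?g q i))) \<omega>)) \<in> borel_measurable (F (?g q i))"
    proof (rule borel_measurable_F_integral)
      show "(\<lambda>\<omega>. H (max 0 (min s (?g q i))) \<omega>) \<in> borel_measurable (F (?g q i))" for s
      proof (rule measurable_F_mono)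
        have "max 0 (min s (?g q i)) \<in> {0..T}" using gT[of i q] i t by auto
        then show "H (max 0 (min s (?g q i))) \<in> borel_measurable (F (max 0 (min s (?g q i))))"
          using H unfolding adapted_upto_def by blast
        show "max 0 (min s (?g q i)) \<le> ?g q i" using gT(1)[of i q] i by simp
      qed
      show "AE \<omega> in M. continuous_on UNIV (\<lambda>s. H (max 0 (min s (?g q i))) \<omega>)"
        using Hc
      proof eventually_elim
        case (elim \<omega>)
        show ?case by (rule continuous_on_compose2[OF elim]) (use gT[of i q] i in \<open>auto intro!: continuous_intros\<close>)
      qed
    qed (use gT[of i q] i in auto)
    also have "(\<lambda>\<omega>. integral {?g q (i - 1)..?g q i} (\<lambda>s. H (max 0 (min s (?g q i))) \<omega>)) =
        (\<lambda>\<omega>. integral {?g q (i - 1)..?g q i} (\<lambda>s. H s \<omega>))"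
      using gT[of "i - 1" q] less_imp_le[OF le_less_trans[OF diff_le_self i]] by (intro ext integral_cong) (auto simp: min_absorb1 max_absorb2)
    finally have [measurable]: "(\<lambda>\<omega>. integral {?g q (i - 1)..?g q i} (\<lambda>s. H s \<omega>)) \<in> borel_measurable (F (?g q i))" .
    show ?thesis unfolding a_def[abs_def] by measurable
  qed
  have sum_le: "AE \<omega> in M. \<forall>q. ennreal (\<Sum>i<2 ^ q. (a q i \<omega>)\<^sup>2 * ?d q) \<le> Q \<omega>"
    using Hc
  proof eventually_elim
    case (elim \<omega>)
    have ct: "continuous_on {0..t} (\<lambda>s. H s \<omega>)" using elim by (rule continuous_on_subset) (use t in auto)
    have sqt: "continuous_on {0..t} (\<lambda>s. (H s \<omega>)\<^sup>2)" by (intro continuous_intros ct)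
    show ?case
    proof
      fix q
      let ?J = "\<lambda>i. integral {?g q i..?g q (Suc i)} (\<lambda>s. (H s \<omega>)\<^sup>2)"
      have J0: "0 \<le> ?J i" if "i < 2 ^ q" for i
        using grid_interval[OF t0(1) that]
        by (intro Henstock_Kurzweil_Integration.integral_nonneg integrable_continuous_real continuous_on_subset[OF sqt]) auto
      have "(\<Sum>i<2 ^ q. (a q i \<omega>)\<^sup>2 * ?d q) = (\<Sum>i<Suc (2 ^ q - 1). (a q i \<omega>)\<^sup>2 * ?d q)" by simp
      \<comment> \<open>The vanishing first coefficient allows an index shift that matches
        coefficient i + 1 with the interval i over which it averages.\<close>
      also have "\<dots> = (\<Sum>i<2 ^ q - 1. (a q (Suc i) \<omega>)\<^sup>2 * ?d q)"
        by (subst sum.lessThan_Suc_shift) (simp add: a_def)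
      also have "\<dots> \<le> (\<Sum>i<2 ^ q - 1. ?J i)"
      proof (rule sum_mono)
        fix i assume "i \<in> {..<(2::nat) ^ q - 1}"
        then have i: "i < 2 ^ q" by auto
        have "continuous_on {?g q i..?g q (Suc i)} (\<lambda>s. H s \<omega>)"
          by (rule continuous_on_subset[OF ct grid_interval[OF t0(1) i]])
        from mean_square_le[OF _ this] gstep[of "Suc i" q]
        show "(a q (Suc i) \<omega>)\<^sup>2 * ?d q \<le> ?J i" by (simp add: a_def)
      qed
      also have "\<dots> \<le> (\<Sum>i<2 ^ q. ?J i)" using J0 by (intro sum_mono2) auto
      also have "\<dots> = integral {0..t} (\<lambda>s. (H s \<omega>)\<^sup>2)" by (rule integral_grid[OF t0(1) sqt, symmetric])
      finally have "ennreal (\<Sum>i<2 ^ q. (a q i \<omega>)\<^sup>2 * ?d q) \<le> ennreal (integral {0..t} (\<lambda>s. (H s \<omega>)\<^sup>2))"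
        by (rule ennreal_leI)
      also have "\<dots> = (\<integral>\<^sup>+s. ennreal ((H s \<omega>)\<^sup>2 * indicator {0..t} s) \<partial>lborel)"
      proof -
        have "integrable lborel (\<lambda>s. indicator {0..t} s *\<^sub>R (H s \<omega>)\<^sup>2)"
          by (rule borel_integrable_compact[OF _ sqt]) simp
        moreover have "integral {0..t} (\<lambda>s. (H s \<omega>)\<^sup>2) = (LBINT s:{0..t}. (H s \<omega>)\<^sup>2)"
          by (rule set_lborel_integral_continuous[OF _ sqt, symmetric]) simp
        ultimately show ?thesis
          by (subst nn_integral_eq_integral) (auto simp: set_lebesgue_integral_def mult.commute)
      qed
      also have "\<dots> \<le> Q \<omega>"
        unfolding Q_def using t by (intro nn_integral_mono) (auto simp: indicator_def)
      finally show "ennreal (\<Sum>i<2 ^ q. (a q i \<omega>)\<^sup>2 * ?d q) \<le> Q \<omega>" .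
    qed
  qed
  have am: "a q i \<in> borel_measurable M" if "i < 2 ^ q" for q i using measurable_F_M[OF a_adapted[OF that]] .
  have sumI: "integrable M (\<lambda>\<omega>. \<Sum>i<2 ^ q. (a q i \<omega>)\<^sup>2 * ?d q)" and
    sumE: "expectation (\<lambda>\<omega>. \<Sum>i<2 ^ q. (a q i \<omega>)\<^sup>2 * ?d q) \<le> enn2real (\<integral>\<^sup>+\<omega>. Q \<omega> \<partial>M)" for q
  proof -
    have nn: "0 \<le> (\<Sum>i<2 ^ q. (a q i \<omega>)\<^sup>2 * ?d q)" for \<omega> using t0 by (intro sum_nonneg) auto
    have le: "(\<integral>\<^sup>+\<omega>. ennreal (\<Sum>i<2 ^ q. (a q i \<omega>)\<^sup>2 * ?d q) \<partial>M) \<le> (\<integral>\<^sup>+\<omega>. Q \<omega> \<partial>M)"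
      using sum_le by (intro nn_integral_mono_AE) auto
    show I: "integrable M (\<lambda>\<omega>. \<Sum>i<2 ^ q. (a q i \<omega>)\<^sup>2 * ?d q)"
    proof (rule integrableI_nonneg)
      show "(\<lambda>\<omega>. \<Sum>i<2 ^ q. (a q i \<omega>)\<^sup>2 * ?d q) \<in> borel_measurable M"
        by (intro borel_measurable_sum borel_measurable_times borel_measurable_power am) auto
      show "(\<integral>\<^sup>+\<omega>. ennreal (\<Sum>i<2 ^ q. (a q i \<omega>)\<^sup>2 * ?d q) \<partial>M) < \<infinity>"
        using le sq unfolding Q_def by (rule order.strict_trans1)
    qed (use nn in simp)
    have "ennreal (expectation (\<lambda>\<omega>. \<Sum>i<2 ^ q. (a q i \<omega>)\<^sup>2 * ?d q)) \<le> (\<integral>\<^sup>+\<omega>. Q \<omega> \<partial>M)"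
      using le nn_integral_eq_integral[OF I] nn by simp
    moreover have "(\<integral>\<^sup>+\<omega>. Q \<omega> \<partial>M) < \<top>" using sq by (simp add: Q_def)
    ultimately show "expectation (\<lambda>\<omega>. \<Sum>i<2 ^ q. (a q i \<omega>)\<^sup>2 * ?d q) \<le> enn2real (\<integral>\<^sup>+\<omega>. Q \<omega> \<partial>M)"
      by (simp add: enn2real_leI ennreal_enn2real flip: ennreal_le_iff[OF enn2real_nonneg])
  qed
  have aI: "integrable M (\<lambda>\<omega>. (a q i \<omega>)\<^sup>2)" if i: "i < 2 ^ q" for q i
  proof (rule Bochner_Integration.integrable_bound)
    show "integrable M (\<lambda>\<omega>. (\<Sum>i<2 ^ q. (a q i \<omega>)\<^sup>2 * ?d q) / ?d q)" using sumI by (rule integrable_divide_zero[rotated])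
    show "(\<lambda>\<omega>. (a q i \<omega>)\<^sup>2) \<in> borel_measurable M" by (intro borel_measurable_power am i)
    have "(a q i \<omega>)\<^sup>2 \<le> (\<Sum>i<2 ^ q. (a q i \<omega>)\<^sup>2 * ?d q) / ?d q" for \<omega>
      unfolding sum_distrib_right[symmetric]
      using member_le_sum[of i "{..<2 ^ q}" "\<lambda>i. (a q i \<omega>)\<^sup>2"] i t0 by simp
    then show "AE \<omega> in M. norm ((a q i \<omega>)\<^sup>2) \<le> norm ((\<Sum>i<2 ^ q. (a q i \<omega>)\<^sup>2 * ?d q) / ?d q)"
      unfolding real_norm_def abs_power2 by (intro always_eventually allI order.trans[OF _ abs_ge_self])
  qed
  define R where "R q \<omega> = (\<Sum>i<2 ^ q. a q i \<omega> * incr (\<lambda>s. B s \<omega>) t q i)" for q \<omega>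
  note iso = ito_isometry_grid[OF t0(2) order.refl a_adapted aI, folded R_def]
  have Rm: "R q \<in> borel_measurable M" for q using iso[of q] measurable_F_M by blast
  have R2: "expectation (\<lambda>\<omega>. (R q \<omega>)\<^sup>2) \<le> enn2real (\<integral>\<^sup>+\<omega>. Q \<omega> \<partial>M)" for q
    using iso[of q] sumE[of q] aI by (subst (asm) Bochner_Integration.integral_sum) auto
  have lim: "AE \<omega> in M. (\<lambda>q. R q \<omega>) \<longlonglongrightarrow> A \<omega>"
    using A_eq C1
  proof eventually_elim
      case (elim \<omega>)
      interpret C1_integrand t "\<lambda>s. H s \<omega>" "k \<omega>" "\<lambda>s. B s \<omega>" by (rule C1_integrand_subinterval[OF elim(2) t])
      obtain K where K: "K \<ge> 0" "\<And>r s. r \<in> {0..t} \<Longrightarrow> s \<in> {0..t} \<Longrightarrow> \<bar>H s \<omega> - H r \<omega>\<bar> \<le> K * \<bar>s - r\<bar>"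
        using h_lipschitz by blast
      \<comment> \<open>Lipschitz continuity of the path puts the average within the order of the
        mesh of the value at the endpoint.\<close>
      have "\<bar>a q i \<omega> - H (?g q i) \<omega>\<bar> \<le> (K * t) / 2 ^ q" if i: "i < 2 ^ q" "0 < i" for q i
      proof -
        let ?I = "{?g q (i - 1)..?g q i}"
        have sub: "?I \<subseteq> {0..t}" using gT[of i q] gT[of "i - 1" q] i by auto
        have c: "continuous_on ?I (\<lambda>s. H s \<omega>)" by (rule continuous_on_subset[OF h_continuous sub])
        have "integral ?I (\<lambda>s. H s \<omega>) - ?d q * H (?g q i) \<omega> = integral ?I (\<lambda>s. H s \<omega> - H (?g q i) \<omega>)"
          using gstep[of i q] i c
          by (subst Henstock_Kurzweil_Integration.integral_diff) (auto intro!: integrable_continuous_real)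
        also have "norm \<dots> \<le> (K * ?d q) * (?g q i - ?g q (i - 1))"
        proof (rule integral_bound)
          show "continuous_on ?I (\<lambda>s. H s \<omega> - H (?g q i) \<omega>)" by (intro continuous_intros c)
          fix s assume s: "s \<in> ?I"
          have "\<bar>H s \<omega> - H (?g q i) \<omega>\<bar> \<le> K * \<bar>s - ?g q i\<bar>" using s sub gT[of i q] i by (intro K) auto
          also have "\<dots> \<le> K * ?d q" using s gstep[of i q] i K(1) by (intro mult_left_mono) auto
          finally show "norm (H s \<omega> - H (?g q i) \<omega>) \<le> K * ?d q" by simp
        qed (use gstep[of i q] i in auto)
        finally have "\<bar>integral ?I (\<lambda>s. H s \<omega>) - ?d q * H (?g q i) \<omega>\<bar> \<le> K * ?d q * ?d q" using gstep[of i q] i by simp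
        moreover have "a q i \<omega> - H (?g q i) \<omega> = (integral ?I (\<lambda>s. H s \<omega>) - ?d q * H (?g q i) \<omega>) / ?d q"
          using i t0 by (simp add: a_def field_simps)
        moreover have "\<bar>x / d\<bar> \<le> c * d" if "\<bar>x\<bar> \<le> c * d * d" "0 < d" for x c d :: real
          using that by (simp add: abs_divide pos_divide_le_eq)
        ultimately show ?thesis using t0 by (metis divide_pos_pos times_divide_eq_right zero_less_numeral zero_less_power)
      qed
      from approximate_left_limit[of "\<lambda>q i. a q i \<omega>", OF this] show ?case
        unfolding elim(1) R_def by (simp add: a_def)
  qed
  have RI: "integrable M (\<lambda>\<omega>. (R q \<omega>)\<^sup>2)" "expectation (R q) = 0" for q using iso[of q] by auto
  show ?thesis using mean_zero_limit[OF Rm A lim RI(1) R2 RI(2)] by blast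
qed

subsection \<open>Sample paths of the low-rank dynamics\<close>

text \<open>\<open>divergence\<close> uses the total derivative of the field, whereas regularity is
  known componentwise.\<close>

lemma divergence_eq:
  fixes G :: "real^'d \<Rightarrow> real^'d"
  assumes "\<And>b. (\<lambda>x. G x $ b) differentiable (at x)"
  shows "divergence G x = (\<Sum>b\<in>UNIV. grad (\<lambda>x. G x $ b) x $ b)"
proof -
  have "(G has_derivative (\<lambda>h. \<chi> b. grad (\<lambda>x. G x $ b) x \<bullet> h)) (at x)"
    unfolding has_derivative_componentwise_within[of G]
    by (auto simp: Basis_vec_def inner_axis intro!: has_derivative_grad assms)
  from frechet_derivative_at[OF this, symmetric] show ?thesis
    by (simp add: divergence_def inner_axis)
qed

lemma mat_divergence_eq:
  fixes G :: "real^'d \<Rightarrow> real^'d^'d"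
  assumes "\<And>b c. (\<lambda>x. G x $ b $ c) differentiable (at x)"
  shows "mat_divergence G x $ b = (\<Sum>c\<in>UNIV. grad (\<lambda>x. G x $ b $ c) x $ c)"
proof -
  have "(G has_derivative (\<lambda>h. \<chi> b c. grad (\<lambda>x. G x $ b $ c) x \<bullet> h)) (at x)"
    unfolding has_derivative_componentwise_within[of G]
    by (auto simp: Basis_vec_def inner_axis intro!: has_derivative_grad assms)
  from frechet_derivative_at[OF this, symmetric] show ?thesis
    by (simp add: mat_divergence_def inner_axis)
qed

text \<open>Vectors are reassembled from their components by the bounded linear embeddings
  \<open>axis b\<close>. Applied twice this serves matrix-valued integrals.\<close>

lemma has_bochner_integral_vec:
  fixes g :: "'a \<Rightarrow> ('c::euclidean_space)^'n"
  assumes "\<And>b. has_bochner_integral M (\<lambda>v. g v $ b) (G $ b)"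
  shows "has_bochner_integral M g G"
proof -
  have ax: "(\<Sum>b\<in>UNIV. axis b (x $ b)) = x" for x :: "'c^'n"
    by (simp add: vec_eq_iff axis_def)
  have "linear (axis b :: 'c \<Rightarrow> 'c^'n)" for b
    by (rule linearI) (simp_all add: vec_eq_iff axis_def)
  then have "bounded_linear (axis b :: 'c \<Rightarrow> 'c^'n)" for b
    by (simp add: linear_conv_bounded_linear)
  from has_bochner_integral_sum[OF has_bochner_integral_bounded_linear[OF this assms]]
  have "has_bochner_integral M (\<lambda>v. \<Sum>b\<in>UNIV. axis b (g v $ b)) (\<Sum>b\<in>UNIV. axis b (G $ b))" .
  then show ?thesis by (simp only: ax)
qed

text \<open>One fixed sample path. The moment identities are deterministic consequences of the form
  of f, the orthonormality of the V_j and the decay, and are separated here from all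
  probability.\<close>

locale lowrank_path =
  fixes T L :: real and w :: "real^'d::finite \<Rightarrow> real" and r m :: nat
    and U :: "nat \<Rightarrow> real^'d \<Rightarrow> real" and e :: "nat \<Rightarrow> 'd"
    and X V :: "nat \<Rightarrow> real \<Rightarrow> real^'d \<Rightarrow> real" and S :: "nat \<Rightarrow> nat \<Rightarrow> real \<Rightarrow> real"
    and E :: "real \<Rightarrow> real^'d \<Rightarrow> real^'d"
  assumes L: "0 < L" and T: "0 < T" and weight: "admissible_weight w"
    and rank: "CARD('d) + 2 \<le> m" "m \<le> r" and enum: "bij_betw e {1..CARD('d)} UNIV"
    and U_1: "U 1 = (\<lambda>v. 1 / norm_v w (\<lambda>_. 1))"
    and U_v: "\<And>i. i \<in> {1..CARD('d)} \<Longrightarrow> U (i + 1) = (\<lambda>v. v $ e i / norm_v w (\<lambda>v. v $ e i))"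
    and U_chi: "U (CARD('d) + 2) = (\<lambda>v. chi2 w v / norm_v w (chi2 w))"
    and fixed_modes: "\<And>a t. a \<in> {1..m} \<Longrightarrow> t \<in> {0..T} \<Longrightarrow> V a t = U a"
    and regular: "regular_path T L w r X S V E"
    and orthonormal: "\<And>t. t \<in> {0..T} \<Longrightarrow> orthonormal_modes (inner_v w) r (\<lambda>j. V j t)"
begin

definition "f t x v = w v * (\<Sum>i\<in>{1..r}. \<Sum>j\<in>{1..r}. X i t x * S i j t * V j t v)"

definition "K k t x = (\<Sum>i\<in>{1..r}. X i t x * S i k t)"

definition "n1 = norm_v w (\<lambda>_. 1)"
definition "nv b = norm_v w (\<lambda>v. v $ b)"
definition "nchi = norm_v w (chi2 w)"
text \<open>The number of the mode belonging to v_b; the successor accounts for the constant mode,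
  which has number 1.\<close>

definition "kv b = Suc (inv_into {1..CARD('d)} e b)"
definition "kchi = CARD('d) + 2"
definition "alpha = inner_v w (\<lambda>v. (norm v)\<^sup>2) (\<lambda>_. 1) / inner_v w (\<lambda>_. 1) (\<lambda>_. 1)"

lemmas [simp del] = One_nat_def

lemma kv_inv: "inv_into {1..CARD('d)} e b \<in> {1..CARD('d)}" "e (inv_into {1..CARD('d)} e b) = b"
proof -
  have "b \<in> e ` {1..CARD('d)}" using enum by (simp add: bij_betw_def)
  then show "inv_into {1..CARD('d)} e b \<in> {1..CARD('d)}" "e (inv_into {1..CARD('d)} e b) = b"
    by (rule inv_into_into, rule f_inv_into_f)
qed

lemma modes: "1 \<in> {1..m}" "kv b \<in> {1..m}" "kchi \<in> {1..m}"
  using rank kv_inv(1)[of b] by (auto simp: kv_def kchi_def)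

lemma modes_r: "k \<in> {1..m} \<Longrightarrow> k \<in> {1..r}" using rank by auto

lemma T0: "0 \<in> {0..T}" using T by simp

lemma U1: "U 1 v = 1 / n1" and Ukv: "U (kv b) v = v $ b / nv b" and Ukchi: "U kchi v = ((norm v)\<^sup>2 - alpha) / nchi"
  using U_1 U_v[OF kv_inv(1), of b] U_chi by (auto simp: Suc_eq_plus1 n1_def kv_def kv_inv nv_def kchi_def nchi_def chi2_def alpha_def)

lemma orth_delta: "t \<in> {0..T} \<Longrightarrow> j \<in> {1..r} \<Longrightarrow> k \<in> {1..r} \<Longrightarrow>
    (\<integral>v. V k t v * (w v * V j t v) \<partial>lborel) = (if j = k then 1 else 0)"
  using orthonormal[of t] by (auto simp: orthonormal_modes_def inner_v_def ac_simps)

text \<open>A vanishing normalization would make the whole mode zero, as division by zero gives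
  zero, contrary to its unit norm.\<close>

lemma norms_nonzero: "n1 \<noteq> 0" "nv b \<noteq> 0" "nchi \<noteq> 0"
proof -
  have nz: "\<exists>v. U k v \<noteq> 0" if k: "k \<in> {1..m}" for k
  proof (rule ccontr)
    assume "\<not> (\<exists>v. U k v \<noteq> 0)"
    then show False using orth_delta[OF T0 modes_r[OF k] modes_r[OF k]] fixed_modes[OF k T0] by simp
  qed
  show "n1 \<noteq> 0" using nz[OF modes(1)] U1 by auto
  show "nv b \<noteq> 0" using nz[OF modes(2)[of b]] Ukv by auto
  show "nchi \<noteq> 0" using nz[OF modes(3)] Ukchi by auto
qed

lemma w_diff: "w differentiable (at v)" and w_cont_grad: "continuous_on UNIV (grad w)"
  using weight by (auto simp: admissible_weight_def)

lemma w_cont: "continuous_on A w"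
proof -
  have "isCont w v" for v using differentiable_imp_continuous_within[OF w_diff] .
  then show ?thesis by (simp add: continuous_at_imp_continuous_on)
qed

lemma at_time:
  assumes "continuous_on ({0..T} \<times> UNIV) (\<lambda>p. g (fst p) (snd p))" "t \<in> {0..T}"
  shows "continuous_on A (g t)"
  by (rule continuous_on_compose2[OF assms(1), of _ "\<lambda>x. (t, x)", simplified])
    (use assms(2) in \<open>auto intro!: continuous_intros\<close>)

lemma X_C1: "i \<in> {1..r} \<Longrightarrow> t \<in> {0..T} \<Longrightarrow> C1_periodic L (X i t)"
proof -
  assume i: "i \<in> {1..r}" and t: "t \<in> {0..T}"
  have "continuous_on ({0..T} \<times> UNIV) (\<lambda>p. grad (X i (fst p)) (snd p))"
    using regular i by (simp add: regular_path_def split_beta)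
  from at_time[OF this t] have "continuous_on UNIV (grad (X i t))" .
  then show ?thesis using regular i t by (auto simp: regular_path_def C1_periodic_def)
qed

lemma X_cont: "i \<in> {1..r} \<Longrightarrow> continuous_on ({0..T} \<times> UNIV) (\<lambda>p. X i (fst p) (snd p))"
  and gX_cont: "i \<in> {1..r} \<Longrightarrow> continuous_on ({0..T} \<times> UNIV) (\<lambda>p. grad (X i (fst p)) (snd p))"
  and S_cont: "i \<in> {1..r} \<Longrightarrow> j \<in> {1..r} \<Longrightarrow> continuous_on {0..T} (S i j)"
  and V_cont: "j \<in> {1..r} \<Longrightarrow> continuous_on ({0..T} \<times> UNIV) (\<lambda>p. V j (fst p) (snd p))"
  and gV_cont: "j \<in> {1..r} \<Longrightarrow> continuous_on ({0..T} \<times> UNIV) (\<lambda>p. grad (V j (fst p)) (snd p))"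
  and V_diff: "j \<in> {1..r} \<Longrightarrow> t \<in> {0..T} \<Longrightarrow> V j t differentiable (at v)"
  and E_cont: "continuous_on ({0..T} \<times> UNIV) (\<lambda>p. E (fst p) (snd p))"
  and maj: "j \<in> {1..r} \<Longrightarrow> k \<in> {1..r} \<Longrightarrow> \<exists>g. integrable lborel g \<and> (\<forall>t\<in>{0..T}. \<forall>v.
        (1 + norm v) * (w v * \<bar>V j t v * V k t v\<bar>) \<le> g v \<and>
        \<bar>V k t v\<bar> * norm (grad (\<lambda>v. w v * V j t v) v) \<le> g v)"
  using regular by (auto simp: regular_path_def split_beta)

lemma at_point:
  assumes "continuous_on ({0..T} \<times> UNIV) (\<lambda>p. g (fst p) (snd p))"
  shows "continuous_on {0..T} (\<lambda>t. g t x)"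
  by (rule continuous_on_compose2[OF assms(1), of _ "\<lambda>t. (t, x)", simplified]) (auto intro!: continuous_intros)

lemma V_cont_v: "j \<in> {1..r} \<Longrightarrow> t \<in> {0..T} \<Longrightarrow> continuous_on A (V j t)"
  using at_time[OF V_cont] .

lemma S_cont2: "i \<in> {1..r} \<Longrightarrow> j \<in> {1..r} \<Longrightarrow> continuous_on ({0..T} \<times> A) (\<lambda>p. S i j (fst p))"
  by (rule continuous_on_compose2[OF S_cont]) (auto intro!: continuous_intros)

lemma wV_diff: "j \<in> {1..r} \<Longrightarrow> t \<in> {0..T} \<Longrightarrow> (\<lambda>v. w v * V j t v) differentiable (at v)"
  by (intro differentiable_mult w_diff V_diff)

lemma wV_grad_cont: "j \<in> {1..r} \<Longrightarrow> t \<in> {0..T} \<Longrightarrow> continuous_on UNIV (grad (\<lambda>v. w v * V j t v))"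
proof -
  assume j: "j \<in> {1..r}" and t: "t \<in> {0..T}"
  have "grad (\<lambda>v. w v * V j t v) = (\<lambda>v. w v *\<^sub>R grad (V j t) v + V j t v *\<^sub>R grad w v)"
    using grad_mult[OF w_diff V_diff[OF j t]] by blast
  then show ?thesis
    by (simp only:) (intro continuous_intros w_cont w_cont_grad V_cont_v at_time[OF gV_cont[OF j] t] j t)
qed

lemma U_diff: "k \<in> {1..m} \<Longrightarrow> U k differentiable (at v)"
  using V_diff[OF modes_r T0, of k v] fixed_modes[OF _ T0, of k] by simp

lemma U_cont: "k \<in> {1..m} \<Longrightarrow> continuous_on A (U k)"
  using V_cont_v[OF modes_r T0, of k A] fixed_modes[OF _ T0, of k] by simp

lemma U_grad_cont: "k \<in> {1..m} \<Longrightarrow> continuous_on A (grad (U k))"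
  using at_time[OF gV_cont[OF modes_r] T0, of k A] fixed_modes[OF _ T0, of k] by simp

section \<open>Velocity moments of the modes and of the density\<close>

definition "I \<phi> j t = (\<integral>v. \<phi> v * (w v * V j t v) \<partial>lborel)"

definition "majorized \<phi> \<longleftrightarrow> continuous_on UNIV \<phi> \<and> (\<forall>j\<in>{1..r}. \<exists>g. integrable lborel g \<and>
  (\<forall>t\<in>{0..T}. \<forall>v. \<bar>\<phi> v * (w v * V j t v)\<bar> \<le> g v))"

text \<open>The assumed majorants concern products of two modes with the weight 1 + |v|. Taking one
  of the two to be a fixed mode turns them into majorants for test functions growing at most like (1
  + |v|) |U_k|.\<close>

lemma majorized_bound:
  assumes k: "k \<in> {1..m}" and cont: "continuous_on UNIV \<phi>" and le: "\<And>v. \<bar>\<phi> v\<bar> \<le> c * ((1 + norm v) * \<bar>U k v\<bar>)"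
  shows "majorized \<phi>"
  unfolding majorized_def
proof (intro conjI cont ballI)
  fix j assume j: "j \<in> {1..r}"
  from maj[OF j modes_r[OF k]] obtain g where g: "integrable lborel g"
    "\<And>t v. t \<in> {0..T} \<Longrightarrow> (1 + norm v) * (w v * \<bar>V j t v * V k t v\<bar>) \<le> g v" by blast
  have w0: "0 \<le> w v" for v using weight by (simp add: admissible_weight_def less_imp_le)
  have "\<bar>\<phi> v * (w v * V j t v)\<bar> \<le> \<bar>c\<bar> * g v" if t: "t \<in> {0..T}" for t v
  proof -
    have "\<bar>\<phi> v\<bar> \<le> \<bar>c\<bar> * ((1 + norm v) * \<bar>U k v\<bar>)"
      using le[of v] mult_right_mono[OF abs_ge_self[of c], of "(1 + norm v) * \<bar>U k v\<bar>"] by (meson abs_ge_zero add_nonneg_nonneg mult_nonneg_nonneg norm_ge_zero order.trans zero_le_one)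
    then have "\<bar>\<phi> v * (w v * V j t v)\<bar> \<le> (\<bar>c\<bar> * ((1 + norm v) * \<bar>U k v\<bar>)) * (w v * \<bar>V j t v\<bar>)"
      unfolding abs_mult using w0[of v] by (intro mult_mono) (auto simp: abs_of_nonneg)
    also have "\<dots> = \<bar>c\<bar> * ((1 + norm v) * (w v * \<bar>V j t v * V k t v\<bar>))"
      by (simp add: fixed_modes[OF k t] abs_mult)
    also have "\<dots> \<le> \<bar>c\<bar> * g v" by (intro mult_left_mono g t) auto
    finally show ?thesis .
  qed
  moreover have "integrable lborel (\<lambda>v. \<bar>c\<bar> * g v)" using g(1) by simp
  ultimately show "\<exists>g. integrable lborel g \<and> (\<forall>t\<in>{0..T}. \<forall>v. \<bar>\<phi> v * (w v * V j t v)\<bar> \<le> g v)" by blast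
qed

lemma I_integrable:
  assumes "majorized \<phi>" "j \<in> {1..r}" "t \<in> {0..T}"
  shows "integrable lborel (\<lambda>v. \<phi> v * (w v * V j t v))"
proof -
  from assms obtain g where g: "integrable lborel g" "\<And>v. \<bar>\<phi> v * (w v * V j t v)\<bar> \<le> g v"
    unfolding majorized_def by blast
  have "continuous_on UNIV (\<lambda>v. \<phi> v * (w v * V j t v))"
    using assms by (intro continuous_intros w_cont V_cont_v) (auto simp: majorized_def)
  then have "(\<lambda>v. \<phi> v * (w v * V j t v)) \<in> borel_measurable lborel"
    using borel_measurable_continuous_onI by simp
  then show ?thesis
    by (rule Bochner_Integration.integrable_bound[OF g(1)]) (use g(2) in \<open>auto intro: order.trans[OF _ abs_ge_self]\<close>)
qed

lemma I_has_integral: "majorized \<phi> \<Longrightarrow> j \<in> {1..r} \<Longrightarrow> t \<in> {0..T} \<Longrightarrow>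
    has_bochner_integral lborel (\<lambda>v. \<phi> v * (w v * V j t v)) (I \<phi> j t)"
  unfolding I_def by (rule has_bochner_integral_integrable[OF I_integrable])

text \<open>Dominated convergence, with a majorant that does not depend on time.\<close>

lemma I_cont:
  assumes \<phi>: "majorized \<phi>" and j: "j \<in> {1..r}"
  shows "continuous_on {0..T} (I \<phi> j)"
proof (rule continuous_on_sequentiallyI)
  fix s a assume s: "\<forall>n. s n \<in> {0..T}" and a: "a \<in> {0..T}" and lim: "s \<longlonglongrightarrow> a"
  from \<phi> j obtain g where g: "integrable lborel g" "\<And>t v. t \<in> {0..T} \<Longrightarrow> \<bar>\<phi> v * (w v * V j t v)\<bar> \<le> g v"
    unfolding majorized_def by blast
  show "(\<lambda>n. I \<phi> j (s n)) \<longlonglongrightarrow> I \<phi> j a"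
    unfolding I_def
  proof (rule integral_dominated_convergence[OF _ _ g(1)])
    show "(\<lambda>v. \<phi> v * (w v * V j a v)) \<in> borel_measurable lborel" "(\<lambda>v. \<phi> v * (w v * V j (s n) v)) \<in> borel_measurable lborel" for n
      using I_integrable[OF \<phi> j] s a by auto
    show "AE v in lborel. (\<lambda>n. \<phi> v * (w v * V j (s n) v)) \<longlonglongrightarrow> \<phi> v * (w v * V j a v)"
      using s a
      by (intro AE_I2 tendsto_intros continuous_on_tendsto_compose[OF at_point[OF V_cont[OF j]] lim]) auto
    show "AE v in lborel. norm (\<phi> v * (w v * V j (s n) v)) \<le> g v" for n using g(2) s by auto
  qed
qed

lemma I_U: "k \<in> {1..m} \<Longrightarrow> j \<in> {1..r} \<Longrightarrow> t \<in> {0..T} \<Longrightarrow> I (U k) j t = (if j = k then 1 else 0)"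
  unfolding I_def using orth_delta[of t j k] fixed_modes[of k t] modes_r[of k] by simp

lemma I_cmult: "I (\<lambda>v. c * \<phi> v) j t = c * I \<phi> j t"
  by (simp add: I_def mult.assoc)

lemma majorized_U: "k \<in> {1..m} \<Longrightarrow> majorized (U k)"
proof (rule majorized_bound[where c = 1])
  show "\<bar>U k v\<bar> \<le> 1 * ((1 + norm v) * \<bar>U k v\<bar>)" for v by (simp add: distrib_right)
qed (auto intro: U_cont)

lemma majorized_Uv: "k \<in> {1..m} \<Longrightarrow> majorized (\<lambda>v. U k v * v $ b)"
proof (rule majorized_bound[where c = 1])
  show "\<bar>U k v * v $ b\<bar> \<le> 1 * ((1 + norm v) * \<bar>U k v\<bar>)" for v
  proof -
    have "\<bar>v $ b\<bar> \<le> 1 + norm v" using component_le_norm_cart[of v b] by simp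
    then show ?thesis using mult_right_mono[of "\<bar>v $ b\<bar>" "1 + norm v" "\<bar>U k v\<bar>"] by (simp add: abs_mult mult.commute)
  qed
qed (auto intro!: U_cont continuous_intros)

lemma majorized_cmult: "majorized \<phi> \<Longrightarrow> majorized (\<lambda>v. c * \<phi> v)"
  unfolding majorized_def
proof (elim conjE, intro conjI ballI)
  fix j assume "\<forall>j\<in>{1..r}. \<exists>g. integrable lborel g \<and> (\<forall>t\<in>{0..T}. \<forall>v. \<bar>\<phi> v * (w v * V j t v)\<bar> \<le> g v)" "j \<in> {1..r}"
  then have "\<exists>g. integrable lborel g \<and> (\<forall>t\<in>{0..T}. \<forall>v. \<bar>\<phi> v * (w v * V j t v)\<bar> \<le> g v)" by (rule bspec)
  then obtain g where g: "integrable lborel g" "\<forall>t\<in>{0..T}. \<forall>v. \<bar>\<phi> v * (w v * V j t v)\<bar> \<le> g v"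
    by (elim exE conjE)
  have "\<bar>c * \<phi> v * (w v * V j t v)\<bar> \<le> \<bar>c\<bar> * g v" if "t \<in> {0..T}" for t v
    using mult_left_mono[OF g(2)[THEN bspec, OF that, THEN spec, of v] abs_ge_zero[of c]] by (simp add: abs_mult mult.assoc)
  moreover have "integrable lborel (\<lambda>v. \<bar>c\<bar> * g v)" using g(1) by simp
  ultimately show "\<exists>g. integrable lborel g \<and> (\<forall>t\<in>{0..T}. \<forall>v. \<bar>c * \<phi> v * (w v * V j t v)\<bar> \<le> g v)" by blast
qed (intro continuous_intros)

lemma majorized_1: "majorized (\<lambda>_. 1)"
  using majorized_cmult[OF majorized_U[OF modes(1)], of n1] norms_nonzero(1) by (simp add: U1)

lemma majorized_v: "majorized (\<lambda>v. v $ b)"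
  using majorized_cmult[OF majorized_U[OF modes(2)], of "nv b" b] norms_nonzero(2)[of b] by (simp add: Ukv)

text \<open>Quadratic growth is reached by combining a mode and the weight: v_b v_c is a multiple of
  the mode of v_b times v_c.\<close>

lemma majorized_vv: "majorized (\<lambda>v. v $ b * v $ c)"
  using majorized_cmult[OF majorized_Uv[OF modes(2)], of "nv b" b c] norms_nonzero(2)[of b] by (simp add: Ukv)

text \<open>Here orthonormality acts: a test function proportional to a fixed mode sees a single
  V_j, so the evolving modes contribute nothing to this moment.\<close>

lemma I_1: "j \<in> {1..r} \<Longrightarrow> t \<in> {0..T} \<Longrightarrow> I (\<lambda>_. 1) j t = (if j = 1 then n1 else 0)"
  using I_cmult[of n1 "U 1" j t] I_U[OF modes(1), of j t] norms_nonzero(1) by (auto simp: U1)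

lemma I_v: "j \<in> {1..r} \<Longrightarrow> t \<in> {0..T} \<Longrightarrow> I (\<lambda>v. v $ b) j t = (if j = kv b then nv b else 0)"
  using I_cmult[of "nv b" "U (kv b)" j t] I_U[OF modes(2), of j t b] norms_nonzero(2)[of b] by (auto simp: Ukv)

lemma moment:
  assumes \<phi>: "majorized \<phi>" and t: "t \<in> {0..T}"
  shows "has_bochner_integral lborel (\<lambda>v. \<phi> v * f t x v) (\<Sum>i\<in>{1..r}. \<Sum>j\<in>{1..r}. X i t x * S i j t * I \<phi> j t)"
proof -
  have "\<phi> v * f t x v = (\<Sum>i\<in>{1..r}. \<Sum>j\<in>{1..r}. X i t x * S i j t * (\<phi> v * (w v * V j t v)))" for v
    by (simp add: f_def sum_distrib_left mult_ac)
  then show ?thesis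
    by (simp only:) (intro has_bochner_integral_sum has_bochner_integral_mult_right I_has_integral \<phi> t)
qed

lemma mass_density_eq: "t \<in> {0..T} \<Longrightarrow> mass_density (f t) x = n1 * K 1 t x"
  using has_bochner_integral_integral_eq[OF moment[OF majorized_1, of t x]] modes_r[OF modes(1)]
  by (simp add: mass_density_def I_1 K_def if_distrib[of "\<lambda>c. _ * c"] sum.delta' sum_distrib_left mult_ac cong: if_cong)

lemma momentum_density_eq: "t \<in> {0..T} \<Longrightarrow> momentum_density (f t) x = (\<chi> b. nv b * K (kv b) t x)"
  unfolding momentum_density_def
proof (rule has_bochner_integral_integral_eq[OF has_bochner_integral_vec])
  fix b assume t: "t \<in> {0..T}"
  show "has_bochner_integral lborel (\<lambda>v. (f t x v *\<^sub>R v) $ b) ((\<chi> b. nv b * K (kv b) t x) $ b)"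
    using moment[OF majorized_v[of b] t, of x] modes_r[OF modes(2), of b] t
    by (simp add: I_v K_def if_distrib[of "\<lambda>c. _ * c"] sum.delta' sum_distrib_left mult_ac cong: if_cong)
qed

definition "J t = momentum_density (f t)"
definition "\<rho> t = mass_density (f t)"

section \<open>Transport and force terms tested with a fixed mode\<close>

definition "grad_majorized k \<longleftrightarrow> (\<forall>b. majorized (\<lambda>v. grad (U k) v $ b))"

text \<open>The divergence in x of the velocity moment of U_k v f, written out in the modes.\<close>

definition "flux k t x = (\<Sum>i\<in>{1..r}. \<Sum>c\<in>UNIV. grad (X i t) x $ c * (\<Sum>j\<in>{1..r}. S i j t * I (\<lambda>v. U k v * v $ c) j t))"

text \<open>The velocity moment of f against the gradient of U_k: what remains of a force term after
  integration by parts in v.\<close>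

definition "P k t x = (\<chi> b. \<Sum>i\<in>{1..r}. \<Sum>j\<in>{1..r}. X i t x * S i j t * I (\<lambda>v. grad (U k) v $ b) j t)"

lemma X_diff: "i \<in> {1..r} \<Longrightarrow> t \<in> {0..T} \<Longrightarrow> X i t differentiable (at x)"
  using C1_periodicD(2)[OF X_C1] .

lemma grad_f_x:
  assumes t: "t \<in> {0..T}"
  shows "grad (\<lambda>y. f t y v) x = (\<Sum>i\<in>{1..r}. \<Sum>j\<in>{1..r}. (S i j t * (w v * V j t v)) *\<^sub>R grad (X i t) x)"
proof -
  have eq: "(\<lambda>y. f t y v) = (\<lambda>y. \<Sum>i\<in>{1..r}. \<Sum>j\<in>{1..r}. (S i j t * (w v * V j t v)) * X i t y)"
    by (simp add: f_def sum_distrib_left mult_ac)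
  have "grad (\<lambda>y. f t y v) x = (\<Sum>i\<in>{1..r}. grad (\<lambda>y. \<Sum>j\<in>{1..r}. (S i j t * (w v * V j t v)) * X i t y) x)"
    unfolding eq by (rule grad_sum) (auto intro!: differentiable_sum differentiable_mult X_diff t)
  also have "\<dots> = (\<Sum>i\<in>{1..r}. \<Sum>j\<in>{1..r}. (S i j t * (w v * V j t v)) *\<^sub>R grad (X i t) x)"
  proof (intro sum.cong refl)
    fix i assume i: "i \<in> {1..r}"
    have "grad (\<lambda>y. \<Sum>j\<in>{1..r}. (S i j t * (w v * V j t v)) * X i t y) x =
        (\<Sum>j\<in>{1..r}. grad (\<lambda>y. (S i j t * (w v * V j t v)) * X i t y) x)"
      by (rule grad_sum) (auto intro!: differentiable_mult X_diff t i)
    then show "grad (\<lambda>y. \<Sum>j\<in>{1..r}. (S i j t * (w v * V j t v)) * X i t y) x =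
        (\<Sum>j\<in>{1..r}. (S i j t * (w v * V j t v)) *\<^sub>R grad (X i t) x)"
      by (simp only: grad_cmult[OF X_diff[OF i t]])
  qed
  finally show ?thesis .
qed

lemma grad_f_v:
  assumes t: "t \<in> {0..T}"
  shows "grad (f t x) v = (\<Sum>i\<in>{1..r}. \<Sum>j\<in>{1..r}. (X i t x * S i j t) *\<^sub>R grad (\<lambda>v. w v * V j t v) v)"
proof -
  have eq: "f t x = (\<lambda>v. \<Sum>i\<in>{1..r}. \<Sum>j\<in>{1..r}. (X i t x * S i j t) * (w v * V j t v))"
    by (auto simp: f_def sum_distrib_left mult_ac)
  have "grad (f t x) v = (\<Sum>i\<in>{1..r}. grad (\<lambda>v. \<Sum>j\<in>{1..r}. (X i t x * S i j t) * (w v * V j t v)) v)"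
    unfolding eq by (rule grad_sum) (intro differentiable_sum ballI finite_atLeastAtMost differentiable_mult wV_diff differentiable_const t; simp)
  also have "\<dots> = (\<Sum>i\<in>{1..r}. \<Sum>j\<in>{1..r}. (X i t x * S i j t) *\<^sub>R grad (\<lambda>v. w v * V j t v) v)"
  proof (intro sum.cong refl)
    fix i
    have "grad (\<lambda>v. \<Sum>j\<in>{1..r}. (X i t x * S i j t) * (w v * V j t v)) v =
        (\<Sum>j\<in>{1..r}. grad (\<lambda>v. (X i t x * S i j t) * (w v * V j t v)) v)"
      by (rule grad_sum) (intro differentiable_mult wV_diff differentiable_const t; simp)
    also have "\<dots> = (\<Sum>j\<in>{1..r}. (X i t x * S i j t) *\<^sub>R grad (\<lambda>v. w v * V j t v) v)"
      by (intro sum.cong refl grad_cmult wV_diff t)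
    finally show "grad (\<lambda>v. \<Sum>j\<in>{1..r}. (X i t x * S i j t) * (w v * V j t v)) v =
        (\<Sum>j\<in>{1..r}. (X i t x * S i j t) *\<^sub>R grad (\<lambda>v. w v * V j t v) v)" .
  qed
  finally show ?thesis .
qed

text \<open>The gradient of U_k w V_j has zero integral. The two terms of the product rule are
  integrable for different reasons: one by the assumed majorant for the gradient of w V_j, the other
  by the moments of the gradient of U_k.\<close>

lemma velocity_by_parts:
  assumes k: "k \<in> {1..m}" "grad_majorized k" and j: "j \<in> {1..r}" and t: "t \<in> {0..T}"
  shows "has_bochner_integral lborel (\<lambda>v. U k v * grad (\<lambda>v. w v * V j t v) v $ b) (- I (\<lambda>v. grad (U k) v $ b) j t)"
proof -
  define h where "h v = U k v * (w v * V j t v)" for v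
  define D1 where "D1 v = U k v * grad (\<lambda>v. w v * V j t v) v $ b" for v
  define D2 where "D2 v = grad (U k) v $ b * (w v * V j t v)" for v
  have hd: "h differentiable (at v)" for v
    unfolding h_def[abs_def] by (intro differentiable_mult U_diff k wV_diff j t)
  have gh: "grad h v $ b = D1 v + D2 v" for v
    unfolding h_def[abs_def] grad_mult[OF U_diff[OF k(1)] wV_diff[OF j t]] by (simp add: D1_def D2_def mult.commute)
  have c1: "continuous_on UNIV D1" and c2: "continuous_on UNIV D2"
    unfolding D1_def[abs_def] D2_def[abs_def]
    by (intro continuous_intros U_cont U_grad_cont wV_grad_cont w_cont V_cont_v k j t)+
  have i2: "integrable lborel D2"
    unfolding D2_def[abs_def] using k(2) by (intro I_integrable j t) (simp add: grad_majorized_def)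
  have i1: "integrable lborel D1"
  proof -
    from maj[OF j modes_r[OF k(1)]] obtain g where g: "integrable lborel g"
      "\<And>v. \<bar>V k t v\<bar> * norm (grad (\<lambda>v. w v * V j t v) v) \<le> g v" using t by blast
    show ?thesis
    proof (rule Bochner_Integration.integrable_bound[OF g(1)])
      show "D1 \<in> borel_measurable lborel" using borel_measurable_continuous_onI[OF c1] by simp
      have "norm (D1 v) \<le> g v" for v
      proof -
        have "norm (D1 v) \<le> \<bar>V k t v\<bar> * norm (grad (\<lambda>v. w v * V j t v) v)"
          unfolding D1_def real_norm_def abs_mult fixed_modes[OF k(1) t]
          by (intro mult_left_mono component_le_norm_cart) simp
        then show ?thesis using g(2)[of v] by (rule order.trans)
      qed
      then show "AE v in lborel. norm (D1 v) \<le> norm (g v)" by (auto intro: order.trans[OF _ abs_ge_self])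
    qed
  qed
  have "(\<integral>v. D1 v + D2 v \<partial>lborel) = 0"
    unfolding gh[symmetric]
  proof (rule integral_grad_zero[OF hd])
    show "continuous_on UNIV (\<lambda>v. grad h v $ b)" unfolding gh by (intro continuous_intros c1 c2)
    show "integrable lborel h" unfolding h_def[abs_def] by (intro I_integrable majorized_U k j t)
    show "integrable lborel (\<lambda>v. grad h v $ b)" unfolding gh by (intro Bochner_Integration.integrable_add i1 i2)
  qed
  then have "(\<integral>v. D1 v \<partial>lborel) = - I (\<lambda>v. grad (U k) v $ b) j t"
    using Bochner_Integration.integral_add[OF i1 i2] by (simp add: I_def D2_def[abs_def])
  with has_bochner_integral_integrable[OF i1] show ?thesis unfolding D1_def[abs_def] by simp
qed

text \<open>The vector a is arbitrary, so that the same identity serves the electric field and the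
  noise vectors \<sigma>_l.\<close>

lemma force_integral:
  assumes k: "k \<in> {1..m}" "grad_majorized k" and t: "t \<in> {0..T}"
  shows "has_bochner_integral lborel (\<lambda>v. U k v * (a \<bullet> grad (f t x) v)) (- (a \<bullet> P k t x))"
proof -
  have eq: "U k v * (a \<bullet> grad (f t x) v) = (\<Sum>b\<in>UNIV. a $ b * (\<Sum>i\<in>{1..r}. \<Sum>j\<in>{1..r}. X i t x * S i j t *
      (U k v * grad (\<lambda>v. w v * V j t v) v $ b)))" for v
    unfolding grad_f_v[OF t] inner_vec_def
    by (simp add: sum_distrib_left mult_ac)
  have "has_bochner_integral lborel (\<lambda>v. U k v * (a \<bullet> grad (f t x) v))
     (\<Sum>b\<in>UNIV. a $ b * (\<Sum>i\<in>{1..r}. \<Sum>j\<in>{1..r}. X i t x * S i j t * (- I (\<lambda>v. grad (U k) v $ b) j t)))"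
    unfolding eq by (intro has_bochner_integral_sum has_bochner_integral_mult_right velocity_by_parts k t)
  then show ?thesis by (simp add: P_def inner_vec_def sum_negf)
qed

lemma transport_integral:
  assumes k: "k \<in> {1..m}" and t: "t \<in> {0..T}"
  shows "has_bochner_integral lborel (\<lambda>v. U k v * (v \<bullet> grad (\<lambda>y. f t y v) x)) (flux k t x)"
proof -
  have eq: "U k v * (v \<bullet> grad (\<lambda>y. f t y v) x) = (\<Sum>i\<in>{1..r}. \<Sum>c\<in>UNIV. grad (X i t) x $ c * (\<Sum>j\<in>{1..r}. S i j t *
      ((U k v * v $ c) * (w v * V j t v))))" for v
  proof -
    have "U k v * (v \<bullet> grad (\<lambda>y. f t y v) x) = (\<Sum>c\<in>UNIV. \<Sum>i\<in>{1..r}. grad (X i t) x $ c * (\<Sum>j\<in>{1..r}. S i j t *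
      ((U k v * v $ c) * (w v * V j t v))))"
      unfolding grad_f_x[OF t] inner_vec_def by (simp add: sum_distrib_left mult_ac)
    also have "\<dots> = (\<Sum>i\<in>{1..r}. \<Sum>c\<in>UNIV. grad (X i t) x $ c * (\<Sum>j\<in>{1..r}. S i j t *
      ((U k v * v $ c) * (w v * V j t v))))" by (rule sum.swap)
    finally show ?thesis .
  qed
  show ?thesis
    unfolding eq flux_def
    by (intro has_bochner_integral_sum has_bochner_integral_mult_right I_has_integral majorized_Uv k t)
qed

lemma tested_drift:
  assumes k: "k \<in> {1..m}" "grad_majorized k" and t: "t \<in> {0..T}"
  shows "(LBINT v. V k t v * rhs_drift (f t) (E t) x v) = - flux k t x + E t x \<bullet> P k t x"
proof -
  have "has_bochner_integral lborel (\<lambda>v. - (U k v * (v \<bullet> grad (\<lambda>y. f t y v) x)) + - (U k v * (E t x \<bullet> grad (f t x) v)))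
      (- flux k t x + - (- (E t x \<bullet> P k t x)))"
    by (intro has_bochner_integral_add has_bochner_integral_minus transport_integral force_integral k t)
  moreover have "V k t v * rhs_drift (f t) (E t) x v = - (U k v * (v \<bullet> grad (\<lambda>y. f t y v) x)) + - (U k v * (E t x \<bullet> grad (f t x) v))" for v
    by (simp add: rhs_drift_def fixed_modes[OF k(1) t] algebra_simps)
  ultimately show ?thesis by (simp add: has_bochner_integral_integral_eq)
qed

lemma tested_noise:
  assumes k: "k \<in> {1..m}" "grad_majorized k" and t: "t \<in> {0..T}"
  shows "(LBINT v. V k t v * rhs_noise s (f t) x v) = s x \<bullet> P k t x"
proof -
  have "has_bochner_integral lborel (\<lambda>v. - (U k v * (s x \<bullet> grad (f t x) v))) (- (- (s x \<bullet> P k t x)))"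
    by (intro has_bochner_integral_minus force_integral k t)
  moreover have "V k t v * rhs_noise s (f t) x v = - (U k v * (s x \<bullet> grad (f t x) v))" for v
    by (simp add: rhs_noise_def fixed_modes[OF k(1) t])
  ultimately show ?thesis by (simp only: has_bochner_integral_integral_eq minus_minus)
qed

lemma P_component:
  assumes "grad_majorized k" "t \<in> {0..T}"
  shows "P k t x $ b = (\<integral>v. grad (U k) v $ b * f t x v \<partial>lborel)"
  using has_bochner_integral_integral_eq[OF moment[of "\<lambda>v. grad (U k) v $ b" t x]] assms
  by (simp add: P_def grad_majorized_def)

lemma grad_U: "grad (U 1) v = 0" "grad (U (kv b)) v = (1 / nv b) *\<^sub>R axis b 1" "grad (U kchi) v = (2 / nchi) *\<^sub>R v"
proof -
  have "U 1 = (\<lambda>_. 1 / n1)" "U (kv b) = (\<lambda>v. (1 / nv b) * v $ b)"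
    and chi: "U kchi = (\<lambda>v. (1 / nchi) * (norm v)\<^sup>2 + - alpha / nchi)"
    by (auto simp: U1 Ukv Ukchi diff_divide_distrib)
  then show "grad (U 1) v = 0" "grad (U (kv b)) v = (1 / nv b) *\<^sub>R axis b 1"
    by (simp_all only: grad_const grad_cmult[OF differentiable_coordinate] grad_coordinate)
  have nd: "(\<lambda>v::real^'d. (norm v)\<^sup>2) differentiable (at v)" using has_derivative_norm_sq differentiable_def by blast
  have "grad (\<lambda>v. (1 / nchi) * (norm v)\<^sup>2 + - alpha / nchi) v = grad (\<lambda>v. (1 / nchi) * (norm v)\<^sup>2) v + grad (\<lambda>_. - alpha / nchi) v"
    by (intro grad_add differentiable_mult differentiable_const nd)
  then show "grad (U kchi) v = (2 / nchi) *\<^sub>R v"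
    unfolding chi by (simp only: grad_cmult[OF nd] grad_norm_sq grad_const) simp
qed

lemma grad_majorized_modes: "grad_majorized 1" "grad_majorized (kv b)" "grad_majorized kchi"
  using majorized_cmult[OF majorized_1, of 0] majorized_cmult[OF majorized_1] majorized_cmult[OF majorized_v, of "2 / nchi"]
  by (auto simp: grad_majorized_def grad_U axis_def intro!: majorized_1)

text \<open>The gradients of the fixed modes are zero, constant and linear in v. Hence a force
  leaves the mass equation untouched, enters the momentum equation through \<rho> and the energy
  equation through J.\<close>

lemma P_modes:
  assumes t: "t \<in> {0..T}"
  shows "P 1 t x = 0" "P (kv b) t x = (\<rho> t x / nv b) *\<^sub>R axis b 1" "P kchi t x = (2 / nchi) *\<^sub>R J t x"
proof -
  show "P 1 t x = 0"
    by (simp add: vec_eq_iff P_component[OF grad_majorized_modes(1) t] grad_U)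
  have "P (kv b) t x $ c = ((1 / nv b) * axis b 1 $ c) * \<rho> t x" for c
    by (simp add: P_component[OF grad_majorized_modes(2) t] grad_U \<rho>_def mass_density_def)
  then show "P (kv b) t x = (\<rho> t x / nv b) *\<^sub>R axis b 1" by (simp add: vec_eq_iff)
  have "J t x $ c = (\<integral>v. v $ c * f t x v \<partial>lborel)" for c
  proof -
    have "J t x $ c = nv c * K (kv c) t x" by (simp add: J_def momentum_density_eq[OF t])
    also have "\<dots> = (\<integral>v. v $ c * f t x v \<partial>lborel)"
      using has_bochner_integral_integral_eq[OF moment[OF majorized_v[of c] t, of x]] modes_r[OF modes(2), of c] t
      by (simp add: I_v K_def if_distrib[of "\<lambda>c. _ * c"] sum.delta' sum_distrib_left mult_ac cong: if_cong)
    finally show ?thesis .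
  qed
  then have "P kchi t x $ c = (2 / nchi) * J t x $ c" for c
    by (simp add: P_component[OF grad_majorized_modes(3) t] grad_U mult.assoc)
  then show "P kchi t x = (2 / nchi) *\<^sub>R J t x" by (simp add: vec_eq_iff)
qed

section \<open>Densities and fluxes in terms of the coefficients \<open>K k\<close>\<close>

lemma K_C1: "k \<in> {1..r} \<Longrightarrow> t \<in> {0..T} \<Longrightarrow> C1_periodic L (K k t)"
  unfolding K_def[abs_def] by (intro C1_periodic_sum C1_periodic_mult C1_periodic_const X_C1) auto

lemma grad_K: "k \<in> {1..r} \<Longrightarrow> t \<in> {0..T} \<Longrightarrow> grad (K k t) x = (\<Sum>i\<in>{1..r}. S i k t *\<^sub>R grad (X i t) x)"
proof -
  assume t: "t \<in> {0..T}"
  have "K k t = (\<lambda>x. \<Sum>i\<in>{1..r}. S i k t * X i t x)" by (auto simp: K_def mult.commute)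
  then have "grad (K k t) x = (\<Sum>i\<in>{1..r}. grad (\<lambda>x. S i k t * X i t x) x)"
    by (simp only:) (rule grad_sum, auto intro!: differentiable_mult X_diff t)
  also have "\<dots> = (\<Sum>i\<in>{1..r}. S i k t *\<^sub>R grad (X i t) x)"
    by (intro sum.cong refl grad_cmult X_diff t)
  finally show ?thesis .
qed

lemma K_cont: "k \<in> {1..r} \<Longrightarrow> continuous_on ({0..T} \<times> UNIV) (\<lambda>p. K k (fst p) (snd p))"
  unfolding K_def by (intro continuous_intros X_cont S_cont2)

lemma flux_cont: "k \<in> {1..m} \<Longrightarrow> continuous_on ({0..T} \<times> UNIV) (\<lambda>p. flux k (fst p) (snd p))"
  unfolding flux_def
  by (intro continuous_intros gX_cont S_cont2 continuous_on_compose2[OF I_cont[OF majorized_Uv]]) auto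

text \<open>Each term is a partial derivative of a periodic function of x with a coefficient
  independent of x.\<close>

lemma flux_integral_zero: "k \<in> {1..m} \<Longrightarrow> t \<in> {0..T} \<Longrightarrow> integral (cell L) (flux k t) = 0"
proof -
  assume t: "t \<in> {0..T}"
  have 1: "((\<lambda>x. grad (X i t) x $ c) has_integral 0) (cell L)" if i: "i \<in> {1..r}" for i c
  proof -
    note D = C1_periodicD[OF X_C1[OF i t]]
    have "integral (cell L) (\<lambda>x. grad (X i t) x $ c) = 0" by (rule integral_cell_grad_zero[OF L D(1,2,4)])
    moreover have "(\<lambda>x. grad (X i t) x $ c) integrable_on cell L" by (rule integrable_on_cell[OF D(4)])
    ultimately show ?thesis by (simp add: has_integral_integrable_integral)
  qed
  have "(flux k t has_integral (\<Sum>i\<in>{1..r}. \<Sum>c\<in>(UNIV::'d set). 0 * (\<Sum>j\<in>{1..r}. S i j t * I (\<lambda>v. U k v * v $ c) j t))) (cell L)"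
    unfolding flux_def[abs_def] by (intro has_integral_sum has_integral_mult_left 1) auto
  then show ?thesis by (simp add: integral_unique)
qed

lemma \<rho>_eq: "t \<in> {0..T} \<Longrightarrow> \<rho> t x = n1 * K 1 t x"
  by (simp add: \<rho>_def mass_density_eq)

lemma J_eq: "t \<in> {0..T} \<Longrightarrow> J t x $ b = nv b * K (kv b) t x"
  by (simp add: J_def momentum_density_eq)

lemma J_C1: "t \<in> {0..T} \<Longrightarrow> C1_periodic L (\<lambda>x. J t x $ b)"
  by (simp only: J_eq) (intro C1_periodic_mult C1_periodic_const K_C1 modes_r modes)

lemma \<rho>_cont: "continuous_on ({0..T} \<times> UNIV) (\<lambda>p. \<rho> (fst p) (snd p))"
proof -
  have "continuous_on ({0..T} \<times> UNIV) (\<lambda>p. n1 * K 1 (fst p) (snd p))" by (intro continuous_intros K_cont modes_r modes)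
  then show ?thesis by (rule continuous_on_eq) (auto simp: \<rho>_eq)
qed

lemma J_cont: "continuous_on ({0..T} \<times> UNIV) (\<lambda>p. J (fst p) (snd p))"
proof -
  have "continuous_on ({0..T} \<times> UNIV) (\<lambda>p. \<chi> b. nv b * K (kv b) (fst p) (snd p))" by (intro continuous_intros continuous_on_vec_lambda K_cont modes_r modes)
  then show ?thesis by (rule continuous_on_eq) (auto simp: J_eq vec_eq_iff)
qed

text \<open>For the second claim: \<open>n1\<close> times the mode 1 is the constant 1, so its flux
  is the divergence of the first velocity moment of f.\<close>

lemma divergence_J:
  assumes t: "t \<in> {0..T}"
  shows "divergence (J t) x = (\<Sum>b\<in>UNIV. grad (\<lambda>x. J t x $ b) x $ b)" "divergence (J t) x = n1 * flux 1 t x"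
proof -
  show 1: "divergence (J t) x = (\<Sum>b\<in>UNIV. grad (\<lambda>x. J t x $ b) x $ b)"
    by (rule divergence_eq) (rule C1_periodicD(2)[OF J_C1[OF t]])
  have "grad (\<lambda>x. J t x $ b) x $ b = (\<Sum>i\<in>{1..r}. grad (X i t) x $ b * (nv b * S i (kv b) t))" for b
    using grad_cmult[OF C1_periodicD(2)[OF K_C1[OF modes_r[OF modes(2)] t]]] grad_K[OF modes_r[OF modes(2)] t]
    by (simp add: J_eq[OF t] sum_distrib_left mult_ac)
  moreover have eqn: "n1 * (\<Sum>j\<in>{1..r}. S i j t * I (\<lambda>v. U 1 v * v $ b) j t) = nv b * S i (kv b) t" for i b
  proof -
    have "I (\<lambda>v. U 1 v * v $ b) j t = (if j = kv b then nv b / n1 else 0)" if "j \<in> {1..r}" for j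
      using I_cmult[of "1 / n1" "\<lambda>v. v $ b" j t] I_v[OF that t, of b] by (simp add: U1)
    then show ?thesis using modes_r[OF modes(2), of b] norms_nonzero(1)
      by (simp add: if_distrib[of "\<lambda>c. _ * c"] sum.delta' cong: if_cong)
  qed
  have "n1 * flux 1 t x = (\<Sum>i\<in>{1..r}. \<Sum>b\<in>UNIV. grad (X i t) x $ b * (nv b * S i (kv b) t))"
    unfolding flux_def eqn[symmetric] by (simp add: sum_distrib_left mult_ac)
  moreover have "(\<Sum>b\<in>UNIV. \<Sum>i\<in>{1..r}. grad (X i t) x $ b * (nv b * S i (kv b) t)) =
      (\<Sum>i\<in>{1..r}. \<Sum>b\<in>UNIV. grad (X i t) x $ b * (nv b * S i (kv b) t))" by (rule sum.swap)
  ultimately show "divergence (J t) x = n1 * flux 1 t x" using 1 by simp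
qed

text \<open>\<open>nv b\<close> times the mode \<open>kv b\<close> is v_b, so its flux is the
  divergence of row b of the second moments.\<close>

lemma mat_divergence_stress:
  assumes t: "t \<in> {0..T}"
  shows "mat_divergence (stress (f t)) x $ b = nv b * flux (kv b) t x"
proof -
  have I_vv: "I (\<lambda>v. v $ b * v $ c) j t = nv b * I (\<lambda>v. U (kv b) v * v $ c) j t" for b c j
    using I_cmult[of "nv b" "\<lambda>v. U (kv b) v * v $ c" j t] norms_nonzero(2)[of b] by (simp add: Ukv)
  have st: "stress (f t) x = (\<chi> b c. \<Sum>i\<in>{1..r}. \<Sum>j\<in>{1..r}. X i t x * S i j t * I (\<lambda>v. v $ b * v $ c) j t)" for x
    unfolding stress_def
  proof (intro has_bochner_integral_integral_eq has_bochner_integral_vec)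
    fix b c
    show "has_bochner_integral lborel (\<lambda>v. (f t x v *\<^sub>R outer v v) $ b $ c)
      ((\<chi> b c. \<Sum>i\<in>{1..r}. \<Sum>j\<in>{1..r}. X i t x * S i j t * I (\<lambda>v. v $ b * v $ c) j t) $ b $ c)"
      using moment[OF majorized_vv[of b c] t, of x] by (simp add: outer_def mult_ac)
  qed
  have comp: "(\<lambda>x. stress (f t) x $ b $ c) = (\<lambda>x. \<Sum>i\<in>{1..r}. (\<Sum>j\<in>{1..r}. S i j t * I (\<lambda>v. v $ b * v $ c) j t) * X i t x)" for b c
    by (simp add: st sum_distrib_left sum_distrib_right mult_ac)
  have "mat_divergence (stress (f t)) x $ b = (\<Sum>c\<in>UNIV. grad (\<lambda>x. stress (f t) x $ b $ c) x $ c)"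
    by (rule mat_divergence_eq, unfold comp) (auto intro!: differentiable_sum differentiable_mult X_diff t)
  also have "\<dots> = (\<Sum>c\<in>UNIV. \<Sum>i\<in>{1..r}. grad (X i t) x $ c * (\<Sum>j\<in>{1..r}. S i j t * I (\<lambda>v. v $ b * v $ c) j t))"
  proof (rule sum.cong[OF refl])
    fix c
    have "grad (\<lambda>x. stress (f t) x $ b $ c) x = (\<Sum>i\<in>{1..r}. grad (\<lambda>x. (\<Sum>j\<in>{1..r}. S i j t * I (\<lambda>v. v $ b * v $ c) j t) * X i t x) x)"
      unfolding comp by (rule grad_sum) (auto intro!: differentiable_mult X_diff t)
    also have "\<dots> = (\<Sum>i\<in>{1..r}. (\<Sum>j\<in>{1..r}. S i j t * I (\<lambda>v. v $ b * v $ c) j t) *\<^sub>R grad (X i t) x)"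
      by (intro sum.cong refl grad_cmult X_diff t)
    finally show "grad (\<lambda>x. stress (f t) x $ b $ c) x $ c = (\<Sum>i\<in>{1..r}. grad (X i t) x $ c * (\<Sum>j\<in>{1..r}. S i j t * I (\<lambda>v. v $ b * v $ c) j t))"
      by (simp add: mult.commute)
  qed
  also have "\<dots> = (\<Sum>i\<in>{1..r}. \<Sum>c\<in>UNIV. grad (X i t) x $ c * (\<Sum>j\<in>{1..r}. S i j t * I (\<lambda>v. v $ b * v $ c) j t))"
    by (rule sum.swap)
  also have "\<dots> = nv b * flux (kv b) t x"
    unfolding flux_def I_vv by (simp add: sum_distrib_left mult_ac)
  finally show ?thesis .
qed

text \<open>|v|^2 is a combination of the mode of \<chi>_2 and the constant function; the constant
  contributes a multiple of the mass density.\<close>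

lemma kinetic_energy_density:
  assumes t: "t \<in> {0..T}"
  shows "(LBINT v. (norm v)\<^sup>2 * f t x v) = nchi * K kchi t x + alpha * \<rho> t x"
proof -
  have "has_bochner_integral lborel (\<lambda>v. nchi * (U kchi v * f t x v) + alpha * (1 * f t x v))
     (nchi * (\<Sum>i\<in>{1..r}. \<Sum>j\<in>{1..r}. X i t x * S i j t * I (U kchi) j t) +
      alpha * (\<Sum>i\<in>{1..r}. \<Sum>j\<in>{1..r}. X i t x * S i j t * I (\<lambda>_. 1) j t))"
    by (intro has_bochner_integral_add has_bochner_integral_mult_right moment majorized_U majorized_1 modes t)
  moreover have "nchi * (U kchi v * f t x v) + alpha * (1 * f t x v) = (norm v)\<^sup>2 * f t x v" for v
    using norms_nonzero(3) by (simp add: Ukchi field_simps)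
  ultimately have "(LBINT v. (norm v)\<^sup>2 * f t x v) = nchi * (\<Sum>i\<in>{1..r}. \<Sum>j\<in>{1..r}. X i t x * S i j t * I (U kchi) j t) +
      alpha * (\<Sum>i\<in>{1..r}. \<Sum>j\<in>{1..r}. X i t x * S i j t * I (\<lambda>_. 1) j t)"
    by (simp add: has_bochner_integral_integral_eq)
  also have "(\<Sum>i\<in>{1..r}. \<Sum>j\<in>{1..r}. X i t x * S i j t * I (U kchi) j t) = K kchi t x"
    using modes_r[OF modes(3)] t modes(3)
    by (simp add: I_U K_def if_distrib[of "\<lambda>c. _ * c"] sum.delta' cong: if_cong)
  also have "(\<Sum>i\<in>{1..r}. \<Sum>j\<in>{1..r}. X i t x * S i j t * I (\<lambda>_. 1) j t) = \<rho> t x"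
    using has_bochner_integral_integral_eq[OF moment[OF majorized_1 t, of x]] by (simp add: \<rho>_def mass_density_def)
  finally show ?thesis .
qed

end

section \<open>Stratonovich integrals of vector fields and of vanishing integrands\<close>

lemma eventually_partition_mesh: "\<forall>\<^sub>F p in mesh_to_zero t. case p of (n, \<pi>) \<Rightarrow> partition_of t n \<pi>"
  unfolding mesh_to_zero_def
  by (rule eventually_INF1[of 1]) (auto simp: eventually_principal)

lemma partition_of_mem:
  assumes "partition_of t n \<pi>" "i \<le> n"
  shows "\<pi> i \<in> {0..t}"
proof -
  have mono: "\<pi> i \<le> \<pi> j" if "i \<le> j" "j \<le> n" for i j
    using that assms(1) by (induction j rule: dec_induct) (auto simp: partition_of_def intro: order.trans)
  from mono[of 0 i] mono[of i n] assms show ?thesis by (auto simp: partition_of_def)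
qed

text \<open>Domination is available only for genuine partitions: other point sequences may leave
  [0, T], where nothing relates the integrands.\<close>

lemma null_in_prob_mono_eventually:
  assumes "null_in_prob M G D" "\<forall>\<^sub>F q in G. Q q" "AE \<omega> in M. \<forall>q. Q q \<longrightarrow> D' q \<omega> \<le> D q \<omega>"
  shows "null_in_prob M G D'"
proof -
  define D'' where "D'' q \<omega> = (if Q q then D' q \<omega> else 0)" for q \<omega>
  have "null_in_prob M G D''"
    by (rule null_in_prob_mono_AE[OF assms(1)]) (use assms(3) in \<open>eventually_elim, auto simp: D''_def\<close>)
  show ?thesis
    unfolding null_in_prob_def
  proof (intro allI impI)
    fix \<epsilon> \<eta> :: real assume "\<epsilon> > 0" "\<eta> > 0"
    with \<open>null_in_prob M G D''\<close>
    have "\<forall>\<^sub>F q in G. \<exists>A\<in>sets M. measure M A < \<eta> \<and> (\<forall>\<omega>\<in>space M - A. D'' q \<omega> \<le> ennreal \<epsilon>)"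
      unfolding null_in_prob_def by blast
    with assms(2) show "\<forall>\<^sub>F q in G. \<exists>A\<in>sets M. measure M A < \<eta> \<and> (\<forall>\<omega>\<in>space M - A. D' q \<omega> \<le> ennreal \<epsilon>)"
      by eventually_elim (simp add: D''_def)
  qed
qed

text \<open>The supremum over C of the vector error is bounded by the sum of the componentwise
  suprema; the scalars \<open>c b\<close> absorb the normalization of the modes.\<close>

lemma (in prob_space) has_strat_integral_vec:
  fixes Y I :: "real \<Rightarrow> 'a \<Rightarrow> 'p::topological_space \<Rightarrow> real^'n"
  assumes J: "\<And>b. has_strat_integral M T (Yb b) Z (Ib b)"
    and Y: "AE \<omega> in M. \<forall>t\<in>{0..T}. \<forall>p b. Y t \<omega> p $ b = c b * Yb b t \<omega> p"
    and I: "\<And>t \<omega> p b. I t \<omega> p $ b = c b * Ib b t \<omega> p"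
  shows "has_strat_integral M T Y Z I"
  unfolding has_strat_integral_def
proof (intro conjI ballI allI impI)
  have "AE \<omega> in M. \<forall>b. continuous_on ({0..T} \<times> UNIV) (\<lambda>(t, p). Ib b t \<omega> p)"
    unfolding AE_all_countable using J by (simp add: has_strat_integral_def)
  then show "AE \<omega> in M. continuous_on ({0..T} \<times> UNIV) (\<lambda>(t, p). I t \<omega> p)"
  proof eventually_elim
    case (elim \<omega>)
    have "continuous_on ({0..T} \<times> UNIV) (\<lambda>x. \<chi> b. c b * (case x of (t, p) \<Rightarrow> Ib b t \<omega> p))"
      using elim by (intro continuous_on_vec_lambda continuous_intros) auto
    moreover have "(\<lambda>x. \<chi> b. c b * (case x of (t, p) \<Rightarrow> Ib b t \<omega> p)) = (\<lambda>(t, p). I t \<omega> p)"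
      by (auto simp: fun_eq_iff vec_eq_iff I)
    ultimately show ?case by (simp only:)
  qed
next
  fix t and C :: "'p set" assume t: "t \<in> {0..T}" and C: "compact C"
  define D where "D b = (\<lambda>(n, \<pi>) \<omega>. SUP p\<in>C. ennreal (norm ((\<Sum>i<n. (Z (\<pi> (Suc i)) \<omega> p - Z (\<pi> i) \<omega> p) *\<^sub>R
      ((1/2) *\<^sub>R (Yb b (\<pi> i) \<omega> p + Yb b (\<pi> (Suc i)) \<omega> p))) - Ib b t \<omega> p)))" for b
  have D: "null_in_prob M (mesh_to_zero t) (D b)" for b
    using J[of b] t C unfolding D_def has_strat_integral_def by blast
  have sum: "null_in_prob M (mesh_to_zero t) (\<lambda>q \<omega>. \<Sum>b\<in>UNIV. ennreal \<bar>c b\<bar> * D b q \<omega>)"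
    by (intro null_in_prob_sum null_in_prob_cmult D) auto
  show "null_in_prob M (mesh_to_zero t) (\<lambda>(n, \<pi>) \<omega>. SUP p\<in>C. ennreal (norm ((\<Sum>i<n. (Z (\<pi> (Suc i)) \<omega> p - Z (\<pi> i) \<omega> p) *\<^sub>R
      ((1/2) *\<^sub>R (Y (\<pi> i) \<omega> p + Y (\<pi> (Suc i)) \<omega> p))) - I t \<omega> p)))"
  proof (rule null_in_prob_mono_eventually[OF sum eventually_partition_mesh], use Y in eventually_elim, intro allI impI)
    case (elim \<omega>)
    fix q :: "nat \<times> (nat \<Rightarrow> real)" assume q: "case q of (n, \<pi>) \<Rightarrow> partition_of t n \<pi>"
    obtain n \<pi> where nq: "q = (n, \<pi>)" by (cases q)
    have mem: "\<pi> i \<in> {0..T}" if "i \<le> n" for i using partition_of_mem[of t n \<pi> i] q nq that t by auto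
    have "ennreal (norm ((\<Sum>i<n. (Z (\<pi> (Suc i)) \<omega> p - Z (\<pi> i) \<omega> p) *\<^sub>R
      ((1/2) *\<^sub>R (Y (\<pi> i) \<omega> p + Y (\<pi> (Suc i)) \<omega> p))) - I t \<omega> p)) \<le> (\<Sum>b\<in>UNIV. ennreal \<bar>c b\<bar> * D b q \<omega>)"
      (is "ennreal (norm ?v) \<le> _") if p: "p \<in> C" for p
    proof -
      define d where "d b = (\<Sum>i<n. (Z (\<pi> (Suc i)) \<omega> p - Z (\<pi> i) \<omega> p) *\<^sub>R
        ((1/2) *\<^sub>R (Yb b (\<pi> i) \<omega> p + Yb b (\<pi> (Suc i)) \<omega> p))) - Ib b t \<omega> p" for b
      have "?v $ b = c b * d b" for b
      proof -
        have "?v $ b = (\<Sum>i<n. (Z (\<pi> (Suc i)) \<omega> p - Z (\<pi> i) \<omega> p) * ((1/2) * (Y (\<pi> i) \<omega> p $ b + Y (\<pi> (Suc i)) \<omega> p $ b))) - I t \<omega> p $ b"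
          by simp
        also have "(\<Sum>i<n. (Z (\<pi> (Suc i)) \<omega> p - Z (\<pi> i) \<omega> p) * ((1/2) * (Y (\<pi> i) \<omega> p $ b + Y (\<pi> (Suc i)) \<omega> p $ b))) =
            (\<Sum>i<n. c b * ((Z (\<pi> (Suc i)) \<omega> p - Z (\<pi> i) \<omega> p) * ((1/2) * (Yb b (\<pi> i) \<omega> p + Yb b (\<pi> (Suc i)) \<omega> p))))"
        proof (rule sum.cong[OF refl])
          fix i assume i: "i \<in> {..<n}"
          then have "Y (\<pi> i) \<omega> p $ b = c b * Yb b (\<pi> i) \<omega> p" "Y (\<pi> (Suc i)) \<omega> p $ b = c b * Yb b (\<pi> (Suc i)) \<omega> p"
            using elim mem by auto
          then show "(Z (\<pi> (Suc i)) \<omega> p - Z (\<pi> i) \<omega> p) * ((1/2) * (Y (\<pi> i) \<omega> p $ b + Y (\<pi> (Suc i)) \<omega> p $ b)) =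
            c b * ((Z (\<pi> (Suc i)) \<omega> p - Z (\<pi> i) \<omega> p) * ((1/2) * (Yb b (\<pi> i) \<omega> p + Yb b (\<pi> (Suc i)) \<omega> p)))"
            by (simp only:) (simp add: field_simps)
        qed
        finally show ?thesis by (simp add: I d_def right_diff_distrib sum_distrib_left)
      qed
      then have "norm ?v \<le> (\<Sum>b\<in>UNIV. \<bar>c b\<bar> * \<bar>d b\<bar>)"
        using norm_le_l1_cart[of ?v] by (simp add: abs_mult)
      then have "ennreal (norm ?v) \<le> ennreal (\<Sum>b\<in>UNIV. \<bar>c b\<bar> * \<bar>d b\<bar>)" by (rule ennreal_leI)
      also have "\<dots> = (\<Sum>b\<in>UNIV. ennreal \<bar>c b\<bar> * ennreal \<bar>d b\<bar>)"
        by (simp add: ennreal_mult flip: sum_ennreal)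
      also have "\<dots> \<le> (\<Sum>b\<in>UNIV. ennreal \<bar>c b\<bar> * D b q \<omega>)"
      proof (intro sum_mono mult_left_mono)
        show "ennreal \<bar>d b\<bar> \<le> D b q \<omega>" for b
          unfolding D_def nq d_def using p by (auto intro!: SUP_upper2)
      qed simp
      finally show ?thesis .
    qed
    then show "(case q of (n, \<pi>) \<Rightarrow> \<lambda>\<omega>. SUP p\<in>C. ennreal (norm ((\<Sum>i<n. (Z (\<pi> (Suc i)) \<omega> p - Z (\<pi> i) \<omega> p) *\<^sub>R
      ((1/2) *\<^sub>R (Y (\<pi> i) \<omega> p + Y (\<pi> (Suc i)) \<omega> p))) - I t \<omega> p))) \<omega> \<le> (\<Sum>b\<in>UNIV. ennreal \<bar>c b\<bar> * D b q \<omega>)"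
      unfolding nq by (auto intro: SUP_least)
  qed
qed

text \<open>At each fixed time and point the integral is zero almost surely; a countable dense set
  and continuity make the null set independent of both.\<close>

lemma (in prob_space) has_strat_integral_zero:
  fixes Y I :: "real \<Rightarrow> 'a \<Rightarrow> 'p::euclidean_space \<Rightarrow> real"
  assumes J: "has_strat_integral M T Y Z I" and Y: "AE \<omega> in M. \<forall>t\<in>{0..T}. \<forall>p. Y t \<omega> p = 0"
  shows "AE \<omega> in M. \<forall>t\<in>{0..T}. \<forall>p. I t \<omega> p = 0"
proof -
  obtain Q :: "(real \<times> 'p) set" where Q: "countable Q" "Q \<subseteq> {0..T} \<times> UNIV" "{0..T} \<times> UNIV \<subseteq> closure Q"
    using separable by metis
  have "AE \<omega> in M. \<forall>x\<in>Q. I (fst x) \<omega> (snd x) = 0"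
    unfolding AE_ball_countable[OF Q(1)]
  proof
    fix x assume "x \<in> Q"
    then obtain t p where x: "x = (t, p)" and t: "t \<in> {0..T}" using Q(2) by (cases x) auto
    let ?X = "\<lambda>q \<omega>. \<Sum>i<2 ^ q. (Z (grid t q (Suc i)) \<omega> p - Z (grid t q i) \<omega> p) *\<^sub>R
      ((1/2) *\<^sub>R (Y (grid t q i) \<omega> p + Y (grid t q (Suc i)) \<omega> p))"
    have "null_in_prob M sequentially (\<lambda>q \<omega>. ennreal \<bar>?X q \<omega> - I t \<omega> p\<bar>)"
      using has_strat_integral_grid[OF J t, of "{p}"] by simp
    moreover have "AE \<omega> in M. (\<lambda>q. ?X q \<omega>) \<longlonglongrightarrow> 0"
      using Y
    proof eventually_elim
      case (elim \<omega>)
      have "?X q \<omega> = 0" for q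
      proof (rule sum.neutral, rule ballI)
        fix i :: nat assume "i \<in> {..<2 ^ q}"
        then have "grid t q i \<in> {0..T}" "grid t q (Suc i) \<in> {0..T}"
          using grid_bounds[of t i q] grid_bounds[of t "Suc i" q] t by auto
        then show "(Z (grid t q (Suc i)) \<omega> p - Z (grid t q i) \<omega> p) *\<^sub>R
          ((1/2) *\<^sub>R (Y (grid t q i) \<omega> p + Y (grid t q (Suc i)) \<omega> p)) = 0" using elim by simp
      qed
      then show ?case by simp
    qed
    ultimately have "AE \<omega> in M. I t \<omega> p = 0" by (rule null_in_prob_limit_unique)
    then show "AE \<omega> in M. I (fst x) \<omega> (snd x) = 0" by (simp add: x)
  qed
  moreover have "AE \<omega> in M. continuous_on ({0..T} \<times> UNIV) (\<lambda>(t, p). I t \<omega> p)"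
    using J by (simp add: has_strat_integral_def)
  ultimately show ?thesis
  proof eventually_elim
    case (elim \<omega>)
    show ?case
    proof (intro ballI allI)
      fix t p assume t: "t \<in> {0..T}"
      then have "(t, p) \<in> closure Q" using Q(3) by auto
      then obtain s where s: "\<And>n. s n \<in> Q" "s \<longlonglongrightarrow> (t, p)" unfolding closure_sequential by blast
      have "s n \<in> {0..T} \<times> UNIV" for n using s(1) Q(2) by blast
      then have "(\<lambda>n. (\<lambda>(t, p). I t \<omega> p) (s n)) \<longlonglongrightarrow> (\<lambda>(t, p). I t \<omega> p) (t, p)"
        using t by (intro continuous_on_tendsto_compose[OF elim(2) s(2)] always_eventually) auto
      moreover have "(\<lambda>(t, p). I t \<omega> p) (s n) = 0" for n using elim(1) s(1)[of n] by (auto simp: split_beta)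
      ultimately show "I t \<omega> p = 0" by (simp add: LIMSEQ_const_iff)
    qed
  qed
qed

subsection \<open>The low-rank dynamics\<close>

locale lowrank_dynamics = filtered_space M F
  for M :: "'w measure" and F :: "real \<Rightarrow> 'w measure" +
  fixes \<beta> :: "'k::finite \<Rightarrow> real \<Rightarrow> 'w \<Rightarrow> real" and \<sigma> :: "real^'d::finite \<Rightarrow> real^'k^'d"
    and L T :: real and r m :: nat and w :: "real^'d \<Rightarrow> real"
    and X :: "nat \<Rightarrow> real \<Rightarrow> 'w \<Rightarrow> real^'d \<Rightarrow> real" and S :: "nat \<Rightarrow> nat \<Rightarrow> real \<Rightarrow> 'w \<Rightarrow> real"
    and V :: "nat \<Rightarrow> real \<Rightarrow> 'w \<Rightarrow> real^'d \<Rightarrow> real" and U :: "nat \<Rightarrow> real^'d \<Rightarrow> real"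
    and e :: "nat \<Rightarrow> 'd" and u :: "real \<Rightarrow> 'w \<Rightarrow> real^'d \<Rightarrow> real"
    and f :: "real \<Rightarrow> 'w \<Rightarrow> real^'d \<Rightarrow> real^'d \<Rightarrow> real" and E :: "real \<Rightarrow> 'w \<Rightarrow> real^'d \<Rightarrow> real^'d"
    and \<rho> :: "real \<Rightarrow> 'w \<Rightarrow> real^'d \<Rightarrow> real" and J :: "real \<Rightarrow> 'w \<Rightarrow> real^'d \<Rightarrow> real^'d"
  assumes LT: "0 < L" "0 < T"
    and independent: "independent_brownian_motions M F \<beta>"
    and sigma: "continuous_on UNIV \<sigma>"
    and weight: "admissible_weight w"
    and f_def: "f = lowrank_density r w X S V"
    and \<rho>_def: "\<rho> = (\<lambda>t \<omega>. mass_density (f t \<omega>))"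
    and J_def: "J = (\<lambda>t \<omega>. momentum_density (f t \<omega>))"
    and E_def: "E = (\<lambda>t \<omega> x. - grad (u t \<omega>) x)"
    and poisson: "AE \<omega> in M. \<forall>t\<in>{0..T}. poisson_potential L (\<rho> t \<omega>) (u t \<omega>)"
    and rank: "CARD('d) + 2 \<le> m" "m \<le> r"
    and enum: "bij_betw e {1..CARD('d)} UNIV"
    and U_1: "U 1 = (\<lambda>v. 1 / norm_v w (\<lambda>_. 1))"
    and U_v: "\<And>i. i \<in> {1..CARD('d)} \<Longrightarrow> U (i + 1) = (\<lambda>v. v $ e i / norm_v w (\<lambda>v. v $ e i))"
    and U_chi: "U (CARD('d) + 2) = (\<lambda>v. chi2 w v / norm_v w (chi2 w))"
    and fixed_modes: "\<And>a t \<omega>. a \<in> {1..m} \<Longrightarrow> t \<in> {0..T} \<Longrightarrow> \<omega> \<in> space M \<Longrightarrow> V a t \<omega> = U a"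
    and adapted_X: "\<And>i x. i \<in> {1..r} \<Longrightarrow> adapted_upto F T (\<lambda>t \<omega>. X i t \<omega> x)"
    and adapted_S: "\<And>i j. i \<in> {1..r} \<Longrightarrow> j \<in> {1..r} \<Longrightarrow> adapted_upto F T (S i j)"
    and regular: "AE \<omega> in M. regular_path T L w r
      (\<lambda>i t. X i t \<omega>) (\<lambda>i j t. S i j t \<omega>) (\<lambda>j t. V j t \<omega>) (\<lambda>t. E t \<omega>)"
    and orthonormal: "AE \<omega> in M. \<forall>t\<in>{0..T}. orthonormal_modes (inner_v w) r (\<lambda>j. V j t \<omega>)"
    and K_eq: "K_equation M T \<beta> \<sigma> r f E X S V"
begin

lemmas [simp del] = One_nat_def

abbreviation "n1 \<equiv> lowrank_path.n1 w"
abbreviation "nv \<equiv> lowrank_path.nv w"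
abbreviation "nchi \<equiv> lowrank_path.nchi w"
abbreviation "kv \<equiv> lowrank_path.kv e"

definition "K k t \<omega> x = (\<Sum>i\<in>{1..r}. X i t \<omega> x * S i k t \<omega>)"
text \<open>\<open>D k\<close> and \<open>Y k l\<close> are the coefficients of dt and of d\<beta>_l
  in the equation for \<open>K k\<close>.\<close>

definition "D k t \<omega> x = (LBINT v. V k t \<omega> v * rhs_drift (f t \<omega>) (E t \<omega>) x v)"
definition "Y k l t \<omega> x = (LBINT v. V k t \<omega> v * rhs_noise (\<lambda>x. column l (\<sigma> x)) (f t \<omega>) x v)"

definition "sample_path \<omega> \<longleftrightarrow> lowrank_path T L w r m U e (\<lambda>i t. X i t \<omega>) (\<lambda>j t. V j t \<omega>) (\<lambda>i j t. S i j t \<omega>) (\<lambda>t. E t \<omega>) \<and>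
  (\<forall>t\<in>{0..T}. poisson_potential L (\<rho> t \<omega>) (u t \<omega>))"

lemma AE_path: "AE \<omega> in M. sample_path \<omega>"
  using regular poisson orthonormal AE_space
proof eventually_elim
  case (elim \<omega>)
  have "lowrank_path T L w r m U e (\<lambda>i t. X i t \<omega>) (\<lambda>j t. V j t \<omega>) (\<lambda>i j t. S i j t \<omega>) (\<lambda>t. E t \<omega>)"
    by (unfold_locales) (use LT weight rank enum U_1 U_v U_chi fixed_modes elim in auto)
  with elim(2) show ?case by (simp add: sample_path_def)
qed

context
  fixes \<omega> assumes path: "sample_path \<omega>"
begin

interpretation P: lowrank_path T L w r m U e "\<lambda>i t. X i t \<omega>" "\<lambda>j t. V j t \<omega>" "\<lambda>i j t. S i j t \<omega>" "\<lambda>t. E t \<omega>"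
  using path by (simp add: sample_path_def)

lemma P_f: "P.f t = f t \<omega>"
  by (simp add: fun_eq_iff P.f_def f_def lowrank_density_def)

lemma P_\<rho>: "P.\<rho> t = \<rho> t \<omega>" and P_J: "P.J t = J t \<omega>"
  by (simp_all add: P.\<rho>_def P.J_def \<rho>_def J_def P_f)

lemma P_K: "P.K k t x = K k t \<omega> x"
  by (simp add: P.K_def K_def)

lemma poisson_path: "t \<in> {0..T} \<Longrightarrow> poisson_potential L (\<rho> t \<omega>) (u t \<omega>)"
  using path by (simp add: sample_path_def)

lemma modes_path: "1 \<in> {1..m}" "kv b \<in> {1..m}" "(lowrank_path.kchi TYPE('d)) \<in> {1..m}" and norms_path: "n1 \<noteq> 0" "nv b \<noteq> 0" "nchi \<noteq> 0"
  using P.modes P.norms_nonzero by auto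

lemma \<rho>_path: "t \<in> {0..T} \<Longrightarrow> \<rho> t \<omega> x = n1 * K 1 t \<omega> x"
  and J_path: "t \<in> {0..T} \<Longrightarrow> J t \<omega> x $ b = nv b * K (kv b) t \<omega> x"
  and \<rho>_cont: "continuous_on ({0..T} \<times> UNIV) (\<lambda>p. \<rho> (fst p) \<omega> (snd p))"
  and J_cont: "continuous_on ({0..T} \<times> UNIV) (\<lambda>p. J (fst p) \<omega> (snd p))"
  and E_cont: "continuous_on ({0..T} \<times> UNIV) (\<lambda>p. E (fst p) \<omega> (snd p))"
  and K_cont: "k \<in> {1..r} \<Longrightarrow> continuous_on ({0..T} \<times> UNIV) (\<lambda>p. K k (fst p) \<omega> (snd p))"
  and J_C1: "t \<in> {0..T} \<Longrightarrow> C1_periodic L (\<lambda>x. J t \<omega> x $ b)"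
  using P.\<rho>_eq P.J_eq P.\<rho>_cont P.J_cont P.E_cont P.K_cont[of k] P.J_C1[of t b] by (auto simp: P_\<rho> P_J P_K)

lemma divergence_J_path: "t \<in> {0..T} \<Longrightarrow> divergence (J t \<omega>) x = (\<Sum>b\<in>UNIV. grad (\<lambda>x. J t \<omega> x $ b) x $ b)"
  using P.divergence_J(1)[of t x] by (simp add: P_J)

lemma divergence_J_cont: "continuous_on ({0..T} \<times> UNIV) (\<lambda>p. divergence (J (fst p) \<omega>) (snd p))"
proof -
  have "continuous_on ({0..T} \<times> UNIV) (\<lambda>p. n1 * P.flux 1 (fst p) (snd p))"
    by (intro continuous_intros P.flux_cont P.modes)
  then show ?thesis by (rule continuous_on_eq) (use P.divergence_J(2) in \<open>auto simp: P_J\<close>)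
qed

lemma D_path:
  assumes t: "t \<in> {0..T}"
  shows "D 1 t \<omega> x = - (1 / n1) * divergence (J t \<omega>) x"
    and "D (kv b) t \<omega> x = (1 / nv b) * (- mat_divergence (stress (f t \<omega>)) x $ b + \<rho> t \<omega> x * E t \<omega> x $ b)"
    and "D (lowrank_path.kchi TYPE('d)) t \<omega> x = - P.flux (lowrank_path.kchi TYPE('d)) t x + (2 / nchi) * (E t \<omega> x \<bullet> J t \<omega> x)"
proof -
  note n = P.norms_nonzero
  show "D 1 t \<omega> x = - (1 / n1) * divergence (J t \<omega>) x"
    using P.tested_drift[OF P.modes(1) P.grad_majorized_modes(1) t, of x] P.divergence_J(2)[OF t, of x] n(1)
    by (simp add: D_def P_f P_J P.P_modes[OF t])
  show "D (kv b) t \<omega> x = (1 / nv b) * (- mat_divergence (stress (f t \<omega>)) x $ b + \<rho> t \<omega> x * E t \<omega> x $ b)"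
    using P.tested_drift[OF P.modes(2) P.grad_majorized_modes(2) t, of b x] P.mat_divergence_stress[OF t, of x b] n(2)[of b]
    by (simp add: D_def P_f P_\<rho> P.P_modes[OF t] inner_axis field_simps)
  show "D (lowrank_path.kchi TYPE('d)) t \<omega> x = - P.flux (lowrank_path.kchi TYPE('d)) t x + (2 / nchi) * (E t \<omega> x \<bullet> J t \<omega> x)"
    using P.tested_drift[OF P.modes(3) P.grad_majorized_modes(3) t, of x]
    by (simp add: D_def P_f P_J P.P_modes[OF t])
qed

lemma Y_path:
  assumes t: "t \<in> {0..T}"
  shows "Y 1 l t \<omega> x = 0" "Y (kv b) l t \<omega> x = \<sigma> x $ b $ l * \<rho> t \<omega> x / nv b"
    "Y (lowrank_path.kchi TYPE('d)) l t \<omega> x = (2 / nchi) * (column l (\<sigma> x) \<bullet> J t \<omega> x)"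
  using P.tested_noise[OF P.modes(1) P.grad_majorized_modes(1) t, of "\<lambda>x. column l (\<sigma> x)" x]
    P.tested_noise[OF P.modes(2) P.grad_majorized_modes(2) t, of b "\<lambda>x. column l (\<sigma> x)" x]
    P.tested_noise[OF P.modes(3) P.grad_majorized_modes(3) t, of "\<lambda>x. column l (\<sigma> x)" x]
  by (simp_all add: Y_def P_f P_\<rho> P_J P.P_modes[OF t] inner_axis column_def)

lemma D_cont:
  "continuous_on ({0..T} \<times> UNIV) (\<lambda>p. D 1 (fst p) \<omega> (snd p))"
  "continuous_on ({0..T} \<times> UNIV) (\<lambda>p. D (kv b) (fst p) \<omega> (snd p))"
  "continuous_on ({0..T} \<times> UNIV) (\<lambda>p. D (lowrank_path.kchi TYPE('d)) (fst p) \<omega> (snd p))"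
proof -
  have "continuous_on ({0..T} \<times> UNIV) (\<lambda>p. - (1 / n1) * divergence (J (fst p) \<omega>) (snd p))"
    by (intro continuous_intros divergence_J_cont)
  then show "continuous_on ({0..T} \<times> UNIV) (\<lambda>p. D 1 (fst p) \<omega> (snd p))"
    by (rule continuous_on_eq) (auto simp: D_path)
  have "continuous_on ({0..T} \<times> UNIV) (\<lambda>p. (1 / nv b) * (- (nv b * P.flux (kv b) (fst p) (snd p)) + \<rho> (fst p) \<omega> (snd p) * E (fst p) \<omega> (snd p) $ b))"
    by (intro continuous_intros P.flux_cont P.modes \<rho>_cont E_cont)
  then show "continuous_on ({0..T} \<times> UNIV) (\<lambda>p. D (kv b) (fst p) \<omega> (snd p))"
    by (rule continuous_on_eq) (use P.mat_divergence_stress in \<open>auto simp: D_path P_f\<close>)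
  have "continuous_on ({0..T} \<times> UNIV) (\<lambda>p. - P.flux (lowrank_path.kchi TYPE('d)) (fst p) (snd p) + (2 / nchi) * (E (fst p) \<omega> (snd p) \<bullet> J (fst p) \<omega> (snd p)))"
    by (intro continuous_intros P.flux_cont P.modes J_cont E_cont)
  then show "continuous_on ({0..T} \<times> UNIV) (\<lambda>p. D (lowrank_path.kchi TYPE('d)) (fst p) \<omega> (snd p))"
    by (rule continuous_on_eq) (auto simp: D_path)
qed

lemma slice_cont:
  assumes "continuous_on ({0..T} \<times> UNIV) (\<lambda>p. g (fst p) \<omega> (snd p))" "t \<in> {0..T}"
  shows "continuous_on A (g t \<omega>)"
  using P.at_time[of "\<lambda>t. g t \<omega>"] assms by simp

text \<open>The fluxes integrate to zero. What remains is the total electric force, which vanishes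
  for the self-consistent field, and in the energy equation the work done by the field.\<close>

lemma cell_D:
  assumes t: "t \<in> {0..T}"
  shows "integral (cell L) (D 1 t \<omega>) = 0" "integral (cell L) (D (kv b) t \<omega>) = 0"
    "integral (cell L) (D (lowrank_path.kchi TYPE('d)) t \<omega>) = (2 / nchi) * integral (cell L) (\<lambda>x. E t \<omega> x \<bullet> J t \<omega> x)"
proof -
  have fc: "continuous_on (cell L) (P.flux k t)" if "k \<in> {1..m}" for k using P.at_time[OF P.flux_cont[OF that] t] .
  have "D 1 t \<omega> = (\<lambda>x. - P.flux 1 t x)"
    using P.norms_nonzero(1) P.divergence_J(2)[OF t] by (auto simp: fun_eq_iff D_path[OF t] P_J)
  then show "integral (cell L) (D 1 t \<omega>) = 0" using P.flux_integral_zero[OF P.modes(1) t] by simp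
  have Ex: "E t \<omega> x $ b = - grad (u t \<omega>) x $ b" for x by (simp add: E_def)
  have "D (kv b) t \<omega> = (\<lambda>x. - P.flux (kv b) t x + (- 1 / nv b) * (\<rho> t \<omega> x * grad (u t \<omega>) x $ b))"
    using P.norms_nonzero(2)[of b] P.mat_divergence_stress[OF t, of _ b] by (auto simp: fun_eq_iff D_path[OF t] P_f Ex field_simps)
  moreover have "integral (cell L) (\<lambda>x. - P.flux (kv b) t x + (- 1 / nv b) * (\<rho> t \<omega> x * grad (u t \<omega>) x $ b)) =
      - integral (cell L) (P.flux (kv b) t) + (- 1 / nv b) * integral (cell L) (\<lambda>x. \<rho> t \<omega> x * grad (u t \<omega>) x $ b)"
  proof -
    note C = C1_periodicD(4)[OF poisson_potentialD(1)[OF poisson_path[OF t]]]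
    have "continuous_on (cell L) (\<lambda>x. \<rho> t \<omega> x * grad (u t \<omega>) x $ b)"
      by (intro continuous_intros C slice_cont[where g = \<rho>, OF \<rho>_cont t])
    then show ?thesis
      by (subst Henstock_Kurzweil_Integration.integral_add)
        (auto intro!: integrable_on_cell continuous_intros fc P.modes simp: P.norms_nonzero)
  qed
  ultimately show "integral (cell L) (D (kv b) t \<omega>) = 0"
    using P.flux_integral_zero[OF P.modes(2) t] poisson_force_zero[OF LT(1) poisson_path[OF t]] by simp
  have "D (lowrank_path.kchi TYPE('d)) t \<omega> = (\<lambda>x. - P.flux (lowrank_path.kchi TYPE('d)) t x + (2 / nchi) * (E t \<omega> x \<bullet> J t \<omega> x))"
    by (auto simp: fun_eq_iff D_path[OF t])
  moreover have "integral (cell L) (\<lambda>x. - P.flux (lowrank_path.kchi TYPE('d)) t x + (2 / nchi) * (E t \<omega> x \<bullet> J t \<omega> x)) =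
      - integral (cell L) (P.flux (lowrank_path.kchi TYPE('d)) t) + (2 / nchi) * integral (cell L) (\<lambda>x. E t \<omega> x \<bullet> J t \<omega> x)"
  proof -
    have "continuous_on (cell L) (\<lambda>x. E t \<omega> x \<bullet> J t \<omega> x)"
      by (intro continuous_intros slice_cont[where g = E, OF E_cont t] slice_cont[where g = J, OF J_cont t])
    then show ?thesis
      by (subst Henstock_Kurzweil_Integration.integral_add)
        (auto intro!: integrable_on_cell continuous_intros fc P.modes simp: P.norms_nonzero)
  qed
  ultimately show "integral (cell L) (D (lowrank_path.kchi TYPE('d)) t \<omega>) = (2 / nchi) * integral (cell L) (\<lambda>x. E t \<omega> x \<bullet> J t \<omega> x)"
    using P.flux_integral_zero[OF P.modes(3) t] by simp
qed

lemma kinetic_path: "t \<in> {0..T} \<Longrightarrow> (LBINT v. (norm v)\<^sup>2 * f t \<omega> x v) = nchi * K (lowrank_path.kchi TYPE('d)) t \<omega> x + lowrank_path.alpha w * \<rho> t \<omega> x"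
  using P.kinetic_energy_density[of t x] by (simp add: P_f P_\<rho> P_K)

end

end

lemma trapezoid_sum_cong:
  assumes "t \<in> {0..T}" "\<And>s. s \<in> {0..T} \<Longrightarrow> y s = y' s"
  shows "trapezoid_sum y b t q = trapezoid_sum y' b t q"
proof (intro sum.cong refl)
  fix i :: nat assume "i \<in> {..<2 ^ q}"
  then have "grid t q i \<in> {0..T}" "grid t q (Suc i) \<in> {0..T}"
    using grid_bounds[of t i q] grid_bounds[of t "Suc i" q] assms(1) by auto
  then show "incr b t q i * (1/2 * (y (grid t q i) + y (grid t q (Suc i)))) = incr b t q i * (1/2 * (y' (grid t q i) + y' (grid t q (Suc i))))"
    using assms(2) by simp
qed

lemma (in filtered_space) measurable_F_AE_limit:
  fixes X :: "nat \<Rightarrow> 'w \<Rightarrow> real"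
  assumes X [measurable]: "\<And>q. X q \<in> borel_measurable (F t)" and lim: "AE \<omega> in M. (\<lambda>q. X q \<omega>) \<longlonglongrightarrow> A \<omega>" and t: "0 \<le> t"
  shows "A \<in> borel_measurable (F t)"
proof (rule measurable_F_AE_cong[OF _ _ t])
  show "(\<lambda>\<omega>. lim (\<lambda>q. X q \<omega>)) \<in> borel_measurable (F t)" by measurable
  show "AE \<omega> in M. lim (\<lambda>q. X q \<omega>) = A \<omega>" using lim by eventually_elim (rule limI)
qed simp

section \<open>Balance equations tested in x\<close>

context lowrank_dynamics
begin

lemma ex_N: "\<exists>N. \<forall>k\<in>{1..r}. (\<forall>l. has_strat_integral M T (Y k l) (\<lambda>t \<omega> _. \<beta> l t \<omega>) (N k l)) \<and>
  (AE \<omega> in M. \<forall>t\<in>{0..T}. \<forall>x. K k t \<omega> x - K k 0 \<omega> x = (LBINT s:{0..t}. D k s \<omega> x) + (\<Sum>l\<in>UNIV. N k l t \<omega> x))"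
proof (rule bchoice, rule ballI)
  fix k assume "k \<in> {1..r}"
  then have "tested_rhs M T \<beta> \<sigma> f E (\<lambda>t \<omega> x h. LBINT v. V k t \<omega> v * h x v)
       (\<lambda>t \<omega> x. (\<Sum>i\<in>{1..r}. X i t \<omega> x * S i k t \<omega>) - (\<Sum>i\<in>{1..r}. X i 0 \<omega> x * S i k 0 \<omega>))"
    using K_eq by (simp add: K_equation_def)
  then show "\<exists>N. (\<forall>l. has_strat_integral M T (Y k l) (\<lambda>t \<omega> _. \<beta> l t \<omega>) (N l)) \<and>
    (AE \<omega> in M. \<forall>t\<in>{0..T}. \<forall>x. K k t \<omega> x - K k 0 \<omega> x = (LBINT s:{0..t}. D k s \<omega> x) + (\<Sum>l\<in>UNIV. N l t \<omega> x))"
    unfolding tested_rhs_def Y_def[abs_def] D_def K_def .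
qed

text \<open>The evolution equation asserts only the existence of noise integrals; they are fixed
  here once, for all modes and all Brownian motions simultaneously.\<close>

definition "N = (SOME N. \<forall>k\<in>{1..r}. (\<forall>l. has_strat_integral M T (Y k l) (\<lambda>t \<omega> _. \<beta> l t \<omega>) (N k l)) \<and>
  (AE \<omega> in M. \<forall>t\<in>{0..T}. \<forall>x. K k t \<omega> x - K k 0 \<omega> x = (LBINT s:{0..t}. D k s \<omega> x) + (\<Sum>l\<in>UNIV. N k l t \<omega> x)))"

lemma N_strat: "k \<in> {1..r} \<Longrightarrow> has_strat_integral M T (Y k l) (\<lambda>t \<omega> _. \<beta> l t \<omega>) (N k l)"
  and N_eq: "k \<in> {1..r} \<Longrightarrow> AE \<omega> in M. \<forall>t\<in>{0..T}. \<forall>x.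
    K k t \<omega> x - K k 0 \<omega> x = (LBINT s:{0..t}. D k s \<omega> x) + (\<Sum>l\<in>UNIV. N k l t \<omega> x)"
  using someI_ex[OF ex_N] unfolding N_def[symmetric] by blast+

lemma mode_range: "k \<in> {1..m} \<Longrightarrow> k \<in> {1..r}" using rank by auto

text \<open>Gathers the basic almost sure facts about a path, so that most arguments discard a
  single null set. It records in particular that the mass mode carries no noise.\<close>

definition "good \<omega> \<longleftrightarrow> sample_path \<omega> \<and>
  (\<forall>k\<in>{1..m}. \<forall>t\<in>{0..T}. \<forall>x. K k t \<omega> x - K k 0 \<omega> x = (LBINT s:{0..t}. D k s \<omega> x) + (\<Sum>l\<in>UNIV. N k l t \<omega> x)) \<and>
  (\<forall>k\<in>{1..m}. \<forall>l. continuous_on ({0..T} \<times> UNIV) (\<lambda>(t, x). N k l t \<omega> x)) \<and>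
  (\<forall>l. continuous_on {0..} (\<lambda>t. \<beta> l t \<omega>)) \<and> (\<forall>l. \<forall>t\<in>{0..T}. \<forall>x. N 1 l t \<omega> x = 0)"

lemma modes: "1 \<in> {1..m}" "kv b \<in> {1..m}" "(lowrank_path.kchi TYPE('d)) \<in> {1..m}" and norms: "n1 \<noteq> 0" "nv b \<noteq> 0" "nchi \<noteq> 0"
proof -
  have "\<exists>\<omega>. sample_path \<omega>" using AE_path ae_filter_bot eventually_happens' by blast
  then obtain \<omega> where "sample_path \<omega>" by blast
  from modes_path[OF this] norms_path[OF this]
  show "1 \<in> {1..m}" "kv b \<in> {1..m}" "(lowrank_path.kchi TYPE('d)) \<in> {1..m}" "n1 \<noteq> 0" "nv b \<noteq> 0" "nchi \<noteq> 0" by auto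
qed

lemma bm: "brownian M F (\<beta> l)"
  by unfold_locales (use independent in \<open>simp add: independent_brownian_motions_def\<close>)

lemma AE_good: "AE \<omega> in M. good \<omega>"
proof -
  have "AE \<omega> in M. \<forall>k\<in>{1..m}. \<forall>t\<in>{0..T}. \<forall>x. K k t \<omega> x - K k 0 \<omega> x = (LBINT s:{0..t}. D k s \<omega> x) + (\<Sum>l\<in>UNIV. N k l t \<omega> x)"
    using N_eq mode_range by (subst AE_ball_countable) auto
  moreover have "AE \<omega> in M. \<forall>k\<in>{1..m}. \<forall>l. continuous_on ({0..T} \<times> UNIV) (\<lambda>(t, x). N k l t \<omega> x)"
  proof (subst AE_ball_countable)
    show "\<forall>k\<in>{1..m}. AE \<omega> in M. \<forall>l. continuous_on ({0..T} \<times> UNIV) (\<lambda>(t, x). N k l t \<omega> x)"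
      unfolding AE_all_countable using N_strat mode_range by (auto simp: has_strat_integral_def)
  qed auto
  moreover have "AE \<omega> in M. \<forall>l. continuous_on {0..} (\<lambda>t. \<beta> l t \<omega>)"
    unfolding AE_all_countable using brownian.B_continuous[OF bm] by blast
  moreover have "AE \<omega> in M. \<forall>l. \<forall>t\<in>{0..T}. \<forall>x. N 1 l t \<omega> x = 0"
    unfolding AE_all_countable
  proof
    fix l
    show "AE \<omega> in M. \<forall>t\<in>{0..T}. \<forall>x. N 1 l t \<omega> x = 0"
    proof (rule has_strat_integral_zero[OF N_strat[OF mode_range[OF modes(1)]]])
      show "AE \<omega> in M. \<forall>t\<in>{0..T}. \<forall>x. Y 1 l t \<omega> x = 0"
        using AE_path by eventually_elim (simp add: Y_path)
    qed
  qed
  ultimately show ?thesis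
    using AE_path by eventually_elim (simp add: good_def)
qed

lemma goodD:
  assumes "good \<omega>"
  shows "sample_path \<omega>" "k \<in> {1..m} \<Longrightarrow> t \<in> {0..T} \<Longrightarrow> K k t \<omega> x - K k 0 \<omega> x = (LBINT s:{0..t}. D k s \<omega> x) + (\<Sum>l\<in>UNIV. N k l t \<omega> x)"
    "k \<in> {1..m} \<Longrightarrow> continuous_on ({0..T} \<times> UNIV) (\<lambda>(t, x). N k l t \<omega> x)"
    "continuous_on {0..} (\<lambda>t. \<beta> l t \<omega>)" "t \<in> {0..T} \<Longrightarrow> N 1 l t \<omega> x = 0"
  using assms unfolding good_def by blast+

lemma time_slice:
  fixes g :: "real \<Rightarrow> 'w \<Rightarrow> real^'d \<Rightarrow> 'c::euclidean_space"
  assumes "continuous_on ({0..T} \<times> UNIV) (\<lambda>p. g (fst p) \<omega> (snd p))" "t \<in> {0..T}"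
  shows "continuous_on {0..t} (\<lambda>s. g s \<omega> x)" "(LBINT s:{0..t}. g s \<omega> x) = integral {0..t} (\<lambda>s. g s \<omega> x)"
proof -
  show c: "continuous_on {0..t} (\<lambda>s. g s \<omega> x)"
    by (rule continuous_on_compose2[OF assms(1), of _ "\<lambda>s. (s, x)", simplified]) (use assms(2) in \<open>auto intro!: continuous_intros\<close>)
  then show "(LBINT s:{0..t}. g s \<omega> x) = integral {0..t} (\<lambda>s. g s \<omega> x)"
    by (intro set_lborel_integral_continuous) auto
qed

lemma cell_swap:
  assumes g: "continuous_on ({0..T} \<times> UNIV) (\<lambda>p. g (fst p) \<omega> (snd p))" and \<phi>: "continuous_on UNIV \<phi>" and t: "t \<in> {0..T}"
  shows "integral (cell L) (\<lambda>x. \<phi> x * integral {0..t} (\<lambda>s. g s \<omega> x :: real)) = integral {0..t} (\<lambda>s. integral (cell L) (\<lambda>x. \<phi> x * g s \<omega> x))"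
    and "continuous_on {0..T} (\<lambda>s. integral (cell L) (\<lambda>x. \<phi> x * g s \<omega> x))"
proof -
  have c: "continuous_on ({0..T} \<times> UNIV) (\<lambda>(s, x). g s \<omega> x)" using g by (simp add: split_beta)
  from continuous_cell_integral[OF c \<phi>] show "continuous_on {0..T} (\<lambda>s. integral (cell L) (\<lambda>x. \<phi> x * g s \<omega> x))" .
  have "continuous_on ({0..t} \<times> cell L) (\<lambda>p. \<phi> (snd p) * g (fst p) \<omega> (snd p))"
    by (intro continuous_on_mult continuous_on_compose2[OF \<phi>] continuous_intros continuous_on_subset[OF g]) (use t in auto)
  then have "integral {0..t} (\<lambda>s. integral (cell L) (\<lambda>x. \<phi> x * g s \<omega> x)) = integral (cell L) (\<lambda>x. integral {0..t} (\<lambda>s. \<phi> x * g s \<omega> x))"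
    by (intro integral_cell_swap) (simp add: split_beta)
  then show "integral (cell L) (\<lambda>x. \<phi> x * integral {0..t} (\<lambda>s. g s \<omega> x)) = integral {0..t} (\<lambda>s. integral (cell L) (\<lambda>x. \<phi> x * g s \<omega> x))"
    by simp
qed

text \<open>Testing in x commutes with the time integral by Fubini on the path. The noise fields are
  integrated as they stand; \<open>cell_strat_integral\<close> relates the result to sums of tested
  coefficients.\<close>

lemma cell_K_equation:
  assumes good: "good \<omega>" and k: "k \<in> {1..m}" and cD: "continuous_on ({0..T} \<times> UNIV) (\<lambda>p. D k (fst p) \<omega> (snd p))"
    and \<phi>: "continuous_on UNIV \<phi>" and t: "t \<in> {0..T}"
  shows "integral (cell L) (\<lambda>x. \<phi> x * K k t \<omega> x) - integral (cell L) (\<lambda>x. \<phi> x * K k 0 \<omega> x) =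
    integral {0..t} (\<lambda>s. integral (cell L) (\<lambda>x. \<phi> x * D k s \<omega> x)) + (\<Sum>l\<in>UNIV. integral (cell L) (\<lambda>x. \<phi> x * N k l t \<omega> x))"
proof -
  have T0: "0 \<in> {0..T}" using LT by simp
  have c\<phi>: "continuous_on (cell L) \<phi>" by (rule continuous_on_subset[OF \<phi>]) simp
  have cK: "continuous_on (cell L) (K k s \<omega>)" if "s \<in> {0..T}" for s
    by (rule slice_cont[where g = "K k", OF goodD(1)[OF good] K_cont[OF goodD(1)[OF good] mode_range[OF k]] that])
  have cN: "continuous_on (cell L) (N k l t \<omega>)" for l
    using slice_cont[where g = "N k l", OF goodD(1)[OF good] _ t] goodD(3)[OF good k, of l] by (simp add: split_beta)
  have cI: "continuous_on (cell L) (\<lambda>x. integral {0..t} (\<lambda>s. D k s \<omega> x))"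
  proof -
    have "continuous_on (cell L \<times> cbox 0 t) (\<lambda>p. D k (snd p) \<omega> (fst p))"
      by (rule continuous_on_compose2[OF cD, of _ "\<lambda>p. (snd p, fst p)", simplified]) (use t in \<open>auto intro!: continuous_intros\<close>)
    from integral_continuous_on_param[of "cell L" 0 t "\<lambda>x s. D k s \<omega> x"] this show ?thesis by (simp add: split_beta)
  qed
  have "integral (cell L) (\<lambda>x. \<phi> x * K k t \<omega> x) - integral (cell L) (\<lambda>x. \<phi> x * K k 0 \<omega> x) =
      integral (cell L) (\<lambda>x. \<phi> x * K k t \<omega> x - \<phi> x * K k 0 \<omega> x)"
    by (intro Henstock_Kurzweil_Integration.integral_diff[symmetric] integrable_on_cell continuous_intros c\<phi> cK t T0)
  also have "\<dots> = integral (cell L) (\<lambda>x. \<phi> x * integral {0..t} (\<lambda>s. D k s \<omega> x) + (\<Sum>l\<in>UNIV. \<phi> x * N k l t \<omega> x))"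
  proof (rule integral_cong)
    fix x
    have "K k t \<omega> x - K k 0 \<omega> x = integral {0..t} (\<lambda>s. D k s \<omega> x) + (\<Sum>l\<in>UNIV. N k l t \<omega> x)"
      using goodD(2)[OF good k t, of x] time_slice(2)[where g = "D k", OF cD t, of x] by simp
    then show "\<phi> x * K k t \<omega> x - \<phi> x * K k 0 \<omega> x = \<phi> x * integral {0..t} (\<lambda>s. D k s \<omega> x) + (\<Sum>l\<in>UNIV. \<phi> x * N k l t \<omega> x)"
      unfolding right_diff_distrib[symmetric] sum_distrib_left[symmetric] distrib_left[symmetric] by simp
  qed
  also have "\<dots> = integral (cell L) (\<lambda>x. \<phi> x * integral {0..t} (\<lambda>s. D k s \<omega> x)) + integral (cell L) (\<lambda>x. \<Sum>l\<in>UNIV. \<phi> x * N k l t \<omega> x)"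
    by (intro Henstock_Kurzweil_Integration.integral_add integrable_on_cell continuous_intros c\<phi> cI cN)
  also have "integral (cell L) (\<lambda>x. \<Sum>l\<in>UNIV. \<phi> x * N k l t \<omega> x) = (\<Sum>l\<in>UNIV. integral (cell L) (\<lambda>x. \<phi> x * N k l t \<omega> x))"
    by (intro Henstock_Kurzweil_Integration.integral_sum integrable_on_cell continuous_intros c\<phi> cN) auto
  finally show ?thesis using cell_swap(1)[where g = "D k", OF cD \<phi> t] by simp
qed

lemma mass_balance:
  assumes good: "good \<omega>" and t: "t \<in> {0..T}"
  shows "\<rho> t \<omega> x - \<rho> 0 \<omega> x = - integral {0..t} (\<lambda>s. divergence (J s \<omega>) x)"
proof -
  note p = goodD(1)[OF good]
  have T0: "0 \<in> {0..T}" using LT by simp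
  have "\<rho> t \<omega> x - \<rho> 0 \<omega> x = n1 * (K 1 t \<omega> x - K 1 0 \<omega> x)"
    using \<rho>_path[OF p] t T0 by (simp add: right_diff_distrib)
  also have "\<dots> = n1 * integral {0..t} (\<lambda>s. D 1 s \<omega> x)"
    using goodD(2)[OF good modes(1) t, of x] goodD(5)[OF good t] time_slice(2)[where g = "D 1", OF D_cont(1)[OF p] t] by simp
  also have "integral {0..t} (\<lambda>s. D 1 s \<omega> x) = integral {0..t} (\<lambda>s. - (1 / n1) * divergence (J s \<omega>) x)"
    using t by (intro integral_cong) (simp add: D_path(1)[OF p])
  also have "n1 * \<dots> = - integral {0..t} (\<lambda>s. divergence (J s \<omega>) x)" using norms(1) by simp
  finally show ?thesis .
qed

text \<open>The continuity equation tested in x supplies the time derivative, which is continuous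
  because the divergence of J is.\<close>

lemma \<rho>_C1:
  assumes good: "good \<omega>" and \<phi>: "continuous_on UNIV \<phi>" and t: "t \<in> {0..T}"
  shows "C1_integrand t (\<lambda>s. integral (cell L) (\<lambda>x. \<phi> x * \<rho> s \<omega> x))
    (\<lambda>s. - integral (cell L) (\<lambda>x. \<phi> x * divergence (J s \<omega>) x)) (\<lambda>s. \<beta> l s \<omega>)"
proof
  note p = goodD(1)[OF good]
  note cd = divergence_J_cont[OF p]
  show "0 \<le> t" using t by simp
  show "continuous_on {0..t} (\<lambda>s. \<beta> l s \<omega>)" using goodD(4)[OF good] by (rule continuous_on_subset) auto
  have "continuous_on {0..T} (\<lambda>s. - integral (cell L) (\<lambda>x. \<phi> x * divergence (J s \<omega>) x))"
    using cell_swap(2)[where g = "\<lambda>s \<omega>. divergence (J s \<omega>)", OF cd \<phi> t] by (rule continuous_on_minus)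
  then show "continuous_on {0..t} (\<lambda>s. - integral (cell L) (\<lambda>x. \<phi> x * divergence (J s \<omega>) x))"
    by (rule continuous_on_subset) (use t in auto)
  fix s assume "s \<in> {0..t}"
  then have s: "s \<in> {0..T}" and T0: "0 \<in> {0..T}" using t by auto
  have c\<phi>: "continuous_on (cell L) \<phi>" by (rule continuous_on_subset[OF \<phi>]) simp
  have c\<rho>: "continuous_on (cell L) (\<rho> r \<omega>)" if "r \<in> {0..T}" for r by (rule slice_cont[where g = \<rho>, OF p \<rho>_cont[OF p] that])
  have "integral (cell L) (\<lambda>x. \<phi> x * \<rho> s \<omega> x) - integral (cell L) (\<lambda>x. \<phi> x * \<rho> 0 \<omega> x) =
      integral (cell L) (\<lambda>x. \<phi> x * \<rho> s \<omega> x - \<phi> x * \<rho> 0 \<omega> x)"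
    by (intro Henstock_Kurzweil_Integration.integral_diff[symmetric] integrable_on_cell continuous_intros c\<phi> c\<rho> s T0)
  also have "\<dots> = integral (cell L) (\<lambda>x. - (\<phi> x * integral {0..s} (\<lambda>s. divergence (J s \<omega>) x)))"
    by (intro integral_cong) (simp add: mass_balance[OF good s] flip: right_diff_distrib)
  also have "\<dots> = integral {0..s} (\<lambda>s. - integral (cell L) (\<lambda>x. \<phi> x * divergence (J s \<omega>) x))"
    using cell_swap(1)[where g = "\<lambda>s \<omega>. divergence (J s \<omega>)", OF cd \<phi> s] by simp
  finally show "integral (cell L) (\<lambda>x. \<phi> x * \<rho> s \<omega> x) = integral (cell L) (\<lambda>x. \<phi> x * \<rho> 0 \<omega> x) +
      integral {0..s} (\<lambda>s. - integral (cell L) (\<lambda>x. \<phi> x * divergence (J s \<omega>) x))" by simp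
qed

lemma total_mass_conserved:
  assumes good: "good \<omega>" and tT: "t \<in> {0..T}"
  shows "integral (cell L) (\<rho> t \<omega>) = integral (cell L) (\<rho> 0 \<omega>)"
proof -
  note p = goodD(1)[OF good]
  \<comment> \<open>\<open>undefined\<close> stands for an arbitrary Brownian index, to fill the
    integrator of the locale.\<close>
  interpret C1_integrand t "\<lambda>s. integral (cell L) (\<lambda>x. 1 * \<rho> s \<omega> x)"
    "\<lambda>s. - integral (cell L) (\<lambda>x. 1 * divergence (J s \<omega>) x)" "\<lambda>s. \<beta> undefined s \<omega>"
    by (rule \<rho>_C1[OF good _ tT]) simp
  have z: "integral (cell L) (\<lambda>x. 1 * divergence (J s \<omega>) x) = 0" if "s \<in> {0..t}" for s
  proof -
    have s: "s \<in> {0..T}" using that tT by auto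
    have "D 1 s \<omega> = (\<lambda>x. - (1 / n1) * divergence (J s \<omega>) x)" by (rule ext, rule D_path(1)[OF p s])
    with cell_D(1)[OF p s] have "integral (cell L) (\<lambda>x. - (1 / n1) * divergence (J s \<omega>) x) = 0" by (simp only:)
    then show ?thesis using norms(1) by simp
  qed
  have "integral {0..t} (\<lambda>s. - integral (cell L) (\<lambda>x. 1 * divergence (J s \<omega>) x)) = integral {0..t} (\<lambda>s. 0)"
    by (intro integral_cong) (simp only: z minus_zero)
  then show ?thesis using h[of t] tT by simp
qed

text \<open>The noise of mode k tested with \<phi> in x. A constant \<phi> yields the noise of total
  momentum and energy; for the modes \<open>kv b\<close> an entry of \<sigma> as \<phi> yields the
  noise of the energy integrand.\<close>

definition "A k l \<phi> t \<omega> = integral (cell L) (\<lambda>x. \<phi> x * N k l t \<omega> x)"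

lemma sigma_cont: "continuous_on UNIV (\<lambda>x. \<sigma> x $ b $ l)"
  by (intro continuous_intros sigma)

lemma column_cont: "continuous_on UNIV (\<lambda>x. column l (\<sigma> x))"
  unfolding column_def by (intro continuous_on_vec_lambda sigma_cont)

lemma Y_cont:
  assumes p: "sample_path \<omega>"
  shows "continuous_on ({0..T} \<times> UNIV) (\<lambda>(t, x). Y (kv b) l t \<omega> x)"
    "continuous_on ({0..T} \<times> UNIV) (\<lambda>(t, x). Y (lowrank_path.kchi TYPE('d)) l t \<omega> x)"
proof -
  have "continuous_on ({0..T} \<times> UNIV) (\<lambda>x. \<sigma> (snd x) $ b $ l * \<rho> (fst x) \<omega> (snd x) / nv b)"
    by (intro continuous_intros continuous_on_compose2[OF sigma_cont] \<rho>_cont p) (use norms in auto)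
  then show "continuous_on ({0..T} \<times> UNIV) (\<lambda>(t, x). Y (kv b) l t \<omega> x)"
    by (rule continuous_on_eq) (auto simp: Y_path[OF p])
  have "continuous_on ({0..T} \<times> UNIV) (\<lambda>x. (2 / nchi) * (column l (\<sigma> (snd x)) \<bullet> J (fst x) \<omega> (snd x)))"
    by (intro continuous_intros continuous_on_compose2[OF column_cont] J_cont p) auto
  then show "continuous_on ({0..T} \<times> UNIV) (\<lambda>(t, x). Y (lowrank_path.kchi TYPE('d)) l t \<omega> x)"
    by (rule continuous_on_eq) (auto simp: Y_path[OF p])
qed

lemma A_cont: "good \<omega> \<Longrightarrow> k \<in> {1..m} \<Longrightarrow> continuous_on UNIV \<phi> \<Longrightarrow> continuous_on {0..T} (\<lambda>t. A k l \<phi> t \<omega>)"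
  unfolding A_def by (rule continuous_cell_integral[OF goodD(3)])

text \<open>The integrand of \<open>A (kv b) l \<phi>\<close> expressed through \<rho>;
  \<open>y'\<close> is its time derivative according to the continuity equation.\<close>

definition "y b l \<phi> s \<omega> = integral (cell L) (\<lambda>x. (\<phi> x * \<sigma> x $ b $ l / nv b) * \<rho> s \<omega> x)"
definition "y' b l \<phi> \<omega> s = - integral (cell L) (\<lambda>x. (\<phi> x * \<sigma> x $ b $ l / nv b) * divergence (J s \<omega>) x)"

lemma weight_cont: "continuous_on UNIV \<phi> \<Longrightarrow> continuous_on UNIV (\<lambda>x. \<phi> x * \<sigma> x $ b $ l / nv b)"
  by (intro continuous_on_divide continuous_on_mult continuous_on_const sigma_cont) (auto simp: norms)

lemma y_C1:
  assumes "good \<omega>" "continuous_on UNIV \<phi>" "t \<in> {0..T}"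
  shows "C1_integrand t (\<lambda>s. y b l \<phi> s \<omega>) (y' b l \<phi> \<omega>) (\<lambda>s. \<beta> l s \<omega>)"
  unfolding y_def y'_def by (rule \<rho>_C1[OF assms(1) weight_cont[OF assms(2)] assms(3)])

lemma A_limit:
  assumes \<phi>: "continuous_on UNIV \<phi>" and t: "t \<in> {0..T}"
  shows "null_in_prob M sequentially (\<lambda>q \<omega>. ennreal \<bar>trapezoid_sum (\<lambda>s. y b l \<phi> s \<omega>) (\<lambda>s. \<beta> l s \<omega>) t q - A (kv b) l \<phi> t \<omega>\<bar>)"
proof (rule null_in_prob_mono_AE)
  show "null_in_prob M sequentially (\<lambda>q \<omega>. ennreal \<bar>
    trapezoid_sum (\<lambda>s. integral (cell L) (\<lambda>x. \<phi> x * Y (kv b) l s \<omega> x)) (\<lambda>s. \<beta> l s \<omega>) t q -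
    integral (cell L) (\<lambda>x. \<phi> x * N (kv b) l t \<omega> x)\<bar>)"
    by (rule cell_strat_integral[OF N_strat[OF mode_range[OF modes(2)]] \<phi> _ t])
      (use AE_path in eventually_elim, rule Y_cont)
  show "AE \<omega> in M. \<forall>q. ennreal \<bar>trapezoid_sum (\<lambda>s. y b l \<phi> s \<omega>) (\<lambda>s. \<beta> l s \<omega>) t q - A (kv b) l \<phi> t \<omega>\<bar>
    \<le> ennreal \<bar>trapezoid_sum (\<lambda>s. integral (cell L) (\<lambda>x. \<phi> x * Y (kv b) l s \<omega> x)) (\<lambda>s. \<beta> l s \<omega>) t q -
    integral (cell L) (\<lambda>x. \<phi> x * N (kv b) l t \<omega> x)\<bar>"
    using AE_path
  proof eventually_elim
    case (elim \<omega>)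
    have "trapezoid_sum (\<lambda>s. y b l \<phi> s \<omega>) (\<lambda>s. \<beta> l s \<omega>) t q =
        trapezoid_sum (\<lambda>s. integral (cell L) (\<lambda>x. \<phi> x * Y (kv b) l s \<omega> x)) (\<lambda>s. \<beta> l s \<omega>) t q" for q
      by (rule trapezoid_sum_cong[OF t]) (simp add: y_def Y_path[OF elim] mult.assoc)
    then show ?case by (simp only: A_def order.refl) simp
  qed
qed

text \<open>The null set may depend on t, which is harmless at a fixed time and at the countably
  many dyadic times.\<close>

lemma A_stieltjes:
  assumes \<phi>: "continuous_on UNIV \<phi>" and t: "t \<in> {0..T}"
  shows "AE \<omega> in M. A (kv b) l \<phi> t \<omega> = C1_integrand.stieltjes t (\<lambda>s. y b l \<phi> s \<omega>) (y' b l \<phi> \<omega>) (\<lambda>s. \<beta> l s \<omega>)"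
  by (rule strat_limit_C1[OF A_limit[OF \<phi> t]]) (use AE_good in eventually_elim, rule y_C1[OF _ \<phi> t])

subsubsection \<open>Adaptedness\<close>

lemma adapted_cell_K:
  assumes k: "k \<in> {1..r}" and \<phi>: "continuous_on UNIV \<phi>" and t: "t \<in> {0..T}"
  shows "(\<lambda>\<omega>. integral (cell L) (\<lambda>x. \<phi> x * K k t \<omega> x)) \<in> borel_measurable (F t)"
proof (rule borel_measurable_F_integral[OF _ compact_cell])
  show "0 \<le> t" using t by simp
  show "(\<lambda>\<omega>. \<phi> x * K k t \<omega> x) \<in> borel_measurable (F t)" for x
    unfolding K_def using adapted_X adapted_S[OF _ k] t
    by (intro borel_measurable_times borel_measurable_sum borel_measurable_const) (auto simp: adapted_upto_def)
  show "AE \<omega> in M. continuous_on UNIV (\<lambda>x. \<phi> x * K k t \<omega> x)"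
    using AE_path
  proof eventually_elim
    case (elim \<omega>)
    show ?case by (intro continuous_intros \<phi> slice_cont[where g = "K k", OF elim K_cont[OF elim k] t])
  qed
qed

lemma adapted_cell_\<rho>:
  assumes \<phi>: "continuous_on UNIV \<phi>"
  shows "adapted_upto F T (\<lambda>t \<omega>. integral (cell L) (\<lambda>x. \<phi> x * \<rho> t \<omega> x))"
  unfolding adapted_upto_def
proof
  fix t assume t: "t \<in> {0..T}"
  have "(\<lambda>\<omega>. n1 * integral (cell L) (\<lambda>x. \<phi> x * K 1 t \<omega> x)) \<in> borel_measurable (F t)"
    by (intro borel_measurable_times borel_measurable_const adapted_cell_K mode_range modes \<phi> t)
  then show "(\<lambda>\<omega>. integral (cell L) (\<lambda>x. \<phi> x * \<rho> t \<omega> x)) \<in> borel_measurable (F t)"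
  proof (rule measurable_F_AE_cong)
    show "AE \<omega> in M. n1 * integral (cell L) (\<lambda>x. \<phi> x * K 1 t \<omega> x) = integral (cell L) (\<lambda>x. \<phi> x * \<rho> t \<omega> x)"
      using AE_path by eventually_elim (simp add: \<rho>_path[OF _ t] mult.left_commute)
  qed (use t in auto)
qed

lemma cell_J:
  assumes p: "sample_path \<omega>" and t: "t \<in> {0..T}" and c: "\<And>b. continuous_on UNIV (\<phi> b)"
  shows "integral (cell L) (\<lambda>x. \<Sum>b\<in>UNIV. \<phi> b x * J t \<omega> x $ b) = (\<Sum>b\<in>UNIV. nv b * integral (cell L) (\<lambda>x. \<phi> b x * K (kv b) t \<omega> x))"
proof -
  have cc: "continuous_on (cell L) (\<phi> b)" for b by (rule continuous_on_subset[OF c]) simp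
  have cK: "continuous_on (cell L) (K (kv b) t \<omega>)" for b
    by (rule slice_cont[where g = "K (kv b)", OF p K_cont[OF p mode_range[OF modes(2)]] t])
  have "integral (cell L) (\<lambda>x. \<Sum>b\<in>UNIV. \<phi> b x * J t \<omega> x $ b) = integral (cell L) (\<lambda>x. \<Sum>b\<in>UNIV. nv b * (\<phi> b x * K (kv b) t \<omega> x))"
    by (simp add: J_path[OF p t] mult.left_commute)
  also have "\<dots> = (\<Sum>b\<in>UNIV. integral (cell L) (\<lambda>x. nv b * (\<phi> b x * K (kv b) t \<omega> x)))"
    by (intro Henstock_Kurzweil_Integration.integral_sum integrable_on_cell continuous_intros cc cK) auto
  finally show ?thesis by simp
qed

definition "G l t \<omega> = (LBINT x:cell L. column l (\<sigma> x) \<bullet> J t \<omega> x)"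

text \<open>The second form goes through the coefficients \<open>K (kv b)\<close>, whose adaptedness
  and evolution equation are known.\<close>

lemma G_path:
  assumes p: "sample_path \<omega>" and t: "t \<in> {0..T}"
  shows "G l t \<omega> = integral (cell L) (\<lambda>x. column l (\<sigma> x) \<bullet> J t \<omega> x)"
    "G l t \<omega> = (\<Sum>b\<in>UNIV. nv b * integral (cell L) (\<lambda>x. \<sigma> x $ b $ l * K (kv b) t \<omega> x))"
proof -
  have "continuous_on (cell L) (\<lambda>x. column l (\<sigma> x) \<bullet> J t \<omega> x)"
    by (intro continuous_intros continuous_on_subset[OF column_cont] slice_cont[where g = J, OF p J_cont[OF p] t]) auto
  then show 1: "G l t \<omega> = integral (cell L) (\<lambda>x. column l (\<sigma> x) \<bullet> J t \<omega> x)"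
    unfolding G_def by (intro set_lborel_integral_continuous) auto
  then show "G l t \<omega> = (\<Sum>b\<in>UNIV. nv b * integral (cell L) (\<lambda>x. \<sigma> x $ b $ l * K (kv b) t \<omega> x))"
    using cell_J[OF p t, of "\<lambda>b x. \<sigma> x $ b $ l"] sigma_cont by (simp add: inner_vec_def column_def)
qed

lemma G_adapted: "adapted_upto F T (G l)"
  unfolding adapted_upto_def
proof
  fix t assume t: "t \<in> {0..T}"
  have "(\<lambda>\<omega>. \<Sum>b\<in>UNIV. nv b * integral (cell L) (\<lambda>x. \<sigma> x $ b $ l * K (kv b) t \<omega> x)) \<in> borel_measurable (F t)"
    by (intro borel_measurable_sum borel_measurable_times borel_measurable_const adapted_cell_K mode_range modes sigma_cont t)
  then show "G l t \<in> borel_measurable (F t)"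
  proof (rule measurable_F_AE_cong)
    show "AE \<omega> in M. (\<Sum>b\<in>UNIV. nv b * integral (cell L) (\<lambda>x. \<sigma> x $ b $ l * K (kv b) t \<omega> x)) = G l t \<omega>"
      using AE_path by eventually_elim (rule G_path(2)[OF _ t, symmetric])
  qed (use t in auto)
qed

lemma G_continuous: "sample_path \<omega> \<Longrightarrow> continuous_on {0..T} (\<lambda>t. G l t \<omega>)"
proof -
  assume p: "sample_path \<omega>"
  have "continuous_on ({0..T} \<times> UNIV) (\<lambda>(t, x). K (kv b) t \<omega> x)" for b
    using K_cont[OF p mode_range[OF modes(2)], of b] by (simp add: split_beta)
  then have "continuous_on {0..T} (\<lambda>t. \<Sum>b\<in>UNIV. nv b * integral (cell L) (\<lambda>x. \<sigma> x $ b $ l * K (kv b) t \<omega> x))"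
    by (intro continuous_intros continuous_cell_integral sigma_cont)
  then show ?thesis by (rule continuous_on_eq) (simp add: G_path(2)[OF p])
qed

subsubsection \<open>Momentum\<close>

text \<open>The constant weight \<open>nv b\<close> cancels the normalization of the mode, so the
  integrand is component b of the integral of \<rho> \<sigma>_l over the cell, which the square
  integrability hypothesis controls.\<close>

lemma momentum_mean_zero:
  assumes t: "t \<in> {0..T}" and sq: "(\<integral>\<^sup>+\<omega>. (\<integral>\<^sup>+s\<in>{0..T}. ennreal
        ((norm (LBINT x:cell L. \<rho> s \<omega> x *\<^sub>R column l (\<sigma> x)))\<^sup>2) \<partial>lborel) \<partial>M) < \<infinity>"
  shows "integrable M (A (kv b) l (\<lambda>_. nv b) t) \<and> expectation (A (kv b) l (\<lambda>_. nv b) t) = 0"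
proof -
  let ?y = "y b l (\<lambda>_. nv b)"
  have c: "continuous_on UNIV (\<lambda>_. nv b)" by simp
  have y_eq: "?y s \<omega> = integral (cell L) (\<lambda>x. \<sigma> x $ b $ l * \<rho> s \<omega> x)" for s \<omega>
    using norms(2)[of b] by (simp add: y_def)
  have y_adapted: "adapted_upto F T ?y"
    unfolding y_def by (rule adapted_cell_\<rho>[OF weight_cont[OF c]])
  interpret b: brownian M F "\<beta> l" by (rule bm)
  have t0: "0 \<le> t" "t \<le> T" using t by auto
  \<comment> \<open>An almost sure limit of sums of adapted quantities; completeness of F T absorbs
    the null set.\<close>
  have Am: "A (kv b) l (\<lambda>_. nv b) t \<in> borel_measurable (F T)"
  proof (rule measurable_F_AE_limit)
    show "(\<lambda>\<omega>. trapezoid_sum (\<lambda>s. ?y s \<omega>) (\<lambda>s. \<beta> l s \<omega>) t q) \<in> borel_measurable (F T)" for q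
    proof (intro borel_measurable_sum borel_measurable_times borel_measurable_diff borel_measurable_add borel_measurable_const)
      fix i :: nat assume "i \<in> {..<2 ^ q}"
      then have g: "0 \<le> grid t q i" "grid t q i \<le> T" "0 \<le> grid t q (Suc i)" "grid t q (Suc i) \<le> T"
        using grid_bounds[OF t0(1), of i q] grid_bounds[OF t0(1), of "Suc i" q] t0 by auto
      show "?y (grid t q i) \<in> borel_measurable (F T)" "?y (grid t q (Suc i)) \<in> borel_measurable (F T)"
        "\<beta> l (grid t q i) \<in> borel_measurable (F T)" "\<beta> l (grid t q (Suc i)) \<in> borel_measurable (F T)"
        using y_adapted g b.B_adapted by (auto simp: adapted_upto_def intro: measurable_F_mono)
    qed
    show "AE \<omega> in M. (\<lambda>q. trapezoid_sum (\<lambda>s. ?y s \<omega>) (\<lambda>s. \<beta> l s \<omega>) t q) \<longlonglongrightarrow> A (kv b) l (\<lambda>_. nv b) t \<omega>"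
      using A_stieltjes[OF c t, of b l] AE_good
    proof eventually_elim
      case (elim \<omega>)
      show ?case unfolding elim(1) by (rule C1_integrand.trapezoid_limit[OF y_C1[OF elim(2) c t]])
    qed
  qed (use LT in simp)
  show ?thesis
  proof (rule b.stieltjes_mean_zero[OF y_adapted _ _ t measurable_F_M[OF Am] A_stieltjes[OF c t]])
    show "AE \<omega> in M. C1_integrand T (\<lambda>s. ?y s \<omega>) (y' b l (\<lambda>_. nv b) \<omega>) (\<lambda>s. \<beta> l s \<omega>)"
      using AE_good by eventually_elim (rule y_C1[OF _ c], use LT in auto)
    have "(\<integral>\<^sup>+\<omega>. (\<integral>\<^sup>+s\<in>{0..T}. ennreal ((?y s \<omega>)\<^sup>2) \<partial>lborel) \<partial>M) \<le> (\<integral>\<^sup>+\<omega>. (\<integral>\<^sup>+s\<in>{0..T}. ennreal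
        ((norm (LBINT x:cell L. \<rho> s \<omega> x *\<^sub>R column l (\<sigma> x)))\<^sup>2) \<partial>lborel) \<partial>M)"
    proof (rule nn_integral_mono_AE, use AE_path in eventually_elim, rule nn_integral_mono)
      fix \<omega> s assume p: "sample_path \<omega>"
      show "ennreal ((?y s \<omega>)\<^sup>2) * indicator {0..T} s \<le> ennreal ((norm (LBINT x:cell L. \<rho> s \<omega> x *\<^sub>R column l (\<sigma> x)))\<^sup>2) * indicator {0..T} s"
      proof (cases "s \<in> {0..T}")
        case True
        have cc: "continuous_on (cell L) (\<lambda>x. \<rho> s \<omega> x *\<^sub>R column l (\<sigma> x))"
          by (intro continuous_intros continuous_on_subset[OF column_cont] slice_cont[where g = \<rho>, OF p \<rho>_cont[OF p] True]) auto
        have "(LBINT x:cell L. \<rho> s \<omega> x *\<^sub>R column l (\<sigma> x)) $ b = integral (cell L) (\<lambda>x. \<rho> s \<omega> x *\<^sub>R column l (\<sigma> x)) $ b"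
          by (simp add: set_lborel_integral_continuous[OF compact_cell cc])
        also have "\<dots> = integral (cell L) (\<lambda>x. (\<rho> s \<omega> x *\<^sub>R column l (\<sigma> x)) $ b)"
          using integral_linear[OF integrable_on_cell[OF cc] bounded_linear_vec_nth[of b]] by (simp add: o_def)
        also have "\<dots> = ?y s \<omega>" by (simp add: y_eq column_def mult.commute)
        finally have le: "\<bar>?y s \<omega>\<bar> \<le> norm (LBINT x:cell L. \<rho> s \<omega> x *\<^sub>R column l (\<sigma> x))"
          using component_le_norm_cart by metis
        from power_mono[OF le abs_ge_zero, of 2]
        have "(?y s \<omega>)\<^sup>2 \<le> (norm (LBINT x:cell L. \<rho> s \<omega> x *\<^sub>R column l (\<sigma> x)))\<^sup>2" by simp
        then show ?thesis by (intro mult_right_mono ennreal_leI) auto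
      qed simp
    qed
    then show "(\<integral>\<^sup>+\<omega>. (\<integral>\<^sup>+s\<in>{0..T}. ennreal ((?y s \<omega>)\<^sup>2) \<partial>lborel) \<partial>M) < \<infinity>" using sq by (rule order.strict_trans1)
  qed
qed

lemma total_momentum_path:
  assumes p: "sample_path \<omega>" and t: "t \<in> {0..T}"
  shows "total_momentum L (f t \<omega>) $ b = nv b * integral (cell L) (\<lambda>x. 1 * K (kv b) t \<omega> x)"
proof -
  have cJ: "continuous_on (cell L) (J t \<omega>)" by (rule slice_cont[where g = J, OF p J_cont[OF p] t])
  have "total_momentum L (f t \<omega>) $ b = integral (cell L) (J t \<omega>) $ b"
    by (simp add: total_momentum_def set_lborel_integral_continuous[OF compact_cell cJ, symmetric]) (simp add: J_def)
  also have "\<dots> = integral (cell L) (\<lambda>x. J t \<omega> x $ b)"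
    using integral_linear[OF integrable_on_cell[OF cJ] bounded_linear_vec_nth[of b]] by (simp add: o_def)
  finally show ?thesis by (simp add: J_path[OF p t])
qed

text \<open>The drift disappears because both the flux and the total electric force integrate to
  zero over the cell.\<close>

lemma total_momentum_balance:
  assumes g: "good \<omega>" and t: "t \<in> {0..T}"
  shows "total_momentum L (f t \<omega>) $ b = total_momentum L (f 0 \<omega>) $ b + (\<Sum>l\<in>UNIV. A (kv b) l (\<lambda>_. nv b) t \<omega>)"
proof -
  note p = goodD(1)[OF g]
  have T0: "0 \<in> {0..T}" using LT by simp
  have "integral {0..t} (\<lambda>s. integral (cell L) (\<lambda>x. 1 * D (kv b) s \<omega> x)) = integral {0..t} (\<lambda>s. 0)"
    using t by (intro integral_cong) (simp add: cell_D(2)[OF p] cong: Henstock_Kurzweil_Integration.integral_cong)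
  then have "integral (cell L) (\<lambda>x. 1 * K (kv b) t \<omega> x) - integral (cell L) (\<lambda>x. 1 * K (kv b) 0 \<omega> x) =
      (\<Sum>l\<in>UNIV. integral (cell L) (\<lambda>x. 1 * N (kv b) l t \<omega> x))"
    using cell_K_equation[OF g modes(2) D_cont(2)[OF p] _ t, of "\<lambda>_. 1" b] by simp
  then have "nv b * integral (cell L) (\<lambda>x. 1 * K (kv b) t \<omega> x) - nv b * integral (cell L) (\<lambda>x. 1 * K (kv b) 0 \<omega> x) =
      nv b * (\<Sum>l\<in>UNIV. integral (cell L) (\<lambda>x. 1 * N (kv b) l t \<omega> x))"
    by (simp only: right_diff_distrib[symmetric])
  then show ?thesis
    by (simp add: total_momentum_path[OF p t] total_momentum_path[OF p T0] A_def sum_distrib_left)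
qed

lemma total_momentum_expectation:
  assumes t: "t \<in> {0..T}" and int: "integrable M (\<lambda>\<omega>. total_momentum L (f 0 \<omega>))"
    and sq: "\<And>l. (\<integral>\<^sup>+\<omega>. (\<integral>\<^sup>+s\<in>{0..T}. ennreal
        ((norm (LBINT x:cell L. \<rho> s \<omega> x *\<^sub>R column l (\<sigma> x)))\<^sup>2) \<partial>lborel) \<partial>M) < \<infinity>"
  shows "integrable M (\<lambda>\<omega>. total_momentum L (f t \<omega>))"
    "(LINT \<omega>|M. total_momentum L (f t \<omega>)) = (LINT \<omega>|M. total_momentum L (f 0 \<omega>))"
proof -
  have comp: "has_bochner_integral M (\<lambda>\<omega>. total_momentum L (f t \<omega>) $ b) ((LINT \<omega>|M. total_momentum L (f 0 \<omega>)) $ b)" for b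
  proof -
    note z = momentum_mean_zero[OF t sq, where b = b]
    have A0: "has_bochner_integral M (A (kv b) l (\<lambda>_. nv b) t) 0" for l
      using z[of l] by (auto simp: has_bochner_integral_iff)
    have "has_bochner_integral M (\<lambda>\<omega>. total_momentum L (f 0 \<omega>) $ b) ((LINT \<omega>|M. total_momentum L (f 0 \<omega>)) $ b)"
      by (rule has_bochner_integral_bounded_linear[OF bounded_linear_vec_nth has_bochner_integral_integrable[OF int]])
    then have i: "has_bochner_integral M (\<lambda>\<omega>. total_momentum L (f 0 \<omega>) $ b + (\<Sum>l\<in>UNIV. A (kv b) l (\<lambda>_. nv b) t \<omega>))
        ((LINT \<omega>|M. total_momentum L (f 0 \<omega>)) $ b + (\<Sum>l\<in>(UNIV::'k set). 0))"
      by (intro has_bochner_integral_add has_bochner_integral_sum A0)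
    have eq: "AE \<omega> in M. total_momentum L (f t \<omega>) $ b = total_momentum L (f 0 \<omega>) $ b + (\<Sum>l\<in>UNIV. A (kv b) l (\<lambda>_. nv b) t \<omega>)"
      using AE_good by eventually_elim (rule total_momentum_balance[OF _ t])
    have m: "(\<lambda>\<omega>. total_momentum L (f t \<omega>) $ b) \<in> borel_measurable M"
    proof (rule measurable_F_M, rule measurable_F_AE_cong)
      show "(\<lambda>\<omega>. nv b * integral (cell L) (\<lambda>x. 1 * K (kv b) t \<omega> x)) \<in> borel_measurable (F t)"
        by (intro borel_measurable_times borel_measurable_const adapted_cell_K mode_range modes t) simp
      show "AE \<omega> in M. nv b * integral (cell L) (\<lambda>x. 1 * K (kv b) t \<omega> x) = total_momentum L (f t \<omega>) $ b"
        using AE_path by eventually_elim (rule total_momentum_path[OF _ t, symmetric])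
    qed (use t in auto)
    show ?thesis
      using i by (subst has_bochner_integral_cong_AE[OF m _ eq]) (auto simp: has_bochner_integral_iff)
  qed
  have "has_bochner_integral M (\<lambda>\<omega>. total_momentum L (f t \<omega>)) (LINT \<omega>|M. total_momentum L (f 0 \<omega>))"
    by (rule has_bochner_integral_vec[OF comp])
  then show "integrable M (\<lambda>\<omega>. total_momentum L (f t \<omega>))"
    "(LINT \<omega>|M. total_momentum L (f t \<omega>)) = (LINT \<omega>|M. total_momentum L (f 0 \<omega>))"
    by (auto simp: has_bochner_integral_iff)
qed

text \<open>The noise field of J is put together from those of the modes \<open>kv b\<close>, the
  factors \<open>nv b\<close> undoing the normalization.\<close>

lemma momentum_density_balance:
  defines "NJ \<equiv> \<lambda>l t \<omega> x. \<chi> b. nv b * N (kv b) l t \<omega> x"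
  shows "has_strat_integral M T (\<lambda>t \<omega> x. \<rho> t \<omega> x *\<^sub>R column l (\<sigma> x)) (\<lambda>t \<omega> _. \<beta> l t \<omega>) (NJ l)"
    and "good \<omega> \<Longrightarrow> t \<in> {0..T} \<Longrightarrow> J t \<omega> x - J 0 \<omega> x =
        - (LBINT s:{0..t}. mat_divergence (stress (f s \<omega>)) x) +
        (LBINT s:{0..t}. \<rho> s \<omega> x *\<^sub>R E s \<omega> x) + (\<Sum>l\<in>UNIV. NJ l t \<omega> x)"
proof -
  show "has_strat_integral M T (\<lambda>t \<omega> x. \<rho> t \<omega> x *\<^sub>R column l (\<sigma> x)) (\<lambda>t \<omega> _. \<beta> l t \<omega>) (NJ l)"
  proof (rule has_strat_integral_vec[where Yb = "\<lambda>b. Y (kv b) l" and Ib = "\<lambda>b. N (kv b) l" and c = nv])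
    show "AE \<omega> in M. \<forall>t\<in>{0..T}. \<forall>p b. (\<rho> t \<omega> p *\<^sub>R column l (\<sigma> p)) $ b = nv b * Y (kv b) l t \<omega> p"
      using AE_path by eventually_elim (use norms in \<open>auto simp: Y_path column_def\<close>)
  qed (auto simp: NJ_def intro: N_strat mode_range modes)
next
  assume g: "good \<omega>" and t: "t \<in> {0..T}"
  note p = goodD(1)[OF g]
  have T0: "0 \<in> {0..T}" using LT by simp
  have cs: "continuous_on {0..t} (\<lambda>s. mat_divergence (stress (f s \<omega>)) x)"
    and c\<rho>E: "continuous_on {0..t} (\<lambda>s. \<rho> s \<omega> x *\<^sub>R E s \<omega> x)"
  proof -
    show 1: "continuous_on {0..t} (\<lambda>s. \<rho> s \<omega> x *\<^sub>R E s \<omega> x)"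
      by (intro continuous_intros time_slice(1)[where g = \<rho>, OF \<rho>_cont[OF p] t] time_slice(1)[where g = E, OF E_cont[OF p] t])
    \<comment> \<open>Solving the drift formula for the divergence of the stress lets it inherit
      continuity in time from the other terms.\<close>
    have "continuous_on {0..t} (\<lambda>s. \<chi> b. \<rho> s \<omega> x * E s \<omega> x $ b - nv b * D (kv b) s \<omega> x)"
      by (intro continuous_intros continuous_on_vec_lambda time_slice(1)[where g = \<rho>, OF \<rho>_cont[OF p] t]
        time_slice(1)[where g = E, OF E_cont[OF p] t] time_slice(1)[where g = "D (kv _)", OF D_cont(2)[OF p] t])
    then show "continuous_on {0..t} (\<lambda>s. mat_divergence (stress (f s \<omega>)) x)"
      by (rule continuous_on_eq) (use t norms in \<open>auto simp: vec_eq_iff D_path[OF p]\<close>)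
  qed
  have "(J t \<omega> x - J 0 \<omega> x) $ b = (- (LBINT s:{0..t}. mat_divergence (stress (f s \<omega>)) x) +
        (LBINT s:{0..t}. \<rho> s \<omega> x *\<^sub>R E s \<omega> x) + (\<Sum>l\<in>UNIV. NJ l t \<omega> x)) $ b" for b
  proof -
    have comp: "integral {0..t} h $ b = integral {0..t} (\<lambda>s. h s $ b)" if "continuous_on {0..t} h" for h :: "real \<Rightarrow> real^'d"
      using integral_linear[OF integrable_continuous_real[OF that] bounded_linear_vec_nth[of b]] by (simp add: o_def)
    have "(J t \<omega> x - J 0 \<omega> x) $ b = nv b * (K (kv b) t \<omega> x - K (kv b) 0 \<omega> x)"
      by (simp add: J_path[OF p t] J_path[OF p T0] right_diff_distrib)
    also have "\<dots> = nv b * integral {0..t} (\<lambda>s. D (kv b) s \<omega> x) + (\<Sum>l\<in>UNIV. NJ l t \<omega> x $ b)"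
      using goodD(2)[OF g modes(2) t, of b x] time_slice(2)[where g = "D (kv b)", OF D_cont(2)[OF p] t, of x]
      by (simp add: NJ_def sum_distrib_left distrib_left)
    also have "nv b * integral {0..t} (\<lambda>s. D (kv b) s \<omega> x) = integral {0..t} (\<lambda>s. nv b * D (kv b) s \<omega> x)" by simp
    also have "\<dots> = integral {0..t} (\<lambda>s. - (mat_divergence (stress (f s \<omega>)) x $ b) + (\<rho> s \<omega> x *\<^sub>R E s \<omega> x) $ b)"
      using norms(2)[of b] t by (intro integral_cong) (simp add: D_path[OF p])
    also have "\<dots> = - integral {0..t} (\<lambda>s. mat_divergence (stress (f s \<omega>)) x $ b) + integral {0..t} (\<lambda>s. (\<rho> s \<omega> x *\<^sub>R E s \<omega> x) $ b)"
      by (subst Henstock_Kurzweil_Integration.integral_add)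
        (auto intro!: integrable_continuous_real continuous_intros continuous_on_component[OF cs, simplified] continuous_on_component[OF c\<rho>E, simplified])
    finally show ?thesis
      by (simp only: set_lborel_integral_continuous[OF compact_Icc cs] set_lborel_integral_continuous[OF compact_Icc c\<rho>E]
        vector_add_component vector_minus_component uminus_vec_def sum_component comp[OF cs] comp[OF c\<rho>E] vec_lambda_beta)
  qed
  then show "J t \<omega> x - J 0 \<omega> x = - (LBINT s:{0..t}. mat_divergence (stress (f s \<omega>)) x) +
        (LBINT s:{0..t}. \<rho> s \<omega> x *\<^sub>R E s \<omega> x) + (\<Sum>l\<in>UNIV. NJ l t \<omega> x)"
    unfolding vec_eq_iff by blast
qed

subsubsection \<open>Energy\<close>

text \<open>The density of the covariation of \<open>G l\<close> with \<beta>_k; the diagonal k = l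
  produces the trace term.\<close>

definition "h l k s \<omega> = integral (cell L) (\<lambda>x. (column l (\<sigma> x) \<bullet> column k (\<sigma> x)) * \<rho> s \<omega> x)"

lemma h_eq:
  assumes p: "sample_path \<omega>" and s: "s \<in> {0..T}"
  shows "h l k s \<omega> = (\<Sum>b\<in>UNIV. nv b * y b k (\<lambda>x. \<sigma> x $ b $ l) s \<omega>)"
proof -
  have c: "continuous_on (cell L) (\<lambda>x. \<sigma> x $ b $ l)" "continuous_on (cell L) (\<rho> s \<omega>)" for b l
    by (rule continuous_on_subset[OF sigma_cont], simp, rule slice_cont[where g = \<rho>, OF p \<rho>_cont[OF p] s])
  have "(\<Sum>b\<in>UNIV. nv b * y b k (\<lambda>x. \<sigma> x $ b $ l) s \<omega>) = (\<Sum>b\<in>UNIV. integral (cell L) (\<lambda>x. \<sigma> x $ b $ l * \<sigma> x $ b $ k * \<rho> s \<omega> x))"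
    using norms(2) by (intro sum.cong refl) (simp add: y_def)
  also have "\<dots> = integral (cell L) (\<lambda>x. \<Sum>b\<in>UNIV. \<sigma> x $ b $ l * \<sigma> x $ b $ k * \<rho> s \<omega> x)"
    by (intro Henstock_Kurzweil_Integration.integral_sum[symmetric] integrable_on_cell continuous_intros c) auto
  also have "\<dots> = h l k s \<omega>" by (simp add: h_def inner_vec_def column_def sum_distrib_right)
  finally show ?thesis ..
qed

lemma h_cont: "sample_path \<omega> \<Longrightarrow> continuous_on {0..T} (\<lambda>s. h l k s \<omega>)"
  unfolding h_def using \<rho>_cont[of \<omega>]
  by (intro continuous_cell_integral continuous_intros column_cont) (simp add: split_beta)

text \<open>The noise of \<open>G l\<close> is a sum of pathwise integrals of C1 integrands, whose
  increments are known to first order by \<open>stieltjes_increment\<close>; the drift contributes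
  the order of the mesh. The constant C depends on the path but not on the mesh.\<close>

lemma G_increment:
  assumes t: "t \<in> {0..T}"
  shows "AE \<omega> in M. \<exists>C. \<forall>q. \<forall>i<2 ^ q. \<bar>incr (\<lambda>s. G l s \<omega>) t q i -
    (\<Sum>k\<in>UNIV. h l k (grid t q i) \<omega> * incr (\<lambda>s. \<beta> k s \<omega>) t q i)\<bar> \<le> C / 2 ^ q"
proof -
  let ?\<phi> = "\<lambda>b x. \<sigma> x $ b $ l"
  let ?St = "\<lambda>b k \<omega> s. C1_integrand.stieltjes s (\<lambda>s. y b k (?\<phi> b) s \<omega>) (y' b k (?\<phi> b) \<omega>) (\<lambda>s. \<beta> k s \<omega>)"
  have t0: "0 \<le> t" using t by simp
  have gT: "grid t q i \<in> {0..T}" if "i \<le> 2 ^ q" for q i using grid_bounds[OF t0 that] t by auto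
  \<comment> \<open>Equality with the pathwise integral holds almost surely at each single time;
    here it is wanted at countably many dyadic times together.\<close>
  have "AE \<omega> in M. \<forall>q i b k. i \<le> 2 ^ q \<longrightarrow> A (kv b) k (?\<phi> b) (grid t q i) \<omega> = ?St b k \<omega> (grid t q i)"
    unfolding AE_all_countable
  proof (intro allI)
    fix q i :: nat and b k
    show "AE \<omega> in M. i \<le> 2 ^ q \<longrightarrow> A (kv b) k (?\<phi> b) (grid t q i) \<omega> = ?St b k \<omega> (grid t q i)"
    proof (cases "i \<le> 2 ^ q")
      case True
      have "continuous_on UNIV (?\<phi> b)" by (rule sigma_cont)
      from A_stieltjes[OF this gT[OF True]] show ?thesis by eventually_elim blast
    qed simp
  qed
  with AE_good show ?thesis
  proof eventually_elim
    case (elim \<omega>)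
    note p = goodD(1)[OF elim(1)]
    have A_St: "A (kv b) k (?\<phi> b) (grid t q i) \<omega> = ?St b k \<omega> (grid t q i)" if "i \<le> 2 ^ q" for q i b k
      using elim(2) that by blast
    define dd where "dd b s = integral (cell L) (\<lambda>x. ?\<phi> b x * D (kv b) s \<omega> x)" for b s
    have dd_cont: "continuous_on {0..T} (dd b)" for b
      unfolding dd_def using cell_swap(2)[where g = "D (kv b)", OF D_cont(2)[OF p] sigma_cont t] .
    have "\<exists>B. \<forall>s\<in>{0..T}. \<bar>dd b s\<bar> \<le> B" for b
    proof -
      have "compact (dd b ` {0..T})" by (rule compact_continuous_image[OF dd_cont]) simp
      then show ?thesis by (metis compact_imp_bounded bounded_iff image_eqI real_norm_def)
    qed
    then obtain B where B: "\<And>b s. s \<in> {0..T} \<Longrightarrow> \<bar>dd b s\<bar> \<le> B b" by metis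
    have "\<forall>b k. \<exists>C. C \<ge> 0 \<and> (\<forall>r\<in>{0..T}. \<forall>s\<in>{0..T}. r \<le> s \<longrightarrow>
        \<bar>?St b k \<omega> s - ?St b k \<omega> r - y b k (?\<phi> b) r \<omega> * (\<beta> k s \<omega> - \<beta> k r \<omega>)\<bar> \<le> C * (s - r))"
      using stieltjes_increment[OF y_C1[OF elim(1) sigma_cont]] LT by (auto intro: less_imp_le)
    then obtain C where C: "\<And>b k r s. r \<in> {0..T} \<Longrightarrow> s \<in> {0..T} \<Longrightarrow> r \<le> s \<Longrightarrow>
        \<bar>?St b k \<omega> s - ?St b k \<omega> r - y b k (?\<phi> b) r \<omega> * (\<beta> k s \<omega> - \<beta> k r \<omega>)\<bar> \<le> C b k * (s - r)"
      by metis
    have "\<bar>incr (\<lambda>s. G l s \<omega>) t q i - (\<Sum>k\<in>UNIV. h l k (grid t q i) \<omega> * incr (\<lambda>s. \<beta> k s \<omega>) t q i)\<bar>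
        \<le> ((\<Sum>b\<in>UNIV. \<bar>nv b\<bar> * (B b + (\<Sum>k\<in>UNIV. C b k))) * t) / 2 ^ q" if i: "i < 2 ^ q" for q i
    proof -
      let ?s = "grid t q i" and ?s' = "grid t q (Suc i)"
      have s: "?s \<in> {0..T}" "?s' \<in> {0..T}" "?s \<le> ?s'" using gT[of i q] gT[of "Suc i" q] i grid_mono[OF t0, of i "Suc i" q] by auto
      have step: "?s' - ?s = t / 2 ^ q" by (simp add: grid_Suc)
      \<comment> \<open>The error of the first order expansion of one pathwise integral, at most
        \<open>C b k\<close> times the step.\<close>
      define R where "R b k = ?St b k \<omega> ?s' - ?St b k \<omega> ?s - y b k (?\<phi> b) ?s \<omega> * (\<beta> k ?s' \<omega> - \<beta> k ?s \<omega>)" for b k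
      have KE: "integral (cell L) (\<lambda>x. ?\<phi> b x * K (kv b) r \<omega> x) - integral (cell L) (\<lambda>x. ?\<phi> b x * K (kv b) 0 \<omega> x) =
          integral {0..r} (dd b) + (\<Sum>k\<in>UNIV. A (kv b) k (?\<phi> b) r \<omega>)" if "r \<in> {0..T}" for r b
        using cell_K_equation[OF elim(1) modes(2)[of b] D_cont(2)[OF p] sigma_cont[where b = b and l = l] that] by (simp add: dd_def[abs_def] A_def)
      have dK: "integral (cell L) (\<lambda>x. ?\<phi> b x * K (kv b) ?s' \<omega> x) - integral (cell L) (\<lambda>x. ?\<phi> b x * K (kv b) ?s \<omega> x) =
          integral {?s..?s'} (dd b) + (\<Sum>k\<in>UNIV. R b k + y b k (?\<phi> b) ?s \<omega> * (\<beta> k ?s' \<omega> - \<beta> k ?s \<omega>))" for b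
      proof -
        have "integral {0..?s} (dd b) + integral {?s..?s'} (dd b) = integral {0..?s'} (dd b)"
          using s by (intro Henstock_Kurzweil_Integration.integral_combine integrable_continuous_real continuous_on_subset[OF dd_cont]) auto
        moreover have "(\<Sum>k\<in>UNIV. R b k + y b k (?\<phi> b) ?s \<omega> * (\<beta> k ?s' \<omega> - \<beta> k ?s \<omega>)) =
            (\<Sum>k\<in>UNIV. A (kv b) k (?\<phi> b) ?s' \<omega>) - (\<Sum>k\<in>UNIV. A (kv b) k (?\<phi> b) ?s \<omega>)"
          using i A_St[of i q b] A_St[of "Suc i" q b] by (simp add: R_def sum_subtractf)
        ultimately show ?thesis using KE[OF s(1), of b] KE[OF s(2), of b] by linarith
      qed
      have "incr (\<lambda>s. G l s \<omega>) t q i = (\<Sum>b\<in>UNIV. nv b * (integral (cell L) (\<lambda>x. ?\<phi> b x * K (kv b) ?s' \<omega> x) -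
          integral (cell L) (\<lambda>x. ?\<phi> b x * K (kv b) ?s \<omega> x)))"
        by (simp add: G_path(2)[OF p s(1)] G_path(2)[OF p s(2)] right_diff_distrib sum_subtractf)
      also have "\<dots> = (\<Sum>b\<in>UNIV. nv b * (integral {?s..?s'} (dd b) + (\<Sum>k\<in>UNIV. R b k))) +
          (\<Sum>b\<in>UNIV. \<Sum>k\<in>UNIV. nv b * y b k (?\<phi> b) ?s \<omega> * (\<beta> k ?s' \<omega> - \<beta> k ?s \<omega>))"
        unfolding dK by (simp add: sum.distrib distrib_left sum_distrib_left mult.assoc)
      also have "(\<Sum>b\<in>UNIV. \<Sum>k\<in>UNIV. nv b * y b k (?\<phi> b) ?s \<omega> * (\<beta> k ?s' \<omega> - \<beta> k ?s \<omega>)) =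
          (\<Sum>k\<in>UNIV. h l k ?s \<omega> * incr (\<lambda>s. \<beta> k s \<omega>) t q i)"
        unfolding h_eq[OF p s(1)] sum_distrib_right by (rule sum.swap)
      finally have "\<bar>incr (\<lambda>s. G l s \<omega>) t q i - (\<Sum>k\<in>UNIV. h l k ?s \<omega> * incr (\<lambda>s. \<beta> k s \<omega>) t q i)\<bar> =
          \<bar>\<Sum>b\<in>UNIV. nv b * (integral {?s..?s'} (dd b) + (\<Sum>k\<in>UNIV. R b k))\<bar>" by simp
      also have "\<dots> \<le> (\<Sum>b\<in>UNIV. \<bar>nv b\<bar> * ((B b + (\<Sum>k\<in>UNIV. C b k)) * (?s' - ?s)))"
      proof (intro order.trans[OF sum_abs] sum_mono, unfold abs_mult, intro mult_left_mono)
        fix b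
        have "norm (integral {?s..?s'} (dd b)) \<le> B b * (?s' - ?s)"
          by (rule integral_bound) (use s B in \<open>auto intro!: continuous_on_subset[OF dd_cont]\<close>)
        moreover have "\<bar>\<Sum>k\<in>UNIV. R b k\<bar> \<le> (\<Sum>k\<in>UNIV. C b k * (?s' - ?s))"
          unfolding R_def by (intro order.trans[OF sum_abs] sum_mono C s)
        ultimately show "\<bar>integral {?s..?s'} (dd b) + (\<Sum>k\<in>UNIV. R b k)\<bar> \<le> (B b + (\<Sum>k\<in>UNIV. C b k)) * (?s' - ?s)"
          by (simp add: distrib_right sum_distrib_right)
      qed auto
      also have "\<dots> = ((\<Sum>b\<in>UNIV. \<bar>nv b\<bar> * (B b + (\<Sum>k\<in>UNIV. C b k))) * t) / 2 ^ q"
        unfolding step by (simp add: sum_distrib_right sum_divide_distrib mult.assoc)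
      finally show ?thesis .
    qed
    then show ?case by blast
  qed
qed

text \<open>The weight \<open>nchi / 2\<close> turns the noise of the mode of \<chi>_2 into the
  noise of the kinetic energy.\<close>

abbreviation "A\<chi> l \<equiv> A (lowrank_path.kchi TYPE('d)) l (\<lambda>_. nchi / 2)"

text \<open>The integrand \<open>G l\<close> has a martingale part of its own, so the sums are kept
  as a limit in probability instead of being evaluated path by path.\<close>

lemma A\<chi>_limit:
  assumes t: "t \<in> {0..T}"
  shows "null_in_prob M sequentially (\<lambda>q \<omega>. ennreal \<bar>trapezoid_sum (\<lambda>s. G l s \<omega>) (\<lambda>s. \<beta> l s \<omega>) t q - A\<chi> l t \<omega>\<bar>)"
proof (rule null_in_prob_mono_AE)
  show "null_in_prob M sequentially (\<lambda>q \<omega>. ennreal \<bar>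
    trapezoid_sum (\<lambda>s. integral (cell L) (\<lambda>x. nchi / 2 * Y (lowrank_path.kchi TYPE('d)) l s \<omega> x)) (\<lambda>s. \<beta> l s \<omega>) t q -
    integral (cell L) (\<lambda>x. nchi / 2 * N (lowrank_path.kchi TYPE('d)) l t \<omega> x)\<bar>)"
    by (rule cell_strat_integral[OF N_strat[OF mode_range[OF modes(3)]] _ _ t])
      (simp, use AE_path in eventually_elim, rule Y_cont)
  show "AE \<omega> in M. \<forall>q. ennreal \<bar>trapezoid_sum (\<lambda>s. G l s \<omega>) (\<lambda>s. \<beta> l s \<omega>) t q - A\<chi> l t \<omega>\<bar>
    \<le> ennreal \<bar>trapezoid_sum (\<lambda>s. integral (cell L) (\<lambda>x. nchi / 2 * Y (lowrank_path.kchi TYPE('d)) l s \<omega> x)) (\<lambda>s. \<beta> l s \<omega>) t q -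
    integral (cell L) (\<lambda>x. nchi / 2 * N (lowrank_path.kchi TYPE('d)) l t \<omega> x)\<bar>"
    using AE_path
  proof eventually_elim
    case (elim \<omega>)
    have "trapezoid_sum (\<lambda>s. G l s \<omega>) (\<lambda>s. \<beta> l s \<omega>) t q =
        trapezoid_sum (\<lambda>s. integral (cell L) (\<lambda>x. nchi / 2 * Y (lowrank_path.kchi TYPE('d)) l s \<omega> x)) (\<lambda>s. \<beta> l s \<omega>) t q" for q
    proof (rule trapezoid_sum_cong[OF t])
      fix s assume s: "s \<in> {0..T}"
      have "nchi / 2 * Y (lowrank_path.kchi TYPE('d)) l s \<omega> x = column l (\<sigma> x) \<bullet> J s \<omega> x" for x
        using norms(3) by (simp add: Y_path[OF elim s])
      then show "G l s \<omega> = integral (cell L) (\<lambda>x. nchi / 2 * Y (lowrank_path.kchi TYPE('d)) l s \<omega> x)"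
        by (simp only: G_path(1)[OF elim s])
    qed
    then show ?case by (simp only: A_def order.refl) simp
  qed
qed

text \<open>The Stratonovich integral minus half the covariation of its integrand with \<beta>_l,
  that is, the Ito integral.\<close>

definition "energy_martingale l t \<omega> = A\<chi> l t \<omega> - 1/2 * integral {0..t} (\<lambda>s. h l l s \<omega>)"

lemma energy_martingale_ito: "has_ito_integral M F T (G l) (\<beta> l) (energy_martingale l)"
  unfolding energy_martingale_def[abs_def]
proof (rule has_ito_integral_of_strat[where h = "\<lambda>k t \<omega>. h l k t \<omega>", OF independent G_adapted])
  show "AE \<omega> in M. continuous_on {0..T} (\<lambda>s. G l s \<omega>)" using AE_path by eventually_elim (rule G_continuous)
  show "AE \<omega> in M. continuous_on {0..T} (\<lambda>s. A\<chi> l s \<omega>)"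
    using AE_good by eventually_elim (rule A_cont[OF _ modes(3)], simp_all)
  show "AE \<omega> in M. continuous_on {0..T} (\<lambda>s. h l k s \<omega>)" for k using AE_path by eventually_elim (rule h_cont)
qed (rule A\<chi>_limit G_increment; assumption)+

lemma trace_columns: "trace (\<sigma> x ** transpose (\<sigma> x)) = (\<Sum>l\<in>UNIV. column l (\<sigma> x) \<bullet> column l (\<sigma> x))"
proof -
  have "trace (\<sigma> x ** transpose (\<sigma> x)) = (\<Sum>b\<in>UNIV. \<Sum>l\<in>UNIV. \<sigma> x $ b $ l * \<sigma> x $ b $ l)"
    by (simp add: trace_def matrix_matrix_mult_def transpose_def)
  also have "\<dots> = (\<Sum>l\<in>UNIV. \<Sum>b\<in>UNIV. \<sigma> x $ b $ l * \<sigma> x $ b $ l)" by (rule sum.swap)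
  finally show ?thesis by (simp add: inner_vec_def column_def)
qed

text \<open>The mode of \<chi>_2 gains the work of the field plus the noise, the mass part of the
  kinetic energy is constant, and the field energy loses exactly that work. Summing the Ito
  corrections over l yields the trace of \<sigma>\<sigma>^T.\<close>

lemma energy_balance:
  assumes g: "good \<omega>" and t: "t \<in> {0..T}"
  shows "total_energy L (f t \<omega>) (E t \<omega>) - total_energy L (f 0 \<omega>) (E 0 \<omega>) =
        (\<Sum>l\<in>UNIV. energy_martingale l t \<omega>) +
        1/2 * (LBINT s:{0..t}. LBINT x:cell L. trace (\<sigma> x ** transpose (\<sigma> x)) * \<rho> s \<omega> x)"
proof -
  note p = goodD(1)[OF g]
  let ?k = "lowrank_path.kchi TYPE('d)"
  have T0: "0 \<in> {0..T}" using LT by simp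
  have c: "continuous_on (cell L) (\<rho> s \<omega>)" "continuous_on (cell L) (K ?k s \<omega>)" "continuous_on (cell L) (E s \<omega>)" if "s \<in> {0..T}" for s
    using slice_cont[where g = \<rho>, OF p \<rho>_cont[OF p] that] slice_cont[where g = "K ?k", OF p K_cont[OF p mode_range[OF modes(3)]] that]
      slice_cont[where g = E, OF p E_cont[OF p] that] by auto
  have energy: "total_energy L (f s \<omega>) (E s \<omega>) = integral (cell L) (\<lambda>x. nchi / 2 * K ?k s \<omega> x) +
      lowrank_path.alpha w / 2 * integral (cell L) (\<rho> s \<omega>) + 1/2 * integral (cell L) (\<lambda>x. (norm (E s \<omega> x))\<^sup>2)" if s: "s \<in> {0..T}" for s
  proof -
    have "(LBINT x:cell L. LBINT v. (norm v)\<^sup>2 * f s \<omega> x v) = (LBINT x:cell L. nchi * K ?k s \<omega> x + lowrank_path.alpha w * \<rho> s \<omega> x)"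
      by (simp add: kinetic_path[OF p s])
    also have "\<dots> = integral (cell L) (\<lambda>x. nchi * K ?k s \<omega> x + lowrank_path.alpha w * \<rho> s \<omega> x)"
      by (intro set_lborel_integral_continuous continuous_intros c s) simp
    also have "\<dots> = nchi * integral (cell L) (K ?k s \<omega>) + lowrank_path.alpha w * integral (cell L) (\<rho> s \<omega>)"
      by (subst Henstock_Kurzweil_Integration.integral_add) (auto intro!: integrable_on_cell continuous_intros c s)
    finally have kin: "(LBINT x:cell L. LBINT v. (norm v)\<^sup>2 * f s \<omega> x v) = nchi * integral (cell L) (K ?k s \<omega>) + lowrank_path.alpha w * integral (cell L) (\<rho> s \<omega>)" .
    have el: "(LBINT x:cell L. (norm (E s \<omega> x))\<^sup>2) = integral (cell L) (\<lambda>x. (norm (E s \<omega> x))\<^sup>2)"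
      by (intro set_lborel_integral_continuous continuous_intros c s) simp
    show ?thesis unfolding total_energy_def kin el by (simp add: field_simps)
  qed
  have kinetic: "integral (cell L) (\<lambda>x. nchi / 2 * K ?k t \<omega> x) - integral (cell L) (\<lambda>x. nchi / 2 * K ?k 0 \<omega> x) =
      integral {0..t} (\<lambda>s. integral (cell L) (\<lambda>x. E s \<omega> x \<bullet> J s \<omega> x)) + (\<Sum>l\<in>UNIV. A\<chi> l t \<omega>)"
  proof -
    have "integral {0..t} (\<lambda>s. integral (cell L) (\<lambda>x. nchi / 2 * D ?k s \<omega> x)) = integral {0..t} (\<lambda>s. integral (cell L) (\<lambda>x. E s \<omega> x \<bullet> J s \<omega> x))"
    proof (rule integral_cong)
      fix s assume "s \<in> {0..t}"
      then have s: "s \<in> {0..T}" using t by auto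
      have "integral (cell L) (\<lambda>x. nchi / 2 * D ?k s \<omega> x) = nchi / 2 * integral (cell L) (D ?k s \<omega>)" by simp
      then show "integral (cell L) (\<lambda>x. nchi / 2 * D ?k s \<omega> x) = integral (cell L) (\<lambda>x. E s \<omega> x \<bullet> J s \<omega> x)"
        using norms(3) by (simp add: cell_D(3)[OF p s])
    qed
    then show ?thesis
      using cell_K_equation[OF g modes(3) D_cont(3)[OF p] _ t, of "\<lambda>_. nchi / 2"] by (simp add: A_def)
  qed
  have electric: "1/2 * integral (cell L) (\<lambda>x. (norm (E t \<omega> x))\<^sup>2) - 1/2 * integral (cell L) (\<lambda>x. (norm (E 0 \<omega> x))\<^sup>2) =
      - integral {0..t} (\<lambda>s. integral (cell L) (\<lambda>x. E s \<omega> x \<bullet> J s \<omega> x))"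
  proof (rule electric_energy_balance[OF LT(1), where T = T and \<rho> = "\<lambda>t. \<rho> t \<omega>" and u = "\<lambda>t. u t \<omega>"])
    show "E s \<omega> x = - grad (u s \<omega>) x" for s x by (simp add: E_def)
    show "continuous_on ({0..T} \<times> UNIV) (\<lambda>(t, x). E t \<omega> x)" "continuous_on ({0..T} \<times> UNIV) (\<lambda>(t, x). J t \<omega> x)"
      using E_cont[OF p] J_cont[OF p] by (simp_all add: split_beta)
    show "continuous_on ({0..T} \<times> UNIV) (\<lambda>(t, x). \<Sum>b\<in>UNIV. grad (\<lambda>x. J t \<omega> x $ b) x $ b)"
      by (rule continuous_on_eq[OF divergence_J_cont[OF p]]) (auto simp: divergence_J_path[OF p])
    fix s x assume s: "s \<in> {0..T}"
    have "integral {0..s} (\<lambda>s. divergence (J s \<omega>) x) = integral {0..s} (\<lambda>s. \<Sum>b\<in>UNIV. grad (\<lambda>x. J s \<omega> x $ b) x $ b)"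
      using s by (intro integral_cong) (simp add: divergence_J_path[OF p])
    then show "\<rho> s \<omega> x - \<rho> 0 \<omega> x = - integral {0..s} (\<lambda>s. \<Sum>b\<in>UNIV. grad (\<lambda>x. J s \<omega> x $ b) x $ b)"
      using mass_balance[OF g s, of x] by simp
  qed (use poisson_path[OF p] J_C1[OF p] t in auto)
  have correction: "(\<Sum>l\<in>UNIV. integral {0..t} (\<lambda>s. h l l s \<omega>)) = (LBINT s:{0..t}. LBINT x:cell L. trace (\<sigma> x ** transpose (\<sigma> x)) * \<rho> s \<omega> x)"
  proof -
    have hc: "continuous_on {0..t} (\<lambda>s. h l l s \<omega>)" for l using h_cont[OF p] by (rule continuous_on_subset) (use t in auto)
    have "(LBINT s:{0..t}. LBINT x:cell L. trace (\<sigma> x ** transpose (\<sigma> x)) * \<rho> s \<omega> x) = (LBINT s:{0..t}. \<Sum>l\<in>UNIV. h l l s \<omega>)"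
    proof (rule set_lebesgue_integral_cong, simp, intro allI impI)
      fix s assume "s \<in> {0..t}"
      then have s: "s \<in> {0..T}" using t by auto
      have cc: "continuous_on (cell L) (\<lambda>x. (column l (\<sigma> x) \<bullet> column l (\<sigma> x)) * \<rho> s \<omega> x)" for l
        by (intro continuous_intros c s continuous_on_subset[OF column_cont]) auto
      have "(LBINT x:cell L. trace (\<sigma> x ** transpose (\<sigma> x)) * \<rho> s \<omega> x) = (LBINT x:cell L. \<Sum>l\<in>UNIV. (column l (\<sigma> x) \<bullet> column l (\<sigma> x)) * \<rho> s \<omega> x)"
        by (simp add: trace_columns sum_distrib_right)
      also have "\<dots> = integral (cell L) (\<lambda>x. \<Sum>l\<in>UNIV. (column l (\<sigma> x) \<bullet> column l (\<sigma> x)) * \<rho> s \<omega> x)"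
        by (intro set_lborel_integral_continuous continuous_on_sum cc) simp
      also have "\<dots> = (\<Sum>l\<in>UNIV. h l l s \<omega>)"
        unfolding h_def by (intro Henstock_Kurzweil_Integration.integral_sum integrable_on_cell cc) auto
      finally show "(LBINT x:cell L. trace (\<sigma> x ** transpose (\<sigma> x)) * \<rho> s \<omega> x) = (\<Sum>l\<in>UNIV. h l l s \<omega>)" .
    qed
    also have "\<dots> = integral {0..t} (\<lambda>s. \<Sum>l\<in>UNIV. h l l s \<omega>)"
      by (intro set_lborel_integral_continuous continuous_on_sum hc) simp
    also have "\<dots> = (\<Sum>l\<in>UNIV. integral {0..t} (\<lambda>s. h l l s \<omega>))"
      by (intro Henstock_Kurzweil_Integration.integral_sum integrable_continuous_real hc) auto
    finally show ?thesis ..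
  qed
  have "(\<Sum>l\<in>UNIV. energy_martingale l t \<omega>) = (\<Sum>l\<in>UNIV. A\<chi> l t \<omega>) - 1/2 * (\<Sum>l\<in>UNIV. integral {0..t} (\<lambda>s. h l l s \<omega>))"
    by (simp add: energy_martingale_def sum_subtractf sum_divide_distrib)
  then show ?thesis
    using kinetic electric energy[OF t] energy[OF T0] total_mass_conserved[OF g t] correction by simp
qed

theorem conservation_laws:
  shows "(AE \<omega> in M. \<forall>t\<in>{0..T}. \<forall>x.
      \<rho> t \<omega> x - \<rho> 0 \<omega> x + (LBINT s:{0..t}. divergence (J s \<omega>) x) = 0) \<and>
    (AE \<omega> in M. \<forall>t\<in>{0..T}. total_mass L (f t \<omega>) = total_mass L (f 0 \<omega>)) \<and>
    (\<exists>N. (\<forall>l. has_strat_integral M T (\<lambda>t \<omega> x. \<rho> t \<omega> x *\<^sub>R column l (\<sigma> x))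
        (\<lambda>t \<omega> _. \<beta> l t \<omega>) (N l)) \<and>
      (AE \<omega> in M. \<forall>t\<in>{0..T}. \<forall>x. J t \<omega> x - J 0 \<omega> x =
        - (LBINT s:{0..t}. mat_divergence (stress (f s \<omega>)) x) +
        (LBINT s:{0..t}. \<rho> s \<omega> x *\<^sub>R E s \<omega> x) + (\<Sum>l\<in>UNIV. N l t \<omega> x))) \<and>
    (integrable M (\<lambda>\<omega>. total_momentum L (f 0 \<omega>)) \<and>
      (\<forall>l. (\<integral>\<^sup>+\<omega>. (\<integral>\<^sup>+s\<in>{0..T}. ennreal
        ((norm (LBINT x:cell L. \<rho> s \<omega> x *\<^sub>R column l (\<sigma> x)))\<^sup>2) \<partial>lborel) \<partial>M) < \<infinity>) \<longrightarrow>
      (\<forall>t\<in>{0..T}. integrable M (\<lambda>\<omega>. total_momentum L (f t \<omega>)) \<and>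
        (LINT \<omega>|M. total_momentum L (f t \<omega>)) = (LINT \<omega>|M. total_momentum L (f 0 \<omega>)))) \<and>
    (\<exists>I. (\<forall>l. has_ito_integral M F T
        (\<lambda>t \<omega>. LBINT x:cell L. column l (\<sigma> x) \<bullet> J t \<omega> x) (\<beta> l) (I l)) \<and>
      (AE \<omega> in M. \<forall>t\<in>{0..T}.
        total_energy L (f t \<omega>) (E t \<omega>) - total_energy L (f 0 \<omega>) (E 0 \<omega>) =
        (\<Sum>l\<in>UNIV. I l t \<omega>) +
        1/2 * (LBINT s:{0..t}. LBINT x:cell L. trace (\<sigma> x ** transpose (\<sigma> x)) * \<rho> s \<omega> x)))"
proof -
  let ?NJ = "\<lambda>l t \<omega> x. \<chi> b. nv b * N (kv b) l t \<omega> x"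
  have T0: "0 \<in> {0..T}" using LT by simp
  show ?thesis
  proof (intro conjI)
    show "AE \<omega> in M. \<forall>t\<in>{0..T}. \<forall>x. \<rho> t \<omega> x - \<rho> 0 \<omega> x + (LBINT s:{0..t}. divergence (J s \<omega>) x) = 0"
      using AE_good
    proof eventually_elim
      case (elim \<omega>)
      then show ?case
        using mass_balance[OF elim] time_slice(2)[where g = "\<lambda>s \<omega>. divergence (J s \<omega>)", OF divergence_J_cont[OF goodD(1)[OF elim]]]
        by simp
    qed
    show "AE \<omega> in M. \<forall>t\<in>{0..T}. total_mass L (f t \<omega>) = total_mass L (f 0 \<omega>)"
      using AE_good
    proof eventually_elim
      case (elim \<omega>)
      note p = goodD(1)[OF elim]
      have "total_mass L (f t \<omega>) = integral (cell L) (\<rho> t \<omega>)" if t: "t \<in> {0..T}" for t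
        using set_lborel_integral_continuous[OF compact_cell slice_cont[where g = \<rho>, OF p \<rho>_cont[OF p] t]]
        by (simp add: total_mass_def \<rho>_def)
      then show ?case using total_mass_conserved[OF elim] T0 by metis
    qed
    show "\<exists>N. (\<forall>l. has_strat_integral M T (\<lambda>t \<omega> x. \<rho> t \<omega> x *\<^sub>R column l (\<sigma> x)) (\<lambda>t \<omega> _. \<beta> l t \<omega>) (N l)) \<and>
      (AE \<omega> in M. \<forall>t\<in>{0..T}. \<forall>x. J t \<omega> x - J 0 \<omega> x =
        - (LBINT s:{0..t}. mat_divergence (stress (f s \<omega>)) x) +
        (LBINT s:{0..t}. \<rho> s \<omega> x *\<^sub>R E s \<omega> x) + (\<Sum>l\<in>UNIV. N l t \<omega> x))"
    proof (intro exI[of _ ?NJ] conjI allI momentum_density_balance(1))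
      show "AE \<omega> in M. \<forall>t\<in>{0..T}. \<forall>x. J t \<omega> x - J 0 \<omega> x =
        - (LBINT s:{0..t}. mat_divergence (stress (f s \<omega>)) x) +
        (LBINT s:{0..t}. \<rho> s \<omega> x *\<^sub>R E s \<omega> x) + (\<Sum>l\<in>UNIV. ?NJ l t \<omega> x)"
        using AE_good by eventually_elim (intro ballI allI momentum_density_balance(2))
    qed
    show "integrable M (\<lambda>\<omega>. total_momentum L (f 0 \<omega>)) \<and>
      (\<forall>l. (\<integral>\<^sup>+\<omega>. (\<integral>\<^sup>+s\<in>{0..T}. ennreal
        ((norm (LBINT x:cell L. \<rho> s \<omega> x *\<^sub>R column l (\<sigma> x)))\<^sup>2) \<partial>lborel) \<partial>M) < \<infinity>) \<longrightarrow>
      (\<forall>t\<in>{0..T}. integrable M (\<lambda>\<omega>. total_momentum L (f t \<omega>)) \<and>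
        (LINT \<omega>|M. total_momentum L (f t \<omega>)) = (LINT \<omega>|M. total_momentum L (f 0 \<omega>)))"
      using total_momentum_expectation by blast
    show "\<exists>I. (\<forall>l. has_ito_integral M F T (\<lambda>t \<omega>. LBINT x:cell L. column l (\<sigma> x) \<bullet> J t \<omega> x) (\<beta> l) (I l)) \<and>
      (AE \<omega> in M. \<forall>t\<in>{0..T}.
        total_energy L (f t \<omega>) (E t \<omega>) - total_energy L (f 0 \<omega>) (E 0 \<omega>) =
        (\<Sum>l\<in>UNIV. I l t \<omega>) +
        1/2 * (LBINT s:{0..t}. LBINT x:cell L. trace (\<sigma> x ** transpose (\<sigma> x)) * \<rho> s \<omega> x))"
    proof (intro exI[of _ energy_martingale] conjI allI)
      show "has_ito_integral M F T (\<lambda>t \<omega>. LBINT x:cell L. column l (\<sigma> x) \<bullet> J t \<omega> x) (\<beta> l) (energy_martingale l)" for l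
        using energy_martingale_ito[of l] by (simp add: G_def[abs_def])
      show "AE \<omega> in M. \<forall>t\<in>{0..T}.
        total_energy L (f t \<omega>) (E t \<omega>) - total_energy L (f 0 \<omega>) (E 0 \<omega>) =
        (\<Sum>l\<in>UNIV. energy_martingale l t \<omega>) +
        1/2 * (LBINT s:{0..t}. LBINT x:cell L. trace (\<sigma> x ** transpose (\<sigma> x)) * \<rho> s \<omega> x)"
        using AE_good by eventually_elim (intro ballI energy_balance)
    qed
  qed
qed

end

theorem mainTheorem4:
  fixes M :: "'w measure" and F :: "real \<Rightarrow> 'w measure"
    and \<beta> :: "'k::finite \<Rightarrow> real \<Rightarrow> 'w \<Rightarrow> real"
    and \<sigma> :: "real^'d \<Rightarrow> real^'k^'d"
    and L T :: real and r m :: nat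
    and w :: "real^'d \<Rightarrow> real"
    and X :: "nat \<Rightarrow> real \<Rightarrow> 'w \<Rightarrow> real^'d \<Rightarrow> real"
    and S :: "nat \<Rightarrow> nat \<Rightarrow> real \<Rightarrow> 'w \<Rightarrow> real"
    and V :: "nat \<Rightarrow> real \<Rightarrow> 'w \<Rightarrow> real^'d \<Rightarrow> real"
    and U :: "nat \<Rightarrow> real^'d \<Rightarrow> real"
    and e :: "nat \<Rightarrow> 'd::finite"
    and u :: "real \<Rightarrow> 'w \<Rightarrow> real^'d \<Rightarrow> real"
    and f :: "real \<Rightarrow> 'w \<Rightarrow> real^'d \<Rightarrow> real^'d \<Rightarrow> real"
    and E :: "real \<Rightarrow> 'w \<Rightarrow> real^'d \<Rightarrow> real^'d"
    and \<rho> :: "real \<Rightarrow> 'w \<Rightarrow> real^'d \<Rightarrow> real"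
    and J :: "real \<Rightarrow> 'w \<Rightarrow> real^'d \<Rightarrow> real^'d"
  assumes LT: "0 < L" "0 < T"
    and basis: "complete_filtered_space M F" "independent_brownian_motions M F \<beta>"
    and sigma: "continuous_on UNIV \<sigma>" "periodic L \<sigma>"
    and weight: "admissible_weight w"
    and f_def: "f = lowrank_density r w X S V"
    and \<rho>_def: "\<rho> = (\<lambda>t \<omega>. mass_density (f t \<omega>))"
    and J_def: "J = (\<lambda>t \<omega>. momentum_density (f t \<omega>))"
    and E_def: "E = (\<lambda>t \<omega> x. - grad (u t \<omega>) x)"
    and poisson: "AE \<omega> in M. \<forall>t\<in>{0..T}. poisson_potential L (\<rho> t \<omega>) (u t \<omega>)"
    and rank: "CARD('d) + 2 \<le> m" "m \<le> r"
    and enum: "bij_betw e {1..CARD('d)} UNIV"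
    and U_1: "U 1 = (\<lambda>v. 1 / norm_v w (\<lambda>_. 1))"
    and U_v: "\<And>i. i \<in> {1..CARD('d)} \<Longrightarrow> U (i + 1) = (\<lambda>v. v $ e i / norm_v w (\<lambda>v. v $ e i))"
    and U_chi: "U (CARD('d) + 2) = (\<lambda>v. chi2 w v / norm_v w (chi2 w))"
    and fixed_modes: "\<And>a t \<omega>. a \<in> {1..m} \<Longrightarrow> t \<in> {0..T} \<Longrightarrow> \<omega> \<in> space M \<Longrightarrow> V a t \<omega> = U a"
    and adapted: "\<And>i x. i \<in> {1..r} \<Longrightarrow> adapted_upto F T (\<lambda>t \<omega>. X i t \<omega> x)"
      "\<And>i j. i \<in> {1..r} \<Longrightarrow> j \<in> {1..r} \<Longrightarrow> adapted_upto F T (S i j)"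
      "\<And>j v. j \<in> {1..r} \<Longrightarrow> adapted_upto F T (\<lambda>t \<omega>. V j t \<omega> v)"
    and regular: "AE \<omega> in M. regular_path T L w r
      (\<lambda>i t. X i t \<omega>) (\<lambda>i j t. S i j t \<omega>) (\<lambda>j t. V j t \<omega>) (\<lambda>t. E t \<omega>)"
    and orthonormal: "AE \<omega> in M. \<forall>t\<in>{0..T}. orthonormal_modes (inner_x L) r (\<lambda>i. X i t \<omega>) \<and>
      orthonormal_modes (inner_v w) r (\<lambda>j. V j t \<omega>) \<and> invertible_upto r (\<lambda>i j. S i j t \<omega>)"
    and gauge: "gauge_conditions M T L w r X V"
    and evolution: "K_equation M T \<beta> \<sigma> r f E X S V" "S_equation M T L \<beta> \<sigma> r f E X S V"
      "W_equation M T L \<beta> \<sigma> w m r f E X S V"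
  shows "(AE \<omega> in M. \<forall>t\<in>{0..T}. \<forall>x.
      \<rho> t \<omega> x - \<rho> 0 \<omega> x + (LBINT s:{0..t}. divergence (J s \<omega>) x) = 0) \<and>
    (AE \<omega> in M. \<forall>t\<in>{0..T}. total_mass L (f t \<omega>) = total_mass L (f 0 \<omega>)) \<and>
    (\<exists>N. (\<forall>l. has_strat_integral M T (\<lambda>t \<omega> x. \<rho> t \<omega> x *\<^sub>R column l (\<sigma> x))
        (\<lambda>t \<omega> _. \<beta> l t \<omega>) (N l)) \<and>
      (AE \<omega> in M. \<forall>t\<in>{0..T}. \<forall>x. J t \<omega> x - J 0 \<omega> x =
        - (LBINT s:{0..t}. mat_divergence (stress (f s \<omega>)) x) +
        (LBINT s:{0..t}. \<rho> s \<omega> x *\<^sub>R E s \<omega> x) + (\<Sum>l\<in>UNIV. N l t \<omega> x))) \<and>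
    (integrable M (\<lambda>\<omega>. total_momentum L (f 0 \<omega>)) \<and>
      (\<forall>l. (\<integral>\<^sup>+\<omega>. (\<integral>\<^sup>+s\<in>{0..T}. ennreal
        ((norm (LBINT x:cell L. \<rho> s \<omega> x *\<^sub>R column l (\<sigma> x)))\<^sup>2) \<partial>lborel) \<partial>M) < \<infinity>) \<longrightarrow>
      (\<forall>t\<in>{0..T}. integrable M (\<lambda>\<omega>. total_momentum L (f t \<omega>)) \<and>
        (LINT \<omega>|M. total_momentum L (f t \<omega>)) = (LINT \<omega>|M. total_momentum L (f 0 \<omega>)))) \<and>
    (\<exists>I. (\<forall>l. has_ito_integral M F T
        (\<lambda>t \<omega>. LBINT x:cell L. column l (\<sigma> x) \<bullet> J t \<omega> x) (\<beta> l) (I l)) \<and>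
      (AE \<omega> in M. \<forall>t\<in>{0..T}.
        total_energy L (f t \<omega>) (E t \<omega>) - total_energy L (f 0 \<omega>) (E 0 \<omega>) =
        (\<Sum>l\<in>UNIV. I l t \<omega>) +
        1/2 * (LBINT s:{0..t}. LBINT x:cell L. trace (\<sigma> x ** transpose (\<sigma> x)) * \<rho> s \<omega> x)))"
proof -
  have orthonormal_V: "AE \<omega> in M. \<forall>t\<in>{0..T}. orthonormal_modes (inner_v w) r (\<lambda>j. V j t \<omega>)"
    using orthonormal by eventually_elim blast
  have filtered: "filtered_space M F"
    using basis(1) by (rule filtered_space.intro)
  have dynamics: "lowrank_dynamics M F \<beta> \<sigma> L T r m w X S V U e u f E \<rho> J"
    using filtered
  proof (rule lowrank_dynamics.intro)
    show "lowrank_dynamics_axioms M F \<beta> \<sigma> L T r m w X S V U e u f E \<rho> J"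
      unfolding lowrank_dynamics_axioms_def
      using LT basis(2) sigma(1) weight f_def \<rho>_def J_def E_def poisson rank enum U_1 U_v U_chi fixed_modes
        adapted(1,2) regular orthonormal_V evolution(1)
      by (intro conjI allI impI) assumption+
  qed
  show ?thesis
    by (rule lowrank_dynamics.conservation_laws[OF dynamics])
qed

end
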